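(* Let $\Gamma$ be a tropical curve with a fixed model without loops or multiple edges, and $D$ a divisor with $r(D)\ge 0$. Let $\mathcal F$ be the (finite) set of rational functions $f_P$, $P\in\Gamma$, such that $D_P$ is a vertex of $|D|$, and let $\phi_{\mathcal F}:\Gamma\to\mathbb{TP}(\mathcal F^* )$ be the map sending $P$ to the class of $(f(P))_{f\in\mathcal F}$. Then: (1) the image $\phi_{\mathcal F}(\Gamma)$ is homeomorphic to the image $\mathrm{Red}(\Gamma)$; (2) there is an injective map $\Theta:|D|_r\to\mathbb{TP}(\mathcal F^* )$ whose image is the tropical convex hull $\mathrm{trop\text{-}conv}(\phi_{\mathcal F}(\Gamma))$ and which satisfies $\Theta(\mathrm{Red}(P))=\phi_{\mathcal F}(P)$ for all $P\in\Gamma$; in particular, $|D|_r$ is homeomorphic to $\mathrm{trop\text{-}conv}(\phi_{\mathcal F}(\Gamma))$.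
   Context: A tropical curve $\Gamma$ is a compact connected metric graph (finite connected graph with edges identified with closed intervals of positive lengths). A divisor is a finite formal integer combination of points. Rational functions are continuous piecewise linear $f:\Gamma\to\mathbb R$ with integer slopes and finitely many pieces per edge; $\mathrm{div}(f)=\sum_v\mathrm{ord}_v(f)(v)$ with $\mathrm{ord}_v(f)$ the sum of outgoing slopes at $v$; $D\sim D'$ if $D-D'=\mathrm{div}(f)$; $|D|=\{E\ge0:E\sim D\}$; $R(D)=\{f: D+\mathrm{div}(f)\ge 0\}$; $r(D)=\min\{\deg(E):E\ge0,\ |D-E|=\emptyset\}-1$. For a closed connected $X\subseteq\Gamma$ and $v\in\partial X$, $\deg^{\mathrm{out}}_X(v)$ is the maximum number of internally disjoint segments in $\Gamma\setminus(X\setminus\{v\})$ with an endpoint at $v$. $D'$ is $P$-reduced if $D'(v)\ge0$ for $v\neq P$ and every closed connected $X$ with $P\notin X$ has a boundary point $v$ with $D'(v)<\deg^{\mathrm{out}}_X(v)$; $D_P$ is the unique $P$-reduced divisor equivalent to $D$, $\mathrm{Red}(P)=D_P$, and $f_P$ is the unique rational function with $D+\mathrm{div}(f_P)=D_P$ and $f_P(P)=0$. Elements of $|D|$ are identified with $R(D)$ modulo additive constants. Tropical operations: $(f\oplus g)(x)=\max(f(x),g(x))$, $c\odot f=c+f$. $\tilde R(D)$ is the tropical module generated by $\{f_P:P\in\Gamma\}$, and the reduced linear system is $|D|_r=\tilde R(D)/\!\sim$, where $g\sim c\odot g$; $\mathrm{Red}(\Gamma)\subseteq|D|_r$ via $D_P\leftrightarrow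 f_P$. $\mathbb{TP}(\mathcal F^* )$ is the tropical projective space of maps $\mathcal F\to\mathbb T$ modulo tropical multiplication by a constant (adding a common constant), and the tropical convex hull of a subset is the set of classes of tropical linear combinations $\bigoplus_i c_i\odot s_i$ of its elements. Cell structure of $|D|$ (for the notion of vertex): with respect to the fixed model with oriented edges, two effective divisors have the same combinatorial type if they have the same coefficient at each vertex of the model and, for each edge, the points of their supports in the interior of that edge, listed in order, have the same multiplicity sequence; open cells of $|D|$ are the connected components of the sets of elements of $|D|$ of fixed type; vertices of $|D|$ are its $0$-dimensional cells (there are finitely many).
   Formalization: The set F of functions f_P with D_P a vertex is shown to be finite only up to additive constants; literal finiteness can fail (on a circle with D = 2q − q', q ≠ q', all D_P coincide but the f_P = f − f(P) are infinitely many). All other claims are for the literal F. *)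

theory Defs
  imports "HOL-Analysis.Analysis"
begin

definition quotient_topology :: "'a topology \<Rightarrow> ('a \<Rightarrow> 'b) \<Rightarrow> 'b topology" where
  "quotient_topology X q = topology (\<lambda>U. U \<subseteq> q ` topspace X \<and> openin X {x \<in> topspace X. q x \<in> U})"

lemma openin_quotient_topology:
  "openin (quotient_topology X q) U \<longleftrightarrow>
     U \<subseteq> q ` topspace X \<and> openin X {x \<in> topspace X. q x \<in> U}"
proof -
  have "istopology (\<lambda>U. U \<subseteq> q ` topspace X \<and> openin X {x \<in> topspace X. q x \<in> U})"
    unfolding istopology_def
  proof (intro conjI allI impI)
    fix S T
    assume S: "S \<subseteq> q ` topspace X \<and> openin X {x \<in> topspace X. q x \<in> S}"
      and T: "T \<subseteq> q ` topspace X \<and> openin X {x \<in> topspace X. q x \<in> T}"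
    show "S \<inter> T \<subseteq> q ` topspace X" using S by blast
    have "{x \<in> topspace X. q x \<in> S \<inter> T} =
        {x \<in> topspace X. q x \<in> S} \<inter> {x \<in> topspace X. q x \<in> T}" by blast
    then show "openin X {x \<in> topspace X. q x \<in> S \<inter> T}" using S T by (simp add: openin_Int)
  next
    fix \<K> assume K: "\<forall>S\<in>\<K>. S \<subseteq> q ` topspace X \<and> openin X {x \<in> topspace X. q x \<in> S}"
    show "\<Union>\<K> \<subseteq> q ` topspace X" using K by blast
    have "{x \<in> topspace X. q x \<in> \<Union>\<K>} = (\<Union>S\<in>\<K>. {x \<in> topspace X. q x \<in> S})" by blast
    then show "openin X {x \<in> topspace X. q x \<in> \<Union>\<K>}" using K by auto
  qed
  then show ?thesis unfolding quotient_topology_def by (simp add: topology_inverse')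
qed

lemma topspace_quotient_topology [simp]: "topspace (quotient_topology X q) = q ` topspace X"
proof (rule antisym)
  show "topspace (quotient_topology X q) \<subseteq> q ` topspace X"
    by (rule conjunct1 [OF iffD1 [OF openin_quotient_topology openin_topspace]])
  have "{x \<in> topspace X. q x \<in> q ` topspace X} = topspace X" by blast
  then show "q ` topspace X \<subseteq> topspace (quotient_topology X q)"
    by (intro openin_subset) (simp add: openin_quotient_topology)
qed

lemma quotient_map_quotient_topology: "quotient_map X (quotient_topology X q) q"
  by (simp add: quotient_map_def openin_quotient_topology)

text \<open>The topology of uniform convergence on \<open>X\<close> (the sup-norm topology, when the members of \<open>M\<close>
  are bounded on \<open>X\<close>).\<close>

definition uniform_topology :: "'a set \<Rightarrow> ('a \<Rightarrow> real) set \<Rightarrow> ('a \<Rightarrow> real) topology" where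
  "uniform_topology X M = topology (\<lambda>U. U \<subseteq> M \<and>
     (\<forall>f\<in>U. \<exists>\<epsilon>>0. \<forall>g\<in>M. (\<forall>x\<in>X. \<bar>g x - f x\<bar> < \<epsilon>) \<longrightarrow> g \<in> U))"

lemma openin_uniform_topology:
  "openin (uniform_topology X M) U \<longleftrightarrow>
     U \<subseteq> M \<and> (\<forall>f\<in>U. \<exists>\<epsilon>>0. \<forall>g\<in>M. (\<forall>x\<in>X. \<bar>g x - f x\<bar> < \<epsilon>) \<longrightarrow> g \<in> U)"
proof -
  define P where "P U \<longleftrightarrow> U \<subseteq> M \<and>
     (\<forall>f\<in>U. \<exists>\<epsilon>>0. \<forall>g\<in>M. (\<forall>x\<in>X. \<bar>g x - f x\<bar> < \<epsilon>) \<longrightarrow> g \<in> U)" for U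
  have "P (S \<inter> T)" if S: "P S" and T: "P T" for S T
    unfolding P_def
  proof (intro conjI ballI)
    show "S \<inter> T \<subseteq> M" using S unfolding P_def by blast
    fix f assume f: "f \<in> S \<inter> T"
    obtain a where a: "a > 0" "\<And>g. g \<in> M \<Longrightarrow> (\<forall>x\<in>X. \<bar>g x - f x\<bar> < a) \<Longrightarrow> g \<in> S"
      using S f unfolding P_def by blast
    obtain b where b: "b > 0" "\<And>g. g \<in> M \<Longrightarrow> (\<forall>x\<in>X. \<bar>g x - f x\<bar> < b) \<Longrightarrow> g \<in> T"
      using T f unfolding P_def by blast
    have "g \<in> S \<inter> T" if "g \<in> M" "\<forall>x\<in>X. \<bar>g x - f x\<bar> < min a b" for g
      using that a(2)[of g] b(2)[of g] by simp
    moreover have "min a b > 0" using a(1) b(1) by simp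
    ultimately show "\<exists>\<epsilon>>0. \<forall>g\<in>M. (\<forall>x\<in>X. \<bar>g x - f x\<bar> < \<epsilon>) \<longrightarrow> g \<in> S \<inter> T" by blast
  qed
  moreover have "P (\<Union>\<K>)" if K: "\<forall>S\<in>\<K>. P S" for \<K>
    unfolding P_def
  proof (intro conjI ballI)
    show "\<Union>\<K> \<subseteq> M" using K unfolding P_def by blast
    fix f assume "f \<in> \<Union>\<K>"
    then obtain S where S: "S \<in> \<K>" "f \<in> S" by blast
    with K obtain a where "a > 0" "\<forall>g\<in>M. (\<forall>x\<in>X. \<bar>g x - f x\<bar> < a) \<longrightarrow> g \<in> S"
      unfolding P_def by blast
    with S show "\<exists>\<epsilon>>0. \<forall>g\<in>M. (\<forall>x\<in>X. \<bar>g x - f x\<bar> < \<epsilon>) \<longrightarrow> g \<in> \<Union>\<K>" by blast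
  qed
  ultimately have "istopology P" by (simp add: istopology_def)
  then show ?thesis
    unfolding uniform_topology_def P_def by (simp add: topology_inverse')
qed

lemma topspace_uniform_topology [simp]: "topspace (uniform_topology X M) = M"
proof (rule antisym)
  show "topspace (uniform_topology X M) \<subseteq> M"
    by (rule conjunct1 [OF iffD1 [OF openin_uniform_topology openin_topspace]])
  have "openin (uniform_topology X M) M"
    by (simp add: openin_uniform_topology gt_ex)
  then show "M \<subseteq> topspace (uniform_topology X M)" by (rule openin_subset)
qed

text \<open>A model without loops or multiple edges: an edge is the ordered pair of its end-vertices, the
  order being its orientation.\<close>

record 'v metric_graph =
  verts :: "'v set"
  edges :: "('v \<times> 'v) set"
  len :: "'v \<times> 'v \<Rightarrow> real"

definition tropical_curve :: "'v metric_graph \<Rightarrow> bool" where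
  "tropical_curve G \<longleftrightarrow>
     finite (verts G) \<and> verts G \<noteq> {} \<and> edges G \<subseteq> verts G \<times> verts G \<and>
     (\<forall>(u, v) \<in> edges G. u \<noteq> v \<and> (v, u) \<notin> edges G) \<and>
     (\<forall>e \<in> edges G. 0 < len G e) \<and>
     (\<forall>u \<in> verts G. \<forall>v \<in> verts G. (u, v) \<in> (edges G \<union> (edges G)\<inverse>)\<^sup>*)"

text \<open>\<open>Inner e t\<close> is the point of the interior of the edge \<open>e\<close> at distance \<open>t\<close> from its tail;
  \<open>edge_point G e\<close> identifies the interval from \<open>0\<close> to \<open>len G e\<close> with the closed edge.\<close>

datatype 'v point = Vertex 'v | Inner "'v \<times> 'v" real

definition curve :: "'v metric_graph \<Rightarrow> 'v point set" where
  "curve G = Vertex ` verts G \<union> {Inner e t | e t. e \<in> edges G \<and> 0 < t \<and> t < len G e}"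

definition edge_point :: "'v metric_graph \<Rightarrow> 'v \<times> 'v \<Rightarrow> real \<Rightarrow> 'v point" where
  "edge_point G e t =
     (if t \<le> 0 then Vertex (fst e) else if len G e \<le> t then Vertex (snd e) else Inner e t)"

text \<open>For a finite graph the metric topology is the final topology for the edge parametrizations.\<close>

definition curve_topology :: "'v metric_graph \<Rightarrow> 'v point topology" where
  "curve_topology G = topology (\<lambda>U. U \<subseteq> curve G \<and>
     (\<forall>e \<in> edges G. openin (top_of_set {0..len G e}) {t \<in> {0..len G e}. edge_point G e t \<in> U}))"

lemma openin_curve_topology:
  "openin (curve_topology G) U \<longleftrightarrow> U \<subseteq> curve G \<and>
     (\<forall>e \<in> edges G. openin (top_of_set {0..len G e}) {t \<in> {0..len G e}. edge_point G e t \<in> U})"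
proof -
  define I where "I S e = {t \<in> {0..len G e}. edge_point G e t \<in> S}" for S e
  define P where
    "P U \<longleftrightarrow> U \<subseteq> curve G \<and> (\<forall>e \<in> edges G. openin (top_of_set {0..len G e}) (I U e))" for U
  have "P (S \<inter> T)" if "P S" "P T" for S T
  proof -
    have "I (S \<inter> T) e = I S e \<inter> I T e" for e by (auto simp: I_def)
    then show ?thesis using that by (auto simp: P_def)
  qed
  moreover have "P (\<Union>\<K>)" if K: "\<forall>S\<in>\<K>. P S" for \<K>
  proof -
    have "I (\<Union>\<K>) e = (\<Union>S\<in>\<K>. I S e)" for e by (auto simp: I_def)
    moreover have "openin (top_of_set {0..len G e}) (\<Union>S\<in>\<K>. I S e)" if "e \<in> edges G" for e
      using K that by (intro openin_Union) (auto simp: P_def)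
    ultimately show ?thesis using K by (auto simp: P_def)
  qed
  ultimately have "istopology P" by (simp add: istopology_def)
  then show ?thesis
    unfolding curve_topology_def P_def I_def by (simp add: topology_inverse')
qed

lemma topspace_curve_topology:
  assumes "tropical_curve G"
  shows "topspace (curve_topology G) = curve G"
proof (rule antisym)
  show "topspace (curve_topology G) \<subseteq> curve G"
    by (rule conjunct1 [OF iffD1 [OF openin_curve_topology openin_topspace]])
  have "{t \<in> {0..len G e}. edge_point G e t \<in> curve G} = {0..len G e}" if "e \<in> edges G" for e
    using assms that by (cases e) (auto simp: tropical_curve_def edge_point_def curve_def)
  then have "openin (curve_topology G) (curve G)"
    by (auto simp: openin_curve_topology)
  then show "curve G \<subseteq> topspace (curve_topology G)" by (rule openin_subset)
qed

text \<open>Functions on the curve are represented extensionally, i.e. with value \<open>undefined\<close> off it.\<close>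

definition rational_functions :: "'v metric_graph \<Rightarrow> ('v point \<Rightarrow> real) set" where
  "rational_functions G =
     {f \<in> extensional (curve G). continuous_map (curve_topology G) euclideanreal f \<and>
        (\<forall>e \<in> edges G. \<exists>B. finite B \<and>
           (\<forall>a b. 0 \<le> a \<and> a < b \<and> b \<le> len G e \<and> {a<..<b} \<inter> B = {} \<longrightarrow>
              (\<exists>(m::int) c. \<forall>t \<in> {a<..<b}. f (edge_point G e t) = of_int m * t + c)))}"

text \<open>Slope of \<open>g\<close> at \<open>t\<close> in the direction \<open>s\<close> (one of \<open>1\<close> and \<open>-1\<close>), for \<open>g\<close> piecewise linear with
  integer slopes.\<close>

definition out_slope :: "(real \<Rightarrow> real) \<Rightarrow> real \<Rightarrow> real \<Rightarrow> int" where
  "out_slope g t s = (THE m. \<forall>\<^sub>F h in at_right 0. g (t + s * h) = g t + of_int m * h)"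

text \<open>The tangent directions at \<open>x\<close>: two at a point of the interior of an edge, one for each incident
  edge at a vertex.\<close>

definition tangents :: "'v metric_graph \<Rightarrow> 'v point \<Rightarrow> (('v \<times> 'v) \<times> real \<times> real) set" where
  "tangents G x = {(e, t, s). e \<in> edges G \<and> 0 \<le> t \<and> t \<le> len G e \<and> edge_point G e t = x \<and>
     (s = 1 \<and> t < len G e \<or> s = -1 \<and> 0 < t)}"

definition ord_at :: "'v metric_graph \<Rightarrow> ('v point \<Rightarrow> real) \<Rightarrow> 'v point \<Rightarrow> int" where
  "ord_at G f x = (\<Sum>(e, t, s) \<in> tangents G x. out_slope (\<lambda>u. f (edge_point G e u)) t s)"

definition divisors :: "'v metric_graph \<Rightarrow> ('v point \<Rightarrow> int) set" where
  "divisors G = {D. finite {x. D x \<noteq> 0} \<and> {x. D x \<noteq> 0} \<subseteq> curve G}"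

definition div_degree :: "('v point \<Rightarrow> int) \<Rightarrow> int" where
  "div_degree D = (\<Sum>x | D x \<noteq> 0. D x)"

definition effective :: "('v point \<Rightarrow> int) \<Rightarrow> bool" where
  "effective D \<longleftrightarrow> (\<forall>x. 0 \<le> D x)"

definition add_div :: "'v metric_graph \<Rightarrow> ('v point \<Rightarrow> int) \<Rightarrow> ('v point \<Rightarrow> real) \<Rightarrow> 'v point \<Rightarrow> int" where
  "add_div G D f = (\<lambda>x. D x + ord_at G f x)"

definition lin_equiv :: "'v metric_graph \<Rightarrow> ('v point \<Rightarrow> int) \<Rightarrow> ('v point \<Rightarrow> int) \<Rightarrow> bool" where
  "lin_equiv G D D' \<longleftrightarrow> (\<exists>f \<in> rational_functions G. \<forall>x. D x - D' x = ord_at G f x)"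

definition linear_system :: "'v metric_graph \<Rightarrow> ('v point \<Rightarrow> int) \<Rightarrow> ('v point \<Rightarrow> int) set" where
  "linear_system G D = {E \<in> divisors G. effective E \<and> lin_equiv G E D}"

definition RR_space :: "'v metric_graph \<Rightarrow> ('v point \<Rightarrow> int) \<Rightarrow> ('v point \<Rightarrow> real) set" where
  "RR_space G D = {f \<in> rational_functions G. effective (add_div G D f)}"

definition div_rank :: "'v metric_graph \<Rightarrow> ('v point \<Rightarrow> int) \<Rightarrow> int" where
  "div_rank G D =
     int (LEAST n. \<exists>E \<in> divisors G. effective E \<and> div_degree E = int n \<and>
            linear_system G (\<lambda>x. D x - E x) = {}) - 1"

text \<open>The segments are the images of the unit interval under the embeddings \<open>\<gamma> i\<close>.\<close>

definition outdeg :: "'v metric_graph \<Rightarrow> 'v point set \<Rightarrow> 'v point \<Rightarrow> nat" where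
  "outdeg G X v = Max {n. \<exists>\<gamma> :: nat \<Rightarrow> real \<Rightarrow> 'v point.
     (\<forall>i<n. embedding_map (top_of_set {0..1}) (curve_topology G) (\<gamma> i) \<and> \<gamma> i 0 = v \<and>
            \<gamma> i ` {0..1} \<subseteq> curve G - (X - {v})) \<and>
     (\<forall>i<n. \<forall>j<n. i \<noteq> j \<longrightarrow> \<gamma> i ` {0<..<1} \<inter> \<gamma> j ` {0<..<1} = {})}"

definition is_reduced :: "'v metric_graph \<Rightarrow> 'v point \<Rightarrow> ('v point \<Rightarrow> int) \<Rightarrow> bool" where
  "is_reduced G P D \<longleftrightarrow>
     (\<forall>v \<in> curve G - {P}. 0 \<le> D v) \<and>
     (\<forall>X. closedin (curve_topology G) X \<and> connectedin (curve_topology G) X \<and> X \<noteq> {} \<and> P \<notin> X \<longrightarrow>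
        (\<exists>v \<in> (curve_topology G) frontier_of X. D v < int (outdeg G X v)))"

definition Red :: "'v metric_graph \<Rightarrow> ('v point \<Rightarrow> int) \<Rightarrow> 'v point \<Rightarrow> 'v point \<Rightarrow> int" where
  "Red G D P = (THE D'. D' \<in> divisors G \<and> lin_equiv G D' D \<and> is_reduced G P D')"

definition red_fun :: "'v metric_graph \<Rightarrow> ('v point \<Rightarrow> int) \<Rightarrow> 'v point \<Rightarrow> 'v point \<Rightarrow> real" where
  "red_fun G D P = (THE f. f \<in> rational_functions G \<and> add_div G D f = Red G D P \<and> f P = 0)"

text \<open>Two elements of \<open>RR_space G D\<close> have the same image under \<open>add_div G D\<close> iff they differ by a
  constant, so this is the topology of \<open>RR_space G D\<close> modulo constants, carried over to the linear
  system.\<close>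

definition linear_system_topology ::
    "'v metric_graph \<Rightarrow> ('v point \<Rightarrow> int) \<Rightarrow> ('v point \<Rightarrow> int) topology" where
  "linear_system_topology G D =
     quotient_topology (uniform_topology (curve G) (RR_space G D)) (add_div G D)"

definition mult_seq :: "'v metric_graph \<Rightarrow> ('v point \<Rightarrow> int) \<Rightarrow> 'v \<times> 'v \<Rightarrow> int list" where
  "mult_seq G E e =
     map (\<lambda>t. E (Inner e t)) (sorted_list_of_set {t \<in> {0<..<len G e}. E (Inner e t) \<noteq> 0})"

definition same_type :: "'v metric_graph \<Rightarrow> ('v point \<Rightarrow> int) \<Rightarrow> ('v point \<Rightarrow> int) \<Rightarrow> bool" where
  "same_type G E E' \<longleftrightarrow>
     (\<forall>v \<in> verts G. E (Vertex v) = E' (Vertex v)) \<and> (\<forall>e \<in> edges G. mult_seq G E e = mult_seq G E' e)"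

definition open_cells :: "'v metric_graph \<Rightarrow> ('v point \<Rightarrow> int) \<Rightarrow> ('v point \<Rightarrow> int) set set" where
  "open_cells G D = (\<Union>E \<in> linear_system G D.
     connected_components_of
       (subtopology (linear_system_topology G D) {E' \<in> linear_system G D. same_type G E E'}))"

text \<open>Open cells are connected, so those of dimension \<open>0\<close> are the singletons.\<close>

definition cell_vertices :: "'v metric_graph \<Rightarrow> ('v point \<Rightarrow> int) \<Rightarrow> ('v point \<Rightarrow> int) set" where
  "cell_vertices G D = {E. {E} \<in> open_cells G D}"

inductive_set red_module :: "'v metric_graph \<Rightarrow> ('v point \<Rightarrow> int) \<Rightarrow> ('v point \<Rightarrow> real) set"
  for G D where
  gen: "P \<in> curve G \<Longrightarrow> red_fun G D P \<in> red_module G D"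
| tmax: "f \<in> red_module G D \<Longrightarrow> g \<in> red_module G D \<Longrightarrow>
      (\<lambda>x \<in> curve G. max (f x) (g x)) \<in> red_module G D"
| shift: "f \<in> red_module G D \<Longrightarrow> (\<lambda>x \<in> curve G. c + f x) \<in> red_module G D"

text \<open>The quotient of the module by additive constants, as a subset of the linear system via
  \<open>f \<mapsto> D + div f\<close>; under this identification \<open>red_fun G D P\<close> becomes \<open>Red G D P\<close>.\<close>

definition reduced_linear_system ::
    "'v metric_graph \<Rightarrow> ('v point \<Rightarrow> int) \<Rightarrow> ('v point \<Rightarrow> int) set" where
  "reduced_linear_system G D = add_div G D ` red_module G D"

text \<open>The tropical semifield is the set of extended reals other than \<open>\<infinity>\<close>; \<open>trop_vectors F\<close> consists
  of the maps on \<open>F\<close> into it that are not constantly \<open>-\<infinity>\<close>.\<close>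

definition trop_vectors :: "'i set \<Rightarrow> ('i \<Rightarrow> ereal) set" where
  "trop_vectors F = {y \<in> F \<rightarrow>\<^sub>E {..<\<infinity>}. \<exists>i \<in> F. y i \<noteq> -\<infinity>}"

definition trop_class :: "'i set \<Rightarrow> ('i \<Rightarrow> ereal) \<Rightarrow> ('i \<Rightarrow> ereal) set" where
  "trop_class F y = {(\<lambda>i\<in>F. ereal c + y i) | c. True}"

definition TP_topology :: "'i set \<Rightarrow> ('i \<Rightarrow> ereal) set topology" where
  "TP_topology F =
     quotient_topology
       (subtopology (product_topology (\<lambda>_. top_of_set {..<\<infinity>}) F) (trop_vectors F)) (trop_class F)"

definition trop_conv :: "'i set \<Rightarrow> ('i \<Rightarrow> ereal) set set \<Rightarrow> ('i \<Rightarrow> ereal) set set" where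
  "trop_conv F S =
     {trop_class F (\<lambda>i\<in>F. Max ((\<lambda>(c, s). ereal c + s i) ` A)) | A :: (real \<times> ('i \<Rightarrow> ereal)) set.
        finite A \<and> A \<noteq> {} \<and> A \<subseteq> UNIV \<times> \<Union>S}"

text \<open>When \<open>Red G D\<close> takes the same value at several points, this set contains functions that differ
  by constants; it is finite up to additive constants only.\<close>

definition vertex_funs :: "'v metric_graph \<Rightarrow> ('v point \<Rightarrow> int) \<Rightarrow> ('v point \<Rightarrow> real) set" where
  "vertex_funs G D = {red_fun G D P | P. P \<in> curve G \<and> Red G D P \<in> cell_vertices G D}"

definition eval_class :: "('p \<Rightarrow> real) set \<Rightarrow> 'p \<Rightarrow> (('p \<Rightarrow> real) \<Rightarrow> ereal) set" where
  "eval_class F P = trop_class F (\<lambda>f\<in>F. ereal (f P))"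

end

theory Submission
  imports Defs
begin

text \<open>Maximality among all \<open>f\<close> in \<open>R(D)\<close> with \<open>f(P) = 0\<close> characterises \<open>f\<^sub>P\<close>: the pointwise supremum
  of these functions lies in \<open>R(D)\<close>, because slopes in \<open>R(D)\<close> are bounded, and its divisor is
  \<open>P\<close>-reduced, because a set on which firing were possible would produce a larger function.

  This gives \<open>f\<^sub>P(x) \<le> f\<^sub>Q(x) + f\<^sub>P(Q)\<close>. The key point is that for given \<open>x\<close> and \<open>P\<close> there is a \<open>Q\<close> for which
  \<open>D\<^sub>Q\<close> is a vertex and \<open>f\<^sub>Q(x) = f\<^sub>P(x) + f\<^sub>Q(P)\<close>. Among the \<open>Q\<close> satisfying this equation take one
  that minimises the integral of \<open>f\<^sub>Q - f\<^sub>Q(x)\<close> over the curve. If \<open>D\<^sub>Q\<close> is not a vertex, its chips can be moved within its cell,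
  and the chips in the interiors of edges then separate the curve; moving \<open>Q\<close> across the cut, away
  from the side of \<open>x\<close>, keeps the equation and contradicts minimality. Consequently \<open>f\<^sub>P\<close>
  is the maximum over the vertex functions \<open>f\<close> of \<open>f - f(P)\<close>, and the reduced module is generated
  by finitely many vertex functions.

  Tropical residuation then provides the homeomorphism: a module element \<open>g\<close> has the coordinates
  \<open>z(f) = max (f - g)\<close>, and is recovered from them as the maximum of the functions \<open>f - z(f)\<close>. Both maps
  are continuous and commute with adding constants, and both projectivizations are open quotients.\<close>

section \<open>Piecewise linear functions on a curve\<close>

text \<open>Slopes are integers and uniformly bounded on R(D), so only finitely many slope patterns
  occur at a point. Functions that approach the supremum can therefore be chosen with one common
  pattern, which keeps the supremum piecewise linear and inside R(D). Maximality of f_P is used in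
  the form \<open>u \<le> u(P)\<close> for every correction \<open>u\<close> that keeps f_P in R(D).
  It yields reducedness, and it forces Q to lie on every cut of D_Q: the side missing Q could
  otherwise be fired. So Q is itself a chip inside an edge. Sending all its chips across the cut,
  with Q moved a distance h along with them, makes f_Q'(Q) + f_Q(Q') equal to D_Q(Q) h: firing gives
  one inequality, the order at Q the other. This equality preserves the equation for x. Two points
  with the same reduced divisor give vertex functions that differ by a constant, so there may be
  infinitely many of these. Coordinates are indexed by all of them, while maxima run over finitely
  many representatives; the product topology suffices because each function is recovered from the
  latter.\<close>

definition ray :: "'v metric_graph \<Rightarrow> ('v \<times> 'v) \<times> real \<times> real \<Rightarrow> real \<Rightarrow> 'v point" where
  "ray G \<tau> h = (case \<tau> of (e, t, s) \<Rightarrow> edge_point G e (t + s * h))"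

text \<open>Germs along rays take the place of neighbourhoods: openness, closedness and continuity
  on the curve are restated through them, which makes most arguments one-dimensional.
  \<open>edge_point\<close> clamps its parameter, so a ray never leaves the curve and only small
  \<open>h\<close> carry information.\<close>

definition near :: "'v metric_graph \<Rightarrow> ('v \<times> 'v) \<times> real \<times> real \<Rightarrow> ('v point \<Rightarrow> bool) \<Rightarrow> bool" where
  "near G \<tau> P \<longleftrightarrow> (\<forall>\<^sub>F h in at_right 0. P (ray G \<tau> h))"

definition has_slope ::
    "'v metric_graph \<Rightarrow> ('v point \<Rightarrow> real) \<Rightarrow> 'v point \<Rightarrow> ('v \<times> 'v) \<times> real \<times> real \<Rightarrow> int \<Rightarrow> bool" where
  "has_slope G f x \<tau> m \<longleftrightarrow> (\<forall>\<^sub>F h in at_right 0. f (ray G \<tau> h) = f x + of_int m * h)"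

definition slope :: "'v metric_graph \<Rightarrow> ('v point \<Rightarrow> real) \<Rightarrow> ('v \<times> 'v) \<times> real \<times> real \<Rightarrow> int" where
  "slope G f \<tau> = (case \<tau> of (e, t, s) \<Rightarrow> out_slope (\<lambda>u. f (edge_point G e u)) t s)"

text \<open>A purely local notion: continuity is a consequence, and so is finiteness of the
  breakpoints, by compactness of the edges (\<open>finite_ord_edge\<close>). In this form it can be
  verified for suprema and for functions glued from pieces; \<open>rational_iff\<close> is the
  bridge to rational functions.\<close>

definition pl :: "'v metric_graph \<Rightarrow> ('v point \<Rightarrow> real) \<Rightarrow> bool" where
  "pl G f \<longleftrightarrow> (\<forall>x \<in> curve G. \<forall>\<tau> \<in> tangents G x. \<exists>m. has_slope G f x \<tau> m)"

lemma ord_at_slope: "ord_at G f x = (\<Sum>\<tau>\<in>tangents G x. slope G f \<tau>)"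
  by (simp add: ord_at_def slope_def)

lemma eventually_at_right_0:
  "(\<forall>\<^sub>F h in at_right (0::real). P h) \<longleftrightarrow> (\<exists>r>0. \<forall>h. 0 < h \<and> h < r \<longrightarrow> P h)"
  by (auto simp: eventually_at_right_field)

lemma near_iff: "near G \<tau> P \<longleftrightarrow> (\<exists>r>0. \<forall>h. 0 < h \<and> h < r \<longrightarrow> P (ray G \<tau> h))"
  unfolding near_def eventually_at_right_0 ..

lemma near_conj: "near G \<tau> P \<Longrightarrow> near G \<tau> Q \<Longrightarrow> near G \<tau> (\<lambda>y. P y \<and> Q y)"
  unfolding near_def by (rule eventually_conj)

lemma near_mono: "near G \<tau> P \<Longrightarrow> (\<And>y. P y \<Longrightarrow> Q y) \<Longrightarrow> near G \<tau> Q"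
  unfolding near_def by (erule eventually_mono)

lemma near_False: "\<not> near G \<tau> (\<lambda>y. False)"
  unfolding near_iff by (metis dense)

lemma near_ex: "near G \<tau> P \<Longrightarrow> \<exists>y. P y"
  using near_False near_mono by metis

lemma has_slope_unique:
  assumes "has_slope G f x \<tau> m" "has_slope G f x \<tau> n" shows "m = n"
proof -
  have "\<forall>\<^sub>F h in at_right (0::real). f x + of_int m * h = f x + of_int n * h"
    by (rule eventually_elim2[OF assms[unfolded has_slope_def]]) metis
  then obtain r where "r > 0" "\<forall>h. 0 < h \<and> h < r \<longrightarrow> f x + of_int m * h = f x + of_int n * h"
    unfolding eventually_at_right_0 by auto
  then have "of_int m * (r/2) = of_int n * (r/2)" by (auto dest!: spec[of _ "r/2"])
  with \<open>r > 0\<close> show ?thesis by simp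
qed

lemma ray_0: "\<tau> \<in> tangents G x \<Longrightarrow> ray G \<tau> 0 = x"
  by (auto simp: tangents_def ray_def)

lemma slope_eq:
  assumes "\<tau> \<in> tangents G x" "has_slope G f x \<tau> m" shows "slope G f \<tau> = m"
proof -
  obtain e t s where \<tau>: "\<tau> = (e, t, s)" by (cases \<tau>)
  have x: "edge_point G e t = x" using assms(1) by (auto simp: \<tau> tangents_def)
  have "(\<forall>\<^sub>F h in at_right 0. f (edge_point G e (t + s * h)) = f (edge_point G e t) + of_int k * h)
        \<longleftrightarrow> has_slope G f x \<tau> k" for k
    by (simp add: has_slope_def \<tau> ray_def x)
  then have "slope G f \<tau> = (THE k. has_slope G f x \<tau> k)"
    unfolding slope_def out_slope_def by (simp add: \<tau>)
  also have "\<dots> = m"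
    using assms(2) has_slope_unique[OF _ assms(2)] by (rule the_equality)
  finally show ?thesis .
qed

lemma pl_slope: "pl G f \<Longrightarrow> x \<in> curve G \<Longrightarrow> \<tau> \<in> tangents G x \<Longrightarrow> has_slope G f x \<tau> (slope G f \<tau>)"
  unfolding pl_def using slope_eq by metis

lemma has_slope_add: "has_slope G f x \<tau> m \<Longrightarrow> has_slope G g x \<tau> n \<Longrightarrow> has_slope G (\<lambda>y. f y + g y) x \<tau> (m + n)"
  unfolding has_slope_def by (erule (1) eventually_elim2) (simp add: algebra_simps)

lemma has_slope_diff: "has_slope G f x \<tau> m \<Longrightarrow> has_slope G g x \<tau> n \<Longrightarrow> has_slope G (\<lambda>y. f y - g y) x \<tau> (m - n)"
  unfolding has_slope_def by (erule (1) eventually_elim2) (simp add: algebra_simps)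

lemma has_slope_const: "has_slope G (\<lambda>y. c) x \<tau> 0"
  unfolding has_slope_def by simp

lemma has_slope_tendsto:
  assumes "has_slope G f x \<tau> m" shows "((\<lambda>h. f (ray G \<tau> h)) \<longlongrightarrow> f x) (at_right 0)"
proof -
  have "((\<lambda>h::real. f x + of_int m * h) \<longlongrightarrow> f x + of_int m * 0) (at_right 0)"
    by (intro tendsto_intros)
  then show ?thesis using assms unfolding has_slope_def
    by (simp add: tendsto_cong)
qed

text \<open>Off a tie, continuity keeps the larger function larger along a short ray; at a tie the
  larger slope wins because \<open>h > 0\<close>.\<close>

lemma has_slope_max:
  assumes f: "has_slope G f x \<tau> m" and g: "has_slope G g x \<tau> n"
  shows "has_slope G (\<lambda>y. max (f y) (g y)) x \<tau> (if f x > g x then m else if g x > f x then n else max m n)"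
proof -
  consider "f x > g x" | "g x > f x" | "f x = g x" by linarith
  then show ?thesis
  proof cases
    case 1
    have "\<forall>\<^sub>F h in at_right 0. g (ray G \<tau> h) < (f x + g x)/2" "\<forall>\<^sub>F h in at_right 0. f (ray G \<tau> h) > (f x + g x)/2"
      using order_tendstoD(1)[OF has_slope_tendsto[OF f], of "(f x + g x)/2"]
        order_tendstoD(2)[OF has_slope_tendsto[OF g], of "(f x + g x)/2"] 1 by (simp_all add: field_simps)
    with f show ?thesis unfolding has_slope_def
      by eventually_elim (use 1 in auto)
  next
    case 2
    have "\<forall>\<^sub>F h in at_right 0. f (ray G \<tau> h) < (f x + g x)/2" "\<forall>\<^sub>F h in at_right 0. g (ray G \<tau> h) > (f x + g x)/2"
      using order_tendstoD(2)[OF has_slope_tendsto[OF f], of "(f x + g x)/2"]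
        order_tendstoD(1)[OF has_slope_tendsto[OF g], of "(f x + g x)/2"] 2 by (simp_all add: field_simps)
    with g show ?thesis unfolding has_slope_def
      by eventually_elim (use 2 in auto)
  next
    case 3
    have p: "\<forall>\<^sub>F h in at_right 0. h > (0::real)" by (simp add: eventually_at_right_less)
    show ?thesis using f g p unfolding has_slope_def
      by eventually_elim (use 3 in \<open>auto simp: max_def mult_right_mono\<close>)
  qed
qed

lemma has_slope_tangent_le:
  assumes "has_slope G f x \<tau> m" and "\<forall>\<^sub>F h in at_right 0. f (ray G \<tau> h) \<le> f x + c * h"
  shows "of_int m \<le> c"
proof -
  have "\<forall>\<^sub>F h in at_right (0::real). of_int m * h \<le> c * h"
    by (rule eventually_elim2[OF assms[unfolded has_slope_def]]) simp
  then obtain r where "r>0" "\<forall>h. 0 < h \<and> h < r \<longrightarrow> of_int m * h \<le> c * h"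
    unfolding eventually_at_right_0 by auto
  then have "of_int m * (r/2) \<le> c * (r/2)" by (auto dest!: spec[of _ "r/2"])
  then show ?thesis using \<open>r>0\<close> by simp
qed

lemma has_slope_tangent_ge:
  assumes "has_slope G f x \<tau> m" and "\<forall>\<^sub>F h in at_right 0. f (ray G \<tau> h) \<ge> f x + c * h"
  shows "of_int m \<ge> c"
proof -
  have "\<forall>\<^sub>F h in at_right (0::real). c * h \<le> of_int m * h"
    by (rule eventually_elim2[OF assms[unfolded has_slope_def]]) simp
  then obtain r where "r>0" "\<forall>h. 0 < h \<and> h < r \<longrightarrow> c * h \<le> of_int m * h"
    unfolding eventually_at_right_0 by auto
  then have "c * (r/2) \<le> of_int m * (r/2)" by (auto dest!: spec[of _ "r/2"])
  then show ?thesis using \<open>r>0\<close> by simp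
qed

lemma pl_add: "pl G f \<Longrightarrow> pl G g \<Longrightarrow> pl G (\<lambda>y. f y + g y)"
  unfolding pl_def using has_slope_add[of G f _ _ _ g] by fast
lemma pl_diff: "pl G f \<Longrightarrow> pl G g \<Longrightarrow> pl G (\<lambda>y. f y - g y)"
  unfolding pl_def using has_slope_diff[of G f _ _ _ g] by fast
lemma pl_max: "pl G f \<Longrightarrow> pl G g \<Longrightarrow> pl G (\<lambda>y. max (f y) (g y))"
  unfolding pl_def using has_slope_max[of G f _ _ _ g] by fast
lemma pl_const: "pl G (\<lambda>y. c)"
  unfolding pl_def using has_slope_const[of G c] by fast

section \<open>The topology of the curve through germs\<close>

locale trop_curve =
  fixes G :: "'v metric_graph"
  assumes tropical: "tropical_curve G"
begin

abbreviation "\<Gamma> \<equiv> curve G"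
abbreviation "T \<equiv> curve_topology G"

lemma edgeD:
  assumes "e \<in> edges G"
  shows "fst e \<in> verts G" "snd e \<in> verts G" "fst e \<noteq> snd e" "0 < len G e"
  using tropical assms by (cases e; force simp: tropical_curve_def)+

lemma finite_verts: "finite (verts G)" and verts_ne: "verts G \<noteq> {}"
  using tropical by (auto simp: tropical_curve_def)

lemma finite_edges: "finite (edges G)"
  using tropical by (auto simp: tropical_curve_def intro: finite_subset[of _ "verts G \<times> verts G"])

lemma topspace_T [simp]: "topspace T = \<Gamma>"
  by (rule topspace_curve_topology[OF tropical])

lemma edge_point_simps [simp]:
  assumes "e \<in> edges G"
  shows "edge_point G e 0 = Vertex (fst e)" "edge_point G e (len G e) = Vertex (snd e)"
    "0 < t \<Longrightarrow> t < len G e \<Longrightarrow> edge_point G e t = Inner e t"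
  using edgeD[OF assms] by (auto simp: edge_point_def)

lemma edge_point_in: "e \<in> edges G \<Longrightarrow> edge_point G e t \<in> \<Gamma>"
  using edgeD[of e] unfolding edge_point_def curve_def by (cases e) auto

lemma ray_in: "\<tau> \<in> tangents G x \<Longrightarrow> ray G \<tau> h \<in> \<Gamma>"
  by (auto simp: tangents_def ray_def intro: edge_point_in)

lemma curve_cases:
  assumes "y \<in> \<Gamma>"
  obtains v where "v \<in> verts G" "y = Vertex v"
  | e t where "e \<in> edges G" "0 < t" "t < len G e" "y = Inner e t" "y = edge_point G e t"
  using assms by (auto simp: curve_def)

lemma tangents_Vertex:
  "tangents G (Vertex v) = (\<lambda>e. (e, 0, 1)) ` {e \<in> edges G. fst e = v} \<union> (\<lambda>e. (e, len G e, -1)) ` {e \<in> edges G. snd e = v}"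
proof -
  have "edge_point G e t = Vertex v \<longleftrightarrow> (t = 0 \<and> fst e = v) \<or> (t = len G e \<and> snd e = v)"
    if "e \<in> edges G" "0 \<le> t" "t \<le> len G e" for e t
    using that edgeD[of e] by (auto simp: edge_point_def)
  then have "(e, t, s) \<in> tangents G (Vertex v) \<longleftrightarrow> e \<in> edges G \<and> 0 \<le> t \<and> t \<le> len G e \<and>
       ((t = 0 \<and> fst e = v) \<or> (t = len G e \<and> snd e = v)) \<and> (s = 1 \<and> t < len G e \<or> s = -1 \<and> 0 < t)" for e t s
    unfolding tangents_def by blast
  then show ?thesis using less_imp_le[OF edgeD(4)] edgeD(4) by (auto simp: image_iff)
qed

lemma tangents_Inner:
  assumes "e \<in> edges G" "0 < t" "t < len G e"
  shows "tangents G (Inner e t) = {(e, t, 1), (e, t, -1)}"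
proof -
  have "edge_point G e' t' = Inner e t \<longleftrightarrow> e' = e \<and> t' = t" if "e' \<in> edges G" "0 \<le> t'" "t' \<le> len G e'" for e' t'
    using that assms by (auto simp: edge_point_def)
  then show ?thesis using assms by (auto simp: tangents_def)
qed

lemma finite_tangents: "finite (tangents G x)"
proof (cases x)
  case (Vertex v) then show ?thesis by (simp add: tangents_Vertex finite_edges)
next
  case (Inner e t)
  have "tangents G (Inner e t) \<subseteq> {(e, t, 1), (e, t, -1)}"
    by (auto simp: tangents_def edge_point_def split: if_splits)
  then show ?thesis using Inner finite_subset by fastforce
qed

lemma tangents_off: "x \<notin> \<Gamma> \<Longrightarrow> tangents G x = {}"
  using edge_point_in by (auto simp: tangents_def)

lemma ord_at_off: "x \<notin> \<Gamma> \<Longrightarrow> ord_at G f x = 0"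
  by (simp add: ord_at_slope tangents_off)

lemma tangent_arm:
  assumes "(e, t, s) \<in> tangents G x"
  obtains R where "R > 0" "\<And>h. 0 < h \<Longrightarrow> h < R \<Longrightarrow> 0 < t + s * h \<and> t + s * h < len G e"
    "\<And>h. 0 < h \<Longrightarrow> h < R \<Longrightarrow> ray G (e, t, s) h = Inner e (t + s * h)"
    "\<And>h. 0 < h \<Longrightarrow> h < R \<Longrightarrow> tangents G (ray G (e, t, s) h) = {(e, t + s * h, 1), (e, t + s * h, -1)}"
proof -
  have e: "e \<in> edges G" and c: "0 \<le> t" "t \<le> len G e" "s = 1 \<and> t < len G e \<or> s = -1 \<and> 0 < t"
    using assms by (auto simp: tangents_def)
  define R where "R = (if s = 1 then len G e - t else t)"
  have "R > 0" using c by (auto simp: R_def)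
  moreover have a: "0 < t + s * h \<and> t + s * h < len G e" if "0 < h" "h < R" for h
    using that c by (auto simp: R_def split: if_splits)
  moreover from a have b: "ray G (e, t, s) h = Inner e (t + s * h)" if "0 < h" "h < R" for h
    using that by (simp add: ray_def e)
  moreover have "tangents G (ray G (e, t, s) h) = {(e, t + s * h, 1), (e, t + s * h, -1)}" if "0 < h" "h < R" for h
    using a b e that tangents_Inner by simp
  ultimately show ?thesis using that by blast
qed

lemma tangentD:
  assumes "(e, t, s) \<in> tangents G x"
  shows "e \<in> edges G" "0 \<le> t" "t \<le> len G e" "edge_point G e t = x" "s = 1 \<or> s = -1" "x \<in> \<Gamma>"
  using assms edge_point_in[of e t] by (auto simp: tangents_def)

lemma edge_fwd: "e \<in> edges G \<Longrightarrow> 0 \<le> t \<Longrightarrow> t < len G e \<Longrightarrow> (e, t, 1) \<in> tangents G (edge_point G e t)"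
  by (auto simp: tangents_def)
lemma edge_bwd: "e \<in> edges G \<Longrightarrow> 0 < t \<Longrightarrow> t \<le> len G e \<Longrightarrow> (e, t, -1) \<in> tangents G (edge_point G e t)"
  by (auto simp: tangents_def)

text \<open>A subset of a closed interval is relatively open iff it contains a one-sided
  neighbourhood on each existing side of each of its points, and these sides are the tangent
  directions.\<close>

lemma openin_T_iff:
  "openin T U \<longleftrightarrow> U \<subseteq> \<Gamma> \<and> (\<forall>x\<in>U. \<forall>\<tau>\<in>tangents G x. near G \<tau> (\<lambda>y. y \<in> U))" (is "?L = ?R")
proof
  assume L: ?L
  have "near G (e,t,s) (\<lambda>y. y \<in> U)" if x: "x \<in> U" and \<tau>: "(e,t,s) \<in> tangents G x" for x e t s
  proof -
    note D = tangentD[OF \<tau>]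
    obtain R where R: "R > 0" "\<And>h. 0 < h \<Longrightarrow> h < R \<Longrightarrow> 0 < t + s * h \<and> t + s * h < len G e"
      using tangent_arm[OF \<tau>] by metis
    have "openin (top_of_set {0..len G e}) {t \<in> {0..len G e}. edge_point G e t \<in> U}"
      using L D(1) unfolding openin_curve_topology by blast
    moreover have "t \<in> {t \<in> {0..len G e}. edge_point G e t \<in> U}" using D x by auto
    ultimately obtain d where d: "d > 0" "ball t d \<inter> {0..len G e} \<subseteq> {t \<in> {0..len G e}. edge_point G e t \<in> U}"
      unfolding openin_contains_ball by blast
    have "ray G (e,t,s) h \<in> U" if "0 < h" "h < min d R" for h
    proof -
      have "t + s * h \<in> ball t d \<inter> {0..len G e}" using that R(2)[of h] D(5) by (auto simp: dist_real_def)
      with d show ?thesis by (auto simp: ray_def)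
    qed
    then show ?thesis unfolding near_iff using d R by (intro exI[of _ "min d R"]) auto
  qed
  then have "near G \<tau> (\<lambda>y. y \<in> U)" if "x \<in> U" "\<tau> \<in> tangents G x" for x \<tau>
    using that by (cases \<tau>) simp
  moreover have "U \<subseteq> \<Gamma>" using openin_subset[OF L] by simp
  ultimately show ?R by blast
next
  assume R: ?R
  show ?L unfolding openin_curve_topology
  proof (intro conjI ballI)
    show "U \<subseteq> \<Gamma>" using R by blast
    fix e assume e: "e \<in> edges G"
    show "openin (top_of_set {0..len G e}) {t \<in> {0..len G e}. edge_point G e t \<in> U}"
      unfolding openin_contains_ball
    proof (intro conjI ballI)
      fix t assume "t \<in> {t \<in> {0..len G e}. edge_point G e t \<in> U}"
      then have t: "0 \<le> t" "t \<le> len G e" "edge_point G e t \<in> U" by auto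
      obtain a where a: "a > 0" "\<And>h. 0 < h \<Longrightarrow> h < a \<Longrightarrow> t + h < len G e \<Longrightarrow> edge_point G e (t + h) \<in> U"
      proof (cases "t < len G e")
        case True
        then have "near G (e,t,1) (\<lambda>y. y \<in> U)" using R edge_fwd[OF e t(1)] t by blast
        then obtain r where "r>0" "\<forall>h. 0 < h \<and> h < r \<longrightarrow> ray G (e,t,1) h \<in> U" unfolding near_iff by auto
        with that[of r] show ?thesis by (auto simp: ray_def)
      qed (use that[of 1] in auto)
      obtain b where b: "b > 0" "\<And>h. 0 < h \<Longrightarrow> h < b \<Longrightarrow> 0 < t - h \<Longrightarrow> edge_point G e (t - h) \<in> U"
      proof (cases "0 < t")
        case True
        then have "near G (e,t,-1) (\<lambda>y. y \<in> U)" using R edge_bwd[OF e _ t(2)] t by blast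
        then obtain r where "r>0" "\<forall>h. 0 < h \<and> h < r \<longrightarrow> ray G (e,t,-1) h \<in> U" unfolding near_iff by auto
        with that[of r] show ?thesis by (auto simp: ray_def)
      qed (use that[of 1] in auto)
      \<comment> \<open>The second minimum keeps every \<open>u\<close> other than \<open>t\<close>
        strictly inside the edge; the value \<open>1\<close> stands for a side that does not
        exist.\<close>
      define d where "d = min (min a b) (min (if t < len G e then len G e - t else 1) (if 0 < t then t else 1))"
      have "d > 0" using a b by (auto simp: d_def)
      moreover have "edge_point G e u \<in> U" if "u \<in> ball t d" "u \<in> {0..len G e}" for u
      proof -
        consider "u = t" | "u > t" | "u < t" by linarith
        then show ?thesis
        proof cases
          case 2
          then show ?thesis using a(2)[of "u - t"] that by (auto simp: d_def dist_real_def split: if_splits)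
        next
          case 3
          then show ?thesis using b(2)[of "t - u"] that by (auto simp: d_def dist_real_def split: if_splits)
        qed (use t in simp)
      qed
      ultimately show "\<exists>d>0. ball t d \<inter> {0..len G e} \<subseteq> {t \<in> {0..len G e}. edge_point G e t \<in> U}" by blast
    qed blast
  qed
qed

lemma closedin_T_iff:
  "closedin T X \<longleftrightarrow> X \<subseteq> \<Gamma> \<and> (\<forall>x\<in>\<Gamma> - X. \<forall>\<tau>\<in>tangents G x. near G \<tau> (\<lambda>y. y \<notin> X))"
proof -
  have "near G \<tau> (\<lambda>y. y \<in> \<Gamma> - X) \<longleftrightarrow> near G \<tau> (\<lambda>y. y \<notin> X)" if "\<tau> \<in> tangents G x" for x \<tau>
    unfolding near_def using ray_in[OF that] by simp
  then show ?thesis unfolding closedin_def openin_T_iff topspace_T by (metis Diff_subset)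
qed

lemma continuous_map_T_iff:
  "continuous_map T euclidean (f::_ \<Rightarrow> 'b::topological_space) \<longleftrightarrow> (\<forall>x\<in>\<Gamma>. \<forall>\<tau>\<in>tangents G x. ((\<lambda>h. f (ray G \<tau> h)) \<longlongrightarrow> f x) (at_right 0))"
  (is "?L = ?R")
proof -
  have "?L \<longleftrightarrow> (\<forall>V. open V \<longrightarrow> openin T {x\<in>\<Gamma>. f x \<in> V})"
    by (simp add: continuous_map_def)
  also have "\<dots> \<longleftrightarrow> (\<forall>V. open V \<longrightarrow> (\<forall>x\<in>\<Gamma>. f x \<in> V \<longrightarrow> (\<forall>\<tau>\<in>tangents G x. \<forall>\<^sub>F h in at_right 0. f (ray G \<tau> h) \<in> V)))"
    unfolding openin_T_iff near_def by (auto simp: ray_in)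
  also have "\<dots> \<longleftrightarrow> ?R" unfolding tendsto_def by blast
  finally show ?thesis .
qed

lemma pl_continuous: "pl G f \<Longrightarrow> continuous_map T euclideanreal f"
  unfolding continuous_map_T_iff pl_def using has_slope_tendsto by blast

lemma continuous_edge_point: "e \<in> edges G \<Longrightarrow> continuous_map (top_of_set {0..len G e}) T (edge_point G e)"
  unfolding continuous_map_def using edge_point_in by (auto simp: openin_curve_topology)

lemma continuous_map_T_edges:
  "continuous_map T euclidean (f::_ \<Rightarrow> 'b::topological_space) \<longleftrightarrow> (\<forall>e\<in>edges G. continuous_on {0..len G e} (\<lambda>t. f (edge_point G e t)))"
proof -
  have "continuous_map T euclidean f \<longleftrightarrow> (\<forall>V. open V \<longrightarrow> openin T {x\<in>\<Gamma>. f x \<in> V})"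
    by (simp add: continuous_map_def)
  also have "\<dots> \<longleftrightarrow> (\<forall>V. open V \<longrightarrow> (\<forall>e\<in>edges G. openin (top_of_set {0..len G e}) ({0..len G e} \<inter> (\<lambda>t. f (edge_point G e t)) -` V)))"
    unfolding openin_curve_topology using edge_point_in
    by (intro all_cong1 imp_cong refl) (auto simp: Int_def Collect_conj_eq[symmetric] cong: ball_cong)
  also have "\<dots> \<longleftrightarrow> (\<forall>e\<in>edges G. continuous_on {0..len G e} (\<lambda>t. f (edge_point G e t)))"
    by (simp add: continuous_on_open_gen continuous_openin_preimage_eq) blast
  finally show ?thesis .
qed

text \<open>The vertices are listed separately because a curve may consist of a single vertex
  without edges.\<close>

lemma curve_eq: "\<Gamma> = Vertex ` verts G \<union> (\<Union>e\<in>edges G. edge_point G e ` {0..len G e})"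
proof
  show "\<Gamma> \<subseteq> Vertex ` verts G \<union> (\<Union>e\<in>edges G. edge_point G e ` {0..len G e})"
  proof
    fix y assume "y \<in> \<Gamma>"
    then show "y \<in> Vertex ` verts G \<union> (\<Union>e\<in>edges G. edge_point G e ` {0..len G e})"
    proof (cases rule: curve_cases)
      case (2 e t)
      then have "y \<in> edge_point G e ` {0..len G e}" by (metis atLeastAtMost_iff imageI less_imp_le)
      with 2(1) show ?thesis by blast
    qed auto
  qed
next
  show "Vertex ` verts G \<union> (\<Union>e\<in>edges G. edge_point G e ` {0..len G e}) \<subseteq> \<Gamma>"
    using edge_point_in by (intro Un_least UN_least image_subsetI) (simp_all add: curve_def)
qed

lemma compact_T: "compactin T \<Gamma>"
proof -
  have "compactin T (Vertex ` verts G)"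
    using finite_verts by (intro finite_imp_compactin) (auto simp: curve_def)
  moreover have "compactin T (\<Union>e\<in>edges G. edge_point G e ` {0..len G e})"
    using finite_edges continuous_edge_point
    by (intro compactin_Union finite_imageI) (auto intro!: image_compactin simp: compactin_subtopology)
  ultimately show ?thesis unfolding curve_eq by (rule compactin_Un)
qed

lemma attains_max:
  assumes "continuous_map T euclideanreal f"
  obtains x where "x \<in> \<Gamma>" "\<And>y. y \<in> \<Gamma> \<Longrightarrow> f y \<le> f x"
proof -
  have "compact (f ` \<Gamma>)" using image_compactin[OF compact_T assms] by simp
  moreover have "f ` \<Gamma> \<noteq> {}" using verts_ne by (auto simp: curve_def)
  ultimately show ?thesis using compact_attains_sup[of "f ` \<Gamma>"] that by auto
qed

lemma edges_connect: "u \<in> verts G \<Longrightarrow> v \<in> verts G \<Longrightarrow> (u, v) \<in> (edges G \<union> (edges G)\<inverse>)\<^sup>*"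
  using tropical by (auto simp: tropical_curve_def)

text \<open>An edge is a continuous image of an interval, so a separation leaves each edge on one
  side; consecutive edges share a vertex, and the graph is connected.\<close>

lemma connected_T: "connectedin T \<Gamma>"
proof -
  have "connected_space T" unfolding connected_space_def
  proof (intro notI, elim exE conjE)
    fix U V assume U: "openin T U" and V: "openin T V" and c: "topspace T \<subseteq> U \<union> V" "U \<inter> V = {}" "U \<noteq> {}" "V \<noteq> {}"
    have edge: "edge_point G e ` {0..len G e} \<subseteq> U \<or> edge_point G e ` {0..len G e} \<subseteq> V" if e: "e \<in> edges G" for e
    proof -
      have "connectedin T (edge_point G e ` {0..len G e})"
        using continuous_edge_point[OF e] by (rule connectedin_continuous_map_image) (simp add: connectedin_subtopology)
      then have "\<not> (edge_point G e ` {0..len G e} \<subseteq> U \<union> V \<and> U \<inter> V \<inter> edge_point G e ` {0..len G e} = {} \<and>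
         U \<inter> edge_point G e ` {0..len G e} \<noteq> {} \<and> V \<inter> edge_point G e ` {0..len G e} \<noteq> {})"
        using U V unfolding connectedin by blast
      moreover have "edge_point G e ` {0..len G e} \<subseteq> \<Gamma>" using edge_point_in[OF e] by auto
      moreover have "A \<subseteq> U \<or> A \<subseteq> V" if "\<not> (A \<subseteq> U \<union> V \<and> U \<inter> V \<inter> A = {} \<and> U \<inter> A \<noteq> {} \<and> V \<inter> A \<noteq> {})" "A \<subseteq> \<Gamma>" for A
        using that c(1,2) by auto
      ultimately show ?thesis by metis
    qed
    have ep: "Vertex (fst e) \<in> edge_point G e ` {0..len G e}" "Vertex (snd e) \<in> edge_point G e ` {0..len G e}" if "e \<in> edges G" for e
      using imageI[of 0 "{0..len G e}" "edge_point G e"] imageI[of "len G e" "{0..len G e}" "edge_point G e"]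
        edgeD(4)[OF that] edge_point_simps(1,2)[OF that] by simp_all
    have key: "W' = {}" if W: "W \<union> W' = \<Gamma>" "W \<inter> W' = {}" "Vertex u \<in> W" "u \<in> verts G"
      and E: "\<And>e. e \<in> edges G \<Longrightarrow> edge_point G e ` {0..len G e} \<subseteq> W \<or> edge_point G e ` {0..len G e} \<subseteq> W'" for W W' u
    proof -
      have v: "Vertex v \<in> W" if "v \<in> verts G" for v
        using edges_connect[OF W(4) that]
      proof (induction rule: rtrancl_induct)
        case (step y z)
        from step(2) obtain e where e: "e \<in> edges G" "e = (y,z) \<or> e = (z,y)" by auto
        have "Vertex y \<in> edge_point G e ` {0..len G e}" "Vertex z \<in> edge_point G e ` {0..len G e}"
          using ep[OF e(1)] e(2) by auto
        then show ?case using E[OF e(1)] step(3) W(2) by (metis IntI empty_iff subsetD)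
      qed (rule W(3))
      have "edge_point G e ` {0..len G e} \<subseteq> W" if "e \<in> edges G" for e
        using v[OF edgeD(1)[OF that]] ep[OF that] E[OF that] W(2) by blast
      then have "\<Gamma> \<subseteq> W" unfolding curve_eq using v by blast
      with W show ?thesis by blast
    qed
    obtain u where u: "u \<in> verts G" using verts_ne by blast
    then have "Vertex u \<in> U \<union> V" using c by (auto simp: curve_def)
    moreover have UV: "U \<union> V = \<Gamma>" "V \<union> U = \<Gamma>" "V \<inter> U = {}" using c openin_subset[OF U] openin_subset[OF V] by auto
    moreover have "V = {}" if "Vertex u \<in> U" using key[OF UV(1) c(2) that u edge] .
    moreover have "edge_point G e ` {0..len G e} \<subseteq> V \<or> edge_point G e ` {0..len G e} \<subseteq> U" if "e \<in> edges G" for e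
      using edge[OF that] by (rule disj_commute[THEN iffD1])
    then have "U = {}" if "Vertex u \<in> V" using key[OF UV(2,3) that u] by metis
    ultimately show False using c(3,4) by blast
  qed
  then show ?thesis using connectedin_topspace[of T] by simp
qed

text \<open>Connectedness in germ form: by \<open>openin_T_iff\<close> both the set where
  \<open>P\<close> holds and its complement are open.\<close>

lemma local_constant:
  assumes "\<And>x \<tau>. x \<in> \<Gamma> \<Longrightarrow> P x \<Longrightarrow> \<tau> \<in> tangents G x \<Longrightarrow> near G \<tau> P"
    and "\<And>x \<tau>. x \<in> \<Gamma> \<Longrightarrow> \<not> P x \<Longrightarrow> \<tau> \<in> tangents G x \<Longrightarrow> near G \<tau> (\<lambda>y. \<not> P y)"
    and "x \<in> \<Gamma>" "P x" "y \<in> \<Gamma>"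
  shows "P y"
proof (rule ccontr)
  assume "\<not> P y"
  have "openin T {x\<in>\<Gamma>. P x}" "openin T {x\<in>\<Gamma>. \<not> P x}"
    unfolding openin_T_iff using assms(1,2) near_conj ray_in unfolding near_def by auto
  moreover have "{x\<in>\<Gamma>. P x} \<noteq> {}" "{x\<in>\<Gamma>. \<not> P x} \<noteq> {}" using assms \<open>\<not> P y\<close> by auto
  moreover have "\<Gamma> \<subseteq> {x\<in>\<Gamma>. P x} \<union> {x\<in>\<Gamma>. \<not> P x}" "{x\<in>\<Gamma>. P x} \<inter> {x\<in>\<Gamma>. \<not> P x} \<inter> \<Gamma> = {}" by auto
  ultimately show False using connected_T unfolding connectedin by blast
qed

end

section \<open>Piecewise linear functions on an edge as sums of hinges\<close>

lemma eventually_at_right_0_notin_finite: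
  assumes "finite A" shows "\<forall>\<^sub>F h in at_right (0::real). h \<notin> A"
proof -
  have "\<forall>\<^sub>F h in at_right (0::real). h \<noteq> a" for a
    unfolding eventually_at_right_0 by (intro exI[of _ "if a > 0 then a else 1"]) auto
  then have "\<forall>\<^sub>F h in at_right (0::real). \<forall>a\<in>A. h \<noteq> a"
    using assms by (intro eventually_ball_finite) auto
  then show ?thesis by (rule eventually_mono) blast
qed

lemma eventually_at_right_0_avoid:
  assumes "finite A" "s = 1 \<or> s = -1" shows "\<forall>\<^sub>F h in at_right (0::real). t + s * h \<notin> A"
proof -
  have "\<forall>\<^sub>F h in at_right 0. h \<notin> (\<lambda>a. s * (a - t)) ` A"
    using assms(1) by (intro eventually_at_right_0_notin_finite) simp
  then show ?thesis
  proof (rule eventually_mono)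
    fix h assume h: "h \<notin> (\<lambda>a. s * (a - t)) ` A"
    show "t + s * h \<notin> A"
    proof
      assume "t + s * h \<in> A"
      then have "s * (t + s * h - t) \<in> (\<lambda>a. s * (a - t)) ` A" by blast
      with h assms(2) show False by auto
    qed
  qed
qed

lemma real_local_constant:
  fixes \<psi> :: "real \<Rightarrow> 'a"
  assumes R: "\<And>t. a \<le> t \<Longrightarrow> t < b \<Longrightarrow> \<forall>\<^sub>F h in at_right 0. \<psi> (t + h) = \<psi> t"
    and L: "\<And>t. a < t \<Longrightarrow> t \<le> b \<Longrightarrow> \<forall>\<^sub>F h in at_right 0. \<psi> (t - h) = \<psi> t"
    and t: "a \<le> t" "t \<le> b"
  shows "\<psi> t = \<psi> a"
proof (rule connected_local_const[of "{a..b}"])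
  show "\<forall>x\<in>{a..b}. \<forall>\<^sub>F y in at x within {a..b}. \<psi> x = \<psi> y"
  proof
    fix x assume x: "x \<in> {a..b}"
    obtain r where r: "r > 0" "\<And>h. 0 < h \<Longrightarrow> h < r \<Longrightarrow> x < b \<Longrightarrow> \<psi> (x + h) = \<psi> x"
      using R[of x] x unfolding eventually_at_right_0 by (cases "x < b") (auto intro: zero_less_one)
    obtain l where l: "l > 0" "\<And>h. 0 < h \<Longrightarrow> h < l \<Longrightarrow> a < x \<Longrightarrow> \<psi> (x - h) = \<psi> x"
      using L[of x] x unfolding eventually_at_right_0 by (cases "a < x") (auto intro: zero_less_one)
    show "\<forall>\<^sub>F y in at x within {a..b}. \<psi> x = \<psi> y" unfolding eventually_at
    proof (intro exI[of _ "min r l"] conjI ballI impI)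
      fix y assume y: "y \<in> {a..b}" "y \<noteq> x \<and> dist y x < min r l"
      show "\<psi> x = \<psi> y" using r(2)[of "y - x"] l(2)[of "x - y"] y by (cases "y < x") (auto simp: dist_real_def)
    qed (use r l in simp)
  qed
qed (use t in auto)

text \<open>\<open>\<rho>\<close> and \<open>\<mu>\<close> are the right and left slopes, both
  measured forwards. Near \<open>t\<close> the function follows its germ at \<open>t\<close>, so the
  slope is locally constant, hence constant; subtracting the linear term leaves a locally constant
  function.\<close>

lemma real_local_affine:
  fixes \<psi> :: "real \<Rightarrow> real"
  assumes R: "\<And>t. 0 \<le> t \<Longrightarrow> t < L \<Longrightarrow> \<forall>\<^sub>F h in at_right 0. \<psi> (t + h) = \<psi> t + \<rho> t * h"
    and Lf: "\<And>t. 0 < t \<Longrightarrow> t \<le> L \<Longrightarrow> \<forall>\<^sub>F h in at_right 0. \<psi> (t - h) = \<psi> t - \<mu> t * h"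
    and eq: "\<And>t. 0 < t \<Longrightarrow> t < L \<Longrightarrow> \<mu> t = \<rho> t"
    and t: "0 \<le> t" "t \<le> L" and L: "0 < L"
  shows "\<psi> t = \<psi> 0 + \<rho> 0 * t"
proof -
  have uniq: "a = b" if "\<forall>\<^sub>F h in at_right 0. f h = c + a * h" "\<forall>\<^sub>F h in at_right 0. f h = c + b * h" for f and a b c :: real
  proof -
    have "\<forall>\<^sub>F h in at_right 0. c + a * h = c + b * h \<and> h > 0"
      using that eventually_at_right_less[of 0] by eventually_elim auto
    then obtain h where "c + a * h = c + b * h" "h > 0"
      using eventually_happens[of _ "at_right (0::real)"] by force
    then show ?thesis by simp
  qed
  \<comment> \<open>The right slope, completed at \<open>L\<close> by the left slope, the only one
    available there.\<close>
  define \<kappa> where "\<kappa> t = (if t < L then \<rho> t else \<mu> t)" for t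
  have "\<kappa> t = \<kappa> 0" if t: "0 \<le> t" "t \<le> L" for t
  proof (rule real_local_constant[OF _ _ t])
    fix t assume t: "0 \<le> t" "t < L"
    obtain r where r: "r > 0" "\<And>h. 0 < h \<Longrightarrow> h < r \<Longrightarrow> \<psi> (t + h) = \<psi> t + \<rho> t * h"
      using R[OF t] unfolding eventually_at_right_0 by blast
    show "\<forall>\<^sub>F h in at_right 0. \<kappa> (t + h) = \<kappa> t" unfolding eventually_at_right_0
    proof (intro exI[of _ "min r (L - t)"] conjI allI impI)
      fix h assume h: "0 < h \<and> h < min r (L - t)"
      have "\<forall>\<^sub>F k in at_right 0. \<psi> (t + h + k) = \<psi> (t + h) + \<rho> t * k" unfolding eventually_at_right_0
        using r(2)[of "h"] r(2)[of "h + _"] h by (intro exI[of _ "r - h"]) (auto simp: algebra_simps)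
      then have "\<rho> (t + h) = \<rho> t" using uniq[OF R] h t by auto
      then show "\<kappa> (t + h) = \<kappa> t" using h t by (simp add: \<kappa>_def)
    qed (use r t in simp)
  next
    fix t assume t: "0 < t" "t \<le> L"
    obtain r where r: "r > 0" "\<And>h. 0 < h \<Longrightarrow> h < r \<Longrightarrow> \<psi> (t - h) = \<psi> t - \<mu> t * h"
      using Lf[OF t] unfolding eventually_at_right_0 by blast
    show "\<forall>\<^sub>F h in at_right 0. \<kappa> (t - h) = \<kappa> t" unfolding eventually_at_right_0
    proof (intro exI[of _ "min r t"] conjI allI impI)
      fix h assume h: "0 < h \<and> h < min r t"
      have "\<forall>\<^sub>F k in at_right 0. \<psi> (t - h + k) = \<psi> (t - h) + \<mu> t * k" unfolding eventually_at_right_0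
      proof (intro exI[of _ h] conjI allI impI)
        fix k assume k: "0 < k \<and> k < h"
        then show "\<psi> (t - h + k) = \<psi> (t - h) + \<mu> t * k"
          using r(2)[of h] r(2)[of "h - k"] h by (simp add: algebra_simps)
      qed (use h in simp)
      then have "\<rho> (t - h) = \<mu> t" using uniq[OF R] h t by auto
      then show "\<kappa> (t - h) = \<kappa> t" using h t eq[of t] by (simp add: \<kappa>_def)
    qed (use r t in simp)
  qed
  then have \<kappa>: "\<rho> t = \<rho> 0" if "0 \<le> t" "t < L" for t using that L unfolding \<kappa>_def by (metis less_imp_le)
  have \<mu>: "\<mu> t = \<rho> 0" if "0 < t" "t \<le> L" for t
    using that \<open>\<And>t. 0 \<le> t \<Longrightarrow> t \<le> L \<Longrightarrow> \<kappa> t = \<kappa> 0\<close>[of t] eq[of t] \<kappa>[of t] L unfolding \<kappa>_def by (cases "t < L") auto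
  have "\<psi> t - \<rho> 0 * t = \<psi> 0 - \<rho> 0 * 0"
  proof (rule real_local_constant[OF _ _ t])
    fix t assume "0 \<le> t" "t < L"
    then show "\<forall>\<^sub>F h in at_right 0. \<psi> (t + h) - \<rho> 0 * (t + h) = \<psi> t - \<rho> 0 * t"
      using R[of t] \<kappa>[of t] by (auto elim!: eventually_mono simp: algebra_simps)
  next
    fix t assume "0 < t" "t \<le> L"
    then show "\<forall>\<^sub>F h in at_right 0. \<psi> (t - h) - \<rho> 0 * (t - h) = \<psi> t - \<rho> 0 * t"
      using Lf[of t] \<mu>[of t] by (auto elim!: eventually_mono simp: algebra_simps)
  qed
  then show ?thesis by simp
qed

lemma sum_mult_filter:
  fixes c :: "'a \<Rightarrow> 'b::comm_semiring_0"
  assumes "finite S"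
  shows "(\<Sum>x\<in>S. c x * (if P x then d else 0)) = (\<Sum>x\<in>{x\<in>S. P x}. c x) * d"
  unfolding sum.inter_filter[OF assms] sum_distrib_right by (rule sum.cong) auto

text \<open>To the right of \<open>t\<close> the hinges with \<open>x \<le> t\<close> are open, to
  the left of \<open>t\<close> only those with \<open>x < t\<close>; the hinge at \<open>t\<close>
  itself accounts for the difference between the two one-sided slopes.\<close>

lemma sum_hinge_right:
  assumes "finite S"
  shows "\<forall>\<^sub>F h in at_right (0::real). (\<Sum>x\<in>S. c x * max 0 (t + h - x)) = (\<Sum>x\<in>S. c x * max 0 (t - x)) + (\<Sum>x\<in>{x\<in>S. x \<le> t}. c x) * h"
proof -
  have "\<forall>\<^sub>F h in at_right (0::real). max 0 (t + h - x) = max 0 (t - x) + (if x \<le> t then h else 0)" for x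
    unfolding eventually_at_right_0 by (intro exI[of _ "if x \<le> t then 1 else x - t"]) auto
  then have "\<forall>\<^sub>F h in at_right (0::real). \<forall>x\<in>S. max 0 (t + h - x) = max 0 (t - x) + (if x \<le> t then h else 0)"
    using assms by (intro eventually_ball_finite) auto
  then show ?thesis
    by eventually_elim (simp add: distrib_left sum.distrib flip: sum_mult_filter[OF assms])
qed

lemma sum_hinge_left:
  assumes "finite S"
  shows "\<forall>\<^sub>F h in at_right (0::real). (\<Sum>x\<in>S. c x * max 0 (t - h - x)) = (\<Sum>x\<in>S. c x * max 0 (t - x)) - (\<Sum>x\<in>{x\<in>S. x < t}. c x) * h"
proof -
  have "\<forall>\<^sub>F h in at_right (0::real). max 0 (t - h - x) = max 0 (t - x) - (if x < t then h else 0)" for x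
    unfolding eventually_at_right_0 by (intro exI[of _ "if x < t then t - x else 1"]) auto
  then have "\<forall>\<^sub>F h in at_right (0::real). \<forall>x\<in>S. max 0 (t - h - x) = max 0 (t - x) - (if x < t then h else 0)"
    using assms by (intro eventually_ball_finite) auto
  then show ?thesis
    by eventually_elim (simp add: right_diff_distrib sum_subtractf flip: sum_mult_filter[OF assms])
qed

context trop_curve
begin

lemma has_slope_arm:
  assumes \<tau>: "(e, t, s) \<in> tangents G x" and m: "has_slope G f x (e, t, s) m"
  shows "\<forall>\<^sub>F h in at_right 0. has_slope G f (ray G (e,t,s) h) (e, t + s * h, s) m \<and> has_slope G f (ray G (e,t,s) h) (e, t + s * h, -s) (-m)"
proof -
  obtain r where r: "r > 0" "\<And>h. 0 < h \<Longrightarrow> h < r \<Longrightarrow> f (ray G (e,t,s) h) = f x + of_int m * h"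
    using m unfolding has_slope_def eventually_at_right_0 by blast
  have ray1: "ray G (e, t + s * h, s) k = ray G (e,t,s) (h + k)" "ray G (e, t + s * h, -s) k = ray G (e,t,s) (h - k)" for h k
    by (simp_all add: ray_def algebra_simps)
  show ?thesis unfolding eventually_at_right_0
  proof (intro exI[of _ r] allI impI conjI)
    fix h assume h: "0 < h \<and> h < r"
    show "has_slope G f (ray G (e,t,s) h) (e, t + s * h, s) m"
      unfolding has_slope_def eventually_at_right_0 ray1
      using r(2)[of h] r(2)[of "h + _"] h by (intro exI[of _ "r - h"]) (auto simp: algebra_simps)
    show "has_slope G f (ray G (e,t,s) h) (e, t + s * h, - s) (- m)"
      unfolding has_slope_def eventually_at_right_0 ray1
      using r(2)[of h] r(2)[of "h - _"] h by (intro exI[of _ "h"]) (auto simp: algebra_simps)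
  qed (use r in simp)
qed

lemma ord_at_Inner:
  assumes "e \<in> edges G" "0 < t" "t < len G e"
  shows "ord_at G f (Inner e t) = slope G f (e, t, 1) + slope G f (e, t, -1)"
  using tangents_Inner[OF assms] by (simp add: ord_at_slope)

text \<open>A point shortly after \<open>x\<close> lies inside the edge and inherits the slope
  \<open>m\<close> forwards and \<open>-m\<close> backwards.\<close>

lemma ord_at_near:
  assumes \<tau>: "\<tau> \<in> tangents G x" and m: "has_slope G f x \<tau> m"
  shows "near G \<tau> (\<lambda>y. ord_at G f y = 0)"
proof -
  obtain e t s where t: "\<tau> = (e, t, s)" by (cases \<tau>)
  have s: "s = 1 \<or> s = -1" using tangentD(5)[OF \<tau>[unfolded t]] .
  obtain R where R: "R > 0" "\<And>h. 0 < h \<Longrightarrow> h < R \<Longrightarrow> tangents G (ray G (e, t, s) h) = {(e, t + s * h, 1), (e, t + s * h, -1)}"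
    using tangent_arm[OF \<tau>[unfolded t]] by metis
  have "\<forall>\<^sub>F h in at_right 0. h > 0 \<and> h < R"
    using R(1) unfolding eventually_at_right_0 by (intro exI[of _ R]) auto
  then show ?thesis unfolding near_def using has_slope_arm[OF \<tau>[unfolded t] m[unfolded t]]
  proof eventually_elim
    case (elim h)
    note T = R(2)[OF conjunct1[OF elim(1)] conjunct2[OF elim(1)]]
    have "slope G f (e, t + s * h, s) = m" "slope G f (e, t + s * h, -s) = -m"
      using slope_eq[of "(e, t + s * h, s)" G "ray G (e,t,s) h" f m] slope_eq[of "(e, t + s * h, -s)" G "ray G (e,t,s) h" f "-m"] elim(2) T s by auto
    then show ?case unfolding t ord_at_slope T using s by auto
  qed
qed

text \<open>Infinitely many breakpoints would accumulate at a point of the closed edge, but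
  \<open>ord_at_near\<close> leaves none close to that point on either side.\<close>

lemma finite_ord_edge:
  assumes "pl G f" "e \<in> edges G"
  shows "finite {x \<in> {0<..<len G e}. ord_at G f (Inner e x) \<noteq> 0}" (is "finite ?S")
proof (rule ccontr)
  assume "infinite ?S"
  then obtain x where x: "x \<in> {0..len G e}" "x islimpt ?S"
    using Heine_Borel_imp_Bolzano_Weierstrass[of "{0..len G e}" ?S] by (auto simp: subset_iff)
  have *: "\<forall>\<^sub>F h in at_right 0. 0 < x + s * h \<longrightarrow> x + s * h < len G e \<longrightarrow> ord_at G f (Inner e (x + s * h)) = 0"
    if "s = 1 \<and> x < len G e \<or> s = -1 \<and> 0 < x" for s
  proof -
    have \<tau>: "(e, x, s) \<in> tangents G (edge_point G e x)" using that assms(2) x by (auto simp: tangents_def)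
    have "near G (e, x, s) (\<lambda>y. ord_at G f y = 0)"
      using ord_at_near[OF \<tau>] assms(1) \<tau> edge_point_in[OF assms(2)] unfolding pl_def by blast
    then show ?thesis unfolding near_def by (rule eventually_mono) (auto simp: ray_def assms(2))
  qed
  obtain r where r: "r > 0" "\<And>h. 0 < h \<Longrightarrow> h < r \<Longrightarrow> 0 < x + h \<Longrightarrow> x + h < len G e \<Longrightarrow> ord_at G f (Inner e (x + h)) = 0"
  proof (cases "x < len G e")
    case True
    with *[of 1] obtain r where "r > 0" "\<forall>h. 0 < h \<and> h < r \<longrightarrow> 0 < x + 1 * h \<longrightarrow> x + 1 * h < len G e \<longrightarrow> ord_at G f (Inner e (x + 1 * h)) = 0"
      unfolding eventually_at_right_0 by auto
    with that[of r] show ?thesis by simp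
  qed (use that[of 1] in auto)
  obtain l where l: "l > 0" "\<And>h. 0 < h \<Longrightarrow> h < l \<Longrightarrow> 0 < x - h \<Longrightarrow> x - h < len G e \<Longrightarrow> ord_at G f (Inner e (x - h)) = 0"
  proof (cases "0 < x")
    case True
    with *[of "-1"] obtain r where "r > 0" "\<forall>h. 0 < h \<and> h < r \<longrightarrow> 0 < x + (-1) * h \<longrightarrow> x + (-1) * h < len G e \<longrightarrow> ord_at G f (Inner e (x + (-1) * h)) = 0"
      unfolding eventually_at_right_0 by auto
    with that[of r] show ?thesis by simp
  qed (use that[of 1] in auto)
  obtain y where y: "y \<in> ?S" "y \<noteq> x" "dist y x < min r l"
    using x(2) r(1) l(1) unfolding islimpt_approachable by (meson min_less_iff_conj)
  then show False using r(2)[of "y - x"] l(2)[of "x - y"] by (cases "x < y") (auto simp: dist_real_def)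
qed

text \<open>Subtracting one hinge per breakpoint, weighted with its order, makes the one-sided
  slopes agree everywhere, so an affine function remains. \<open>S\<close> may be any finite set of
  interior points that contains the breakpoints; this later allows splitting the sum into chips and
  points of \<open>D\<close>.\<close>

lemma pl_hinges:
  assumes f: "pl G f" and e: "e \<in> edges G" and t: "0 \<le> t" "t \<le> len G e"
    and S: "finite S" "S \<subseteq> {0<..<len G e}" "\<And>x. x \<in> {0<..<len G e} \<Longrightarrow> x \<notin> S \<Longrightarrow> ord_at G f (Inner e x) = 0"
  shows "f (edge_point G e t) = f (Vertex (fst e)) + of_int (slope G f (e, 0, 1)) * t + (\<Sum>x\<in>S. of_int (ord_at G f (Inner e x)) * max 0 (t - x))"
proof -
  define c where "c x = real_of_int (ord_at G f (Inner e x))" for x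
  define \<psi> where "\<psi> t = f (edge_point G e t) - (\<Sum>x\<in>S. c x * max 0 (t - x))" for t
  define \<rho> where "\<rho> t = of_int (slope G f (e, t, 1)) - (\<Sum>x\<in>{x\<in>S. x \<le> t}. c x)" for t
  define \<mu> where "\<mu> t = - of_int (slope G f (e, t, -1)) - (\<Sum>x\<in>{x\<in>S. x < t}. c x)" for t
  have "\<psi> t = \<psi> 0 + \<rho> 0 * t"
  proof (rule real_local_affine[OF _ _ _ t edgeD(4)[OF e]])
    fix t assume t: "0 \<le> t" "t < len G e"
    have "has_slope G f (edge_point G e t) (e, t, 1) (slope G f (e, t, 1))"
      using pl_slope[OF f edge_point_in[OF e] edge_fwd[OF e t]] .
    then show "\<forall>\<^sub>F h in at_right 0. \<psi> (t + h) = \<psi> t + \<rho> t * h"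
      using sum_hinge_right[OF S(1), of c t] unfolding has_slope_def ray_def
      by eventually_elim (simp add: \<psi>_def \<rho>_def algebra_simps)
  next
    fix t assume t: "0 < t" "t \<le> len G e"
    have "has_slope G f (edge_point G e t) (e, t, -1) (slope G f (e, t, -1))"
      using pl_slope[OF f edge_point_in[OF e] edge_bwd[OF e t]] .
    then show "\<forall>\<^sub>F h in at_right 0. \<psi> (t - h) = \<psi> t - \<mu> t * h"
      using sum_hinge_left[OF S(1), of c t] unfolding has_slope_def ray_def
      by eventually_elim (simp add: \<psi>_def \<mu>_def algebra_simps)
  next
    fix t assume t: "0 < t" "t < len G e"
    have "(\<Sum>x\<in>{x\<in>S. x \<le> t}. c x) = (\<Sum>x\<in>{x\<in>S. x < t}. c x) + c t"
    proof (cases "t \<in> S")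
      case True
      have "{x\<in>S. x \<le> t} = insert t {x\<in>S. x < t}" using True by auto
      then show ?thesis using S(1) by simp
    next
      case False
      then have "{x\<in>S. x \<le> t} = {x\<in>S. x < t}" by (auto simp: less_le)
      then show ?thesis using S(3)[of t] False t by (simp add: c_def)
    qed
    moreover have "c t = of_int (slope G f (e, t, 1)) + of_int (slope G f (e, t, -1))"
      using ord_at_Inner[OF e t] by (simp add: c_def)
    ultimately show "\<mu> t = \<rho> t" by (simp add: \<mu>_def \<rho>_def)
  qed
  moreover have "{x\<in>S. x \<le> 0} = {}" "(\<Sum>x\<in>S. c x * max 0 (0 - x)) = 0" using S(2) by (auto intro!: sum.neutral)
  ultimately show ?thesis by (simp add: \<psi>_def \<rho>_def c_def e)
qed

lemma slope_hinges:
  assumes f: "pl G f" and e: "e \<in> edges G"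
    and S: "finite S" "S \<subseteq> {0<..<len G e}" "\<And>x. x \<in> {0<..<len G e} \<Longrightarrow> x \<notin> S \<Longrightarrow> ord_at G f (Inner e x) = 0"
  shows "0 \<le> t \<Longrightarrow> t < len G e \<Longrightarrow> slope G f (e, t, 1) = slope G f (e, 0, 1) + (\<Sum>x\<in>{x\<in>S. x \<le> t}. ord_at G f (Inner e x))"
    and "0 < t \<Longrightarrow> t \<le> len G e \<Longrightarrow> slope G f (e, t, -1) = - slope G f (e, 0, 1) - (\<Sum>x\<in>{x\<in>S. x < t}. ord_at G f (Inner e x))"
proof -
  let ?c = "\<lambda>x. real_of_int (ord_at G f (Inner e x))"
  note H = pl_hinges[OF f e _ _ S]
  {
    assume t: "0 \<le> t" "t < len G e"
    have "\<forall>\<^sub>F h in at_right 0. h > 0 \<and> h < len G e - t"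
      using t unfolding eventually_at_right_0 by (intro exI[of _ "len G e - t"]) auto
    then have "has_slope G f (edge_point G e t) (e, t, 1) (slope G f (e, 0, 1) + (\<Sum>x\<in>{x\<in>S. x \<le> t}. ord_at G f (Inner e x)))"
      unfolding has_slope_def using sum_hinge_right[OF S(1), of ?c t]
    proof eventually_elim
      case (elim h)
      then show ?case using H[of "t + h"] H[of t] t by (simp add: ray_def distrib_left distrib_right)
    qed
    from slope_eq[OF edge_fwd[OF e t] this]
    show "slope G f (e, t, 1) = slope G f (e, 0, 1) + (\<Sum>x\<in>{x\<in>S. x \<le> t}. ord_at G f (Inner e x))" .
  }
  {
    assume t: "0 < t" "t \<le> len G e"
    have "\<forall>\<^sub>F h in at_right 0. h > 0 \<and> h < t"
      using t unfolding eventually_at_right_0 by (intro exI[of _ "t"]) auto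
    then have "has_slope G f (edge_point G e t) (e, t, -1) (- slope G f (e, 0, 1) - (\<Sum>x\<in>{x\<in>S. x < t}. ord_at G f (Inner e x)))"
      unfolding has_slope_def using sum_hinge_left[OF S(1), of ?c t]
    proof eventually_elim
      case (elim h)
      then show ?case using H[of "t - h"] H[of t] t by (simp add: ray_def right_diff_distrib left_diff_distrib)
    qed
    from slope_eq[OF edge_bwd[OF e t] this]
    show "slope G f (e, t, -1) = - slope G f (e, 0, 1) - (\<Sum>x\<in>{x\<in>S. x < t}. ord_at G f (Inner e x))" .
  }
qed

text \<open>Forwards, a short ray avoids the finite exceptional set \<open>B\<close> and is thus an
  affine piece. Backwards, the points of nonzero order serve as \<open>B\<close>: by the hinge
  formula nothing changes between them.\<close>

lemma rational_iff: "f \<in> rational_functions G \<longleftrightarrow> f \<in> extensional \<Gamma> \<and> pl G f"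
proof (intro iffI conjI)
  assume f: "f \<in> rational_functions G"
  then show "f \<in> extensional \<Gamma>" by (simp add: rational_functions_def)
  have c: "continuous_map T euclideanreal f" using f by (simp add: rational_functions_def)
  show "pl G f" unfolding pl_def
  proof (intro ballI)
    fix x \<tau> assume x: "x \<in> \<Gamma>" and \<tau>: "\<tau> \<in> tangents G x"
    obtain e t s where t: "\<tau> = (e, t, s)" by (cases \<tau>)
    note D = tangentD[OF \<tau>[unfolded t]]
    have "\<forall>e \<in> edges G. \<exists>B. finite B \<and> (\<forall>a b. 0 \<le> a \<and> a < b \<and> b \<le> len G e \<and> {a<..<b} \<inter> B = {} \<longrightarrow>
              (\<exists>(m::int) c. \<forall>t \<in> {a<..<b}. f (edge_point G e t) = of_int m * t + c))"
      using f unfolding rational_functions_def by (elim CollectE conjE)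
    from bspec[OF this D(1)] obtain B where B: "finite B" "\<forall>a b. 0 \<le> a \<and> a < b \<and> b \<le> len G e \<and> {a<..<b} \<inter> B = {} \<longrightarrow>
              (\<exists>(m::int) c. \<forall>t \<in> {a<..<b}. f (edge_point G e t) = of_int m * t + c)"
      by (elim exE conjE)
    obtain R where R: "R > 0" "\<And>h. 0 < h \<Longrightarrow> h < R \<Longrightarrow> 0 < t + s * h \<and> t + s * h < len G e"
      using tangent_arm[OF \<tau>[unfolded t]] by metis
    obtain r0 where r0: "r0 > 0" "\<And>h. 0 < h \<Longrightarrow> h < r0 \<Longrightarrow> t + s * h \<notin> B"
      using eventually_at_right_0_avoid[OF B(1) D(5), of t] unfolding eventually_at_right_0 by blast
    define r where "r = min R r0 / 2"
    have r: "r > 0" "r < R" "r < r0" using R r0 by (auto simp: r_def)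
    define a b where "a = min t (t + s * r)" and "b = max t (t + s * r)"
    have in_ab: "u \<in> {a<..<b} \<longleftrightarrow> (\<exists>h. 0 < h \<and> h < r \<and> u = t + s * h)" for u
    proof
      assume "u \<in> {a<..<b}"
      then show "\<exists>h. 0 < h \<and> h < r \<and> u = t + s * h"
        using D(5) r(1) by (intro exI[of _ "s * (u - t)"]) (elim disjE; simp add: a_def b_def)
    next
      assume "\<exists>h. 0 < h \<and> h < r \<and> u = t + s * h"
      then obtain h where "0 < h" "h < r" "u = t + s * h" by blast
      then show "u \<in> {a<..<b}" using D(5) by (elim disjE) (simp_all add: a_def b_def)
    qed
    have "0 \<le> t + s * r \<and> t + s * r \<le> len G e" using R(2)[of r] r by simp
    then have "a \<ge> 0" "a < b" "b \<le> len G e"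
      using D(2,3,5) r by (auto simp: a_def b_def)
    moreover have "{a<..<b} \<inter> B = {}"
    proof (rule equals0I)
      fix u assume u: "u \<in> {a<..<b} \<inter> B"
      then obtain h where "0 < h" "h < r" "u = t + s * h" using in_ab by blast
      then show False using r0(2)[of h] r u by simp
    qed
    ultimately obtain m :: int and k where mk: "\<And>u. u \<in> {a<..<b} \<Longrightarrow> f (edge_point G e u) = of_int m * u + k"
      using B(2)[rule_format, of a b] by blast
    have e: "\<forall>\<^sub>F h in at_right 0. f (ray G \<tau> h) = of_int m * (t + s * h) + k"
      unfolding eventually_at_right_0
    proof (intro exI[of _ r] conjI allI impI)
      fix h assume "0 < h \<and> h < r"
      then have "t + s * h \<in> {a<..<b}" using in_ab by blast
      then show "f (ray G \<tau> h) = of_int m * (t + s * h) + k" by (simp add: mk ray_def t)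
    qed (rule r(1))
    \<comment> \<open>The affine expression is known for \<open>h > 0\<close> only; continuity of
      \<open>f\<close> provides its value at \<open>x\<close>.\<close>
    have l1: "((\<lambda>h. of_int m * (t + s * h) + k) \<longlongrightarrow> of_int m * (t + s * 0) + k) (at_right 0)"
      by (intro tendsto_intros)
    have "((\<lambda>h. f (ray G \<tau> h)) \<longlongrightarrow> f x) (at_right 0)"
      using c x \<tau> unfolding continuous_map_T_iff by blast
    then have l2: "((\<lambda>h. of_int m * (t + s * h) + k) \<longlongrightarrow> f x) (at_right 0)"
      by (rule Lim_transform_eventually[OF _ e])
    have "f x = of_int m * t + k"
      using tendsto_unique[OF trivial_limit_at_right_real l2 l1] by simp
    then have "has_slope G f x \<tau> (if s = 1 then m else - m)"
      unfolding has_slope_def using D(5) by (intro eventually_mono[OF e]) (auto simp: algebra_simps)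
    then show "\<exists>m. has_slope G f x \<tau> m" by blast
  qed
next
  assume f: "f \<in> extensional \<Gamma> \<and> pl G f"
  have "\<exists>B. finite B \<and> (\<forall>a b. 0 \<le> a \<and> a < b \<and> b \<le> len G e \<and> {a<..<b} \<inter> B = {} \<longrightarrow>
              (\<exists>(m::int) c. \<forall>t \<in> {a<..<b}. f (edge_point G e t) = of_int m * t + c))" if e: "e \<in> edges G" for e
  proof -
    define S where "S = {x \<in> {0<..<len G e}. ord_at G f (Inner e x) \<noteq> 0}"
    have S: "finite S" "S \<subseteq> {0<..<len G e}" "\<And>x. x \<in> {0<..<len G e} \<Longrightarrow> x \<notin> S \<Longrightarrow> ord_at G f (Inner e x) = 0"
      using finite_ord_edge[OF _ e] f by (auto simp: S_def)
    have "\<exists>(m::int) c. \<forall>t \<in> {a<..<b}. f (edge_point G e t) = of_int m * t + c"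
      if ab: "0 \<le> a" "a < b" "b \<le> len G e" "{a<..<b} \<inter> S = {}" for a b
    proof (intro exI ballI)
      fix t assume t: "t \<in> {a<..<b}"
      let ?c = "\<lambda>x. real_of_int (ord_at G f (Inner e x))"
      have "?c x * max 0 (t - x) = (if x \<le> a then ?c x * t - ?c x * x else 0)" if "x \<in> S" for x
      proof (cases "x \<le> a")
        case False
        then have "x \<ge> b" using that ab(4) by (metis IntI empty_iff greaterThanLessThan_iff not_le)
        then show ?thesis using t False by simp
      qed (use t in \<open>simp add: algebra_simps max_def\<close>)
      then have sum: "(\<Sum>x\<in>S. ?c x * max 0 (t - x)) = (\<Sum>x\<in>{x\<in>S. x \<le> a}. ?c x) * t - (\<Sum>x\<in>{x\<in>S. x \<le> a}. ?c x * x)"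
        unfolding sum_distrib_right sum_subtractf[symmetric] sum.inter_filter[OF S(1)] by (intro sum.cong refl) simp
      then show "f (edge_point G e t) = of_int (slope G f (e, 0, 1) + (\<Sum>x\<in>{x\<in>S. x \<le> a}. ord_at G f (Inner e x))) * t
         + (f (Vertex (fst e)) - (\<Sum>x\<in>{x\<in>S. x \<le> a}. ?c x * x))"
        using pl_hinges[OF conjunct2[OF f] e _ _ S, of t] t ab unfolding sum by (simp add: distrib_right)
    qed
    then show ?thesis by (intro exI[of _ S] conjI allI impI S(1)) simp
  qed
  then show "f \<in> rational_functions G"
    using f pl_continuous[of f] unfolding rational_functions_def by simp
qed

text \<open>Nonnegative orders on the open stretch make \<open>f\<close> convex along the ray, and a
  convex function lies above its tangents. \<open>k\<close> may lie on either side of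
  \<open>h\<close>, although the slope is taken outwards.\<close>

lemma arm_convex:
  assumes f: "pl G f" and \<tau>: "(e, t, s) \<in> tangents G x"
    and r: "\<And>h. 0 < h \<Longrightarrow> h < r \<Longrightarrow> 0 < t + s * h \<and> t + s * h < len G e"
    and o: "\<And>h. 0 < h \<Longrightarrow> h < r \<Longrightarrow> 0 \<le> ord_at G f (ray G (e, t, s) h)"
    and h: "0 \<le> h" "h < r" "0 \<le> k" "k < r"
  shows "f (ray G (e, t, s) k) \<ge> f (ray G (e, t, s) h) + of_int (slope G f (e, t + s * h, s)) * (k - h)"
proof -
  note D = tangentD[OF \<tau>]
  note e = D(1)
  define S where "S = {x \<in> {0<..<len G e}. ord_at G f (Inner e x) \<noteq> 0}"
  have S: "finite S" "S \<subseteq> {0<..<len G e}" "\<And>x. x \<in> {0<..<len G e} \<Longrightarrow> x \<notin> S \<Longrightarrow> ord_at G f (Inner e x) = 0"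
    using finite_ord_edge[OF f e] by (auto simp: S_def)
  let ?c = "\<lambda>x. real_of_int (ord_at G f (Inner e x))"
  let ?u = "t + s * h" and ?v = "t + s * k"
  have uv: "0 \<le> ?u" "?u \<le> len G e" "0 \<le> ?v" "?v \<le> len G e"
    using r[of h] r[of k] D h by (cases "h = 0"; cases "k = 0"; force)+
  have pos: "?c x \<ge> 0" if "x = t + s * j" "0 < j" "j < r" for x j
    using o[OF that(2,3)] r[OF that(2,3)] by (simp add: ray_def e that(1))
  have F: "f (ray G (e, t, s) k) = f (ray G (e, t, s) h) + of_int (slope G f (e, 0, 1)) * (?v - ?u) + (\<Sum>x\<in>S. ?c x * (max 0 (?v - x) - max 0 (?u - x)))"
    using pl_hinges[OF f e uv(1,2) S] pl_hinges[OF f e uv(3,4) S]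
    by (simp add: ray_def right_diff_distrib sum_subtractf algebra_simps)
  show ?thesis
  proof (cases "s = 1")
    case True
    have "?u < len G e"
    proof (cases "h = 0")
      case True then show ?thesis using \<open>s = 1\<close> \<tau> by (auto simp: tangents_def)
    qed (use r[of h] h in auto)
    then have sl: "slope G f (e, ?u, 1) = slope G f (e, 0, 1) + (\<Sum>x\<in>{x\<in>S. x \<le> ?u}. ord_at G f (Inner e x))"
      using slope_hinges(1)[OF f e S uv(1)] by simp
    \<comment> \<open>A break outside the open stretch contributes linearly there, so its sign is
      irrelevant; inside the stretch the order is nonnegative and the hinge is convex.\<close>
    have "(\<Sum>x\<in>S. ?c x * (if x \<le> ?u then ?v - ?u else 0)) \<le> (\<Sum>x\<in>S. ?c x * (max 0 (?v - x) - max 0 (?u - x)))"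
    proof (rule sum_mono)
      fix x assume "x \<in> S"
      show "?c x * (if x \<le> ?u then ?v - ?u else 0) \<le> ?c x * (max 0 (?v - x) - max 0 (?u - x))"
      proof (cases "x \<le> t \<or> x \<ge> t + r")
        case True then show ?thesis using \<open>s = 1\<close> h by (auto simp: max_def)
      next
        case False
        then have "?c x \<ge> 0" using pos[of x "x - t"] \<open>s = 1\<close> by auto
        then show ?thesis by (rule mult_left_mono[rotated]) (auto simp: max_def)
      qed
    qed
    moreover note sum_mult_filter[OF S(1), of ?c "\<lambda>x. x \<le> ?u" "?v - ?u"]
    moreover have "of_int (slope G f (e, ?u, 1)) * (k - h) = of_int (slope G f (e, 0, 1)) * (?v - ?u) + (\<Sum>x\<in>{x\<in>S. x \<le> ?u}. ?c x) * (?v - ?u)"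
      unfolding sl using True by (simp add: algebra_simps)
    ultimately show ?thesis using F True by simp
  next
    case False
    then have s: "s = -1" using D(5) by blast
    have "0 < ?u"
    proof (cases "h = 0")
      case True then show ?thesis using s \<tau> by (auto simp: tangents_def)
    qed (use r[of h] h in auto)
    then have sl: "slope G f (e, ?u, -1) = - slope G f (e, 0, 1) - (\<Sum>x\<in>{x\<in>S. x < ?u}. ord_at G f (Inner e x))"
      using slope_hinges(2)[OF f e S _ uv(2)] by simp
    have "(\<Sum>x\<in>S. ?c x * (if x < ?u then ?v - ?u else 0)) \<le> (\<Sum>x\<in>S. ?c x * (max 0 (?v - x) - max 0 (?u - x)))"
    proof (rule sum_mono)
      fix x assume "x \<in> S"
      show "?c x * (if x < ?u then ?v - ?u else 0) \<le> ?c x * (max 0 (?v - x) - max 0 (?u - x))"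
      proof (cases "x \<ge> t \<or> x \<le> t - r")
        case True
        then have "\<not> x < ?u \<and> max 0 (?v - x) = 0 \<and> max 0 (?u - x) = 0 \<or> x < ?u \<and> max 0 (?v - x) = ?v - x \<and> max 0 (?u - x) = ?u - x"
          using s h by auto
        then show ?thesis by auto
      next
        case False
        then have "?c x \<ge> 0" using pos[of x "t - x"] s by auto
        then show ?thesis by (rule mult_left_mono[rotated]) (auto simp: max_def)
      qed
    qed
    moreover note sum_mult_filter[OF S(1), of ?c "\<lambda>x. x < ?u" "?v - ?u"]
    moreover have "of_int (slope G f (e, ?u, -1)) * (k - h) = of_int (slope G f (e, 0, 1)) * (?v - ?u) + (\<Sum>x\<in>{x\<in>S. x < ?u}. ?c x) * (?v - ?u)"
      unfolding sl using s by (simp add: algebra_simps)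
    ultimately show ?thesis using F s by simp
  qed
qed

end

section \<open>Slope bounds and maximal functions\<close>

text \<open>If each label stayed a positive distance below the supremum, the least of these finitely
  many distances would bound all of \<open>J\<close> away from it. The labels will be integer slopes
  and slope patterns.\<close>

lemma Sup_pigeonhole:
  fixes a :: "'j \<Rightarrow> real"
  assumes "finite A" "\<And>j. j \<in> J \<Longrightarrow> l j \<in> A" "J \<noteq> {}" "bdd_above (a ` J)"
  obtains \<alpha> where "\<alpha> \<in> A" "\<And>\<epsilon>. 0 < \<epsilon> \<Longrightarrow> \<exists>j\<in>J. l j = \<alpha> \<and> (SUP j\<in>J. a j) - \<epsilon> < a j"
proof (rule ccontr)
  assume nt: "\<not> thesis"
  have "\<forall>\<alpha>\<in>A. \<exists>\<epsilon>>0. \<forall>j\<in>J. l j = \<alpha> \<longrightarrow> a j \<le> (SUP j\<in>J. a j) - \<epsilon>"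
  proof (rule ballI, rule ccontr)
    fix \<alpha> assume \<alpha>: "\<alpha> \<in> A" and n: "\<not> (\<exists>\<epsilon>>0. \<forall>j\<in>J. l j = \<alpha> \<longrightarrow> a j \<le> (SUP j\<in>J. a j) - \<epsilon>)"
    have "\<exists>j\<in>J. l j = \<alpha> \<and> (SUP j\<in>J. a j) - \<epsilon> < a j" if "0 < \<epsilon>" for \<epsilon>
    proof -
      have "\<not> (\<forall>j\<in>J. l j = \<alpha> \<longrightarrow> a j \<le> (SUP j\<in>J. a j) - \<epsilon>)" using n that by blast
      then show ?thesis by (simp add: not_le)
    qed
    then show False using that[OF \<alpha>] nt by blast
  qed
  from bchoice[OF this] obtain \<epsilon> where \<epsilon>: "\<And>\<alpha>. \<alpha> \<in> A \<Longrightarrow> \<epsilon> \<alpha> > 0" "\<And>\<alpha> j. \<alpha> \<in> A \<Longrightarrow> j \<in> J \<Longrightarrow> l j = \<alpha> \<Longrightarrow> a j \<le> (SUP j\<in>J. a j) - \<epsilon> \<alpha>"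
    by blast
  have "A \<noteq> {}" using assms by auto
  define \<delta> where "\<delta> = Min (\<epsilon> ` A)"
  have "\<delta> > 0" using \<open>A \<noteq> {}\<close> assms(1) \<epsilon>(1) by (simp add: \<delta>_def)
  have "a j \<le> (SUP j\<in>J. a j) - \<delta>" if "j \<in> J" for j
  proof -
    have "\<delta> \<le> \<epsilon> (l j)" using assms that by (simp add: \<delta>_def)
    then show ?thesis using \<epsilon>(2)[OF assms(2)[OF that] that refl] by linarith
  qed
  then have "(SUP j\<in>J. a j) \<le> (SUP j\<in>J. a j) - \<delta>" using assms(3) by (rule cSUP_least[rotated])
  with \<open>\<delta> > 0\<close> show False by simp
qed

text \<open>The \<open>m\<close> are subgradients and hence increase with \<open>h\<close>. Being
  integers above \<open>-B\<close>, those at \<open>h > 0\<close> attain a least value, at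
  \<open>h0\<close> say, and monotonicity makes them constant below \<open>h0\<close>.\<close>

lemma subgradient_eventually_linear:
  fixes F :: "real \<Rightarrow> real" and B :: int
  assumes r: "r > 0" and sub: "\<And>h. 0 \<le> h \<Longrightarrow> h < r \<Longrightarrow> \<exists>m::int. - B \<le> m \<and> (\<forall>k. 0 \<le> k \<and> k < r \<longrightarrow> F k \<ge> F h + of_int m * (k - h))"
  shows "\<exists>m::int. \<forall>\<^sub>F h in at_right 0. F h = F 0 + of_int m * h"
proof -
  obtain m :: "real \<Rightarrow> int" where m: "\<And>h. 0 \<le> h \<Longrightarrow> h < r \<Longrightarrow> - B \<le> m h"
    "\<And>h k. 0 \<le> h \<Longrightarrow> h < r \<Longrightarrow> 0 \<le> k \<Longrightarrow> k < r \<Longrightarrow> F k \<ge> F h + of_int (m h) * (k - h)"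
  proof -
    have "\<forall>h. \<exists>m::int. 0 \<le> h \<and> h < r \<longrightarrow> - B \<le> m \<and> (\<forall>k. 0 \<le> k \<and> k < r \<longrightarrow> F k \<ge> F h + of_int m * (k - h))"
      using sub by blast
    from choice[OF this] that show ?thesis by blast
  qed
  have mono: "m h \<le> m k" if "0 \<le> h" "h < k" "k < r" for h k
  proof -
    have "F k \<ge> F h + of_int (m h) * (k - h)" "F h \<ge> F k + of_int (m k) * (h - k)" using m(2) that by auto
    then have "of_int (m h) * (k - h) \<le> of_int (m k) * (k - h)" by (simp add: algebra_simps)
    then show ?thesis using that by simp
  qed
  define \<nu> where "\<nu> h = nat (m h + B)" for h
  obtain h0 where h0: "0 < h0" "h0 < r" "\<And>h. 0 < h \<Longrightarrow> h < r \<Longrightarrow> \<nu> h0 \<le> \<nu> h"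
    using ex_has_least_nat[of "\<lambda>h. 0 < h \<and> h < r" "r/2" \<nu>] r by auto
  have eq: "m h = m h0" if "0 < h" "h \<le> h0" for h
    using mono[of h h0] h0(3)[of h] m(1)[of h] m(1)[of h0] that h0(1,2) unfolding \<nu>_def by (cases "h = h0") auto
  have lin: "F k = F h + of_int (m h0) * (k - h)" if "0 < h" "h < h0" "0 < k" "k < h0" for h k
    using m(2)[of h k] m(2)[of k h] eq[of h] eq[of k] that h0(2) by (simp add: algebra_simps)
  have "F h = F 0 + of_int (m h0) * h" if h: "0 < h" "h < h0" for h
  proof (rule antisym)
    show "F h \<le> F 0 + of_int (m h0) * h" using m(2)[of h 0] eq[of h] h h0(2) by (simp add: algebra_simps)
    \<comment> \<open>Continuity at \<open>0\<close> is not given; instead the subgradient at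
      \<open>0\<close> bounds \<open>F k\<close> from below, and \<open>k\<close> is taken so close
      to \<open>0\<close> that the error is at most \<epsilon>.\<close>
    show "F h \<ge> F 0 + of_int (m h0) * h"
    proof (rule field_le_epsilon)
      fix \<epsilon> :: real assume \<epsilon>: "\<epsilon> > 0"
      define M where "M = \<bar>of_int (m h0) - of_int (m 0)\<bar> + (1::real)"
      have M: "M > 0" by (simp add: M_def)
      define k where "k = min (h0/2) (\<epsilon> / M)"
      have k: "0 < k" "k < h0" "k * M \<le> \<epsilon>" using h0 \<epsilon> M by (auto simp: k_def min_def field_simps)
      have "F 0 + of_int (m 0) * k \<le> F k" using m(2)[of 0 k] k h0(2) r by simp
      moreover have "F h = F k + of_int (m h0) * (h - k)" using lin[of k h] h k by simp
      moreover have "(of_int (m h0) - of_int (m 0)) * k \<le> M * k" using k by (intro mult_right_mono) (auto simp: M_def)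
      ultimately show "F 0 + of_int (m h0) * h \<le> F h + \<epsilon>" using k(3) by (simp add: algebra_simps)
    qed
  qed
  then show ?thesis unfolding eventually_at_right_0 using h0(1) by (intro exI[of _ "m h0"] exI[of _ h0]) auto
qed

context trop_curve
begin

lemma pl_cong:
  assumes "\<And>x. x \<in> \<Gamma> \<Longrightarrow> f x = g x"
  shows "pl G f \<longleftrightarrow> pl G g"
proof -
  have "has_slope G f x \<tau> m \<longleftrightarrow> has_slope G g x \<tau> m" if "x \<in> \<Gamma>" "\<tau> \<in> tangents G x" for x \<tau> m
    unfolding has_slope_def using assms[OF ray_in[OF that(2)]] assms[OF that(1)] by simp
  then show ?thesis unfolding pl_def by (intro ball_cong refl) blast
qed

lemma slope_cong:
  assumes "\<And>x. x \<in> \<Gamma> \<Longrightarrow> f x = g x" "\<tau> \<in> tangents G x"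
  shows "slope G f \<tau> = slope G g \<tau>"
  using assms edge_point_in unfolding slope_def tangents_def by (auto split: prod.splits)

lemma ord_at_cong: "(\<And>x. x \<in> \<Gamma> \<Longrightarrow> f x = g x) \<Longrightarrow> ord_at G f x = ord_at G g x"
  unfolding ord_at_slope by (rule sum.cong[OF refl]) (rule slope_cong)

lemma pl_restrict [simp]: "pl G (restrict f \<Gamma>) \<longleftrightarrow> pl G f"
  by (rule pl_cong) simp

lemma ord_at_restrict [simp]: "ord_at G (restrict f \<Gamma>) x = ord_at G f x"
  by (rule ord_at_cong) simp

lemma slope_add:
  assumes "pl G f" "pl G g" "\<tau> \<in> tangents G x"
  shows "slope G (\<lambda>y. f y + g y) \<tau> = slope G f \<tau> + slope G g \<tau>"
proof -
  have "x \<in> \<Gamma>" using tangents_off assms(3) by blast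
  then show ?thesis using slope_eq[OF assms(3) has_slope_add] pl_slope assms by metis
qed

lemma slope_diff:
  assumes "pl G f" "pl G g" "\<tau> \<in> tangents G x"
  shows "slope G (\<lambda>y. f y - g y) \<tau> = slope G f \<tau> - slope G g \<tau>"
proof -
  have "x \<in> \<Gamma>" using tangents_off assms(3) by blast
  then show ?thesis using slope_eq[OF assms(3) has_slope_diff] pl_slope assms by metis
qed

lemma slope_const: "\<tau> \<in> tangents G x \<Longrightarrow> slope G (\<lambda>y. c) \<tau> = 0"
  using slope_eq has_slope_const by blast

lemma ord_at_add: "pl G f \<Longrightarrow> pl G g \<Longrightarrow> ord_at G (\<lambda>y. f y + g y) x = ord_at G f x + ord_at G g x"
  unfolding ord_at_slope sum.distrib[symmetric] by (rule sum.cong[OF refl]) (rule slope_add)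

lemma ord_at_diff: "pl G f \<Longrightarrow> pl G g \<Longrightarrow> ord_at G (\<lambda>y. f y - g y) x = ord_at G f x - ord_at G g x"
  unfolding ord_at_slope sum_subtractf[symmetric] by (rule sum.cong[OF refl]) (rule slope_diff)

lemma ord_at_const: "ord_at G (\<lambda>y. c) x = 0"
  unfolding ord_at_slope by (rule sum.neutral) (use slope_const in blast)

lemma near_notin_finite:
  assumes "\<tau> \<in> tangents G x" "finite A" shows "near G \<tau> (\<lambda>y. y \<notin> A)"
proof -
  obtain e t s where \<tau>: "\<tau> = (e, t, s)" by (cases \<tau>)
  obtain R where R: "R > 0" "\<And>h. 0 < h \<Longrightarrow> h < R \<Longrightarrow> ray G (e, t, s) h = Inner e (t + s * h)"
    using tangent_arm[OF assms(1)[unfolded \<tau>]] by metis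
  have "finite {u. Inner e u \<in> A}" using assms(2) by (rule finite_vimageI[unfolded vimage_def]) (simp add: inj_def)
  from eventually_at_right_0_avoid[OF this tangentD(5)[OF assms(1)[unfolded \<tau>]], of t]
  have "\<forall>\<^sub>F h in at_right 0. Inner e (t + s * h) \<notin> A" by simp
  moreover have "\<forall>\<^sub>F h in at_right 0. 0 < h \<and> h < R"
    using R(1) unfolding eventually_at_right_0 by (intro exI[of _ R]) auto
  ultimately show ?thesis unfolding near_def \<tau> by eventually_elim (use R in simp)
qed

lemma card_tangents_Vertex: "card (tangents G (Vertex v)) \<le> 2 * card (edges G)"
proof -
  have "card (tangents G (Vertex v)) \<le> card ((\<lambda>e. (e, 0::real, 1::real)) ` {e \<in> edges G. fst e = v}) + card ((\<lambda>e. (e, len G e, -1::real)) ` {e \<in> edges G. snd e = v})"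
    unfolding tangents_Vertex by (rule card_Un_le)
  also have "\<dots> \<le> card (edges G) + card (edges G)"
    by (intro add_mono order_trans[OF card_image_le] card_mono) (auto simp: finite_edges)
  finally show ?thesis by simp
qed

end

section \<open>Uniform slope bounds on R(D)\<close>

locale div_class = trop_curve +
  fixes D :: "'a point \<Rightarrow> int"
  assumes D: "D \<in> divisors G" and RR_ne: "RR_space G D \<noteq> {}"
begin

abbreviation "RR \<equiv> RR_space G D"

lemma RR_iff: "f \<in> RR \<longleftrightarrow> f \<in> extensional \<Gamma> \<and> pl G f \<and> (\<forall>x. 0 \<le> D x + ord_at G f x)"
  by (simp add: RR_space_def rational_iff effective_def add_div_def)

lemma finite_D: "finite {x. D x \<noteq> 0}" and D_off: "x \<notin> \<Gamma> \<Longrightarrow> D x = 0"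
  using D by (auto simp: divisors_def)

lemma RR_pl: "f \<in> RR \<Longrightarrow> pl G f" and RR_ord: "f \<in> RR \<Longrightarrow> - D x \<le> ord_at G f x"
  using RR_iff[of f] by (auto simp: algebra_simps) (metis add.commute minus_le_iff neg_le_iff_le diff_ge_0_iff_ge diff_minus_eq_add minus_diff_eq uminus_add_conv_diff)

text \<open>For \<open>f\<close> in \<open>RR\<close> the order at \<open>x\<close> is at least
  \<open>- D x\<close>. The sum of absolute values bounds all sums of orders along an edge from
  below, also when \<open>D\<close> is not effective.\<close>

definition D_norm :: int where "D_norm = (\<Sum>x | D x \<noteq> 0. \<bar>D x\<bar>)"

lemma D_norm_ge: "\<bar>D x\<bar> \<le> D_norm"
proof (cases "D x = 0")
  case False
  then show ?thesis unfolding D_norm_def using finite_D by (intro member_le_sum) auto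
qed (simp add: D_norm_def sum_nonneg)

lemma D_norm_nonneg: "0 \<le> D_norm"
  by (simp add: D_norm_def sum_nonneg)

lemma D_norm_edge: "finite S \<Longrightarrow> (\<Sum>x\<in>S. \<bar>D (Inner e x)\<bar>) \<le> D_norm"
proof -
  assume S: "finite S"
  have "(\<Sum>x\<in>S. \<bar>D (Inner e x)\<bar>) = (\<Sum>y\<in>Inner e ` S. \<bar>D y\<bar>)" by (subst sum.reindex) (auto simp: inj_on_def)
  also have "\<dots> = (\<Sum>y\<in>{y \<in> Inner e ` S. D y \<noteq> 0}. \<bar>D y\<bar>)" using S by (intro sum.mono_neutral_right) auto
  also have "\<dots> \<le> D_norm" unfolding D_norm_def using finite_D by (intro sum_mono2) auto
  finally show ?thesis .
qed

definition ord_breaks :: "('a point \<Rightarrow> real) \<Rightarrow> 'a \<times> 'a \<Rightarrow> real set" where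
  "ord_breaks f e = {x \<in> {0<..<len G e}. ord_at G f (Inner e x) \<noteq> 0}"

lemma ord_breaks:
  assumes "pl G f" "e \<in> edges G"
  shows "finite (ord_breaks f e)" "ord_breaks f e \<subseteq> {0<..<len G e}" "\<And>x. x \<in> {0<..<len G e} \<Longrightarrow> x \<notin> ord_breaks f e \<Longrightarrow> ord_at G f (Inner e x) = 0"
  using finite_ord_edge[OF assms] by (auto simp: ord_breaks_def)

lemma sum_ord_ge: "f \<in> RR \<Longrightarrow> finite S \<Longrightarrow> - D_norm \<le> (\<Sum>x\<in>S. ord_at G f (Inner e x))"
proof -
  assume f: "f \<in> RR" and S: "finite S"
  have "- \<bar>D (Inner e x)\<bar> \<le> ord_at G f (Inner e x)" for x using RR_ord[OF f, of "Inner e x"] by linarith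
  then have "(\<Sum>x\<in>S. - \<bar>D (Inner e x)\<bar>) \<le> (\<Sum>x\<in>S. ord_at G f (Inner e x))" by (rule sum_mono)
  then show ?thesis using D_norm_edge[OF S, of e] by (simp add: sum_negf)
qed

text \<open>Negative orders are controlled by \<open>D\<close>, so the total variation of the slope
  along an edge exceeds its net change by at most \<open>2 * D_norm\<close>.\<close>

lemma sum_abs_ord_le:
  assumes "f \<in> RR" "finite S" shows "(\<Sum>x\<in>S. \<bar>ord_at G f (Inner e x)\<bar>) \<le> (\<Sum>x\<in>S. ord_at G f (Inner e x)) + 2 * D_norm"
proof -
  have "\<bar>ord_at G f (Inner e x)\<bar> \<le> ord_at G f (Inner e x) + 2 * \<bar>D (Inner e x)\<bar>" for x
    using RR_ord[OF assms(1), of "Inner e x"] by linarith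
  then have "(\<Sum>x\<in>S. \<bar>ord_at G f (Inner e x)\<bar>) \<le> (\<Sum>x\<in>S. ord_at G f (Inner e x) + 2 * \<bar>D (Inner e x)\<bar>)" by (rule sum_mono)
  then show ?thesis using D_norm_edge[OF assms(2), of e] by (simp add: sum.distrib flip: sum_distrib_left)
qed

lemma end_slope:
  assumes "pl G f" "e \<in> edges G"
  shows "slope G f (e, len G e, -1) = - slope G f (e, 0, 1) - (\<Sum>x\<in>ord_breaks f e. ord_at G f (Inner e x))"
proof -
  have "{x \<in> ord_breaks f e. x < len G e} = ord_breaks f e" by (auto simp: ord_breaks_def)
  then show ?thesis using slope_hinges(2)[OF assms ord_breaks[OF assms], of "len G e"] edgeD(4)[OF assms(2)] by simp
qed

text \<open>Negative orders on the edge diminish the slope by at most \<open>D_norm\<close> in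
  total. A ray that starts steeper than that rises all the way to the other end, and seen from there
  it descends almost as steeply.\<close>

lemma vertex_arm:
  assumes f: "f \<in> RR" and \<tau>: "\<tau> \<in> tangents G (Vertex u)" and m: "D_norm < slope G f \<tau>"
  obtains w \<sigma> where "w \<in> verts G" "\<sigma> \<in> tangents G (Vertex w)" "slope G f \<sigma> \<le> - slope G f \<tau> + D_norm" "f (Vertex u) < f (Vertex w)"
proof -
  note pl = RR_pl[OF f]
  consider e where "e \<in> edges G" "fst e = u" "\<tau> = (e, 0, 1)" | e where "e \<in> edges G" "snd e = u" "\<tau> = (e, len G e, -1)"
    using \<tau> unfolding tangents_Vertex by auto
  then show ?thesis
  proof cases
    case (1 e)
    note S = ord_breaks[OF pl 1(1)] and L = edgeD(4)[OF 1(1)]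
    have "(\<Sum>x\<in>ord_breaks f e. - of_int \<bar>D (Inner e x)\<bar> * len G e) \<le> (\<Sum>x\<in>ord_breaks f e. of_int (ord_at G f (Inner e x)) * max 0 (len G e - x))"
    proof (rule sum_mono)
      fix x assume "x \<in> ord_breaks f e"
      then have x: "0 < x" "x < len G e" using S(2) by auto
      have "- real_of_int \<bar>D (Inner e x)\<bar> * len G e \<le> - real_of_int \<bar>D (Inner e x)\<bar> * (len G e - x)"
        using x by (simp add: mult_left_mono)
      also have "\<dots> \<le> of_int (ord_at G f (Inner e x)) * (len G e - x)"
        using RR_ord[OF f, of "Inner e x"] x by (intro mult_right_mono) linarith+
      finally show "- of_int \<bar>D (Inner e x)\<bar> * len G e \<le> of_int (ord_at G f (Inner e x)) * max 0 (len G e - x)"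
        using x by simp
    qed
    moreover have "(\<Sum>x\<in>ord_breaks f e. - of_int \<bar>D (Inner e x)\<bar> * len G e) = - of_int (\<Sum>x\<in>ord_breaks f e. \<bar>D (Inner e x)\<bar>) * len G e"
      by (simp add: sum_distrib_right sum_negf)
    moreover have "of_int (\<Sum>x\<in>ord_breaks f e. \<bar>D (Inner e x)\<bar>) * len G e \<le> of_int D_norm * len G e"
      using D_norm_edge[OF S(1), of e] L by (intro mult_right_mono) (simp_all only: of_int_le_iff less_imp_le)
    moreover have "of_int D_norm * len G e < of_int (slope G f (e, 0, 1)) * len G e"
      using m L unfolding 1 by simp
    moreover have "f (Vertex (snd e)) = f (Vertex u) + of_int (slope G f (e, 0, 1)) * len G e + (\<Sum>x\<in>ord_breaks f e. of_int (ord_at G f (Inner e x)) * max 0 (len G e - x))"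
      using pl_hinges[OF pl 1(1) _ _ S, of "len G e"] L 1 by simp
    ultimately have "f (Vertex u) < f (Vertex (snd e))" by linarith
    moreover have "slope G f (e, len G e, -1) \<le> - slope G f (e, 0, 1) + D_norm"
      using end_slope[OF pl 1(1)] sum_ord_ge[OF f S(1), of e] by linarith
    moreover have "(e, len G e, -1) \<in> tangents G (Vertex (snd e))" "snd e \<in> verts G"
      using 1(1) edgeD(2)[OF 1(1)] by (auto simp: tangents_Vertex)
    ultimately show ?thesis using that 1 by blast
  next
    case (2 e)
    note S = ord_breaks[OF pl 2(1)] and L = edgeD(4)[OF 2(1)]
    let ?c = "\<lambda>x. real_of_int (ord_at G f (Inner e x))"
    have "(\<Sum>x\<in>ord_breaks f e. - of_int \<bar>D (Inner e x)\<bar> * len G e) \<le> (\<Sum>x\<in>ord_breaks f e. ?c x * x)"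
    proof (rule sum_mono)
      fix x assume "x \<in> ord_breaks f e"
      then have x: "0 < x" "x < len G e" using S(2) by auto
      have "- real_of_int \<bar>D (Inner e x)\<bar> * len G e \<le> - real_of_int \<bar>D (Inner e x)\<bar> * x"
        using x by (simp add: mult_left_mono)
      also have "\<dots> \<le> of_int (ord_at G f (Inner e x)) * x"
        using RR_ord[OF f, of "Inner e x"] x by (intro mult_right_mono) linarith+
      finally show "- of_int \<bar>D (Inner e x)\<bar> * len G e \<le> of_int (ord_at G f (Inner e x)) * x" .
    qed
    moreover have "(\<Sum>x\<in>ord_breaks f e. - of_int \<bar>D (Inner e x)\<bar> * len G e) = - of_int (\<Sum>x\<in>ord_breaks f e. \<bar>D (Inner e x)\<bar>) * len G e"
      by (simp add: sum_distrib_right sum_negf)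
    moreover have "of_int (\<Sum>x\<in>ord_breaks f e. \<bar>D (Inner e x)\<bar>) * len G e \<le> of_int D_norm * len G e"
      using D_norm_edge[OF S(1), of e] L by (intro mult_right_mono) (simp_all only: of_int_le_iff less_imp_le)
    moreover have "of_int D_norm * len G e < of_int (slope G f (e, len G e, -1)) * len G e"
      using m L unfolding 2 by simp
    \<comment> \<open>The edge is climbed from head to tail, whereas the hinge formula starts at the
      tail. Writing each hinge as \<open>len G e - x\<close> and absorbing the sum of orders into
      the end slope reverses the direction.\<close>
    moreover have "(\<Sum>x\<in>ord_breaks f e. ?c x * max 0 (len G e - x)) = (\<Sum>x\<in>ord_breaks f e. ?c x * len G e - ?c x * x)"
      using S(2) by (intro sum.cong) (auto simp: max_def algebra_simps)
    then have "(\<Sum>x\<in>ord_breaks f e. ?c x * max 0 (len G e - x)) = of_int (\<Sum>x\<in>ord_breaks f e. ord_at G f (Inner e x)) * len G e - (\<Sum>x\<in>ord_breaks f e. ?c x * x)"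
      by (simp add: sum_subtractf sum_distrib_right)
    moreover have "of_int (slope G f (e, len G e, -1)) * len G e = - of_int (slope G f (e, 0, 1)) * len G e - of_int (\<Sum>x\<in>ord_breaks f e. ord_at G f (Inner e x)) * len G e"
      unfolding end_slope[OF pl 2(1)] by (simp add: algebra_simps)
    moreover have "f (Vertex u) = f (Vertex (fst e)) + of_int (slope G f (e, 0, 1)) * len G e + (\<Sum>x\<in>ord_breaks f e. ?c x * max 0 (len G e - x))"
      using pl_hinges[OF pl 2(1) _ _ S, of "len G e"] L 2 by simp
    ultimately have "f (Vertex u) < f (Vertex (fst e))" by linarith
    moreover have "slope G f (e, 0, 1) \<le> - slope G f (e, len G e, -1) + D_norm"
      using end_slope[OF pl 2(1)] sum_ord_ge[OF f S(1), of e] by linarith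
    moreover have "(e, 0, 1) \<in> tangents G (Vertex (fst e))" "fst e \<in> verts G"
      using 2(1) edgeD(1)[OF 2(1)] by (auto simp: tangents_Vertex)
    ultimately show ?thesis using that 2 by blast
  qed
qed

text \<open>Tuned to a single step: at the upper end of a ray of slope \<open>climb (Suc n)\<close>,
  at most \<open>2 * card (edges G)\<close> directions of slope at most \<open>climb n\<close> face
  a descent of at least \<open>climb (Suc n) - D_norm\<close>. The order there would be at most
  \<open>- D_norm - 1\<close>, which is too small by one.\<close>

primrec climb :: "nat \<Rightarrow> int" where
  "climb 0 = 0" | "climb (Suc n) = 2 * int (card (edges G)) * climb n + 2 * D_norm + 1"

lemma climb_nonneg: "0 \<le> climb n"
  by (induction n) (auto simp: D_norm_nonneg)

text \<open>A steep ascent at a vertex forces a slightly less steep ascent at the next vertex, so that the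
  slope bounds the number of vertices from below.\<close>

lemma climb_card:
  assumes f: "f \<in> RR"
  shows "u \<in> verts G \<Longrightarrow> \<tau> \<in> tangents G (Vertex u) \<Longrightarrow> climb n \<le> slope G f \<tau> \<Longrightarrow>
    Suc n \<le> card {w \<in> verts G. f (Vertex u) \<le> f (Vertex w)}"
proof (induction n arbitrary: u \<tau>)
  case 0
  have "{w \<in> verts G. f (Vertex u) \<le> f (Vertex w)} \<noteq> {}" using 0 by auto
  then show ?case using finite_verts by (simp add: Suc_le_eq card_gt_0_iff)
next
  case (Suc n)
  have "0 \<le> 2 * int (card (edges G)) * climb n" using climb_nonneg[of n] by (intro mult_nonneg_nonneg) auto
  then have "D_norm < slope G f \<tau>" using Suc.prems(3) D_norm_nonneg unfolding climb.simps by linarith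
  from vertex_arm[OF f Suc.prems(2) this]
  obtain w \<sigma> where w: "w \<in> verts G" "\<sigma> \<in> tangents G (Vertex w)" "slope G f \<sigma> \<le> - slope G f \<tau> + D_norm" "f (Vertex u) < f (Vertex w)" .
  have "\<exists>\<rho>\<in>tangents G (Vertex w). climb n \<le> slope G f \<rho>"
  proof (rule ccontr)
    assume "\<not> (\<exists>\<rho>\<in>tangents G (Vertex w). climb n \<le> slope G f \<rho>)"
    then have "\<And>\<rho>. \<rho> \<in> tangents G (Vertex w) - {\<sigma>} \<Longrightarrow> slope G f \<rho> \<le> climb n" by force
    then have "(\<Sum>\<rho>\<in>tangents G (Vertex w) - {\<sigma>}. slope G f \<rho>) \<le> (\<Sum>\<rho>\<in>tangents G (Vertex w) - {\<sigma>}. climb n)" by (rule sum_mono)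
    also have "\<dots> \<le> (\<Sum>\<rho>\<in>tangents G (Vertex w). climb n)"
      using climb_nonneg finite_tangents by (intro sum_mono2) auto
    also have "\<dots> \<le> 2 * int (card (edges G)) * climb n"
      using card_tangents_Vertex[of w] climb_nonneg[of n] by (auto intro!: mult_right_mono)
    finally have "ord_at G f (Vertex w) \<le> slope G f \<sigma> + 2 * int (card (edges G)) * climb n"
      unfolding ord_at_slope using w(2) by (simp add: sum.remove[OF finite_tangents w(2)])
    moreover have "- D_norm \<le> ord_at G f (Vertex w)" using RR_ord[OF f, of "Vertex w"] D_norm_ge[of "Vertex w"] by linarith
    ultimately show False using w(3) Suc.prems(3) by simp
  qed
  then obtain \<rho> where "\<rho> \<in> tangents G (Vertex w)" "climb n \<le> slope G f \<rho>" by blast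
  from Suc.IH[OF w(1) this] have "Suc n \<le> card {x \<in> verts G. f (Vertex w) \<le> f (Vertex x)}" .
  also have "Suc \<dots> = card (insert u {x \<in> verts G. f (Vertex w) \<le> f (Vertex x)})"
    using w(4) finite_verts by simp
  also have "\<dots> \<le> card {w \<in> verts G. f (Vertex u) \<le> f (Vertex w)}"
    using w(4) Suc.prems(1) finite_verts by (intro card_mono) auto
  finally show ?case by simp
qed

text \<open>A slope above \<open>climb (card (verts G))\<close> would by \<open>climb_card\<close>
  require more vertices than there are. Upper bounds in all directions at a vertex, together with
  the lower bound for its order, give the lower bound; comparing the slopes at both ends of an edge
  bounds the sum of its orders.\<close>

lemma RR_bound:
  obtains B :: int where "B \<ge> 0"
    "\<And>f v \<tau>. f \<in> RR \<Longrightarrow> v \<in> verts G \<Longrightarrow> \<tau> \<in> tangents G (Vertex v) \<Longrightarrow> \<bar>slope G f \<tau>\<bar> \<le> B"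
    "\<And>f e. f \<in> RR \<Longrightarrow> e \<in> edges G \<Longrightarrow> (\<Sum>x\<in>ord_breaks f e. \<bar>ord_at G f (Inner e x)\<bar>) \<le> B"
proof -
  define K where "K = climb (card (verts G))"
  have K0: "K \<ge> 0" unfolding K_def by (rule climb_nonneg)
  have up: "slope G f \<tau> \<le> K" if f: "f \<in> RR" and v: "v \<in> verts G" and \<tau>: "\<tau> \<in> tangents G (Vertex v)" for f v \<tau>
  proof (rule ccontr)
    assume "\<not> slope G f \<tau> \<le> K"
    then have "Suc (card (verts G)) \<le> card {w \<in> verts G. f (Vertex v) \<le> f (Vertex w)}"
      using climb_card[OF f v \<tau>, of "card (verts G)"] by (simp add: K_def)
    also have "\<dots> \<le> card (verts G)" using finite_verts by (intro card_mono) auto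
    finally show False by simp
  qed
  define B where "B = D_norm + 2 * int (card (edges G)) * K + K"
  have lo: "- B \<le> slope G f \<tau>" if f: "f \<in> RR" and v: "v \<in> verts G" and \<tau>: "\<tau> \<in> tangents G (Vertex v)" for f v \<tau>
  proof -
    have "(\<Sum>\<rho>\<in>tangents G (Vertex v) - {\<tau>}. slope G f \<rho>) \<le> (\<Sum>\<rho>\<in>tangents G (Vertex v) - {\<tau>}. K)"
      using up[OF f v] by (intro sum_mono) auto
    also have "\<dots> \<le> (\<Sum>\<rho>\<in>tangents G (Vertex v). K)"
      using K0 finite_tangents by (intro sum_mono2) auto
    also have "\<dots> \<le> 2 * int (card (edges G)) * K"
      using card_tangents_Vertex[of v] K0 by (auto intro!: mult_right_mono)
    finally have "ord_at G f (Vertex v) \<le> slope G f \<tau> + 2 * int (card (edges G)) * K"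
      unfolding ord_at_slope by (simp add: sum.remove[OF finite_tangents \<tau>])
    moreover have "- D_norm \<le> ord_at G f (Vertex v)" using RR_ord[OF f, of "Vertex v"] D_norm_ge[of "Vertex v"] by linarith
    ultimately show ?thesis using K0 by (simp add: B_def)
  qed
  have BK: "K \<le> B" using K0 D_norm_nonneg by (simp add: B_def)
  show ?thesis
  proof (rule that[of "2 * B + 2 * D_norm"])
    show "0 \<le> 2 * B + 2 * D_norm" using BK K0 D_norm_nonneg by simp
  next
    fix f v \<tau> assume "f \<in> RR" "v \<in> verts G" "\<tau> \<in> tangents G (Vertex v)"
    from up[OF this] lo[OF this] show "\<bar>slope G f \<tau>\<bar> \<le> 2 * B + 2 * D_norm" using BK D_norm_nonneg K0 by linarith
  next
    fix f e assume f: "f \<in> RR" and e: "e \<in> edges G"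
    have "(e, len G e, -1) \<in> tangents G (Vertex (snd e))" "(e, 0, 1) \<in> tangents G (Vertex (fst e))"
      using e by (auto simp: tangents_Vertex)
    then have "- B \<le> slope G f (e, len G e, -1)" "- B \<le> slope G f (e, 0, 1)"
      using lo[OF f] edgeD[OF e] by blast+
    then have "(\<Sum>x\<in>ord_breaks f e. ord_at G f (Inner e x)) \<le> 2 * B" using end_slope[OF RR_pl[OF f] e] by linarith
    then show "(\<Sum>x\<in>ord_breaks f e. \<bar>ord_at G f (Inner e x)\<bar>) \<le> 2 * B + 2 * D_norm"
      using sum_abs_ord_le[OF f ord_breaks(1)[OF RR_pl[OF f] e], of e] by linarith
  qed
qed

text \<open>Inside an edge the slope is the starting slope plus a partial sum of orders, up to sign.
  Both are bounded by the constant of \<open>RR_bound\<close>, whence the factor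
  \<open>2\<close>.\<close>

lemma RR_slope_bound:
  obtains B :: int where "B \<ge> 0"
    "\<And>f x \<tau>. f \<in> RR \<Longrightarrow> \<tau> \<in> tangents G x \<Longrightarrow> \<bar>slope G f \<tau>\<bar> \<le> B"
    "\<And>f e s t. f \<in> RR \<Longrightarrow> e \<in> edges G \<Longrightarrow> s \<in> {0..len G e} \<Longrightarrow> t \<in> {0..len G e} \<Longrightarrow>
       \<bar>f (edge_point G e s) - f (edge_point G e t)\<bar> \<le> of_int B * \<bar>s - t\<bar>"
proof -
  obtain B where B: "B \<ge> 0"
    "\<And>f v \<tau>. f \<in> RR \<Longrightarrow> v \<in> verts G \<Longrightarrow> \<tau> \<in> tangents G (Vertex v) \<Longrightarrow> \<bar>slope G f \<tau>\<bar> \<le> B"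
    "\<And>f e. f \<in> RR \<Longrightarrow> e \<in> edges G \<Longrightarrow> (\<Sum>x\<in>ord_breaks f e. \<bar>ord_at G f (Inner e x)\<bar>) \<le> B"
    using RR_bound by blast
  have s0: "\<bar>slope G f (e, 0, 1)\<bar> \<le> B" if "f \<in> RR" "e \<in> edges G" for f e
    using B(2)[OF that(1) edgeD(1)[OF that(2)], of "(e,0,1)"] that by (auto simp: tangents_Vertex)
  have part: "\<bar>\<Sum>x\<in>S. ord_at G f (Inner e x)\<bar> \<le> B" if "f \<in> RR" "e \<in> edges G" "S \<subseteq> ord_breaks f e" for f e S
  proof -
    have "\<bar>\<Sum>x\<in>S. ord_at G f (Inner e x)\<bar> \<le> (\<Sum>x\<in>S. \<bar>ord_at G f (Inner e x)\<bar>)" by (rule sum_abs)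
    also have "\<dots> \<le> (\<Sum>x\<in>ord_breaks f e. \<bar>ord_at G f (Inner e x)\<bar>)"
      using that ord_breaks(1)[OF RR_pl[OF that(1)] that(2)] by (intro sum_mono2) auto
    finally show ?thesis using B(3)[OF that(1,2)] by linarith
  qed
  show ?thesis
  proof (rule that[of "2 * B"])
    show "0 \<le> 2 * B" using B(1) by simp
  next
    fix f x \<tau> assume f: "f \<in> RR" and "\<tau> \<in> tangents G x"
    moreover obtain e t s where \<tau>: "\<tau> = (e, t, s)" by (cases \<tau>)
    ultimately have T: "e \<in> edges G" "0 \<le> t" "t \<le> len G e" "s = 1 \<and> t < len G e \<or> s = -1 \<and> 0 < t"
      by (auto simp: tangents_def)
    note pl = RR_pl[OF f]
    show "\<bar>slope G f \<tau>\<bar> \<le> 2 * B"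
    proof -
      have "\<bar>\<Sum>x\<in>{x \<in> ord_breaks f e. x \<le> t}. ord_at G f (Inner e x)\<bar> \<le> B" "\<bar>\<Sum>x\<in>{x \<in> ord_breaks f e. x < t}. ord_at G f (Inner e x)\<bar> \<le> B"
        by (rule part[OF f T(1)], blast)+
      moreover have "slope G f (e, t, 1) = slope G f (e, 0, 1) + (\<Sum>x\<in>{x \<in> ord_breaks f e. x \<le> t}. ord_at G f (Inner e x))" if "t < len G e"
        by (rule slope_hinges(1)[OF pl T(1) ord_breaks[OF pl T(1)] T(2) that])
      moreover have "slope G f (e, t, -1) = - slope G f (e, 0, 1) - (\<Sum>x\<in>{x \<in> ord_breaks f e. x < t}. ord_at G f (Inner e x))" if "0 < t"
        by (rule slope_hinges(2)[OF pl T(1) ord_breaks[OF pl T(1)] that T(3)])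
      ultimately show ?thesis using T(4) s0[OF f T(1)] unfolding \<tau> by (cases "s = 1") auto
    qed
  next
    fix f e s t assume f: "f \<in> RR" and e: "e \<in> edges G" and s: "s \<in> {0..len G e}" "t \<in> {0..len G e}"
    note pl = RR_pl[OF f]
    note H = pl_hinges[OF pl e _ _ ord_breaks[OF pl e]]
    let ?c = "\<lambda>x. real_of_int (ord_at G f (Inner e x))"
    have "f (edge_point G e s) - f (edge_point G e t) = of_int (slope G f (e, 0, 1)) * (s - t) + (\<Sum>x\<in>ord_breaks f e. ?c x * (max 0 (s - x) - max 0 (t - x)))"
      using H[of s] H[of t] s by (simp add: right_diff_distrib sum_subtractf)
    moreover have "\<bar>of_int (slope G f (e, 0, 1)) * (s - t)\<bar> \<le> of_int B * \<bar>s - t\<bar>"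
      unfolding abs_mult using s0[OF f e] by (intro mult_right_mono) linarith+
    moreover have "\<bar>\<Sum>x\<in>ord_breaks f e. ?c x * (max 0 (s - x) - max 0 (t - x))\<bar> \<le> of_int B * \<bar>s - t\<bar>"
    proof -
      have "\<bar>\<Sum>x\<in>ord_breaks f e. ?c x * (max 0 (s - x) - max 0 (t - x))\<bar> \<le> (\<Sum>x\<in>ord_breaks f e. \<bar>?c x * (max 0 (s - x) - max 0 (t - x))\<bar>)"
        by (rule sum_abs)
      also have "\<dots> \<le> (\<Sum>x\<in>ord_breaks f e. \<bar>?c x\<bar> * \<bar>s - t\<bar>)"
        unfolding abs_mult by (intro sum_mono mult_left_mono) (auto simp: max_def)
      also have "\<dots> = of_int (\<Sum>x\<in>ord_breaks f e. \<bar>ord_at G f (Inner e x)\<bar>) * \<bar>s - t\<bar>"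
        by (simp add: sum_distrib_right)
      also have "\<dots> \<le> of_int B * \<bar>s - t\<bar>" using B(3)[OF f e] by (intro mult_right_mono) (simp_all only: of_int_le_iff abs_ge_zero)
      finally show ?thesis .
    qed
    ultimately show "\<bar>f (edge_point G e s) - f (edge_point G e t)\<bar> \<le> of_int (2 * B) * \<bar>s - t\<bar>" by simp
  qed
qed

lemma RR_diff_bounded:
  assumes "x \<in> \<Gamma>" "y \<in> \<Gamma>" shows "\<exists>M. \<forall>f\<in>RR. f x - f y \<le> M"
proof -
  obtain B :: int where B: "B \<ge> 0" "\<And>f e s t. f \<in> RR \<Longrightarrow> e \<in> edges G \<Longrightarrow> s \<in> {0..len G e} \<Longrightarrow> t \<in> {0..len G e} \<Longrightarrow>
       \<bar>f (edge_point G e s) - f (edge_point G e t)\<bar> \<le> of_int B * \<bar>s - t\<bar>"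
    using RR_slope_bound by metis
  have toV: "\<exists>v\<in>verts G. \<exists>M. \<forall>f\<in>RR. \<bar>f x - f (Vertex v)\<bar> \<le> M" if "x \<in> \<Gamma>" for x
    using that
  proof (cases rule: curve_cases)
    case (1 v) then show ?thesis by (intro bexI[of _ v] exI[of _ 0]) auto
  next
    case (2 e t)
    have "\<forall>f\<in>RR. \<bar>f x - f (Vertex (fst e))\<bar> \<le> of_int B * \<bar>t - 0\<bar>"
      using B(2)[of _ e t 0] 2 edge_point_simps(1)[OF 2(1)] by auto
    then show ?thesis using edgeD(1)[OF 2(1)] by blast
  qed
  have VV: "\<exists>M. \<forall>f\<in>RR. \<bar>f (Vertex u) - f (Vertex v)\<bar> \<le> M" if "u \<in> verts G" "v \<in> verts G" for u v
    using edges_connect[OF that]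
  proof (induction rule: rtrancl_induct)
    case base show ?case by (intro exI[of _ 0]) simp
  next
    case (step y z)
    then obtain M where M: "\<forall>f\<in>RR. \<bar>f (Vertex u) - f (Vertex y)\<bar> \<le> M" by blast
    obtain e where e: "e \<in> edges G" "e = (y, z) \<or> e = (z, y)" using step(2) by auto
    have "\<bar>f (Vertex y) - f (Vertex z)\<bar> \<le> of_int B * len G e" if "f \<in> RR" for f
      using B(2)[OF that e(1), of "len G e" 0] edge_point_simps(1,2)[OF e(1)] edgeD(4)[OF e(1)] e(2) by auto
    then have "\<forall>f\<in>RR. \<bar>f (Vertex u) - f (Vertex z)\<bar> \<le> M + of_int B * len G e" using M by force
    then show ?case by blast
  qed
  obtain u M1 where u: "u \<in> verts G" "\<forall>f\<in>RR. \<bar>f x - f (Vertex u)\<bar> \<le> M1" using toV[OF assms(1)] by blast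
  obtain v M2 where v: "v \<in> verts G" "\<forall>f\<in>RR. \<bar>f y - f (Vertex v)\<bar> \<le> M2" using toV[OF assms(2)] by blast
  obtain M3 where "\<forall>f\<in>RR. \<bar>f (Vertex u) - f (Vertex v)\<bar> \<le> M3" using VV[OF u(1) v(1)] by blast
  then have "\<forall>f\<in>RR. f x - f y \<le> M1 + M2 + M3" using u(2) v(2) by force
  then show ?thesis by blast
qed

text \<open>This will turn out to be the function of the \<open>P\<close>-reduced divisor, which gives the latter a
  description by a supremum instead of by reducedness.\<close>

definition rd :: "'a point \<Rightarrow> 'a point \<Rightarrow> real" where
  "rd P = (\<lambda>x\<in>\<Gamma>. SUP f\<in>RR. f x - f P)"

lemma rd_bdd: "x \<in> \<Gamma> \<Longrightarrow> P \<in> \<Gamma> \<Longrightarrow> bdd_above ((\<lambda>f. f x - f P) ` RR)"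
  using RR_diff_bounded[of x P] by (auto simp: bdd_above_def)

lemma rd_ge: "x \<in> \<Gamma> \<Longrightarrow> P \<in> \<Gamma> \<Longrightarrow> f \<in> RR \<Longrightarrow> f x - f P \<le> rd P x"
  unfolding rd_def using rd_bdd by (auto intro: cSUP_upper)

lemma rd_self: "P \<in> \<Gamma> \<Longrightarrow> rd P P = 0"
  unfolding rd_def using RR_ne by simp

text \<open>The stretch only has to avoid the support of \<open>D\<close> and therefore serves all
  members of \<open>RR\<close> at once. This uniformity is what allows passing to the
  supremum.\<close>

lemma arm_no_D:
  assumes "(e, t, s) \<in> tangents G x"
  obtains r where "r > 0" "\<And>h. 0 < h \<Longrightarrow> h < r \<Longrightarrow> 0 < t + s * h \<and> t + s * h < len G e"
    "\<And>f h. f \<in> RR \<Longrightarrow> 0 < h \<Longrightarrow> h < r \<Longrightarrow> 0 \<le> ord_at G f (ray G (e, t, s) h)"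
    "\<And>f h k. f \<in> RR \<Longrightarrow> 0 \<le> h \<Longrightarrow> h < r \<Longrightarrow> 0 \<le> k \<Longrightarrow> k < r \<Longrightarrow>
      f (ray G (e, t, s) h) + of_int (slope G f (e, t + s * h, s)) * (k - h) \<le> f (ray G (e, t, s) k)"
proof -
  obtain R where R: "R > 0" "\<And>h. 0 < h \<Longrightarrow> h < R \<Longrightarrow> 0 < t + s * h \<and> t + s * h < len G e"
    using tangent_arm[OF assms] by metis
  obtain q where q: "q > 0" "\<And>h. 0 < h \<Longrightarrow> h < q \<Longrightarrow> ray G (e, t, s) h \<notin> {x. D x \<noteq> 0}"
    using near_notin_finite[OF assms finite_D] unfolding near_iff by blast
  have o: "0 \<le> ord_at G f (ray G (e, t, s) h)" if "f \<in> RR" "0 < h" "h < min R q" for f h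
    using RR_ord[OF that(1), of "ray G (e, t, s) h"] q(2)[of h] that by simp
  show ?thesis
  proof (rule that[of "min R q"])
    fix f h k assume "f \<in> RR" "0 \<le> h" "h < min R q" "0 \<le> k" "k < min R q"
    then show "f (ray G (e, t, s) h) + of_int (slope G f (e, t + s * h, s)) * (k - h) \<le> f (ray G (e, t, s) k)"
      using arm_convex[OF RR_pl assms, of f "min R q" h k] R(2) o by simp
  qed (use R q o in auto)
qed

text \<open>At each point of the arm, functions approaching the supremum can be chosen with one
  common outward slope; their supporting lines pass to the limit. So \<open>rd P\<close> has integer
  subgradients with a common lower bound along the arm, and
  \<open>subgradient_eventually_linear\<close> applies.\<close>

lemma rd_pl:
  assumes P: "P \<in> \<Gamma>" shows "pl G (rd P)"
  unfolding pl_def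
proof (intro ballI)
  fix x \<tau> assume x: "x \<in> \<Gamma>" and \<tau>0: "\<tau> \<in> tangents G x"
  obtain e t s where \<tau>: "\<tau> = (e, t, s)" by (cases \<tau>)
  note \<tau>1 = \<tau>0[unfolded \<tau>]
  note TD = tangentD[OF \<tau>1]
  obtain r where r: "r > 0" "\<And>h. 0 < h \<Longrightarrow> h < r \<Longrightarrow> 0 < t + s * h \<and> t + s * h < len G e"
    "\<And>f h k. f \<in> RR \<Longrightarrow> 0 \<le> h \<Longrightarrow> h < r \<Longrightarrow> 0 \<le> k \<Longrightarrow> k < r \<Longrightarrow>
      f (ray G (e, t, s) h) + of_int (slope G f (e, t + s * h, s)) * (k - h) \<le> f (ray G (e, t, s) k)"
    using arm_no_D[OF \<tau>1] by metis
  obtain B :: int where B: "B \<ge> 0" "\<And>f x \<tau>. f \<in> RR \<Longrightarrow> \<tau> \<in> tangents G x \<Longrightarrow> \<bar>slope G f \<tau>\<bar> \<le> B"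
    using RR_slope_bound by metis
  have tan: "(e, t + s * h, s) \<in> tangents G (ray G \<tau> h)" if "0 \<le> h" "h < r" for h
  proof (cases "h = 0")
    case True then show ?thesis using \<tau>1 ray_0[OF \<tau>1] unfolding \<tau> by simp
  next
    case False
    then show ?thesis using r(2)[of h] that TD by (auto simp: tangents_def ray_def \<tau>)
  qed
  note inG = ray_in[OF \<tau>0]
  have "\<exists>m::int. \<forall>\<^sub>F h in at_right 0. rd P (ray G \<tau> h) = rd P (ray G \<tau> 0) + of_int m * h"
  proof (rule subgradient_eventually_linear[OF r(1), of B])
    fix h assume h: "0 \<le> h" "h < r"
    have "slope G f (e, t + s * h, s) \<in> {-B..B}" if "f \<in> RR" for f
      using B(2)[OF that tan[OF h]] by auto
    then obtain m where m: "m \<in> {-B..B}"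
      "\<And>\<epsilon>. 0 < \<epsilon> \<Longrightarrow> \<exists>f\<in>RR. slope G f (e, t + s * h, s) = m \<and> (SUP f\<in>RR. f (ray G \<tau> h) - f P) - \<epsilon> < f (ray G \<tau> h) - f P"
      using Sup_pigeonhole[of "{-B..B}" RR "\<lambda>f. slope G f (e, t + s * h, s)" "\<lambda>f. f (ray G \<tau> h) - f P", OF _ _ RR_ne rd_bdd[OF inG P]]
      by auto
    have "rd P (ray G \<tau> h) + of_int m * (k - h) \<le> rd P (ray G \<tau> k)" if k: "0 \<le> k" "k < r" for k
    proof (rule field_le_epsilon)
      fix \<epsilon> :: real assume "\<epsilon> > 0"
      from m(2)[OF this] obtain f where f: "f \<in> RR" "slope G f (e, t + s * h, s) = m" "rd P (ray G \<tau> h) - \<epsilon> < f (ray G \<tau> h) - f P"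
        unfolding rd_def using inG by auto
      then show "rd P (ray G \<tau> h) + of_int m * (k - h) \<le> rd P (ray G \<tau> k) + \<epsilon>"
        using r(3)[OF f(1) h k] rd_ge[OF inG P f(1), of k] unfolding \<tau> by simp
    qed
    then show "\<exists>m::int. - B \<le> m \<and> (\<forall>k. 0 \<le> k \<and> k < r \<longrightarrow> rd P (ray G \<tau> h) + of_int m * (k - h) \<le> rd P (ray G \<tau> k))"
      using m(1) by (intro exI[of _ m]) auto
  qed
  then show "\<exists>m. has_slope G (rd P) x \<tau> m" unfolding has_slope_def ray_0[OF \<tau>0] .
qed

text \<open>Some slope pattern \<open>\<alpha>\<close> at \<open>x\<close> is shared by functions
  approaching the supremum, and their supporting lines show that each slope of \<open>rd P\<close>
  at \<open>x\<close> is at least that of \<open>\<alpha>\<close>. The sum of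
  \<open>\<alpha>\<close> is the order of a member of \<open>RR\<close>, hence at least
  \<open>- D x\<close>.\<close>

lemma rd_RR:
  assumes P: "P \<in> \<Gamma>" shows "rd P \<in> RR"
  unfolding RR_iff
proof (intro conjI allI)
  show "rd P \<in> extensional \<Gamma>" by (simp add: rd_def)
  show pl: "pl G (rd P)" by (rule rd_pl[OF P])
  fix x
  show "0 \<le> D x + ord_at G (rd P) x"
  proof (cases "x \<in> \<Gamma>")
    case x: True
    obtain B :: int where B: "B \<ge> 0" "\<And>f x \<tau>. f \<in> RR \<Longrightarrow> \<tau> \<in> tangents G x \<Longrightarrow> \<bar>slope G f \<tau>\<bar> \<le> B"
      using RR_slope_bound by metis
    define A where "A = PiE (tangents G x) (\<lambda>\<tau>. {-B..B})"
    have finA: "finite A" unfolding A_def using finite_tangents by (intro finite_PiE) auto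
    have lab: "restrict (slope G f) (tangents G x) \<in> A" if "f \<in> RR" for f
      unfolding A_def using B(2)[OF that] by (fastforce intro!: restrict_PiE_iff[THEN iffD2])
    obtain \<alpha> where "\<alpha> \<in> A" and \<alpha>: "\<And>\<epsilon>. 0 < \<epsilon> \<Longrightarrow> \<exists>f\<in>RR. restrict (slope G f) (tangents G x) = \<alpha> \<and> (SUP f\<in>RR. f x - f P) - \<epsilon> < f x - f P"
      using Sup_pigeonhole[of A RR "\<lambda>f. restrict (slope G f) (tangents G x)" "\<lambda>f. f x - f P", OF finA lab RR_ne rd_bdd[OF x P]] by blast
    have "\<alpha> \<tau> \<le> slope G (rd P) \<tau>" if \<tau>0: "\<tau> \<in> tangents G x" for \<tau>
    proof -
      obtain e t s where \<tau>: "\<tau> = (e, t, s)" by (cases \<tau>)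
      obtain r where r: "r > 0" "\<And>f h k. f \<in> RR \<Longrightarrow> 0 \<le> h \<Longrightarrow> h < r \<Longrightarrow> 0 \<le> k \<Longrightarrow> k < r \<Longrightarrow>
        f (ray G (e, t, s) h) + of_int (slope G f (e, t + s * h, s)) * (k - h) \<le> f (ray G (e, t, s) k)"
        using arm_no_D[OF \<tau>0[unfolded \<tau>]] by metis
      have "rd P x + of_int (\<alpha> \<tau>) * k \<le> rd P (ray G \<tau> k)" if k: "0 < k" "k < r" for k
      proof (rule field_le_epsilon)
        fix \<epsilon> :: real assume "\<epsilon> > 0"
        from \<alpha>[OF this] obtain f where f: "f \<in> RR" "restrict (slope G f) (tangents G x) = \<alpha>" "rd P x - \<epsilon> < f x - f P"
          unfolding rd_def using x by auto
        have "slope G f \<tau> = \<alpha> \<tau>" using f(2) \<tau>0 by (metis restrict_apply')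
        then show "rd P x + of_int (\<alpha> \<tau>) * k \<le> rd P (ray G \<tau> k) + \<epsilon>"
          using r(2)[OF f(1), of 0 k] r(1) k f(3) rd_ge[OF ray_in[OF \<tau>0] P f(1), of k] ray_0[OF \<tau>0] unfolding \<tau> by simp
      qed
      then have "\<forall>\<^sub>F h in at_right 0. rd P x + of_int (\<alpha> \<tau>) * h \<le> rd P (ray G \<tau> h)"
        unfolding eventually_at_right_0 using r(1) by blast
      from has_slope_tangent_ge[OF pl_slope[OF pl x \<tau>0] this] show ?thesis by simp
    qed
    then have "(\<Sum>\<tau>\<in>tangents G x. \<alpha> \<tau>) \<le> ord_at G (rd P) x" unfolding ord_at_slope by (rule sum_mono)
    moreover obtain f where f: "f \<in> RR" "restrict (slope G f) (tangents G x) = \<alpha>" using \<alpha>[of 1] by auto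
    then have "ord_at G f x = (\<Sum>\<tau>\<in>tangents G x. \<alpha> \<tau>)" unfolding ord_at_slope by (intro sum.cong) auto
    ultimately show ?thesis using RR_ord[OF f(1), of x] by simp
  qed (simp add: ord_at_off D_off)
qed

end

section \<open>Firing a set\<close>

context trop_curve
begin

lemma edge_point_eq_Inner:
  assumes "e' \<in> edges G" "0 \<le> t" "t \<le> len G e'"
  shows "edge_point G e' t = Inner e u \<longleftrightarrow> e' = e \<and> t = u \<and> 0 < u \<and> u < len G e"
  using assms by (auto simp: edge_point_def)

lemma edge_point_inj:
  assumes "e \<in> edges G" "s \<in> {0..len G e}" "t \<in> {0..len G e}" "edge_point G e s = edge_point G e t"
  shows "s = t"
  using assms edgeD[OF assms(1)] by (auto simp: edge_point_def split: if_splits)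

lemma openin_Inner:
  assumes e: "e \<in> edges G" and ab: "0 \<le> a" "b \<le> len G e"
  shows "openin T (Inner e ` {a<..<b})"
  unfolding openin_curve_topology
proof (intro conjI ballI)
  show "Inner e ` {a<..<b} \<subseteq> \<Gamma>"
  proof (rule image_subsetI)
    fix u assume "u \<in> {a<..<b}"
    then show "Inner e u \<in> \<Gamma>" using edge_point_in[OF e, of u] edge_point_simps(3)[OF e, of u] ab by simp
  qed
  fix e' assume e': "e' \<in> edges G"
  have "t \<in> {t \<in> {0..len G e'}. edge_point G e' t \<in> Inner e ` {a<..<b}} \<longleftrightarrow> t \<in> (if e' = e then {a<..<b} else {})" for t
  proof
    assume "t \<in> {t \<in> {0..len G e'}. edge_point G e' t \<in> Inner e ` {a<..<b}}"
    then obtain u where "0 \<le> t" "t \<le> len G e'" "edge_point G e' t = Inner e u" "u \<in> {a<..<b}" by auto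
    then show "t \<in> (if e' = e then {a<..<b} else {})" using edge_point_eq_Inner[OF e', of t e u] by simp
  next
    assume "t \<in> (if e' = e then {a<..<b} else {})"
    then have "e' = e" "t \<in> {a<..<b}" by (auto split: if_splits)
    then show "t \<in> {t \<in> {0..len G e'}. edge_point G e' t \<in> Inner e ` {a<..<b}}" using ab e edge_point_simps(3)[OF e, of t] by auto
  qed
  then have "{t \<in> {0..len G e'}. edge_point G e' t \<in> Inner e ` {a<..<b}} = (if e' = e then {a<..<b} else {})"
    by blast
  moreover have "openin (top_of_set {0..len G e}) {a<..<b}"
    using ab by (intro open_subset) auto
  ultimately show "openin (top_of_set {0..len G e'}) {t \<in> {0..len G e'}. edge_point G e' t \<in> Inner e ` {a<..<b}}"
    by simp
qed

lemma closedin_edge_segment: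
  assumes e: "e \<in> edges G" and ab: "0 \<le> a" "b \<le> len G e"
  shows "closedin T (edge_point G e ` {a..b})"
proof -
  have "openin T (\<Gamma> - edge_point G e ` {a..b})"
    unfolding openin_curve_topology
  proof (intro conjI ballI)
    fix e' assume e': "e' \<in> edges G"
    define K where "K = {t \<in> {0..len G e'}. edge_point G e' t \<in> edge_point G e ` {a..b}}"
    have "closed K"
    proof (cases "e' = e")
      case True
      have "K = {a..b}"
      proof
        show "K \<subseteq> {a..b}"
        proof
          fix t assume "t \<in> K"
          then obtain u where u: "u \<in> {a..b}" "edge_point G e t = edge_point G e u" "t \<in> {0..len G e}" by (auto simp: K_def True)
          then have "t = u" using edge_point_inj[OF e, of t u] ab by auto
          with u show "t \<in> {a..b}" by simp
        qed
      qed (use ab in \<open>auto simp: K_def True\<close>)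
      then show ?thesis by simp
    next
      case False
      have "K \<subseteq> {0, len G e'}"
      proof
        fix t assume "t \<in> K"
        then obtain u where u: "u \<in> {a..b}" "edge_point G e' t = edge_point G e u" "t \<in> {0..len G e'}" by (auto simp: K_def)
        show "t \<in> {0, len G e'}"
        proof (rule ccontr)
          assume "t \<notin> {0, len G e'}"
          then have "edge_point G e' t = Inner e' t" using u(3) e' by auto
          then show False using edge_point_eq_Inner[OF e, of u e' t] u ab False by auto
        qed
      qed
      then show ?thesis using finite_imp_closed finite_subset by blast
    qed
    moreover have "{t \<in> {0..len G e'}. edge_point G e' t \<in> \<Gamma> - edge_point G e ` {a..b}} = {0..len G e'} \<inter> - K"
      using edge_point_in[OF e'] by (auto simp: K_def)
    ultimately show "openin (top_of_set {0..len G e'}) {t \<in> {0..len G e'}. edge_point G e' t \<in> \<Gamma> - edge_point G e ` {a..b}}"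
      by (simp add: openin_open_Int open_Compl)
  qed blast
  moreover have "edge_point G e ` {a..b} \<subseteq> \<Gamma>" using edge_point_in[OF e] by blast
  ultimately show ?thesis by (simp add: closedin_def)
qed

lemma ray_segment:
  assumes "(e, t, s) \<in> tangents G x"
  shows "(\<lambda>h. ray G (e, t, s) h) ` {a..b} = edge_point G e ` (if s = 1 then {t + a..t + b} else {t - b..t - a})"
    and "(\<lambda>h. ray G (e, t, s) h) ` {a<..<b} = edge_point G e ` (if s = 1 then {t + a<..<t + b} else {t - b<..<t - a})"
proof -
  have s: "s = 1 \<or> s = -1" using tangentD(5)[OF assms] .
  have im: "(\<lambda>h. ray G (e, t, s) h) ` A = edge_point G e ` (\<lambda>h. t + s * h) ` A" for A
    by (simp add: ray_def image_image)
  have "(\<lambda>h. t + s * h) ` {a..b} = (if s = 1 then {t + a..t + b} else {t - b..t - a})"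
    using s by (auto simp: image_iff intro: bexI[of _ "s * (_ - t)"])
  then show "(\<lambda>h. ray G (e, t, s) h) ` {a..b} = edge_point G e ` (if s = 1 then {t + a..t + b} else {t - b..t - a})"
    by (simp only: im)
  have "(\<lambda>h. t + s * h) ` {a<..<b} = (if s = 1 then {t + a<..<t + b} else {t - b<..<t - a})"
  proof (rule set_eqI, rule iffI)
    fix u assume "u \<in> (if s = 1 then {t + a<..<t + b} else {t - b<..<t - a})"
    then have "u = t + s * (s * (u - t))" "s * (u - t) \<in> {a<..<b}" using s by (auto split: if_splits)
    then show "u \<in> (\<lambda>h. t + s * h) ` {a<..<b}" by blast
  qed (use s in auto)
  then show "(\<lambda>h. ray G (e, t, s) h) ` {a<..<b} = edge_point G e ` (if s = 1 then {t + a<..<t + b} else {t - b<..<t - a})"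
    by (simp only: im)
qed

text \<open>Here the length is explicit, unlike in \<open>tangent_arm\<close>, because closed
  segments need a definite end.\<close>

lemma arm_length:
  assumes "(e, t, s) \<in> tangents G x"
  obtains R where "R > 0" "R = (if s = 1 then len G e - t else t)"
    "\<And>h. 0 < h \<Longrightarrow> h < R \<Longrightarrow> 0 < t + s * h \<and> t + s * h < len G e"
    "\<And>h. 0 < h \<Longrightarrow> h < R \<Longrightarrow> ray G (e, t, s) h = Inner e (t + s * h)"
    "\<And>h. 0 < h \<Longrightarrow> h < R \<Longrightarrow> tangents G (ray G (e, t, s) h) = {(e, t + s * h, 1), (e, t + s * h, -1)}"
proof -
  have e: "e \<in> edges G" and c: "0 \<le> t" "t \<le> len G e" "s = 1 \<and> t < len G e \<or> s = -1 \<and> 0 < t"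
    using assms by (auto simp: tangents_def)
  define R where "R = (if s = 1 then len G e - t else t)"
  have "R > 0" using c by (auto simp: R_def)
  moreover have a: "0 < t + s * h \<and> t + s * h < len G e" if "0 < h" "h < R" for h
    using that c by (auto simp: R_def split: if_splits)
  moreover from a have b: "ray G (e, t, s) h = Inner e (t + s * h)" if "0 < h" "h < R" for h
    using that by (simp add: ray_def e)
  moreover have "tangents G (ray G (e, t, s) h) = {(e, t + s * h, 1), (e, t + s * h, -1)}" if "0 < h" "h < R" for h
    using a b e that tangents_Inner by simp
  ultimately show ?thesis using that R_def by blast
qed

lemma openin_arm:
  assumes \<tau>: "\<tau> \<in> tangents G x" and R: "\<tau> = (e, t, s)" "b \<le> (if s = 1 then len G e - t else t)" "0 \<le> a"
  shows "openin T (ray G \<tau> ` {a<..<b})"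
proof -
  note \<tau>' = \<tau>[unfolded R]
  note D = tangentD[OF \<tau>']
  let ?J = "if s = 1 then {t + a<..<t + b} else {t - b<..<t - a}"
  have J: "?J \<subseteq> {0<..<len G e}" using R D by (auto split: if_splits)
  then have "edge_point G e u = Inner e u" if "u \<in> ?J" for u using that D(1) by auto
  then have "ray G \<tau> ` {a<..<b} = Inner e ` ?J" unfolding R(1) ray_segment(2)[OF \<tau>'] by (intro image_cong refl)
  moreover have "openin T (Inner e ` ?J)" using openin_Inner[OF D(1)] R D by (auto split: if_splits)
  ultimately show ?thesis by simp
qed

lemma closedin_arm:
  assumes \<tau>: "\<tau> \<in> tangents G x" and R: "\<tau> = (e, t, s)" "b \<le> (if s = 1 then len G e - t else t)" "0 \<le> a"
  shows "closedin T (ray G \<tau> ` {a..b})"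
proof -
  note \<tau>' = \<tau>[unfolded R]
  note D = tangentD[OF \<tau>']
  show ?thesis unfolding R(1) ray_segment(1)[OF \<tau>'] using closedin_edge_segment[OF D(1)] R D by (auto split: if_splits)
qed

lemma connectedin_arm:
  assumes \<tau>: "\<tau> \<in> tangents G x" and R: "\<tau> = (e, t, s)" "b \<le> (if s = 1 then len G e - t else t)" "0 \<le> a"
  shows "connectedin T (ray G \<tau> ` {a..b})"
proof -
  note \<tau>' = \<tau>[unfolded R]
  note D = tangentD[OF \<tau>']
  have "connectedin T (edge_point G e ` J)" if "connected J" "J \<subseteq> {0..len G e}" for J
    using continuous_edge_point[OF D(1)] by (rule connectedin_continuous_map_image) (simp add: that connectedin_subtopology)
  then show ?thesis unfolding R(1) ray_segment(1)[OF \<tau>'] using R D by (auto split: if_splits)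
qed

lemma ray_inj:
  assumes \<tau>: "(e, t, s) \<in> tangents G x" and "b \<le> (if s = 1 then len G e - t else t)"
    "0 \<le> h" "h \<le> b" "0 \<le> k" "k \<le> b" "ray G (e, t, s) h = ray G (e, t, s) k"
  shows "h = k"
proof -
  note D = tangentD[OF \<tau>]
  have "t + s * h = t + s * k"
    using assms D by (intro edge_point_inj[OF D(1)]) (auto simp: ray_def split: if_splits)
  then show ?thesis using D(5) by auto
qed

text \<open>If membership in \<open>X\<close> alternated along the ray, two points outside
  \<open>X\<close> would bound an open stretch of the edge that meets \<open>X\<close>, while
  \<open>X\<close> also meets the open complement of the closed stretch. This separates
  \<open>X\<close>.\<close>

lemma connected_closed_dichotomy:
  assumes c: "connectedin T X" and x: "x \<in> X" and \<tau>0: "\<tau> \<in> tangents G x"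
  shows "near G \<tau> (\<lambda>y. y \<in> X) \<or> near G \<tau> (\<lambda>y. y \<notin> X)"
proof (rule ccontr)
  assume "\<not> ?thesis"
  then have n1: "\<And>r. r > 0 \<Longrightarrow> \<exists>h. 0 < h \<and> h < r \<and> ray G \<tau> h \<notin> X" and n2: "\<And>r. r > 0 \<Longrightarrow> \<exists>h. 0 < h \<and> h < r \<and> ray G \<tau> h \<in> X"
    unfolding near_iff by blast+
  obtain e t s where \<tau>: "\<tau> = (e, t, s)" by (cases \<tau>)
  obtain R where R: "R > 0" "R = (if s = 1 then len G e - t else t)"
    using arm_length[OF \<tau>0[unfolded \<tau>]] by metis
  obtain h3 where h3: "0 < h3" "h3 < R" "ray G \<tau> h3 \<notin> X" using n1 R(1) by blast
  obtain h2 where h2: "0 < h2" "h2 < h3" "ray G \<tau> h2 \<in> X" using n2 h3(1) by blast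
  obtain h1 where h1: "0 < h1" "h1 < h2" "ray G \<tau> h1 \<notin> X" using n1 h2(1) by blast
  obtain h0 where h0: "0 < h0" "h0 < h1" "ray G \<tau> h0 \<in> X" using n2 h1(1) by blast
  let ?U = "ray G \<tau> ` {h1<..<h3}" and ?V = "\<Gamma> - ray G \<tau> ` {h1..h3}"
  have "openin T ?U" using openin_arm[OF \<tau>0 \<tau>, of h3 h1] R h3 h1 by simp
  moreover have "closedin T (ray G \<tau> ` {h1..h3})" using closedin_arm[OF \<tau>0 \<tau>, of h3 h1] R h3 h1 by simp
  then have "openin T ?V" by (metis closedin_def topspace_T)
  moreover have "X \<subseteq> ?U \<union> ?V"
  proof
    fix y assume y: "y \<in> X"
    then have "y \<in> \<Gamma>" using c by (auto simp: connectedin_def)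
    moreover have "y \<noteq> ray G \<tau> h1" "y \<noteq> ray G \<tau> h3" using y h1 h3 by auto
    moreover have "h \<in> {h1<..<h3}" if "h \<in> {h1..h3}" "h \<noteq> h1" "h \<noteq> h3" for h using that by auto
    ultimately show "y \<in> ?U \<union> ?V" by blast
  qed
  moreover have "?U \<inter> ?V \<inter> X = {}" by force
  moreover have "ray G \<tau> h2 \<in> ?U \<inter> X" using h2 h1 by auto
  moreover have "ray G \<tau> h0 \<notin> ray G \<tau> ` {h1..h3}"
  proof
    assume "ray G \<tau> h0 \<in> ray G \<tau> ` {h1..h3}"
    then obtain k where "k \<in> {h1..h3}" "ray G \<tau> h0 = ray G \<tau> k" by blast
    then have "h0 = k" using ray_inj[OF \<tau>0[unfolded \<tau>], of h3 h0 k] R h0 h1 h2 h3 unfolding \<tau> by simp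
    with \<open>k \<in> {h1..h3}\<close> h0 show False by simp
  qed
  then have "ray G \<tau> h0 \<in> ?V \<inter> X" using h0 ray_in[OF \<tau>0] by blast
  ultimately show False using c unfolding connectedin by blast
qed

text \<open>Firing a set \<open>X\<close>: the function drops from \<open>0\<close> on \<open>X\<close> with prescribed slopes along the directions
  that leave \<open>X\<close>.\<close>

lemma fire:
  fixes w :: "('v \<times> 'v) \<times> real \<times> real \<Rightarrow> int"
  assumes X: "X \<subseteq> \<Gamma>"
    and H1: "\<And>y \<tau>. y \<in> \<Gamma> - X \<Longrightarrow> \<tau> \<in> tangents G y \<Longrightarrow> near G \<tau> (\<lambda>z. z \<notin> X)"
    and H2: "\<And>y \<tau>. y \<in> X \<Longrightarrow> \<tau> \<in> tangents G y \<Longrightarrow> near G \<tau> (\<lambda>z. z \<in> X) \<or> near G \<tau> (\<lambda>z. z \<notin> X)"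
    and fin: "finite {\<tau>. \<exists>y\<in>X. \<tau> \<in> tangents G y \<and> near G \<tau> (\<lambda>z. z \<notin> X)}" (is "finite ?\<Lambda>")
    and w: "\<And>\<tau>. 1 \<le> w \<tau>"
  obtains u \<delta> where "pl G u" "\<delta> > 0" "\<And>y. y \<in> X \<Longrightarrow> u y = 0" "\<And>y. y \<in> \<Gamma> - X \<Longrightarrow> u y < 0"
    "\<And>y \<tau> h. y \<in> X \<Longrightarrow> \<tau> \<in> tangents G y \<Longrightarrow> near G \<tau> (\<lambda>z. z \<notin> X) \<Longrightarrow> 0 < h \<Longrightarrow> h < \<delta> \<Longrightarrow> u (ray G \<tau> h) = - of_int (w \<tau>) * h"
    "\<And>y. y \<in> \<Gamma> - X \<Longrightarrow> 0 \<le> ord_at G u y"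
    "\<And>y. y \<in> X \<Longrightarrow> ord_at G u y = - (\<Sum>\<tau>\<in>{\<tau>\<in>tangents G y. near G \<tau> (\<lambda>z. z \<notin> X)}. w \<tau>)"
proof -
  define \<Lambda> where "\<Lambda> = ?\<Lambda>"
  have finL: "finite \<Lambda>" using fin by (simp add: \<Lambda>_def)
  have \<Lambda>D: "edge_point G e t \<in> X" "(e, t, s) \<in> tangents G (edge_point G e t)" "near G (e, t, s) (\<lambda>z. z \<notin> X)" if "(e, t, s) \<in> \<Lambda>" for e t s
  proof -
    note L = that
    obtain y where y: "y \<in> X" "(e, t, s) \<in> tangents G y" "near G (e, t, s) (\<lambda>z. z \<notin> X)" using L unfolding \<Lambda>_def by blast
    have "edge_point G e t = y" by (rule tangentD(4)[OF y(2)])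
    then show "edge_point G e t \<in> X" "(e, t, s) \<in> tangents G (edge_point G e t)" "near G (e, t, s) (\<lambda>z. z \<notin> X)" using y by simp_all
  qed
  have base: "\<exists>r>0. \<forall>h. 0 < h \<and> h < r \<longrightarrow> ray G \<tau> h \<notin> X \<and> (case \<tau> of (e, t, s) \<Rightarrow> 0 < t + s * h \<and> t + s * h < len G e)" if "\<tau> \<in> \<Lambda>" for \<tau>
  proof -
    obtain e t s where \<tau>: "\<tau> = (e, t, s)" by (cases \<tau>)
    note L = \<Lambda>D[OF that[unfolded \<tau>]]
    obtain R where R: "R > 0" "\<And>h. 0 < h \<Longrightarrow> h < R \<Longrightarrow> 0 < t + s * h \<and> t + s * h < len G e"
      using tangent_arm[OF L(2)] by metis
    obtain r where "r > 0" "\<forall>h. 0 < h \<and> h < r \<longrightarrow> ray G \<tau> h \<notin> X" using L(3) unfolding near_iff \<tau> by blast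
    then show ?thesis using R by (intro exI[of _ "min r R"]) (auto simp: \<tau>)
  qed
  obtain \<rho> where \<rho>: "\<And>\<tau>. \<tau> \<in> \<Lambda> \<Longrightarrow> \<rho> \<tau> > 0" "\<And>\<tau> h. \<tau> \<in> \<Lambda> \<Longrightarrow> 0 < h \<Longrightarrow> h < \<rho> \<tau> \<Longrightarrow> ray G \<tau> h \<notin> X"
    "\<And>e t s h. (e, t, s) \<in> \<Lambda> \<Longrightarrow> 0 < h \<Longrightarrow> h < \<rho> (e, t, s) \<Longrightarrow> 0 < t + s * h \<and> t + s * h < len G e"
  proof -
    have "\<forall>\<tau>\<in>\<Lambda>. \<exists>r. r>0 \<and> (\<forall>h. 0 < h \<and> h < r \<longrightarrow> ray G \<tau> h \<notin> X \<and> (case \<tau> of (e, t, s) \<Rightarrow> 0 < t + s * h \<and> t + s * h < len G e))"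
      using base by blast
    from bchoice[OF this] obtain \<rho> where "\<forall>\<tau>\<in>\<Lambda>. \<rho> \<tau>>0 \<and> (\<forall>h. 0 < h \<and> h < \<rho> \<tau> \<longrightarrow> ray G \<tau> h \<notin> X \<and> (case \<tau> of (e, t, s) \<Rightarrow> 0 < t + s * h \<and> t + s * h < len G e))" ..
    then show ?thesis by (intro that[of \<rho>]) fastforce+
  qed
  \<comment> \<open>Half the differences of distinct base parameters: with \<open>r\<close> below
    all of them, arms of length less than \<open>r\<close> that start at different points of one
    edge cannot meet.\<close>
  define Gaps where "Gaps = (\<lambda>(\<tau>, \<tau>'). \<bar>fst (snd \<tau>) - fst (snd \<tau>')\<bar> / 2) ` {(\<tau>, \<tau>') \<in> \<Lambda> \<times> \<Lambda>. fst (snd \<tau>) \<noteq> fst (snd \<tau>')}"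
  define r where "r = Min (insert 1 (\<rho> ` \<Lambda> \<union> Gaps))"
  have "{(\<tau>, \<tau>') \<in> \<Lambda> \<times> \<Lambda>. fst (snd \<tau>) \<noteq> fst (snd \<tau>')} \<subseteq> \<Lambda> \<times> \<Lambda>" by blast
  then have "finite {(\<tau>, \<tau>') \<in> \<Lambda> \<times> \<Lambda>. fst (snd \<tau>) \<noteq> fst (snd \<tau>')}"
    by (rule finite_subset) (intro finite_cartesian_product finL)
  then have finG: "finite Gaps" unfolding Gaps_def by (rule finite_imageI)
  have gpos: "g > 0" if "g \<in> Gaps" for g using that by (auto simp: Gaps_def)
  have r: "r > 0" unfolding r_def using finL finG \<rho>(1) gpos by (subst Min_gr_iff) auto
  have r\<rho>: "r \<le> \<rho> \<tau>" if "\<tau> \<in> \<Lambda>" for \<tau> unfolding r_def using finL finG that by (intro Min_le) auto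
  have rG: "2 * r \<le> \<bar>t - t'\<bar>" if "(e, t, s) \<in> \<Lambda>" "(e', t', s') \<in> \<Lambda>" "t \<noteq> t'" for e t s e' t' s'
  proof -
    have "\<bar>t - t'\<bar> / 2 \<in> Gaps" unfolding Gaps_def using that by (intro image_eqI[of _ _ "((e, t, s), (e', t', s'))"]) auto
    then have "r \<le> \<bar>t - t'\<bar> / 2" unfolding r_def using finL finG by (intro Min_le) auto
    then show ?thesis by simp
  qed
  have inner: "ray G (e, t, s) h = Inner e (t + s * h)" "0 < t + s * h" "t + s * h < len G e" if "(e, t, s) \<in> \<Lambda>" "0 < h" "h < r" for e t s h
    using \<rho>(3)[OF that(1,2)] r\<rho>[OF that(1)] that(3) tangentD(1)[OF \<Lambda>D(2)[OF that(1)]] by (auto simp: ray_def)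
  have uniq: "\<tau> = \<tau>' \<and> h = h'" if "\<tau> \<in> \<Lambda>" "\<tau>' \<in> \<Lambda>" "0 < h" "h < r" "0 < h'" "h' < r" "ray G \<tau> h = ray G \<tau>' h'" for \<tau> \<tau>' h h'
  proof -
    obtain e t s where \<tau>: "\<tau> = (e, t, s)" by (cases \<tau>)
    obtain e' t' s' where \<tau>': "\<tau>' = (e', t', s')" by (cases \<tau>')
    have s: "s = 1 \<or> s = -1" "s' = 1 \<or> s' = -1" using \<Lambda>D(2) tangentD(5) that(1,2) unfolding \<tau> \<tau>' by blast+
    have e: "e = e'" "t + s * h = t' + s' * h'" using that inner(1) unfolding \<tau> \<tau>' by auto
    have "t = t'"
    proof (rule ccontr)
      assume "t \<noteq> t'"
      then have "2 * r \<le> \<bar>t - t'\<bar>" using rG that(1,2) unfolding \<tau> \<tau>' by blast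
      then show False using e(2) s that(3-6) by auto
    qed
    then show ?thesis using e s that(3,5) unfolding \<tau> \<tau>' by auto
  qed
  \<comment> \<open>\<open>N\<close> places \<open>y\<close> on an arm at distance
    \<open>h \<le> r / 2\<close>. Along the arm \<open>u\<close> falls with slope \<open>w\<close>
    down to the level \<open>- r / 2\<close>, which it keeps on the rest of the complement of
    \<open>X\<close>; as \<open>w\<close> is at least \<open>1\<close>, the level is reached by
    distance \<open>r / 2\<close>. The arm in the description is unique by
    \<open>uniq\<close>.\<close>
  define N where "N y \<tau> h \<longleftrightarrow> \<tau> \<in> \<Lambda> \<and> 0 < h \<and> h \<le> r / 2 \<and> y = ray G \<tau> h" for y \<tau> h
  define u where "u y = (if y \<in> X then 0 else if \<exists>\<tau> h. N y \<tau> h then THE z. \<exists>\<tau> h. N y \<tau> h \<and> z = - min (r/2) (of_int (w \<tau>) * h) else - r / 2)" for y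
  have uX: "u y = 0" if "y \<in> X" for y using that by (simp add: u_def)
  have wr: "of_int (w \<tau>) * h \<ge> h" if "h > 0" for \<tau> and h :: real using w[of \<tau>] that by simp
  have uA: "u (ray G \<tau> h) = - min (r/2) (of_int (w \<tau>) * h)" if "\<tau> \<in> \<Lambda>" "0 < h" "h < r" for \<tau> h
  proof -
    have nX: "ray G \<tau> h \<notin> X" using \<rho>(2)[OF that(1,2)] r\<rho>[OF that(1)] that(3) by simp
    show ?thesis
    proof (cases "h \<le> r/2")
      case True
      then have N: "N (ray G \<tau> h) \<tau> h" using that by (simp add: N_def)
      have U: "\<tau>' = \<tau> \<and> h' = h" if "N (ray G \<tau> h) \<tau>' h'" for \<tau>' h'
        using uniq[of \<tau> \<tau>' h h'] that \<open>\<tau> \<in> \<Lambda>\<close> \<open>0 < h\<close> \<open>h < r\<close> r unfolding N_def by auto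
      have "(THE z. \<exists>\<tau>' h'. N (ray G \<tau> h) \<tau>' h' \<and> z = - min (r/2) (of_int (w \<tau>') * h')) = - min (r/2) (of_int (w \<tau>) * h)"
        using N U by (intro the_equality) blast+
      moreover have ex: "\<exists>\<tau>' h'. N (ray G \<tau> h) \<tau>' h'" using N by blast
      ultimately show ?thesis by (simp only: u_def if_not_P[OF nX] ex if_True)
    next
      case False
      have "\<not> N (ray G \<tau> h) \<tau>' h'" for \<tau>' h'
        using uniq[of \<tau> \<tau>' h h'] that False r unfolding N_def by auto
      then have nex: "\<not> (\<exists>\<tau>' h'. N (ray G \<tau> h) \<tau>' h')" by blast
      have "u (ray G \<tau> h) = - r / 2" by (simp only: u_def if_not_P[OF nX] if_not_P[OF nex])
      then show ?thesis using False wr[OF that(2), of \<tau>] by simp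
    qed
  qed
  have uC: "u y = - r / 2" if nX: "y \<notin> X" and n: "\<And>\<tau> h. \<not> N y \<tau> h" for y
  proof -
    have nex: "\<not> (\<exists>\<tau>' h'. N y \<tau>' h')" using n by blast
    show ?thesis by (simp only: u_def if_not_P[OF nX] if_not_P[OF nex])
  qed
  have sX: "has_slope G u y \<tau> (if \<tau> \<in> \<Lambda> then - w \<tau> else 0)" if y: "y \<in> X" and \<tau>: "\<tau> \<in> tangents G y" for y \<tau>
  proof (cases "\<tau> \<in> \<Lambda>")
    case True
    have wp: "0 < real_of_int (w \<tau>)" using w[of \<tau>] by simp
    have "u (ray G \<tau> h) = u y + of_int (- w \<tau>) * h" if "0 < h" "h < min r (r / 2 / of_int (w \<tau>))" for h
    proof -
      have "of_int (w \<tau>) * h \<le> r / 2" using that wp by (simp add: field_simps)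
      then show ?thesis using uA[OF True] that uX[OF y] by simp
    qed
    moreover have "min r (r / 2 / of_int (w \<tau>)) > 0" using r wp by simp
    ultimately show ?thesis using True unfolding has_slope_def eventually_at_right_0
      by (intro exI[of _ "min r (r / 2 / of_int (w \<tau>))"]) simp
  next
    case False
    then have "\<not> near G \<tau> (\<lambda>z. z \<notin> X)" using y \<tau> unfolding \<Lambda>_def by blast
    then have "near G \<tau> (\<lambda>z. z \<in> X)" using H2[OF y \<tau>] by blast
    then show ?thesis using False unfolding has_slope_def near_def by (simp add: uX[OF y]) (erule eventually_mono, simp add: uX)
  qed
  \<comment> \<open>Where \<open>w * h = r / 2\<close> the forward slope is already \<open>0\<close>
    and the backward one still \<open>w\<close>, so the order is \<open>w\<close>; this is why one
    comparison is strict and the other is not. Elsewhere on the arm the two slopes cancel.\<close>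
  have sA: "has_slope G u y (e, t + s * h, s) (if of_int (w (e,t,s)) * h < r/2 then - w (e,t,s) else 0) \<and>
     has_slope G u y (e, t + s * h, -s) (if of_int (w (e,t,s)) * h \<le> r/2 then w (e,t,s) else 0)"
    if \<tau>: "(e, t, s) \<in> \<Lambda>" and h: "0 < h" "h < r" and y: "y = ray G (e, t, s) h" for e t s h y
  proof -
    let ?w = "real_of_int (w (e,t,s))"
    have wp: "0 < ?w" using w[of "(e,t,s)"] by simp
    have ray1: "ray G (e, t + s * h, s) k = ray G (e,t,s) (h + k)" "ray G (e, t + s * h, -s) k = ray G (e,t,s) (h - k)" for k
      by (simp_all add: ray_def algebra_simps)
    have uy: "u y = - min (r/2) (?w * h)" using uA[OF \<tau> h] y by simp
    have 1: "has_slope G u y (e, t + s * h, s) (if ?w * h < r/2 then - w (e,t,s) else 0)"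
    proof (cases "?w * h < r/2")
      case True
      define q where "q = min (r - h) ((r/2 - ?w * h) / ?w)"
      have "q > 0" using True h wp by (simp add: q_def)
      moreover have "u (ray G (e, t, s) (h + k)) = u y - ?w * k" if k: "0 < k" "k < q" for k
      proof -
        have "?w * (h + k) \<le> r/2" using k wp by (simp add: q_def field_simps)
        then show ?thesis using uA[OF \<tau>, of "h + k"] k h uy True by (simp add: q_def algebra_simps)
      qed
      ultimately show ?thesis using True unfolding has_slope_def eventually_at_right_0 ray1 by (intro exI[of _ q]) auto
    next
      case False
      have "u (ray G (e, t, s) (h + k)) = u y" if k: "0 < k" "k < r - h" for k
      proof -
        have "?w * h \<le> ?w * (h + k)" using k wp by simp
        then show ?thesis using uA[OF \<tau>, of "h + k"] k h uy False by simp
      qed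
      then show ?thesis using False h unfolding has_slope_def eventually_at_right_0 ray1 by (intro exI[of _ "r - h"]) auto
    qed
    have 2: "has_slope G u y (e, t + s * h, -s) (if ?w * h \<le> r/2 then w (e,t,s) else 0)"
    proof (cases "?w * h \<le> r/2")
      case True
      have "u (ray G (e, t, s) (h - k)) = u y + ?w * k" if k: "0 < k" "k < h" for k
      proof -
        have "?w * (h - k) \<le> ?w * h" using k wp by simp
        then show ?thesis using uA[OF \<tau>, of "h - k"] k h uy True by (simp add: algebra_simps)
      qed
      then show ?thesis using True h unfolding has_slope_def eventually_at_right_0 ray1 by (intro exI[of _ h]) auto
    next
      case False
      define q where "q = min h ((?w * h - r/2) / ?w)"
      have "q > 0" using False h wp by (simp add: q_def)
      moreover have "u (ray G (e, t, s) (h - k)) = u y" if k: "0 < k" "k < q" for k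
      proof -
        have "?w * (h - k) \<ge> r/2" using k wp by (simp add: q_def field_simps)
        then show ?thesis using uA[OF \<tau>, of "h - k"] k h uy False by (simp add: q_def)
      qed
      ultimately show ?thesis using False unfolding has_slope_def eventually_at_right_0 ray1 by (intro exI[of _ q]) auto
    qed
    show ?thesis using 1 2 by blast
  qed
  have sC: "has_slope G u y \<tau> 0" if y: "y \<in> \<Gamma> - X" and nA: "\<And>\<tau> h. \<tau> \<in> \<Lambda> \<Longrightarrow> 0 < h \<Longrightarrow> h < r \<Longrightarrow> y \<noteq> ray G \<tau> h" and \<tau>: "\<tau> \<in> tangents G y" for y \<tau>
  proof -
    obtain e1 t1 s1 where t1: "\<tau> = (e1, t1, s1)" by (cases \<tau>)
    note D1 = tangentD[OF \<tau>[unfolded t1]]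
    obtain R where R: "R > 0" "\<And>k. 0 < k \<Longrightarrow> k < R \<Longrightarrow> ray G \<tau> k = Inner e1 (t1 + s1 * k)"
      using tangent_arm[OF \<tau>[unfolded t1]] unfolding t1 by metis
    have "\<forall>\<^sub>F k in at_right 0. \<forall>h. \<not> N (ray G \<tau> k) \<sigma> h" if \<sigma>0: "\<sigma> \<in> \<Lambda>" for \<sigma>
    proof -
      obtain e t s where \<sigma>: "\<sigma> = (e, t, s)" by (cases \<sigma>)
      note L = \<Lambda>D[OF \<sigma>0[unfolded \<sigma>]]
      have s: "s = 1 \<or> s = -1" using tangentD(5)[OF L(2)] .
      show ?thesis
      proof (cases "e = e1")
        case False
        have "\<not> N (ray G \<tau> k) \<sigma> h" if k: "0 < k" "k < R" for h k
        proof
          assume "N (ray G \<tau> k) \<sigma> h"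
          then have "Inner e1 (t1 + s1 * k) = Inner e (t + s * h)" using R(2)[OF k] inner(1)[OF \<sigma>0[unfolded \<sigma>], of h] r unfolding N_def \<sigma> by auto
          then show False using False by simp
        qed
        then show ?thesis unfolding eventually_at_right_0 using R(1) by (intro exI[of _ R]) blast
      next
        case True
        \<comment> \<open>The signed coordinate of \<open>y\<close> along the arm of
          \<open>\<sigma>\<close>. The value \<open>0\<close> would put \<open>y\<close> into
          \<open>X\<close>, and values between \<open>0\<close> and \<open>r\<close> are excluded by
          \<open>nA\<close>. So points near \<open>y\<close> miss the truncated arm, which is only
          \<open>r / 2\<close> long.\<close>
        define q where "q = s * (t1 - t)"
        have t1': "t1 = t + s * q" using s by (auto simp: q_def)
        have q: "q < 0 \<or> q \<ge> r"
        proof (rule ccontr)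
          assume "\<not> (q < 0 \<or> q \<ge> r)"
          then have q: "0 \<le> q" "q < r" by auto
          have "y = ray G \<sigma> q" unfolding \<sigma> ray_def using D1(4) t1' True by simp
          then show False using nA[OF \<sigma>0, of q] q y L(1) by (cases "q = 0") (auto simp: \<sigma> ray_def)
        qed
        define m where "m = min R (if q < 0 then - q else r / 2)"
        have "m > 0" using R(1) q r by (auto simp: m_def)
        moreover have "\<not> N (ray G \<tau> k) \<sigma> h" if k: "0 < k" "k < m" for h k
        proof
          assume N: "N (ray G \<tau> k) \<sigma> h"
          then have "Inner e1 (t1 + s1 * k) = Inner e (t + s * h)" using R(2)[of k] k inner(1)[OF \<sigma>0[unfolded \<sigma>], of h] r unfolding N_def \<sigma> by (auto simp: m_def)
          then have "s * q + s1 * k = s * h" using t1' by simp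
          then have "\<bar>h - q\<bar> = k" using s D1(5) k by auto
          then show False using N k q r unfolding N_def m_def by (auto split: if_splits)
        qed
        ultimately show ?thesis unfolding eventually_at_right_0 by (intro exI[of _ m]) blast
      qed
    qed
    then have "\<forall>\<^sub>F k in at_right 0. \<forall>\<sigma>\<in>\<Lambda>. \<forall>h. \<not> N (ray G \<tau> k) \<sigma> h" using finL by (intro eventually_ball_finite) auto
    moreover have "\<forall>\<^sub>F k in at_right 0. ray G \<tau> k \<notin> X" using H1[OF y \<tau>] unfolding near_def .
    moreover have uy: "u y = - r / 2"
    proof (rule uC)
      show "y \<notin> X" using y by blast
      fix \<sigma> h show "\<not> N y \<sigma> h" using nA[of \<sigma> h] r unfolding N_def by auto
    qed
    ultimately have "\<forall>\<^sub>F k in at_right 0. (\<forall>\<sigma>\<in>\<Lambda>. \<forall>h. \<not> N (ray G \<tau> k) \<sigma> h) \<and> ray G \<tau> k \<notin> X" by (intro eventually_conj)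
    then show ?thesis unfolding has_slope_def
    proof (rule eventually_mono)
      fix k assume k: "(\<forall>\<sigma>\<in>\<Lambda>. \<forall>h. \<not> N (ray G \<tau> k) \<sigma> h) \<and> ray G \<tau> k \<notin> X"
      then have "\<not> N (ray G \<tau> k) \<sigma> h" for \<sigma> h unfolding N_def by blast
      then have "u (ray G \<tau> k) = - r / 2" using k by (intro uC) blast+
      then show "u (ray G \<tau> k) = u y + of_int 0 * k" using uy by simp
    qed
  qed
  have tanA: "tangents G (ray G (e,t,s) h) = {(e, t + s * h, s), (e, t + s * h, -s)}" "(e, t + s * h, s) \<noteq> (e, t + s * h, -s)"
    if \<tau>: "(e, t, s) \<in> \<Lambda>" and h: "0 < h" "h < r" for e t s h
    using tangents_Inner[OF tangentD(1)[OF \<Lambda>D(2)[OF \<tau>]] inner(2,3)[OF \<tau> h]] inner(1)[OF \<tau> h] tangentD(5)[OF \<Lambda>D(2)[OF \<tau>]] by auto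
  have pl: "pl G u" unfolding pl_def
  proof (intro ballI)
    fix y \<tau> assume y: "y \<in> \<Gamma>" and \<tau>: "\<tau> \<in> tangents G y"
    show "\<exists>m. has_slope G u y \<tau> m"
    proof (cases "y \<in> X")
      case True then show ?thesis using sX[OF True \<tau>] by blast
    next
      case False
      show ?thesis
      proof (cases "\<exists>\<sigma> h. \<sigma> \<in> \<Lambda> \<and> 0 < h \<and> h < r \<and> y = ray G \<sigma> h")
        case True
        then obtain \<sigma>' h where \<sigma>': "\<sigma>' \<in> \<Lambda>" and h: "0 < h" "h < r" and yh': "y = ray G \<sigma>' h" by blast
        obtain e t s where ets: "\<sigma>' = (e, t, s)" by (cases \<sigma>')
        note \<sigma> = \<sigma>'[unfolded ets] and yh = yh'[unfolded ets]
        have "\<tau> = (e, t + s * h, s) \<or> \<tau> = (e, t + s * h, -s)" using \<tau> tanA(1)[OF \<sigma> h] yh by blast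
        then show ?thesis
        proof
          assume "\<tau> = (e, t + s * h, s)"
          then show ?thesis using conjunct1[OF sA[OF \<sigma> h yh]] by (intro exI) simp
        next
          assume "\<tau> = (e, t + s * h, -s)"
          then show ?thesis using conjunct2[OF sA[OF \<sigma> h yh]] by (intro exI) simp
        qed
      next
        case F: False
        have "y \<in> \<Gamma> - X" using y False by blast
        moreover have "y \<noteq> ray G \<sigma> h" if "\<sigma> \<in> \<Lambda>" "0 < h" "h < r" for \<sigma> h using F that by metis
        ultimately have "has_slope G u y \<tau> 0" using sC[OF _ _ \<tau>] by blast
        then show ?thesis by blast
      qed
    qed
  qed
  define W where "W = Max (insert 1 (w ` \<Lambda>))"
  have W: "1 \<le> W" "\<And>\<tau>. \<tau> \<in> \<Lambda> \<Longrightarrow> w \<tau> \<le> W" using finL by (auto simp: W_def)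
  show ?thesis
  \<comment> \<open>Up to this distance no arm, however steep, has passed the level
    \<open>- r / 2\<close>.\<close>
  proof (rule that[OF pl, of "r / 2 / of_int W"])
    show "r / 2 / of_int W > 0" using r W(1) by simp
  next
    fix y \<tau> and h :: real assume y: "y \<in> X" "\<tau> \<in> tangents G y" "near G \<tau> (\<lambda>z. z \<notin> X)" and h: "0 < h" "h < r / 2 / of_int W"
    have \<tau>: "\<tau> \<in> \<Lambda>" using y unfolding \<Lambda>_def by blast
    have "of_int W * h < r / 2" using h W(1) by (simp add: field_simps)
    moreover have "of_int (w \<tau>) * h \<le> of_int W * h" using W(2)[OF \<tau>] h by (intro mult_right_mono) auto
    ultimately have "of_int (w \<tau>) * h < r / 2" by linarith
    then show "u (ray G \<tau> h) = - of_int (w \<tau>) * h" using uA[OF \<tau> h(1)] wr[OF h(1), of \<tau>] r by simp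
  next
    fix y assume "y \<in> X" then show "u y = 0" by (rule uX)
  next
    fix y assume y: "y \<in> \<Gamma> - X"
    show "u y < 0"
    proof (cases "\<exists>\<tau> h. N y \<tau> h")
      case True
      then obtain \<tau> h where N': "\<tau> \<in> \<Lambda>" "0 < h" "h \<le> r / 2" "y = ray G \<tau> h" unfolding N_def by blast
      have N: "\<tau> \<in> \<Lambda>" "0 < h" "h < r" "y = ray G \<tau> h" using N' r by simp_all
      show ?thesis using uA[OF N(1-3)] N(2,4) wr[OF N(2), of \<tau>] r by simp
    next
      case False
      then have "u y = - r / 2" using y by (intro uC) blast+
      then show ?thesis using r by simp
    qed
  next
    fix y assume y: "y \<in> \<Gamma> - X"
    show "0 \<le> ord_at G u y"
    proof (cases "\<exists>\<sigma> h. \<sigma> \<in> \<Lambda> \<and> 0 < h \<and> h < r \<and> y = ray G \<sigma> h")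
      case True
      then obtain \<sigma>' h where \<sigma>': "\<sigma>' \<in> \<Lambda>" and h: "0 < h" "h < r" and yh': "y = ray G \<sigma>' h" by blast
        obtain e t s where ets: "\<sigma>' = (e, t, s)" by (cases \<sigma>')
        note \<sigma> = \<sigma>'[unfolded ets] and yh = yh'[unfolded ets]
      note S = sA[OF \<sigma> h yh]
      note T = tanA[OF \<sigma> h, folded yh]
      have "slope G u (e, t + s * h, s) = (if of_int (w (e,t,s)) * h < r/2 then - w (e,t,s) else 0)"
        using slope_eq[of "(e, t + s * h, s)" G y] S T(1) by blast
      moreover have "slope G u (e, t + s * h, -s) = (if of_int (w (e,t,s)) * h \<le> r/2 then w (e,t,s) else 0)"
        using slope_eq[of "(e, t + s * h, -s)" G y] S T(1) by blast
      ultimately show ?thesis using T(2) w[of "(e,t,s)"] unfolding ord_at_slope T(1) by auto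
    next
      case F: False
      have "slope G u \<tau> = 0" if \<tau>: "\<tau> \<in> tangents G y" for \<tau>
      proof -
        have "y \<noteq> ray G \<sigma> h" if "\<sigma> \<in> \<Lambda>" "0 < h" "h < r" for \<sigma> h using F that by metis
        then have "has_slope G u y \<tau> 0" using sC[OF y _ \<tau>] by blast
        then show ?thesis by (rule slope_eq[OF \<tau>])
      qed
      then show ?thesis unfolding ord_at_slope by simp
    qed
  next
    fix y assume y: "y \<in> X"
    have "slope G u \<tau> = (if near G \<tau> (\<lambda>z. z \<notin> X) then - w \<tau> else 0)" if "\<tau> \<in> tangents G y" for \<tau>
    proof -
      have "\<tau> \<in> \<Lambda> \<longleftrightarrow> near G \<tau> (\<lambda>z. z \<notin> X)"
        unfolding \<Lambda>_def mem_Collect_eq using y that by metis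
      then show ?thesis using slope_eq[OF that sX[OF y that]] by simp
    qed
    then have "ord_at G u y = (\<Sum>\<tau>\<in>tangents G y. if near G \<tau> (\<lambda>z. z \<notin> X) then - w \<tau> else 0)"
      unfolding ord_at_slope by (intro sum.cong) auto
    also have "\<dots> = - (\<Sum>\<tau>\<in>{\<tau>\<in>tangents G y. near G \<tau> (\<lambda>z. z \<notin> X)}. w \<tau>)"
      unfolding sum.inter_filter[OF finite_tangents, symmetric] by (simp add: sum_negf)
    finally show "ord_at G u y = - (\<Sum>\<tau>\<in>{\<tau>\<in>tangents G y. near G \<tau> (\<lambda>z. z \<notin> X)}. w \<tau>)" .
  qed
qed

end

section \<open>Reduced divisors\<close>

context trop_curve
begin

text \<open>Otherwise every direction at \<open>v\<close> has, arbitrarily close to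
  \<open>v\<close>, a point off the open arc. Such points bound a star-shaped neighbourhood of
  \<open>v\<close> that the arc can leave only through them; yet it has to reach \<open>y1\<close>,
  which the arms are too short to contain. This contradicts connectedness of the arc.\<close>

lemma embedded_arc_covers_arm:
  assumes \<gamma>: "embedding_map (top_of_set {0..1::real}) T \<gamma>" and v: "\<gamma> 0 = v"
  shows "\<exists>\<tau>\<in>tangents G v. near G \<tau> (\<lambda>y. y \<in> \<gamma> ` {0<..<1})"
proof (rule ccontr)
  assume n: "\<not> ?thesis"
  have hm: "homeomorphic_map (top_of_set {0..1}) (subtopology T (\<gamma> ` {0..1})) \<gamma>"
    using \<gamma> by (simp add: embedding_map_def)
  have inj: "inj_on \<gamma> {0..1}" using homeomorphic_imp_injective_map[OF hm] by simp
  have cont: "continuous_map (top_of_set {0..1}) T \<gamma>"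
    using homeomorphic_imp_continuous_map[OF hm] by (simp add: continuous_map_in_subtopology)
  have in\<Gamma>: "\<gamma> s \<in> \<Gamma>" if "s \<in> {0..1}" for s
    using continuous_map_image_subset_topspace[OF cont] that by auto
  define y1 where "y1 = \<gamma> (1/2)"
  have y1: "y1 \<noteq> v" using inj_onD[OF inj, of "1/2" 0] v by (auto simp: y1_def)
  have v\<Gamma>: "v \<in> \<Gamma>" using in\<Gamma>[of 0] v by simp
  have ex: "\<exists>k>0. k \<le> (case \<tau> of (e, t, s) \<Rightarrow> if s = 1 then len G e - t else t) \<and> ray G \<tau> k \<notin> \<gamma> ` {0<..<1} \<and> (\<forall>h. 0 < h \<and> h \<le> k \<longrightarrow> ray G \<tau> h \<noteq> y1)"
    if \<tau>0: "\<tau> \<in> tangents G v" for \<tau>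
  proof -
    obtain e t s where \<tau>: "\<tau> = (e, t, s)" by (cases \<tau>)
    obtain R where R: "R > 0" "R = (if s = 1 then len G e - t else t)"
      using arm_length[OF \<tau>0[unfolded \<tau>]] by metis
    obtain q where q: "q > 0" "\<And>h. 0 < h \<Longrightarrow> h < q \<Longrightarrow> ray G \<tau> h \<notin> {y1}"
      using near_notin_finite[OF \<tau>0, of "{y1}"] unfolding near_iff by blast
    have "\<not> near G \<tau> (\<lambda>y. y \<in> \<gamma> ` {0<..<1})" using n \<tau>0 by blast
    then have "\<exists>h. 0 < h \<and> h < min R q \<and> ray G \<tau> h \<notin> \<gamma> ` {0<..<1}"
      unfolding near_iff using R(1) q(1) by (metis min_less_iff_conj)
    then obtain k where k: "0 < k" "k < min R q" "ray G \<tau> k \<notin> \<gamma> ` {0<..<1}" by blast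
    show ?thesis
    proof (intro exI[of _ k] conjI allI impI)
      show "k \<le> (case \<tau> of (e, t, s) \<Rightarrow> if s = 1 then len G e - t else t)" using k(2) R(2) \<tau> by simp
      fix h assume "0 < h \<and> h \<le> k"
      then show "ray G \<tau> h \<noteq> y1" using q(2)[of h] k(2) by simp
    qed (use k in simp_all)
  qed
  then have "\<forall>\<tau>\<in>tangents G v. \<exists>k. k > 0 \<and> k \<le> (case \<tau> of (e, t, s) \<Rightarrow> if s = 1 then len G e - t else t) \<and> ray G \<tau> k \<notin> \<gamma> ` {0<..<1} \<and> (\<forall>h. 0 < h \<and> h \<le> k \<longrightarrow> ray G \<tau> h \<noteq> y1)"
    by blast
  from bchoice[OF this] obtain k where k: "\<And>\<tau>. \<tau> \<in> tangents G v \<Longrightarrow> k \<tau> > 0"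
    "\<And>\<tau>. \<tau> \<in> tangents G v \<Longrightarrow> k \<tau> \<le> (case \<tau> of (e, t, s) \<Rightarrow> if s = 1 then len G e - t else t)"
    "\<And>\<tau>. \<tau> \<in> tangents G v \<Longrightarrow> ray G \<tau> (k \<tau>) \<notin> \<gamma> ` {0<..<1}"
    "\<And>\<tau> h. \<tau> \<in> tangents G v \<Longrightarrow> 0 < h \<Longrightarrow> h \<le> k \<tau> \<Longrightarrow> ray G \<tau> h \<noteq> y1"
    by blast
  define N where "N = insert v (\<Union>\<tau>\<in>tangents G v. ray G \<tau> ` {0<..<k \<tau>})"
  define cN where "cN = insert v (\<Union>\<tau>\<in>tangents G v. ray G \<tau> ` {0..k \<tau>})"
  have oA: "openin T (ray G \<tau> ` {0<..<k \<tau>})" "closedin T (ray G \<tau> ` {0..k \<tau>})" if "\<tau> \<in> tangents G v" for \<tau>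
  proof -
    obtain e t s where \<tau>: "\<tau> = (e, t, s)" by (cases \<tau>)
    have kk: "k \<tau> \<le> (if s = 1 then len G e - t else t)" using k(2)[OF that] \<tau> by simp
    show "openin T (ray G \<tau> ` {0<..<k \<tau>})" "closedin T (ray G \<tau> ` {0..k \<tau>})"
      by (rule openin_arm[OF that \<tau> kk order_refl], rule closedin_arm[OF that \<tau> kk order_refl])
  qed
  have "openin T N" unfolding openin_T_iff
  proof (intro conjI ballI)
    show "N \<subseteq> \<Gamma>" using v\<Gamma> ray_in by (auto simp: N_def)
    fix x \<tau> assume x: "x \<in> N" and \<tau>: "\<tau> \<in> tangents G x"
    show "near G \<tau> (\<lambda>y. y \<in> N)"
    proof (cases "x = v")
      case True
      then have \<tau>v: "\<tau> \<in> tangents G v" using \<tau> by simp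
      have "\<forall>h. 0 < h \<and> h < k \<tau> \<longrightarrow> ray G \<tau> h \<in> N"
      proof (intro allI impI)
        fix h assume "0 < h \<and> h < k \<tau>"
        then have "ray G \<tau> h \<in> ray G \<tau> ` {0<..<k \<tau>}" by simp
        then show "ray G \<tau> h \<in> N" unfolding N_def using \<tau>v by blast
      qed
      then show ?thesis unfolding near_iff using k(1) \<tau> True by blast
    next
      case False
      then obtain \<sigma> where \<sigma>: "\<sigma> \<in> tangents G v" "x \<in> ray G \<sigma> ` {0<..<k \<sigma>}" using x by (auto simp: N_def)
      then have "near G \<tau> (\<lambda>y. y \<in> ray G \<sigma> ` {0<..<k \<sigma>})" using oA(1)[OF \<sigma>(1)] \<tau> unfolding openin_T_iff by blast
      then show ?thesis by (rule near_mono) (use \<sigma>(1) in \<open>auto simp: N_def\<close>)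
    qed
  qed
  moreover have "closedin T cN"
  proof -
    have "closedin T {v}" using closedin_T_iff[of "{v}"] v\<Gamma> near_notin_finite[of _ _ "{v}"] by simp
    moreover have "closedin T (\<Union>\<tau>\<in>tangents G v. ray G \<tau> ` {0..k \<tau>})"
      using finite_tangents oA(2) by (intro closedin_Union) auto
    ultimately show ?thesis unfolding cN_def using closedin_Un by fastforce
  qed
  then have "openin T (\<Gamma> - cN)" by (simp add: closedin_def)
  moreover have con: "connectedin T (\<gamma> ` {0..<1})"
    by (rule connectedin_continuous_map_image[OF cont]) (auto simp: connectedin_subtopology)
  moreover have "\<gamma> ` {0..<1} \<subseteq> N \<union> (\<Gamma> - cN)"
  proof (rule image_subsetI)
    fix s assume s: "s \<in> {0..<1::real}"
    show "\<gamma> s \<in> N \<union> (\<Gamma> - cN)"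
    proof (cases "\<gamma> s \<in> cN \<and> \<gamma> s \<noteq> v")
      case True
      then obtain \<tau> h where \<tau>: "\<tau> \<in> tangents G v" "h \<in> {0..k \<tau>}" "\<gamma> s = ray G \<tau> h" by (auto simp: cN_def)
      have "h \<noteq> 0" using True \<tau> ray_0[OF \<tau>(1)] by auto
      have "s \<noteq> 0" using True v by auto
      then have "\<gamma> s \<in> \<gamma> ` {0<..<1}" using s by auto
      then have "h \<noteq> k \<tau>" using k(3)[OF \<tau>(1)] \<tau>(3) by auto
      then have "h \<in> {0<..<k \<tau>}" using \<tau>(2) \<open>h \<noteq> 0\<close> by auto
      then show ?thesis using \<tau>(1,3) unfolding N_def by blast
    next
      case False
      then show ?thesis using in\<Gamma>[of s] s by (auto simp: N_def)
    qed
  qed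
  moreover have "N \<inter> (\<Gamma> - cN) \<inter> \<gamma> ` {0..<1} = {}"
  proof -
    have "N \<subseteq> cN" unfolding N_def cN_def by fastforce
    then show ?thesis by blast
  qed
  moreover have "N \<inter> \<gamma> ` {0..<1} \<noteq> {}"
  proof -
    have "v \<in> \<gamma> ` {0..<1}" using v by (intro image_eqI[of _ _ 0]) auto
    then show ?thesis by (auto simp: N_def)
  qed
  moreover have "y1 \<in> (\<Gamma> - cN) \<inter> \<gamma> ` {0..<1}"
  proof -
    have "y1 \<notin> cN"
    proof
      assume "y1 \<in> cN"
      then obtain \<tau> h where \<tau>: "\<tau> \<in> tangents G v" "h \<in> {0..k \<tau>}" "y1 = ray G \<tau> h" using y1 by (auto simp: cN_def)
      then have "h = 0" using k(4)[OF \<tau>(1), of h] by (cases "h = 0") auto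
      then show False using \<tau>(3) ray_0[OF \<tau>(1)] y1 by simp
    qed
    then show ?thesis using in\<Gamma>[of "1/2"] by (auto simp: y1_def)
  qed
  ultimately show False unfolding connectedin by blast
qed

text \<open>A continuous left inverse on the whole curve makes the segment an embedding. It is a
  tent function that rises up to distance \<open>\<rho>\<close> and returns to \<open>0\<close> at
  \<open>2 * \<rho>\<close>; the factor \<open>2\<close> leaves room for this on the same edge, so
  that extending by \<open>0\<close> is continuous.\<close>

lemma straight_arm_embedding:
  assumes \<tau>0: "\<tau> \<in> tangents G v" and R: "\<tau> = (e, t, s)" "2 * \<rho> \<le> (if s = 1 then len G e - t else t)" and \<rho>: "0 < \<rho>"
  shows "embedding_map (top_of_set {0..1}) T (\<lambda>x. ray G \<tau> (x * \<rho>))"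
proof (rule section_imp_embedding_map)
  note \<tau>' = \<tau>0[unfolded R]
  note D = tangentD[OF \<tau>']
  define tent where "tent x = max 0 (min (x / \<rho>) (2 - x / \<rho>))" for x
  define g where "g y = (case y of Vertex _ \<Rightarrow> 0 | Inner e' u \<Rightarrow> if e' = e then tent (s * (u - t)) else 0)" for y
  have tent01: "tent x \<in> {0..1}" for x using \<rho> by (auto simp: tent_def field_simps min_def)
  have tent0: "tent x = 0" if "x \<le> 0 \<or> 2 * \<rho> \<le> x" for x
    using that \<rho> by (auto simp: tent_def field_simps min_def)
  have ge: "g (edge_point G e' u) = (if e' = e then tent (s * (u - t)) else 0)" if "e' \<in> edges G" "u \<in> {0..len G e'}" for e' u
  proof -
    have "u = 0 \<or> u = len G e' \<or> 0 < u \<and> u < len G e'" using that(2) by auto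
    then consider "u = 0" | "u = len G e'" | "0 < u" "u < len G e'" by blast
    then show ?thesis
    proof cases
      case 1
      then have "e' = e \<Longrightarrow> tent (s * (u - t)) = 0" using R(2) D(2,3,5) by (intro tent0) (auto split: if_splits)
      then show ?thesis using 1 that(1) by (simp add: g_def)
    next
      case 2
      then have "e' = e \<Longrightarrow> tent (s * (u - t)) = 0" using R(2) D(2,3,5) by (intro tent0) (auto split: if_splits)
      then show ?thesis using 2 that(1) by (simp add: g_def)
    next
      case 3
      then show ?thesis using that(1) by (simp add: g_def)
    qed
  qed
  have "continuous_map T euclideanreal g" unfolding continuous_map_T_edges
  proof
    fix e' assume e': "e' \<in> edges G"
    have "continuous_on {0..len G e'} (\<lambda>u. if e' = e then tent (s * (u - t)) else 0)"
      unfolding tent_def using \<rho> by (cases "e' = e") (auto intro!: continuous_intros)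
    then show "continuous_on {0..len G e'} (\<lambda>u. g (edge_point G e' u))"
      by (rule continuous_on_eq) (simp add: ge[OF e'])
  qed
  moreover have "g y \<in> {0..1}" for y using tent01 by (auto simp: g_def split: point.split)
  ultimately have g: "continuous_map T (top_of_set {0..1}) g"
    unfolding continuous_map_in_subtopology by blast
  have le: "\<rho> \<le> (if s = 1 then len G e - t else t)" using R(2) \<rho> by (auto split: if_splits)
  have uin: "t + s * (x * \<rho>) \<in> {0..len G e}" if "x \<in> {0..1}" for x
  proof -
    have "0 \<le> x * \<rho>" "x * \<rho> \<le> 1 * \<rho>" using that \<rho> by (auto intro: mult_right_mono)
    then show ?thesis using le D(2,3,5) by (auto split: if_splits)
  qed
  have f: "continuous_map (top_of_set {0..1}) T (\<lambda>x. ray G \<tau> (x * \<rho>))"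
  proof -
    have "continuous_map (top_of_set {0..1}) (top_of_set {0..len G e}) (\<lambda>x. t + s * (x * \<rho>))"
      unfolding continuous_map_in_subtopology using uin by (auto intro!: continuous_intros)
    from continuous_map_compose[OF this continuous_edge_point[OF D(1)]]
    show ?thesis by (simp add: ray_def R(1) o_def)
  qed
  have "g (ray G \<tau> (x * \<rho>)) = x" if x: "x \<in> {0..1}" for x
  proof -
    have "s * (s * (x * \<rho>)) = x * \<rho>" using D(5) by auto
    moreover have "tent (x * \<rho>) = x" using x \<rho> by (auto simp: tent_def)
    ultimately show ?thesis using ge[OF D(1) uin[OF x]] D(5) by (auto simp: ray_def R(1))
  qed
  then show "section_map (top_of_set {0..1}) T (\<lambda>x. ray G \<tau> (x * \<rho>))"
    unfolding section_map_def retraction_maps_def using f g by auto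
qed

text \<open>An arc leaving \<open>X\<close> covers the germ of a direction, and internally disjoint
  arcs cover different ones; conversely, short straight segments in all leaving directions form an
  admissible family.\<close>

lemma outdeg_eq:
  assumes X: "X \<subseteq> \<Gamma>" and v: "v \<in> \<Gamma>"
  shows "outdeg G X v = card {\<tau> \<in> tangents G v. near G \<tau> (\<lambda>y. y \<notin> X)}"
proof -
  define L where "L = {\<tau> \<in> tangents G v. near G \<tau> (\<lambda>y. y \<notin> X)}"
  have finL: "finite L" unfolding L_def using finite_tangents by simp
  define ok where "ok n \<gamma> \<longleftrightarrow> (\<forall>i<n. embedding_map (top_of_set {0..1}) T (\<gamma> i) \<and> \<gamma> i 0 = v \<and>
            \<gamma> i ` {0..1} \<subseteq> \<Gamma> - (X - {v})) \<and>
     (\<forall>i<n. \<forall>j<n. i \<noteq> j \<longrightarrow> \<gamma> i ` {0<..<1} \<inter> \<gamma> j ` {0<..<1} = {})" for n :: nat and \<gamma> :: "nat \<Rightarrow> real \<Rightarrow> 'v point"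
  have le: "n \<le> card L" if "ok n \<gamma>" for n \<gamma>
  proof -
    have "\<forall>i\<in>{..<n}. \<exists>\<tau>. \<tau> \<in> tangents G v \<and> near G \<tau> (\<lambda>y. y \<in> \<gamma> i ` {0<..<1})"
    proof
      fix i assume "i \<in> {..<n}"
      then have "embedding_map (top_of_set {0..1}) T (\<gamma> i) \<and> \<gamma> i 0 = v" using that unfolding ok_def by simp
      then show "\<exists>\<tau>. \<tau> \<in> tangents G v \<and> near G \<tau> (\<lambda>y. y \<in> \<gamma> i ` {0<..<1})"
        using embedded_arc_covers_arm[of "\<gamma> i" v] by blast
    qed
    from bchoice[OF this] obtain \<tau> where \<tau>0: "\<forall>i\<in>{..<n}. \<tau> i \<in> tangents G v \<and> near G (\<tau> i) (\<lambda>y. y \<in> \<gamma> i ` {0<..<1})" ..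
    have \<tau>: "\<tau> i \<in> tangents G v" "near G (\<tau> i) (\<lambda>y. y \<in> \<gamma> i ` {0<..<1})" if "i < n" for i
      using bspec[OF \<tau>0, of i] that by blast+
    have "inj_on \<tau> {..<n}"
    proof (rule inj_onI, rule ccontr)
      fix i j assume ij: "i \<in> {..<n}" "j \<in> {..<n}" "\<tau> i = \<tau> j" "i \<noteq> j"
      then have "near G (\<tau> i) (\<lambda>y. y \<in> \<gamma> i ` {0<..<1} \<and> y \<in> \<gamma> j ` {0<..<1})"
        using \<tau>(2)[of i] \<tau>(2)[of j] by (intro near_conj) auto
      from near_ex[OF this] obtain y where "y \<in> \<gamma> i ` {0<..<1} \<and> y \<in> \<gamma> j ` {0<..<1}" ..
      moreover have "\<gamma> i ` {0<..<1} \<inter> \<gamma> j ` {0<..<1} = {}" using that ij unfolding ok_def by blast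
      ultimately show False by blast
    qed
    moreover have "\<tau> ` {..<n} \<subseteq> L"
    proof (rule image_subsetI)
      fix i assume "i \<in> {..<n}"
      then have i: "i < n" by simp
      have em: "embedding_map (top_of_set {0..1}) T (\<gamma> i)" "\<gamma> i 0 = v" "\<gamma> i ` {0..1} \<subseteq> \<Gamma> - (X - {v})" using that i unfolding ok_def by blast+
      have inj: "inj_on (\<gamma> i) {0..1}" using homeomorphic_imp_injective_map em(1) unfolding embedding_map_def by fastforce
      have "near G (\<tau> i) (\<lambda>y. y \<notin> X)"
      proof (rule near_mono[OF \<tau>(2)[OF i]])
        fix y assume "y \<in> \<gamma> i ` {0<..<1}"
        then obtain s where s: "0 < s" "s < 1" "y = \<gamma> i s" by auto
        then have "y \<noteq> v" using inj_onD[OF inj, of s 0] em(2) by auto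
        moreover have "y \<in> \<gamma> i ` {0..1}" using s by auto
        ultimately show "y \<notin> X" using em(3) by blast
      qed
      then show "\<tau> i \<in> L" using \<tau>(1)[OF i] by (simp add: L_def)
    qed
    ultimately show ?thesis using card_inj_on_le[OF _ _ finL] by fastforce
  qed
  have ge: "\<exists>\<gamma>. ok (card L) \<gamma>"
  proof -
    obtain b where b: "bij_betw b {0..<card L} L" using ex_bij_betw_nat_finite[OF finL] by blast
    have bL: "b i \<in> L" if "i < card L" for i using b that by (auto simp: bij_betw_def)
    have "\<forall>\<tau>\<in>L. \<exists>\<rho>. \<rho> > 0 \<and> 2 * \<rho> \<le> (case \<tau> of (e, t, s) \<Rightarrow> if s = 1 then len G e - t else t) \<and> (\<forall>h. 0 < h \<and> h \<le> \<rho> \<longrightarrow> ray G \<tau> h \<notin> X)"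
    proof
      fix \<tau> assume \<tau>L: "\<tau> \<in> L"
      obtain e t s where \<tau>: "\<tau> = (e, t, s)" by (cases \<tau>)
      have \<tau>0: "\<tau> \<in> tangents G v" and "near G \<tau> (\<lambda>y. y \<notin> X)" using \<tau>L by (auto simp: L_def)
      then obtain q where q: "q > 0" "\<And>h. 0 < h \<Longrightarrow> h < q \<Longrightarrow> ray G \<tau> h \<notin> X" unfolding near_iff by blast
      obtain R where R: "R > 0" "R = (if s = 1 then len G e - t else t)"
        using arm_length[OF \<tau>0[unfolded \<tau>]] by metis
      show "\<exists>\<rho>. \<rho> > 0 \<and> 2 * \<rho> \<le> (case \<tau> of (e, t, s) \<Rightarrow> if s = 1 then len G e - t else t) \<and> (\<forall>h. 0 < h \<and> h \<le> \<rho> \<longrightarrow> ray G \<tau> h \<notin> X)"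
      proof (intro exI[of _ "min R q / 2"] conjI allI impI)
        show "2 * (min R q / 2) \<le> (case \<tau> of (e, t, s) \<Rightarrow> if s = 1 then len G e - t else t)" using R(2) \<tau> by simp
        fix h assume "0 < h \<and> h \<le> min R q / 2"
        then show "ray G \<tau> h \<notin> X" using q(2)[of h] R(1) q(1) by simp
      qed (use R(1) q(1) in simp)
    qed
    from bchoice[OF this] obtain \<rho> where \<rho>: "\<And>\<tau>. \<tau> \<in> L \<Longrightarrow> \<rho> \<tau> > 0" "\<And>\<tau>. \<tau> \<in> L \<Longrightarrow> 2 * \<rho> \<tau> \<le> (case \<tau> of (e, t, s) \<Rightarrow> if s = 1 then len G e - t else t)"
      "\<And>\<tau> h. \<tau> \<in> L \<Longrightarrow> 0 < h \<Longrightarrow> h \<le> \<rho> \<tau> \<Longrightarrow> ray G \<tau> h \<notin> X"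
      by blast
    have LT: "\<tau> \<in> tangents G v" if "\<tau> \<in> L" for \<tau> using that by (simp add: L_def)
    define \<gamma> where "\<gamma> i x = ray G (b i) (x * \<rho> (b i))" for i and x :: real
    have pos: "0 < x * \<rho> \<tau>" "x * \<rho> \<tau> \<le> \<rho> \<tau>" if "0 < x" "x \<le> 1" "\<tau> \<in> L" for x \<tau>
      using that \<rho>(1)[OF that(3)] mult_right_mono[of x 1 "\<rho> \<tau>"] by auto
    have A: "embedding_map (top_of_set {0..1}) T (\<gamma> i) \<and> \<gamma> i 0 = v \<and> \<gamma> i ` {0..1} \<subseteq> \<Gamma> - (X - {v})" if i: "i < card L" for i
    proof (intro conjI)
      obtain e t s where \<tau>: "b i = (e, t, s)" by (cases "b i")
      have "2 * \<rho> (b i) \<le> (if s = 1 then len G e - t else t)" using \<rho>(2)[OF bL[OF i]] \<tau> by simp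
      from straight_arm_embedding[OF LT[OF bL[OF i]] \<tau> this \<rho>(1)[OF bL[OF i]]]
      show "embedding_map (top_of_set {0..1}) T (\<gamma> i)" unfolding \<gamma>_def .
      show "\<gamma> i 0 = v" using ray_0[OF LT[OF bL[OF i]]] by (simp add: \<gamma>_def)
      show "\<gamma> i ` {0..1} \<subseteq> \<Gamma> - (X - {v})"
      proof (rule image_subsetI)
        fix x :: real assume x: "x \<in> {0..1}"
        show "\<gamma> i x \<in> \<Gamma> - (X - {v})"
        proof (cases "x = 0")
          case True then show ?thesis using \<open>\<gamma> i 0 = v\<close> v by simp
        next
          case False
          then show ?thesis using \<rho>(3)[OF bL[OF i] pos[OF _ _ bL[OF i], of x]] x ray_in[OF LT[OF bL[OF i]]] by (simp add: \<gamma>_def)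
        qed
      qed
    qed
    have B: "\<gamma> i ` {0<..<1} \<inter> \<gamma> j ` {0<..<1} = {}" if ij: "i < card L" "j < card L" "i \<noteq> j" for i j
    proof (rule equals0I)
      fix y assume "y \<in> \<gamma> i ` {0<..<1} \<inter> \<gamma> j ` {0<..<1}"
      then obtain x x' where x: "0 < x" "x < 1" "y = \<gamma> i x" "0 < x'" "x' < 1" "y = \<gamma> j x'" by auto
      obtain e t s where \<tau>: "b i = (e, t, s)" by (cases "b i")
      obtain e' t' s' where \<tau>': "b j = (e', t', s')" by (cases "b j")
      have ne: "b i \<noteq> b j" using b ij by (auto simp: bij_betw_def inj_on_def)
      note T1 = LT[OF bL[OF ij(1)], unfolded \<tau>] and T2 = LT[OF bL[OF ij(2)], unfolded \<tau>']
      note D1 = tangentD[OF T1] and D2 = tangentD[OF T2]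
      define h h' where "h = x * \<rho> (b i)" and "h' = x' * \<rho> (b j)"
      have h: "0 < h" "h \<le> \<rho> (b i)" using pos[of x, OF _ _ bL[OF ij(1)]] x by (auto simp: h_def)
      have h': "0 < h'" "h' \<le> \<rho> (b j)" using pos[of x', OF _ _ bL[OF ij(2)]] x by (auto simp: h'_def)
      obtain R where R: "R = (if s = 1 then len G e - t else t)" "\<And>h. 0 < h \<Longrightarrow> h < R \<Longrightarrow> ray G (e, t, s) h = Inner e (t + s * h)"
        using arm_length[OF T1] by metis
      obtain R' where R': "R' = (if s' = 1 then len G e' - t' else t')" "\<And>h. 0 < h \<Longrightarrow> h < R' \<Longrightarrow> ray G (e', t', s') h = Inner e' (t' + s' * h)"
        using arm_length[OF T2] by metis
      have "2 * \<rho> (b i) \<le> R" "2 * \<rho> (b j) \<le> R'" using \<rho>(2)[OF bL[OF ij(1)]] \<rho>(2)[OF bL[OF ij(2)]] R R' \<tau> \<tau>' by auto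
      then have hR: "h < R" "h' < R'" using h h' \<rho>(1)[OF bL[OF ij(1)]] \<rho>(1)[OF bL[OF ij(2)]] by auto
      have "y = ray G (b i) h" "y = ray G (b j) h'" using x(3,6) by (simp_all add: \<gamma>_def h_def h'_def)
      then have "Inner e (t + s * h) = Inner e' (t' + s' * h')"
        using R(2)[OF h(1) hR(1)] R'(2)[OF h'(1) hR(2)] unfolding \<tau> \<tau>' by simp
      then have ee: "e = e'" "t + s * h = t' + s' * h'" by auto
      have "t = t'" using edge_point_inj[OF D1(1), of t t'] D1 D2 ee(1) by simp
      then have "s * h = s' * h'" using ee by simp
      then have "s = s'" using h(1) h'(1) by (cases "s = 1"; cases "s' = 1") (use D1(5) D2(5) in simp_all)
      then show False using ne \<tau> \<tau>' ee(1) \<open>t = t'\<close> by simp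
    qed
    have "ok (card L) \<gamma>" unfolding ok_def by (intro conjI allI impI) (simp_all add: A B)
    then show ?thesis by blast
  qed
  have "outdeg G X v = Max {n. \<exists>\<gamma>. ok n \<gamma>}" unfolding outdeg_def ok_def ..
  also have "\<dots> = card L"
  proof (rule Max_eqI)
    show "finite {n. \<exists>\<gamma>. ok n \<gamma>}" by (rule finite_subset[of _ "{..card L}"]) (use le in auto)
  qed (use le ge in blast)+
  finally show ?thesis by (simp add: L_def)
qed

section \<open>The maximum principle\<close>

lemma frontier_iff:
  assumes X: "closedin T X"
  shows "v \<in> T frontier_of X \<longleftrightarrow> v \<in> X \<and> v \<notin> T interior_of X"
  using X unfolding frontier_of_def by (metis Diff_iff closure_of_eq)

lemma leaving_frontier:
  assumes X: "closedin T X" and v: "v \<in> X" and \<tau>: "\<tau> \<in> tangents G v" "near G \<tau> (\<lambda>y. y \<notin> X)"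
  shows "v \<in> T frontier_of X"
proof -
  have "v \<notin> T interior_of X"
  proof
    assume "v \<in> T interior_of X"
    then have "near G \<tau> (\<lambda>y. y \<in> T interior_of X)" using openin_interior_of[of T X] \<tau>(1) unfolding openin_T_iff by blast
    then have "near G \<tau> (\<lambda>y. y \<in> X)" by (rule near_mono) (use interior_of_subset in fast)
    from near_conj[OF this \<tau>(2)] have "near G \<tau> (\<lambda>y. False)" by (rule near_mono) blast
    then show False using near_False by metis
  qed
  with v show ?thesis unfolding frontier_iff[OF X] by blast
qed

lemma slope_le_max:
  assumes u: "pl G u" and x: "x \<in> \<Gamma>" and mx: "\<And>y. y \<in> \<Gamma> \<Longrightarrow> u y \<le> u x" and \<tau>: "\<tau> \<in> tangents G x"
  shows "slope G u \<tau> \<le> 0"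
proof -
  have "\<forall>\<^sub>F h in at_right 0. u (ray G \<tau> h) \<le> u x + 0 * h" using mx ray_in[OF \<tau>] by simp
  from has_slope_tangent_le[OF pl_slope[OF u x \<tau>] this] show ?thesis by simp
qed

text \<open>The connected component of the maximum set of \<open>u\<close> violates reducedness unless it contains \<open>P\<close>.\<close>

lemma reduced_max:
  assumes red: "is_reduced G P E" and u: "pl G u" and eff: "\<And>x. x \<in> \<Gamma> - {P} \<Longrightarrow> 0 \<le> E x + ord_at G u x"
    and y: "y \<in> \<Gamma>"
  shows "u y \<le> u P"
proof -
  obtain y0 where y0: "y0 \<in> \<Gamma>" "\<And>y. y \<in> \<Gamma> \<Longrightarrow> u y \<le> u y0" using attains_max[OF pl_continuous[OF u]] by blast
  define M where "M = {y \<in> \<Gamma>. u y = u y0}"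
  have cM: "closedin T M"
    using closedin_continuous_map_preimage[OF pl_continuous[OF u], of "{u y0}"] by (simp add: M_def)
  define X where "X = connected_component_of_set (subtopology T M) y0"
  have XM: "X \<subseteq> M" using connected_component_of_subset_topspace[of "subtopology T M" y0] by (auto simp: X_def)
  have cX: "closedin T X" unfolding X_def by (rule closedin_trans_full[OF closedin_connected_component_of cM])
  have conX: "connectedin T X" using connectedin_connected_component_of[of "subtopology T M" y0]
    by (simp add: X_def connectedin_subtopology)
  have "y0 \<in> X" unfolding X_def using y0(1) by (simp add: connected_component_of_refl M_def)
  have X\<Gamma>: "X \<subseteq> \<Gamma>" using XM by (auto simp: M_def)
  have "P \<in> X"
  proof (rule ccontr)
    assume P: "P \<notin> X"
    then obtain v where v: "v \<in> T frontier_of X" "E v < int (outdeg G X v)"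
      using red cX conX \<open>y0 \<in> X\<close> unfolding is_reduced_def by blast
    have vX: "v \<in> X" using v(1) unfolding frontier_iff[OF cX] by blast
    have vM: "u v = u y0" "v \<in> \<Gamma>" using vX XM by (auto simp: M_def)
    have le0: "slope G u \<tau> \<le> 0" if "\<tau> \<in> tangents G v" for \<tau>
      using slope_le_max[OF u vM(2) _ that] y0(2) vM(1) by simp
    \<comment> \<open>With slope \<open>0\<close> the function would stay at its maximum along a
      short arm, which would then belong to the component; so a direction leaving \<open>X\<close>
      has a negative integer slope.\<close>
    have le1: "slope G u \<tau> \<le> -1" if \<tau>0: "\<tau> \<in> tangents G v" and nr: "near G \<tau> (\<lambda>y. y \<notin> X)" for \<tau>
    proof (rule ccontr)
      assume "\<not> slope G u \<tau> \<le> -1"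
      then have "slope G u \<tau> = 0" using le0[OF \<tau>0] by linarith
      then have "has_slope G u v \<tau> 0" using pl_slope[OF u vM(2) \<tau>0] by simp
      then obtain r where r: "r > 0" "\<And>h. 0 < h \<Longrightarrow> h < r \<Longrightarrow> u (ray G \<tau> h) = u v"
        unfolding has_slope_def eventually_at_right_0 by auto
      obtain e t s where \<tau>: "\<tau> = (e, t, s)" by (cases \<tau>)
      obtain R where R: "R > 0" "R = (if s = 1 then len G e - t else t)"
        using arm_length[OF \<tau>0[unfolded \<tau>]] by metis
      define b where "b = min R (r/2)"
      have b: "b > 0" "b < r" "b \<le> (if s = 1 then len G e - t else t)" using R r by (auto simp: b_def)
      let ?A = "ray G \<tau> ` {0..b}"
      have "connectedin T ?A" by (rule connectedin_arm[OF \<tau>0 \<tau> b(3) order_refl])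
      moreover have vA: "v \<in> ?A" using ray_0[OF \<tau>0] b(1) by (intro image_eqI[of _ _ 0]) auto
      moreover have "?A \<subseteq> M"
      proof (rule image_subsetI)
        fix h assume "h \<in> {0..b}"
        then show "ray G \<tau> h \<in> M" using r(2)[of h] b(2) ray_in[OF \<tau>0, of h] ray_0[OF \<tau>0] vM by (cases "h = 0") (auto simp: M_def)
      qed
      ultimately have "connectedin (subtopology T M) (X \<union> ?A)"
        using conX XM vX unfolding connectedin_subtopology by (intro conjI connectedin_Un) auto
      from connected_component_of_maximal[OF this, of y0] have "X \<union> ?A \<subseteq> X" using \<open>y0 \<in> X\<close> unfolding X_def by blast
      then have "\<forall>h. 0 < h \<and> h < b \<longrightarrow> ray G \<tau> h \<in> X" by auto
      then have "near G \<tau> (\<lambda>y. y \<in> X)" unfolding near_iff using b(1) by blast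
      from near_conj[OF this nr] have "near G \<tau> (\<lambda>y. False)" by (rule near_mono) blast
      then show False using near_False by metis
    qed
    have "ord_at G u v \<le> (\<Sum>\<tau>\<in>tangents G v. if near G \<tau> (\<lambda>y. y \<notin> X) then -1 else 0)"
      unfolding ord_at_slope using le0 le1 by (intro sum_mono) auto
    also have "\<dots> = - int (outdeg G X v)"
      unfolding outdeg_eq[OF X\<Gamma> vM(2)] sum.inter_filter[OF finite_tangents, symmetric] by simp
    finally have "E v + ord_at G u v < 0" using v(2) by linarith
    moreover have "v \<noteq> P" using P vX by blast
    ultimately show False using eff[of v] vM(2) by simp
  qed
  then have "u P = u y0" using XM by (auto simp: M_def)
  then show ?thesis using y0(2)[OF y] by simp
qed

text \<open>The difference has order zero everywhere. At a maximum all its slopes are nonpositive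
  with sum zero, hence zero; the set of maximum points is thus open as well as closed.\<close>

lemma const_of_ord_eq:
  assumes f: "pl G f" and g: "pl G g" and eq: "\<And>x. ord_at G f x = ord_at G g x"
  obtains c where "\<And>x. x \<in> \<Gamma> \<Longrightarrow> f x = g x + c"
proof -
  define u where "u y = f y - g y" for y
  have u: "pl G u" unfolding u_def by (rule pl_diff[OF f g])
  obtain y0 where y0: "y0 \<in> \<Gamma>" "\<And>y. y \<in> \<Gamma> \<Longrightarrow> u y \<le> u y0" using attains_max[OF pl_continuous[OF u]] by blast
  have o: "ord_at G u x = 0" for x unfolding u_def using ord_at_diff[OF f g] eq by simp
  have "u x = u y0" if "x \<in> \<Gamma>" for x
  proof (rule local_constant[of "\<lambda>y. u y = u y0" y0])
    fix x \<tau> assume x: "x \<in> \<Gamma>" and ux: "u x = u y0" and \<tau>: "\<tau> \<in> tangents G x"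
    have le: "slope G u \<sigma> \<le> 0" if "\<sigma> \<in> tangents G x" for \<sigma> using slope_le_max[OF u x _ that] y0(2) ux by simp
    have "(\<Sum>\<sigma>\<in>tangents G x. - slope G u \<sigma>) = 0" using o[of x] by (simp add: ord_at_slope sum_negf)
    then have "- slope G u \<tau> = 0" using sum_nonneg_0[OF finite_tangents _ _ \<tau>, of "\<lambda>\<sigma>. - slope G u \<sigma>"] le by simp
    then have "has_slope G u x \<tau> 0" using pl_slope[OF u x \<tau>] by simp
    then show "near G \<tau> (\<lambda>y. u y = u y0)" unfolding has_slope_def near_def using ux by simp
  next
    fix x \<tau> assume x: "x \<in> \<Gamma>" and ux: "u x \<noteq> u y0" and \<tau>: "\<tau> \<in> tangents G x"
    show "near G \<tau> (\<lambda>y. u y \<noteq> u y0)" unfolding near_def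
      using tendsto_imp_eventually_ne[OF has_slope_tendsto[OF pl_slope[OF u x \<tau>]] ux] .
  qed (use y0(1) that in simp_all)
  then show ?thesis by (intro that[of "u y0"]) (simp add: u_def algebra_simps)
qed

end

section \<open>The supremum as the function of the reduced divisor\<close>

context div_class
begin

lemma finite_supp_ord:
  assumes "pl G f" shows "finite {x. ord_at G f x \<noteq> 0}"
proof -
  have "{x. ord_at G f x \<noteq> 0} \<subseteq> Vertex ` verts G \<union> (\<Union>e\<in>edges G. Inner e ` ord_breaks f e)"
  proof
    fix x assume x: "x \<in> {x. ord_at G f x \<noteq> 0}"
    then have "x \<in> \<Gamma>" using ord_at_off by blast
    then show "x \<in> Vertex ` verts G \<union> (\<Union>e\<in>edges G. Inner e ` ord_breaks f e)"
    proof (cases rule: curve_cases)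
      case (2 e t)
      then have "t \<in> ord_breaks f e" using x by (simp add: ord_breaks_def)
      then show ?thesis using 2 by blast
    qed blast
  qed
  moreover have "finite (Vertex ` verts G \<union> (\<Union>e\<in>edges G. Inner e ` ord_breaks f e))"
    using finite_verts finite_edges ord_breaks(1)[OF assms] by simp
  ultimately show ?thesis by (rule finite_subset)
qed

lemma add_div_divisors:
  assumes "pl G f" shows "add_div G D f \<in> divisors G"
proof -
  have "{x. add_div G D f x \<noteq> 0} \<subseteq> {x. D x \<noteq> 0} \<union> {x. ord_at G f x \<noteq> 0}" by (auto simp: add_div_def)
  then have "finite {x. add_div G D f x \<noteq> 0}" using finite_D finite_supp_ord[OF assms] finite_subset by blast
  moreover have "add_div G D f x = 0" if "x \<notin> \<Gamma>" for x using that by (simp add: add_div_def D_off ord_at_off)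
  ultimately show ?thesis unfolding divisors_def by blast
qed

text \<open>Adding to \<open>rd P\<close> a function that lies below its value at \<open>P\<close> somewhere would contradict maximality.\<close>

lemma fire_contradiction:
  assumes P: "P \<in> \<Gamma>" and u: "pl G u" and eff: "\<And>x. 0 \<le> add_div G D (rd P) x + ord_at G u x" and y: "y \<in> \<Gamma>"
  shows "u y \<le> u P"
proof -
  note r = RR_pl[OF rd_RR[OF P]]
  have "(\<lambda>x\<in>\<Gamma>. rd P x + u x) \<in> RR"
    unfolding RR_iff using eff by (simp add: pl_add[OF r u] ord_at_add[OF r u] add_div_def add.assoc)
  from rd_ge[OF y P this] show ?thesis using y P rd_self[OF P] by simp
qed

text \<open>If \<open>X\<close> violated reducedness, each of its points would carry a chip for
  every leaving direction, and \<open>X\<close> could be fired with weight \<open>1\<close>. The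
  result stays in \<open>RR\<close> but sinks at \<open>P\<close> relative to \<open>X\<close>,
  against \<open>fire_contradiction\<close>.\<close>

lemma rd_reduced:
  assumes P: "P \<in> \<Gamma>" shows "is_reduced G P (add_div G D (rd P))"
  unfolding is_reduced_def
proof (intro conjI ballI allI impI)
  let ?E = "add_div G D (rd P)"
  have E0: "0 \<le> ?E x" for x using rd_RR[OF P] unfolding RR_space_def effective_def by blast
  show "0 \<le> ?E x" for x by (rule E0)
  fix X assume X: "closedin T X \<and> connectedin T X \<and> X \<noteq> {} \<and> P \<notin> X"
  show "\<exists>v\<in>T frontier_of X. ?E v < int (outdeg G X v)"
  proof (rule ccontr)
    assume "\<not> ?thesis"
    then have ge: "\<And>v. v \<in> T frontier_of X \<Longrightarrow> int (outdeg G X v) \<le> ?E v" by force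
    have X\<Gamma>: "X \<subseteq> \<Gamma>" using X closedin_subset by fastforce
    have fire_ok: "int (card {\<tau>\<in>tangents G y. near G \<tau> (\<lambda>z. z \<notin> X)}) \<le> ?E y" if y: "y \<in> X" for y
    proof (cases "{\<tau>\<in>tangents G y. near G \<tau> (\<lambda>z. z \<notin> X)} = {}")
      case True then show ?thesis using E0[of y] unfolding True by simp
    next
      case False
      then have "y \<in> T frontier_of X" using leaving_frontier[of X y] X y by blast
      then show ?thesis using ge[of y] outdeg_eq[OF X\<Gamma>, of y] X\<Gamma> y by auto
    qed
    have H1: "near G \<tau> (\<lambda>z. z \<notin> X)" if "y \<in> \<Gamma> - X" "\<tau> \<in> tangents G y" for y \<tau>
      using X that unfolding closedin_T_iff by blast
    have H2: "near G \<tau> (\<lambda>z. z \<in> X) \<or> near G \<tau> (\<lambda>z. z \<notin> X)" if "y \<in> X" "\<tau> \<in> tangents G y" for y \<tau>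
      using connected_closed_dichotomy X that by blast
    \<comment> \<open>A closed connected set might leave in infinitely many places. Here it cannot,
      because each such place consumes a chip of the divisor.\<close>
    have "{\<tau>. \<exists>y\<in>X. \<tau> \<in> tangents G y \<and> near G \<tau> (\<lambda>z. z \<notin> X)} \<subseteq> (\<Union>y\<in>{y. ?E y \<noteq> 0}. tangents G y)"
    proof
      fix \<tau> assume "\<tau> \<in> {\<tau>. \<exists>y\<in>X. \<tau> \<in> tangents G y \<and> near G \<tau> (\<lambda>z. z \<notin> X)}"
      then obtain y where y: "y \<in> X" "\<tau> \<in> {\<tau>\<in>tangents G y. near G \<tau> (\<lambda>z. z \<notin> X)}" by blast
      then have "{\<tau>\<in>tangents G y. near G \<tau> (\<lambda>z. z \<notin> X)} \<noteq> {}" by blast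
      moreover have "finite {\<tau>\<in>tangents G y. near G \<tau> (\<lambda>z. z \<notin> X)}" using finite_tangents by simp
      ultimately have "0 < card {\<tau>\<in>tangents G y. near G \<tau> (\<lambda>z. z \<notin> X)}" by (intro card_gt_0_iff[THEN iffD2] conjI)
      then have "?E y \<noteq> 0" using fire_ok[OF y(1)] by linarith
      then show "\<tau> \<in> (\<Union>y\<in>{y. ?E y \<noteq> 0}. tangents G y)" using y(2) by blast
    qed
    moreover have "finite {y. ?E y \<noteq> 0}" using add_div_divisors[OF RR_pl[OF rd_RR[OF P]]] unfolding divisors_def by blast
    ultimately have fin: "finite {\<tau>. \<exists>y\<in>X. \<tau> \<in> tangents G y \<and> near G \<tau> (\<lambda>z. z \<notin> X)}"
      using finite_tangents finite_subset by (metis (no_types, lifting) finite_UN)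
    show False
    proof (rule fire[where w = "\<lambda>_. 1", OF X\<Gamma> H1 H2 fin])
      fix u and \<delta> :: real
      assume u: "pl G u" "\<delta> > 0" "\<And>y. y \<in> X \<Longrightarrow> u y = 0" "\<And>y. y \<in> \<Gamma> - X \<Longrightarrow> u y < 0"
        "\<And>y. y \<in> \<Gamma> - X \<Longrightarrow> 0 \<le> ord_at G u y"
        "\<And>y. y \<in> X \<Longrightarrow> ord_at G u y = - (\<Sum>\<tau>\<in>{\<tau>\<in>tangents G y. near G \<tau> (\<lambda>z. z \<notin> X)}. 1)"
      obtain y where y: "y \<in> X" using X by blast
      have "u y \<le> u P"
      proof (rule fire_contradiction[OF P u(1)])
        fix x show "0 \<le> ?E x + ord_at G u x"
        proof (cases "x \<in> X")
          case True then show ?thesis using u(6)[OF True] fire_ok[OF True] by simp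
        next
          case False
          then show ?thesis using u(5)[of x] E0[of x] ord_at_off[of x u] by (cases "x \<in> \<Gamma>") auto
        qed
      qed (use y X\<Gamma> in blast)
      then show False using u(3)[OF y] u(4)[of P] P X by simp
    qed simp_all
  qed
qed

text \<open>Two equivalent divisors reduced at \<open>P\<close> differ by the divisor of a function;
  \<open>reduced_max\<close>, applied to this function and to its negative, shows that it attains
  both its maximum and its minimum at \<open>P\<close>.\<close>

lemma Red_eq:
  assumes P: "P \<in> \<Gamma>" shows "Red G D P = add_div G D (rd P)"
  unfolding Red_def
proof (rule the_equality)
  let ?E = "add_div G D (rd P)"
  note r = RR_pl[OF rd_RR[OF P]]
  have "lin_equiv G ?E D" unfolding lin_equiv_def
    using rd_RR[OF P] by (intro bexI[of _ "rd P"]) (auto simp: add_div_def RR_space_def)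
  then show "?E \<in> divisors G \<and> lin_equiv G ?E D \<and> is_reduced G P ?E"
    using add_div_divisors[OF r] rd_reduced[OF P] by blast
  fix D' assume D': "D' \<in> divisors G \<and> lin_equiv G D' D \<and> is_reduced G P D'"
  then obtain f where f: "f \<in> rational_functions G" "\<And>x. D' x - D x = ord_at G f x" unfolding lin_equiv_def by blast
  have plf: "pl G f" using f(1) rational_iff by blast
  have E0: "0 \<le> ?E x" for x using rd_RR[OF P] unfolding RR_space_def effective_def by blast
  have 1: "f y - rd P y \<le> f P - rd P P" if y: "y \<in> \<Gamma>" for y
  proof (rule reduced_max[OF rd_reduced[OF P] pl_diff[OF plf r] _ y])
    fix x assume "x \<in> \<Gamma> - {P}"
    then have "0 \<le> D' x" using D' unfolding is_reduced_def by blast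
    then show "0 \<le> ?E x + ord_at G (\<lambda>y. f y - rd P y) x"
      using f(2)[of x] by (simp add: ord_at_diff[OF plf r] add_div_def)
  qed
  have 2: "rd P y - f y \<le> rd P P - f P" if y: "y \<in> \<Gamma>" for y
  proof (rule reduced_max[OF _ pl_diff[OF r plf] _ y])
    show "is_reduced G P D'" using D' by blast
    fix x assume "x \<in> \<Gamma> - {P}"
    show "0 \<le> D' x + ord_at G (\<lambda>y. rd P y - f y) x"
      using f(2)[of x] E0[of x] by (simp add: ord_at_diff[OF r plf] add_div_def)
  qed
  have "f y = rd P y + (f P - rd P P)" if "y \<in> \<Gamma>" for y using 1[OF that] 2[OF that] by simp
  then have "ord_at G f x = ord_at G (\<lambda>y. rd P y + (f P - rd P P)) x" for x by (rule ord_at_cong)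
  then have "ord_at G f x = ord_at G (rd P) x" for x using ord_at_add[OF r pl_const] ord_at_const by simp
  then show "D' = ?E" using f(2) by (intro ext) (simp add: add_div_def algebra_simps)
qed

lemma add_div_eq_iff:
  assumes f: "f \<in> RR" and g: "g \<in> RR"
  shows "add_div G D f = add_div G D g \<longleftrightarrow> (\<exists>c. f = (\<lambda>x\<in>\<Gamma>. c + g x))"
proof
  assume "add_div G D f = add_div G D g"
  then have "ord_at G f x = ord_at G g x" for x unfolding add_div_def by (metis add_left_cancel)
  then obtain c where "\<And>x. x \<in> \<Gamma> \<Longrightarrow> f x = g x + c" using const_of_ord_eq[OF RR_pl[OF f] RR_pl[OF g]] by metis
  moreover have "f \<in> extensional \<Gamma>" using f RR_iff by blast
  ultimately have "f = (\<lambda>x\<in>\<Gamma>. c + g x)" by (intro extensionalityI[of _ \<Gamma>]) auto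
  then show "\<exists>c. f = (\<lambda>x\<in>\<Gamma>. c + g x)" by blast
next
  assume "\<exists>c. f = (\<lambda>x\<in>\<Gamma>. c + g x)"
  then obtain c where c: "f = (\<lambda>x\<in>\<Gamma>. c + g x)" by blast
  show "add_div G D f = add_div G D g" unfolding c add_div_def
    using ord_at_add[OF pl_const RR_pl[OF g]] ord_at_const by simp
qed

lemma red_fun_eq:
  assumes P: "P \<in> \<Gamma>" shows "red_fun G D P = rd P"
  unfolding red_fun_def Red_eq[OF P]
proof (rule the_equality)
  have "rd P \<in> rational_functions G" using rd_RR[OF P] by (simp add: RR_space_def)
  then show "rd P \<in> rational_functions G \<and> add_div G D (rd P) = add_div G D (rd P) \<and> rd P P = 0" using rd_self[OF P] by simp
  fix f assume f: "f \<in> rational_functions G \<and> add_div G D f = add_div G D (rd P) \<and> f P = 0"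
  then have "f \<in> RR" using rd_RR[OF P] by (simp add: RR_space_def)
  then obtain c where c: "f = (\<lambda>x\<in>\<Gamma>. c + rd P x)" using add_div_eq_iff rd_RR[OF P] f by blast
  then have "c = 0" using f P rd_self[OF P] by auto
  moreover have "rd P \<in> extensional \<Gamma>" using rd_RR[OF P] RR_iff by blast
  ultimately show "f = rd P" using c by (simp add: extensional_restrict)
qed

end

section \<open>Cells of the linear system\<close>

lemma sum_if_eq_swap:
  fixes k :: "nat \<Rightarrow> 'b::comm_ring"
  assumes "finite S" "p ` {..<n} \<subseteq> S"
  shows "(\<Sum>x\<in>S. (\<Sum>i<n. if p i = x then k i else 0) * h x) = (\<Sum>i<n. k i * h (p i))"
proof -
  have "(\<Sum>x\<in>S. (\<Sum>i<n. if p i = x then k i else 0) * h x) = (\<Sum>x\<in>S. \<Sum>i<n. if p i = x then k i * h x else 0)"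
    unfolding sum_distrib_right by (intro sum.cong refl) simp
  also have "\<dots> = (\<Sum>i<n. \<Sum>x\<in>S. if p i = x then k i * h x else 0)" by (rule sum.swap)
  also have "\<dots> = (\<Sum>i<n. k i * h (p i))"
  proof (rule sum.cong[OF refl])
    fix i assume "i \<in> {..<n}"
    then have "p i \<in> S" using assms(2) by blast
    then show "(\<Sum>x\<in>S. if p i = x then k i * h x else 0) = k i * h (p i)" using assms(1) by (simp add: sum.delta')
  qed
  finally show ?thesis .
qed

context trop_curve
begin

text \<open>The converse of \<open>pl_hinges\<close>: vertex values, starting slopes and weighted
  breaks determine a piecewise linear function as soon as they agree at the head of each edge, which
  is the condition \<open>end_value\<close>.\<close>

lemma hinge_function:
  fixes a :: "'v \<Rightarrow> real" and \<sigma> :: "'v \<times> 'v \<Rightarrow> int" and S :: "'v \<times> 'v \<Rightarrow> real set" and c :: "'v \<times> 'v \<Rightarrow> real \<Rightarrow> int"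
  assumes S: "\<And>e. e \<in> edges G \<Longrightarrow> finite (S e)" "\<And>e. e \<in> edges G \<Longrightarrow> S e \<subseteq> {0<..<len G e}"
    and end_value: "\<And>e. e \<in> edges G \<Longrightarrow> a (snd e) = a (fst e) + of_int (\<sigma> e) * len G e + (\<Sum>x\<in>S e. of_int (c e x) * max 0 (len G e - x))"
    and gV: "\<And>v. v \<in> verts G \<Longrightarrow> g (Vertex v) = a v"
    and gI: "\<And>e t. e \<in> edges G \<Longrightarrow> 0 < t \<Longrightarrow> t < len G e \<Longrightarrow> g (Inner e t) = a (fst e) + of_int (\<sigma> e) * t + (\<Sum>x\<in>S e. of_int (c e x) * max 0 (t - x))"
  shows "pl G g"
    and "e \<in> edges G \<Longrightarrow> slope G g (e, 0, 1) = \<sigma> e"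
    and "e \<in> edges G \<Longrightarrow> slope G g (e, len G e, -1) = - \<sigma> e - (\<Sum>x\<in>S e. c e x)"
    and "e \<in> edges G \<Longrightarrow> 0 < t \<Longrightarrow> t < len G e \<Longrightarrow> ord_at G g (Inner e t) = (if t \<in> S e then c e t else 0)"
proof -
  have g: "g (edge_point G e t) = a (fst e) + of_int (\<sigma> e) * t + (\<Sum>x\<in>S e. of_int (c e x) * max 0 (t - x))"
    if e: "e \<in> edges G" and t: "0 \<le> t" "t \<le> len G e" for e t
  proof -
    consider "t = 0" | "t = len G e" | "0 < t" "t < len G e" using t by linarith
    then show ?thesis
    proof cases
      case 1
      have "(\<Sum>x\<in>S e. of_int (c e x) * max 0 (0 - x)) = (0::real)" using S(2)[OF e] by (intro sum.neutral) auto
      then show ?thesis using 1 gV edgeD[OF e] e by simp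
    next
      case 2 then show ?thesis using gV edgeD[OF e] e end_value[OF e] by simp
    next
      case 3 then show ?thesis using gI e by simp
    qed
  qed
  have fwd: "has_slope G g (edge_point G e t) (e, t, 1) (\<sigma> e + (\<Sum>x\<in>{x\<in>S e. x \<le> t}. c e x))" if e: "e \<in> edges G" and t: "0 \<le> t" "t < len G e" for e t
  proof -
    have "\<forall>\<^sub>F h in at_right 0. h > 0 \<and> h < len G e - t"
      using t unfolding eventually_at_right_0 by (intro exI[of _ "len G e - t"]) auto
    then show ?thesis unfolding has_slope_def using sum_hinge_right[OF S(1)[OF e], of "\<lambda>x. of_int (c e x)" t]
    proof eventually_elim
      case (elim h)
      then show ?case using g[OF e, of "t + h"] g[OF e, of t] t by (simp add: ray_def distrib_left distrib_right)
    qed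
  qed
  have bwd: "has_slope G g (edge_point G e t) (e, t, -1) (- \<sigma> e - (\<Sum>x\<in>{x\<in>S e. x < t}. c e x))" if e: "e \<in> edges G" and t: "0 < t" "t \<le> len G e" for e t
  proof -
    have "\<forall>\<^sub>F h in at_right 0. h > 0 \<and> h < t"
      using t unfolding eventually_at_right_0 by (intro exI[of _ "t"]) auto
    then show ?thesis unfolding has_slope_def using sum_hinge_left[OF S(1)[OF e], of "\<lambda>x. of_int (c e x)" t]
    proof eventually_elim
      case (elim h)
      then show ?case using g[OF e, of "t - h"] g[OF e, of t] t by (simp add: ray_def right_diff_distrib left_diff_distrib)
    qed
  qed
  show "pl G g" unfolding pl_def
  proof (intro ballI)
    fix x \<tau> assume \<tau>: "\<tau> \<in> tangents G x"
    then obtain e t s where "\<tau> = (e, t, s)" "e \<in> edges G" "0 \<le> t" "t \<le> len G e" "edge_point G e t = x" "s = 1 \<and> t < len G e \<or> s = -1 \<and> 0 < t"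
      unfolding tangents_def by blast
    then show "\<exists>m. has_slope G g x \<tau> m" using fwd[of e t] bwd[of e t] by blast
  qed
  have s1: "slope G g (e, t, 1) = \<sigma> e + (\<Sum>x\<in>{x\<in>S e. x \<le> t}. c e x)" if e: "e \<in> edges G" and t: "0 \<le> t" "t < len G e" for e t
    by (rule slope_eq[OF edge_fwd[OF e t] fwd[OF e t]])
  have s2: "slope G g (e, t, -1) = - \<sigma> e - (\<Sum>x\<in>{x\<in>S e. x < t}. c e x)" if e: "e \<in> edges G" and t: "0 < t" "t \<le> len G e" for e t
    by (rule slope_eq[OF edge_bwd[OF e t] bwd[OF e t]])
  show "slope G g (e, 0, 1) = \<sigma> e" if e: "e \<in> edges G"
  proof -
    have z: "{x\<in>S e. x \<le> 0} = {}" using S(2)[OF e] by force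
    show ?thesis using s1[OF e order_refl edgeD(4)[OF e]] unfolding z by simp
  qed
  show "slope G g (e, len G e, -1) = - \<sigma> e - (\<Sum>x\<in>S e. c e x)" if e: "e \<in> edges G"
  proof -
    have "{x\<in>S e. x < len G e} = S e" using S(2)[OF e] by force
    then show ?thesis using s2[OF e, of "len G e"] edgeD(4)[OF e] by simp
  qed
  show "ord_at G g (Inner e t) = (if t \<in> S e then c e t else 0)" if e: "e \<in> edges G" and t: "0 < t" "t < len G e"
  proof (cases "t \<in> S e")
    case True
    have "{x\<in>S e. x \<le> t} = insert t {x\<in>S e. x < t}" using True by auto
    then show ?thesis using ord_at_Inner[OF e t, of g] s1[OF e, of t] s2[OF e, of t] t S(1)[OF e] True by simp
  next
    case False
    then have "{x\<in>S e. x \<le> t} = {x\<in>S e. x < t}" by (auto simp: less_le)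
    then show ?thesis using ord_at_Inner[OF e t, of g] s1[OF e, of t] s2[OF e, of t] t False by simp
  qed
qed

end

section \<open>Chips and combinatorial types\<close>

context div_class
begin

abbreviation "E \<equiv> add_div G D"
abbreviation "LTop \<equiv> linear_system_topology G D"
abbreviation "LS \<equiv> linear_system G D"

lemma linear_system_eq: "LS = E ` RR"
proof (rule set_eqI, rule iffI)
  fix F assume "F \<in> LS"
  then obtain f where "effective F" "f \<in> rational_functions G" "\<forall>x. F x - D x = ord_at G f x"
    unfolding linear_system_def lin_equiv_def by blast
  moreover have "F = E f" using calculation(3) by (intro ext) (simp add: add_div_def algebra_simps)
  ultimately show "F \<in> E ` RR" unfolding RR_space_def by blast
next
  fix F assume "F \<in> E ` RR"
  then obtain f where f: "f \<in> RR" "F = E f" by blast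
  then have "f \<in> rational_functions G" "effective F" by (auto simp: RR_space_def)
  moreover have "\<forall>x. F x - D x = ord_at G f x" using f by (simp add: add_div_def)
  ultimately show "F \<in> LS" unfolding linear_system_def lin_equiv_def using add_div_divisors[OF RR_pl[OF f(1)]] f(2) by blast
qed

lemma topspace_LT [simp]: "topspace LTop = LS"
  by (simp add: linear_system_topology_def linear_system_eq)

lemma RR_shift: "f \<in> RR \<Longrightarrow> (\<lambda>x\<in>\<Gamma>. c + f x) \<in> RR"
  unfolding RR_iff by (simp add: pl_add[OF pl_const] ord_at_add[OF pl_const] ord_at_const)

lemma E_shift: "f \<in> RR \<Longrightarrow> E (\<lambda>x\<in>\<Gamma>. c + f x) = E f"
  using add_div_eq_iff[OF RR_shift] by blast

text \<open>The saturation of \<open>W\<close> is the union of its translates by constants, and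
  translation preserves uniform distances.\<close>

lemma E_open:
  assumes W: "openin (uniform_topology \<Gamma> RR) W" shows "openin LTop (E ` W)"
  unfolding linear_system_topology_def openin_quotient_topology topspace_uniform_topology
proof (intro conjI)
  have WR: "W \<subseteq> RR" using W by (simp add: openin_uniform_topology)
  then show "E ` W \<subseteq> E ` RR" by blast
  show "openin (uniform_topology \<Gamma> RR) {x \<in> RR. E x \<in> E ` W}" unfolding openin_uniform_topology
  proof (intro conjI ballI)
    fix g assume "g \<in> {x \<in> RR. E x \<in> E ` W}"
    then obtain w where w: "w \<in> W" "g \<in> RR" "E g = E w" by blast
    then obtain c where c: "g = (\<lambda>x\<in>\<Gamma>. c + w x)" using add_div_eq_iff WR by blast
    obtain \<epsilon> where \<epsilon>: "\<epsilon> > 0" "\<And>g. g \<in> RR \<Longrightarrow> (\<forall>x\<in>\<Gamma>. \<bar>g x - w x\<bar> < \<epsilon>) \<Longrightarrow> g \<in> W"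
      using W w(1) unfolding openin_uniform_topology by blast
    show "\<exists>\<epsilon>>0. \<forall>g'\<in>RR. (\<forall>x\<in>\<Gamma>. \<bar>g' x - g x\<bar> < \<epsilon>) \<longrightarrow> g' \<in> {x \<in> RR. E x \<in> E ` W}"
    proof (intro exI[of _ \<epsilon>] conjI ballI impI \<epsilon>(1))
      fix g' assume g': "g' \<in> RR" "\<forall>x\<in>\<Gamma>. \<bar>g' x - g x\<bar> < \<epsilon>"
      have "(\<lambda>x\<in>\<Gamma>. - c + g' x) \<in> W"
      proof (rule \<epsilon>(2)[OF RR_shift[OF g'(1)]], rule ballI)
        fix x assume x: "x \<in> \<Gamma>"
        then have "g x = c + w x" using c by simp
        then have "(\<lambda>x\<in>\<Gamma>. - c + g' x) x - w x = g' x - g x" using x by simp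
        then show "\<bar>(\<lambda>x\<in>\<Gamma>. - c + g' x) x - w x\<bar> < \<epsilon>" using bspec[OF g'(2) x] by simp
      qed
      then have "E (\<lambda>x\<in>\<Gamma>. - c + g' x) \<in> E ` W" by (rule imageI)
      then show "g' \<in> {x \<in> RR. E x \<in> E ` W}" using g'(1) unfolding E_shift[OF g'(1)] by blast
    qed
  qed blast
qed

text \<open>The combinatorial type is refined by the starting slopes, which makes all data discrete
  except for chip positions and vertex values; these can be interpolated linearly. The resulting
  classes will be connected and relatively open within a type.\<close>

definition related :: "('a point \<Rightarrow> real) \<Rightarrow> ('a point \<Rightarrow> real) \<Rightarrow> bool" where
  "related f g \<longleftrightarrow> same_type G (E f) (E g) \<and> (\<forall>e\<in>edges G. slope G f (e, 0, 1) = slope G g (e, 0, 1))"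

definition chips :: "('a point \<Rightarrow> real) \<Rightarrow> 'a \<times> 'a \<Rightarrow> real list" where
  "chips f e = sorted_list_of_set {t \<in> {0<..<len G e}. E f (Inner e t) \<noteq> 0}"

definition D_breaks :: "'a \<times> 'a \<Rightarrow> real set" where
  "D_breaks e = {t \<in> {0<..<len G e}. D (Inner e t) \<noteq> 0}"

lemma finite_Inner: "finite {x. F x \<noteq> (0::int)} \<Longrightarrow> finite {t \<in> {0<..<len G e}. F (Inner e t) \<noteq> 0}"
  by (rule finite_subset[OF _ finite_vimageI[of "{x. F x \<noteq> 0}" "Inner e"]]) (auto simp: inj_def)

lemma finite_SD: "finite (D_breaks e)"
  unfolding D_breaks_def by (rule finite_Inner[OF finite_D])

lemma chips:
  assumes "f \<in> RR"
  shows "set (chips f e) = {t \<in> {0<..<len G e}. E f (Inner e t) \<noteq> 0}" "sorted_wrt (<) (chips f e)" "distinct (chips f e)"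
    "mult_seq G (E f) e = map (\<lambda>t. E f (Inner e t)) (chips f e)"
proof -
  have "finite {x. E f x \<noteq> 0}" using add_div_divisors[OF RR_pl[OF assms]] by (simp add: divisors_def)
  then have fin: "finite {t \<in> {0<..<len G e}. E f (Inner e t) \<noteq> 0}" by (rule finite_Inner)
  then show "set (chips f e) = {t \<in> {0<..<len G e}. E f (Inner e t) \<noteq> 0}" unfolding chips_def by simp
  show "sorted_wrt (<) (chips f e)" "distinct (chips f e)" unfolding chips_def by simp_all
  show "mult_seq G (E f) e = map (\<lambda>t. E f (Inner e t)) (chips f e)" unfolding mult_seq_def chips_def ..
qed

lemma E_nonneg: "f \<in> RR \<Longrightarrow> 0 \<le> E f x"
  by (auto simp: RR_space_def effective_def)

lemma mult_pos:
  assumes "f \<in> RR" "i < length (chips f e)"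
  shows "mult_seq G (E f) e ! i = E f (Inner e (chips f e ! i))" "0 < mult_seq G (E f) e ! i" "0 < chips f e ! i" "chips f e ! i < len G e"
proof -
  have "chips f e ! i \<in> set (chips f e)" using assms(2) by simp
  then have "chips f e ! i \<in> {t \<in> {0<..<len G e}. E f (Inner e t) \<noteq> 0}" using chips(1)[OF assms(1)] by blast
  then show "mult_seq G (E f) e ! i = E f (Inner e (chips f e ! i))" "0 < mult_seq G (E f) e ! i" "0 < chips f e ! i" "chips f e ! i < len G e"
    using assms chips(4)[OF assms(1)] E_nonneg[OF assms(1), of "Inner e (chips f e ! i)"] by simp_all
qed

lemma sum_chips:
  assumes "f \<in> RR"
  shows "(\<Sum>i<length (chips f e). of_int (mult_seq G (E f) e ! i) * h (chips f e ! i)) = (\<Sum>x\<in>set (chips f e). of_int (E f (Inner e x)) * h x)"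
proof -
  have b: "bij_betw ((!) (chips f e)) {..<length (chips f e)} (set (chips f e))"
    using chips(3)[OF assms] by (rule bij_betw_nth) auto
  have "(\<Sum>x\<in>set (chips f e). of_int (E f (Inner e x)) * h x) = (\<Sum>i<length (chips f e). of_int (E f (Inner e (chips f e ! i))) * h (chips f e ! i))"
    by (rule sum.reindex_bij_betw[OF b, symmetric])
  also have "\<dots> = (\<Sum>i<length (chips f e). of_int (mult_seq G (E f) e ! i) * h (chips f e ! i))"
    using mult_pos(1)[OF assms] by (intro sum.cong) auto
  finally show ?thesis ..
qed

definition D_part :: "'a \<times> 'a \<Rightarrow> real \<Rightarrow> real" where
  "D_part e t = (\<Sum>x\<in>D_breaks e. of_int (D (Inner e x)) * max 0 (t - x))"

text \<open>Since orders are \<open>E f - D\<close>, the hinges split into those of the chips and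
  the fixed part \<open>D_part\<close>, which is the same for all members of
  \<open>RR\<close>.\<close>

lemma chip_formula:
  assumes f: "f \<in> RR" and e: "e \<in> edges G" and t: "0 \<le> t" "t \<le> len G e"
  shows "f (edge_point G e t) = f (Vertex (fst e)) + of_int (slope G f (e, 0, 1)) * t +
     (\<Sum>i<length (chips f e). of_int (mult_seq G (E f) e ! i) * max 0 (t - chips f e ! i)) - D_part e t"
proof -
  define S where "S = set (chips f e) \<union> D_breaks e"
  have S: "finite S" unfolding S_def using finite_SD by (intro finite_UnI) simp_all
  have S': "S \<subseteq> {0<..<len G e}" unfolding S_def chips(1)[OF f] D_breaks_def by blast
  note S = S S'
  have S0: "ord_at G f (Inner e x) = 0" if "x \<in> {0<..<len G e}" "x \<notin> S" for x
    using that chips(1)[OF f, of e] by (auto simp: S_def D_breaks_def add_div_def)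
  have "(\<Sum>x\<in>S. of_int (ord_at G f (Inner e x)) * max 0 (t - x)) = (\<Sum>x\<in>S. of_int (E f (Inner e x)) * max 0 (t - x)) - (\<Sum>x\<in>S. of_int (D (Inner e x)) * max 0 (t - x))"
    by (simp add: add_div_def algebra_simps flip: sum_subtractf)
  also have "(\<Sum>x\<in>S. of_int (E f (Inner e x)) * max 0 (t - x)) = (\<Sum>x\<in>set (chips f e). of_int (E f (Inner e x)) * max 0 (t - x))"
    using S by (intro sum.mono_neutral_right) (auto simp: S_def chips(1)[OF f] D_breaks_def)
  also have "(\<Sum>x\<in>S. of_int (D (Inner e x)) * max 0 (t - x)) = D_part e t"
    unfolding D_part_def using S by (intro sum.mono_neutral_right) (auto simp: S_def chips(1)[OF f] D_breaks_def)
  finally show ?thesis using pl_hinges[OF RR_pl[OF f] e t S S0] sum_chips[OF f, of e "\<lambda>x. max 0 (t - x)"] by simp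
qed

definition pos :: "('a point \<Rightarrow> real) \<Rightarrow> ('a point \<Rightarrow> real) \<Rightarrow> real \<Rightarrow> 'a \<times> 'a \<Rightarrow> nat \<Rightarrow> real" where
  "pos f g l e i = (1 - l) * chips f e ! i + l * chips g e ! i"

text \<open>Interpolation between two functions of the same combinatorial type by moving the chips.\<close>

definition move_chips :: "('a point \<Rightarrow> real) \<Rightarrow> ('a point \<Rightarrow> real) \<Rightarrow> real \<Rightarrow> 'a point \<Rightarrow> real" where
  "move_chips f g l = (\<lambda>y\<in>\<Gamma>. case y of Vertex v \<Rightarrow> (1 - l) * f y + l * g y
     | Inner e t \<Rightarrow> (1 - l) * f (Vertex (fst e)) + l * g (Vertex (fst e)) + of_int (slope G f (e, 0, 1)) * t +
         (\<Sum>i<length (chips f e). of_int (mult_seq G (E f) e ! i) * max 0 (t - pos f g l e i)) - D_part e t)"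

lemma relatedD:
  assumes "related f g" "e \<in> edges G" "f \<in> RR" "g \<in> RR"
  shows "slope G f (e, 0, 1) = slope G g (e, 0, 1)" "mult_seq G (E f) e = mult_seq G (E g) e" "length (chips f e) = length (chips g e)"
proof -
  show "slope G f (e, 0, 1) = slope G g (e, 0, 1)" using assms by (auto simp: related_def)
  show *: "mult_seq G (E f) e = mult_seq G (E g) e" using assms by (auto simp: related_def same_type_def)
  show "length (chips f e) = length (chips g e)" using arg_cong[OF *, of length] chips(4)[OF assms(3)] chips(4)[OF assms(4)] by simp
qed

lemma pos_bounds:
  assumes "related f g" "e \<in> edges G" "f \<in> RR" "g \<in> RR" "0 \<le> l" "l \<le> 1" "i < length (chips f e)"
  shows "0 < pos f g l e i" "pos f g l e i < len G e" "i < j \<Longrightarrow> j < length (chips f e) \<Longrightarrow> pos f g l e i < pos f g l e j"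
proof -
  note ln = relatedD(3)[OF assms(1-4)]
  note P = mult_pos(3,4)[OF assms(3), of _ e] mult_pos(3,4)[OF assms(4), of _ e, folded ln]
  have cc: "(1 - l) * a + l * b < (1 - l) * a' + l * b'" if "a < a'" "b < b'" for a b a' b' :: real
  proof (cases "l = 1")
    case False
    then have "(1 - l) * a < (1 - l) * a'" "l * b \<le> l * b'" using that assms(5,6) by (auto intro: mult_left_mono)
    then show ?thesis by linarith
  qed (use that in simp)
  show "0 < pos f g l e i" using cc[of 0 "chips f e ! i" 0 "chips g e ! i"] P(1,3)[OF assms(7)] by (simp add: pos_def)
  show "pos f g l e i < len G e" using cc[of "chips f e ! i" "len G e" "chips g e ! i" "len G e"] P(2,4)[OF assms(7)] by (simp add: pos_def algebra_simps)
  show "pos f g l e i < pos f g l e j" if "i < j" "j < length (chips f e)"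
    unfolding pos_def using chips(2)[OF assms(3), of e] chips(2)[OF assms(4), of e] that ln
    by (intro cc) (auto simp: sorted_wrt_iff_nth_less)
qed

text \<open>The point at issue is the head of the edge, where the interpolated vertex value has to
  match the hinge formula. All chips stay inside the edge, so there the formula is affine in the
  chip positions and compatible with interpolation.\<close>

lemma move_chips_edge:
  assumes R: "related f g" and e: "e \<in> edges G" and f: "f \<in> RR" and g: "g \<in> RR" and l: "0 \<le> l" "l \<le> 1" and t: "0 \<le> t" "t \<le> len G e"
  shows "move_chips f g l (edge_point G e t) = (1 - l) * f (Vertex (fst e)) + l * g (Vertex (fst e)) + of_int (slope G f (e, 0, 1)) * t +
         (\<Sum>i<length (chips f e). of_int (mult_seq G (E f) e ! i) * max 0 (t - pos f g l e i)) - D_part e t" (is "_ = ?r t")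
proof -
  note P = pos_bounds[OF R e f g l]
  consider "t = 0" | "t = len G e" | "0 < t" "t < len G e" using t by linarith
  then show ?thesis
  proof cases
    case 1
    have "(\<Sum>i<length (chips f e). of_int (mult_seq G (E f) e ! i) * max 0 (0 - pos f g l e i)) = 0"
    proof (rule sum.neutral, rule ballI)
      fix i assume "i \<in> {..<length (chips f e)}"
      then show "of_int (mult_seq G (E f) e ! i) * max 0 (0 - pos f g l e i) = 0" using P(1)[of i] by simp
    qed
    moreover have "D_part e 0 = 0" unfolding D_part_def by (intro sum.neutral) (auto simp: D_breaks_def)
    ultimately show ?thesis using 1 edge_point_in[OF e, of 0] e by (simp add: move_chips_def)
  next
    case 2
    have L: "0 \<le> len G e" using edgeD(4)[OF e] by simp
    let ?k = "\<lambda>i. real_of_int (mult_seq G (E f) e ! i)"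
    have hinge: "(\<Sum>i<length (chips f e). ?k i * max 0 (len G e - q i)) = (\<Sum>i<length (chips f e). ?k i * (len G e - q i))"
      if "\<And>i. i < length (chips f e) \<Longrightarrow> q i < len G e" for q
      using that by (intro sum.cong) (force simp: max_def)+
    have F: "f (Vertex (snd e)) = f (Vertex (fst e)) + of_int (slope G f (e, 0, 1)) * len G e + (\<Sum>i<length (chips f e). ?k i * (len G e - chips f e ! i)) - D_part e (len G e)"
      using chip_formula[OF f e L order_refl] hinge[of "\<lambda>i. chips f e ! i"] mult_pos(4)[OF f] e by simp
    have Gg: "g (Vertex (snd e)) = g (Vertex (fst e)) + of_int (slope G f (e, 0, 1)) * len G e + (\<Sum>i<length (chips f e). ?k i * (len G e - chips g e ! i)) - D_part e (len G e)"
      using chip_formula[OF g e L order_refl] hinge[of "\<lambda>i. chips g e ! i"] mult_pos(4)[OF g] relatedD[OF R e f g] e by simp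
    have "(\<Sum>i<length (chips f e). ?k i * (len G e - pos f g l e i)) = (1 - l) * (\<Sum>i<length (chips f e). ?k i * (len G e - chips f e ! i)) + l * (\<Sum>i<length (chips f e). ?k i * (len G e - chips g e ! i))"
      unfolding sum_distrib_left sum.distrib[symmetric] by (intro sum.cong refl) (simp add: pos_def algebra_simps)
    then have "?r (len G e) = (1 - l) * f (Vertex (snd e)) + l * g (Vertex (snd e))"
      using hinge[of "pos f g l e"] P(2) unfolding F Gg by (simp add: algebra_simps)
    then show ?thesis using 2 edge_point_in[OF e, of "len G e"] e by (simp add: move_chips_def)
  next
    case 3
    then show ?thesis using edge_point_in[OF e, of t] e by (simp add: move_chips_def)
  qed
qed

definition move_breaks :: "('a point \<Rightarrow> real) \<Rightarrow> ('a point \<Rightarrow> real) \<Rightarrow> real \<Rightarrow> 'a \<times> 'a \<Rightarrow> real set" where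
  "move_breaks f g l e = pos f g l e ` {..<length (chips f e)} \<union> D_breaks e"

definition move_orders :: "('a point \<Rightarrow> real) \<Rightarrow> ('a point \<Rightarrow> real) \<Rightarrow> real \<Rightarrow> 'a \<times> 'a \<Rightarrow> real \<Rightarrow> int" where
  "move_orders f g l e x = (\<Sum>i<length (chips f e). if pos f g l e i = x then mult_seq G (E f) e ! i else 0)"

lemma move_chips_props:
  assumes R: "related f g" and f: "f \<in> RR" and g: "g \<in> RR" and l: "0 \<le> l" "l \<le> 1"
  shows "pl G (move_chips f g l)"
    and "e \<in> edges G \<Longrightarrow> slope G (move_chips f g l) (e, 0, 1) = slope G f (e, 0, 1)"
    and "e \<in> edges G \<Longrightarrow> slope G (move_chips f g l) (e, len G e, -1) = - slope G f (e, 0, 1) - ((\<Sum>i<length (chips f e). mult_seq G (E f) e ! i) - (\<Sum>x\<in>D_breaks e. D (Inner e x)))"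
    and "e \<in> edges G \<Longrightarrow> 0 < t \<Longrightarrow> t < len G e \<Longrightarrow> E (move_chips f g l) (Inner e t) = move_orders f g l e t"
proof -
  define c where "c e x = move_orders f g l e x - D (Inner e x)" for e x
  have finS: "finite (move_breaks f g l e)" for e using finite_SD by (simp add: move_breaks_def)
  have subS: "move_breaks f g l e \<subseteq> {0<..<len G e}" if "e \<in> edges G" for e
    using pos_bounds(1,2)[OF R that f g l] by (auto simp: move_breaks_def D_breaks_def)
  have csum: "(\<Sum>x\<in>move_breaks f g l e. real_of_int (c e x) * h x) = (\<Sum>i<length (chips f e). of_int (mult_seq G (E f) e ! i) * h (pos f g l e i)) - (\<Sum>x\<in>D_breaks e. of_int (D (Inner e x)) * h x)"
    if "e \<in> edges G" for e and h :: "real \<Rightarrow> real"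
  proof -
    have "(\<Sum>x\<in>move_breaks f g l e. real_of_int (c e x) * h x) = (\<Sum>x\<in>move_breaks f g l e. (\<Sum>i<length (chips f e). if pos f g l e i = x then real_of_int (mult_seq G (E f) e ! i) else 0) * h x) - (\<Sum>x\<in>move_breaks f g l e. of_int (D (Inner e x)) * h x)"
      by (simp add: c_def move_orders_def left_diff_distrib sum_subtractf if_distrib cong: if_cong)
    also have "(\<Sum>x\<in>move_breaks f g l e. (\<Sum>i<length (chips f e). if pos f g l e i = x then real_of_int (mult_seq G (E f) e ! i) else 0) * h x) = (\<Sum>i<length (chips f e). of_int (mult_seq G (E f) e ! i) * h (pos f g l e i))"
      by (rule sum_if_eq_swap[OF finS]) (simp add: move_breaks_def)
    also have "(\<Sum>x\<in>move_breaks f g l e. of_int (D (Inner e x)) * h x) = (\<Sum>x\<in>D_breaks e. of_int (D (Inner e x)) * h x)"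
      using finS subS[OF that] by (intro sum.mono_neutral_right) (auto simp: move_breaks_def D_breaks_def)
    finally show ?thesis .
  qed
  have ends: "(1 - l) * f (Vertex (snd e)) + l * g (Vertex (snd e)) = (1 - l) * f (Vertex (fst e)) + l * g (Vertex (fst e)) + of_int (slope G f (e, 0, 1)) * len G e + (\<Sum>x\<in>move_breaks f g l e. of_int (c e x) * max 0 (len G e - x))"
    if e: "e \<in> edges G" for e
  proof -
    have "move_chips f g l (edge_point G e (len G e)) = (1 - l) * f (Vertex (snd e)) + l * g (Vertex (snd e))"
      using edge_point_in[OF e, of "len G e"] e by (simp add: move_chips_def)
    then show ?thesis using move_chips_edge[OF R e f g l _ order_refl] edgeD(4)[OF e] csum[OF e] by (simp add: D_part_def)
  qed
  have mvV: "move_chips f g l (Vertex v) = (1 - l) * f (Vertex v) + l * g (Vertex v)" if "v \<in> verts G" for v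
    using that by (simp add: move_chips_def curve_def)
  have mvI: "move_chips f g l (Inner e t) = (1 - l) * f (Vertex (fst e)) + l * g (Vertex (fst e)) + of_int (slope G f (e, 0, 1)) * t + (\<Sum>x\<in>move_breaks f g l e. of_int (c e x) * max 0 (t - x))"
    if e: "e \<in> edges G" and t: "0 < t" "t < len G e" for e t
    using move_chips_edge[OF R e f g l, of t] t e csum[OF e] by (simp add: D_part_def)
  note H = hinge_function[where a = "\<lambda>v. (1 - l) * f (Vertex v) + l * g (Vertex v)" and \<sigma> = "\<lambda>e. slope G f (e, 0, 1)" and S = "move_breaks f g l" and c = c and g = "move_chips f g l",
      OF finS subS ends mvV mvI]
  have H3: "slope G (move_chips f g l) (e, len G e, -1) = - slope G f (e, 0, 1) - (\<Sum>x\<in>move_breaks f g l e. c e x)" if e: "e \<in> edges G" for e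
    by (rule H(3)) (assumption | rule e)+
  have H4: "ord_at G (move_chips f g l) (Inner e t) = (if t \<in> move_breaks f g l e then c e t else 0)" if e: "e \<in> edges G" "0 < t" "t < len G e" for e t
    by (rule H(4)) (assumption | rule e)+
  show "pl G (move_chips f g l)" by (rule H(1))
  show "slope G (move_chips f g l) (e, 0, 1) = slope G f (e, 0, 1)" if e: "e \<in> edges G" by (rule H(2)) (assumption | rule e)+
  show "slope G (move_chips f g l) (e, len G e, -1) = - slope G f (e, 0, 1) - ((\<Sum>i<length (chips f e). mult_seq G (E f) e ! i) - (\<Sum>x\<in>D_breaks e. D (Inner e x)))" if e: "e \<in> edges G"
  proof -
    have "real_of_int (\<Sum>x\<in>move_breaks f g l e. c e x) = real_of_int ((\<Sum>i<length (chips f e). mult_seq G (E f) e ! i) - (\<Sum>x\<in>D_breaks e. D (Inner e x)))"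
      using csum[OF e, of "\<lambda>_. 1"] by simp
    then have "(\<Sum>x\<in>move_breaks f g l e. c e x) = (\<Sum>i<length (chips f e). mult_seq G (E f) e ! i) - (\<Sum>x\<in>D_breaks e. D (Inner e x))" by (simp only: of_int_eq_iff)
    then show ?thesis using H3[OF e] by simp
  qed
  show "E (move_chips f g l) (Inner e t) = move_orders f g l e t" if e: "e \<in> edges G" and t: "0 < t" "t < len G e"
  proof (cases "t \<in> move_breaks f g l e")
    case True
    then show ?thesis using H4[OF e t] by (simp add: add_div_def c_def)
  next
    case False
    then have "move_orders f g l e t = 0" "D (Inner e t) = 0" using t by (auto simp: move_orders_def move_breaks_def D_breaks_def intro!: sum.neutral)
    then show ?thesis using H4[OF e t] False by (simp add: add_div_def)
  qed
qed

lemma move_chips_ends: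
  assumes R: "related f g" and f: "f \<in> RR" and g: "g \<in> RR"
  shows "move_chips f g 0 = f" "move_chips f g 1 = g"
proof -
  have "move_chips f g 0 y = f y \<and> move_chips f g 1 y = g y" if "y \<in> \<Gamma>" for y
    using that
  proof (cases rule: curve_cases)
    case (1 v) then show ?thesis using that by (simp add: move_chips_def)
  next
    case (2 e t)
    then show ?thesis using move_chips_edge[OF R 2(1) f g, of 0 t] move_chips_edge[OF R 2(1) f g, of 1 t] chip_formula[OF f 2(1), of t] chip_formula[OF g 2(1), of t]
      relatedD[OF R 2(1) f g] by (simp add: pos_def)
  qed
  moreover have "move_chips f g l \<in> extensional \<Gamma>" for l by (simp add: move_chips_def)
  moreover have "f \<in> extensional \<Gamma>" "g \<in> extensional \<Gamma>" using f g RR_iff by blast+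
  ultimately show "move_chips f g 0 = f" "move_chips f g 1 = g" by (auto intro: extensionalityI[of _ \<Gamma>])
qed

text \<open>The slope at the tail of an edge is kept, and that at its head depends only on the tail
  slope, the multiplicities and \<open>D\<close>; so the divisor at vertices is unchanged. Convex
  combinations of increasing lists are increasing, so chips neither merge nor swap.\<close>

lemma move_chips_related:
  assumes R: "related f g" and f: "f \<in> RR" and g: "g \<in> RR" and l: "0 \<le> l" "l \<le> 1"
  shows "move_chips f g l \<in> RR" "related f (move_chips f g l)"
proof -
  note M = move_chips_props[OF R f g l]
  \<comment> \<open>At \<open>l = 0\<close> the path is at \<open>f\<close>, which puts the end
    slopes of \<open>f\<close> into the form used for all \<open>l\<close>.\<close>
  note M0 = move_chips_props[OF R f g order_refl zero_le_one, unfolded move_chips_ends(1)[OF R f g]]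
  have EV: "E (move_chips f g l) (Vertex v) = E f (Vertex v)" for v
  proof -
    have "slope G (move_chips f g l) \<tau> = slope G f \<tau>" if "\<tau> \<in> tangents G (Vertex v)" for \<tau>
      using that M(2,3) M0(3) by (auto simp: tangents_Vertex)
    then show ?thesis unfolding add_div_def ord_at_slope by simp
  qed
  have mpos: "0 \<le> move_orders f g l e t" for e t
    unfolding move_orders_def by (intro sum_nonneg) (simp add: less_imp_le[OF mult_pos(2)[OF f]])
  show RR: "move_chips f g l \<in> RR" unfolding RR_iff
  proof (intro conjI allI)
    show "move_chips f g l \<in> extensional \<Gamma>" by (simp add: move_chips_def)
    show "pl G (move_chips f g l)" by (rule M(1))
    fix x show "0 \<le> D x + ord_at G (move_chips f g l) x"
    proof (cases "x \<in> \<Gamma>")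
      case True
      then show ?thesis
      proof (cases rule: curve_cases)
        case (1 v) then show ?thesis using EV[of v] E_nonneg[OF f, of x] by (simp add: add_div_def)
      next
        case (2 e t) then show ?thesis using M(4)[OF 2(1-3)] mpos[of e t] by (simp add: add_div_def)
      qed
    qed (simp add: D_off ord_at_off)
  qed
  show "related f (move_chips f g l)" unfolding related_def same_type_def
  proof (intro conjI ballI)
    fix v show "E f (Vertex v) = E (move_chips f g l) (Vertex v)" by (simp add: EV)
  next
    fix e assume e: "e \<in> edges G"
    show "slope G f (e, 0, 1) = slope G (move_chips f g l) (e, 0, 1)" using M(2)[OF e] by simp
    define ps where "ps = map (pos f g l e) [0..<length (chips f e)]"
    have sp: "sorted_wrt (<) ps" unfolding ps_def using pos_bounds(3)[OF R e f g l] by (auto simp: sorted_wrt_iff_nth_less)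
    have m: "move_orders f g l e (pos f g l e i) = mult_seq G (E f) e ! i" if i: "i < length (chips f e)" for i
    proof -
      have "(pos f g l e j = pos f g l e i) = (j = i)" if "j < length (chips f e)" for j
      proof (cases i j rule: linorder_cases)
        case less
        then show ?thesis using pos_bounds(3)[OF R e f g l i less that] by simp
      next
        case greater
        then show ?thesis using pos_bounds(3)[OF R e f g l that greater i] by simp
      qed simp
      then have "move_orders f g l e (pos f g l e i) = (\<Sum>j<length (chips f e). if j = i then mult_seq G (E f) e ! j else 0)"
        unfolding move_orders_def by (intro sum.cong) auto
      then show ?thesis using i by simp
    qed
    have set: "set ps = {t \<in> {0<..<len G e}. E (move_chips f g l) (Inner e t) \<noteq> 0}"
    proof (rule set_eqI, rule iffI)
      fix t assume "t \<in> set ps"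
      then obtain i where i: "i < length (chips f e)" "t = pos f g l e i" by (auto simp: ps_def)
      then show "t \<in> {t \<in> {0<..<len G e}. E (move_chips f g l) (Inner e t) \<noteq> 0}"
        using pos_bounds(1,2)[OF R e f g l i(1)] M(4)[OF e, of t] m[OF i(1)] mult_pos(2)[OF f i(1)] by simp
    next
      fix t assume t: "t \<in> {t \<in> {0<..<len G e}. E (move_chips f g l) (Inner e t) \<noteq> 0}"
      then have "move_orders f g l e t \<noteq> 0" using M(4)[OF e, of t] by simp
      then obtain i where i: "i \<in> {..<length (chips f e)}" "(if pos f g l e i = t then mult_seq G (E f) e ! i else 0) \<noteq> 0"
        unfolding move_orders_def by (rule sum.not_neutral_contains_not_neutral)
      then have "pos f g l e i = t" by (meson)
      then show "t \<in> set ps" using i(1) by (auto simp: ps_def)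
    qed
    have "chips (move_chips f g l) e = ps"
      using sp chips(2)[OF RR, of e] chips(1)[OF RR, of e] set by (intro sorted_distinct_set_unique) (auto simp: strict_sorted_iff)
    then have mq: "mult_seq G (E (move_chips f g l)) e = map (\<lambda>t. E (move_chips f g l) (Inner e t)) ps" using chips(4)[OF RR, of e] by simp
    have ln: "length (mult_seq G (E f) e) = length (chips f e)" using chips(4)[OF f, of e] by simp
    show "mult_seq G (E f) e = mult_seq G (E (move_chips f g l)) e"
    proof (rule nth_equalityI)
      show "length (mult_seq G (E f) e) = length (mult_seq G (E (move_chips f g l)) e)" unfolding mq ln by (simp add: ps_def)
      fix i assume "i < length (mult_seq G (E f) e)"
      then have i: "i < length (chips f e)" unfolding ln .
      then have "mult_seq G (E (move_chips f g l)) e ! i = E (move_chips f g l) (Inner e (pos f g l e i))" unfolding mq by (simp add: ps_def)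
      also have "\<dots> = mult_seq G (E f) e ! i" using M(4)[OF e pos_bounds(1,2)[OF R e f g l i]] m[OF i] by simp
      finally show "mult_seq G (E f) e ! i = mult_seq G (E (move_chips f g l)) e ! i" ..
    qed
  qed
qed

text \<open>Vertex values move with speed at most \<open>CV\<close> and the hinges of an edge with
  speed at most \<open>CE e\<close>, because no chip travels farther than its edge is long. This
  makes the path continuous in the uniform topology.\<close>

lemma mv_Lipschitz:
  assumes R: "related f g" and f: "f \<in> RR" and g: "g \<in> RR"
  obtains C where "0 < C" "\<And>l m y. 0 \<le> l \<Longrightarrow> l \<le> 1 \<Longrightarrow> 0 \<le> m \<Longrightarrow> m \<le> 1 \<Longrightarrow> y \<in> \<Gamma> \<Longrightarrow> \<bar>move_chips f g l y - move_chips f g m y\<bar> \<le> C * \<bar>l - m\<bar>"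
proof -
  let ?k = "\<lambda>e i. real_of_int (mult_seq G (E f) e ! i)"
  define CV where "CV = (\<Sum>v\<in>verts G. \<bar>g (Vertex v) - f (Vertex v)\<bar>)"
  define CE where "CE e = (\<Sum>i<length (chips f e). ?k e i * len G e)" for e
  define C where "C = CV + (\<Sum>e\<in>edges G. CE e) + 1"
  have CE0: "0 \<le> CE e" if "e \<in> edges G" for e
    unfolding CE_def using mult_pos(2)[OF f, of _ e] edgeD(4)[OF that] by (intro sum_nonneg mult_nonneg_nonneg) (auto intro: less_imp_le)
  have CV0: "0 \<le> CV" by (simp add: CV_def sum_nonneg)
  have CEs: "CE e \<le> (\<Sum>e\<in>edges G. CE e)" if "e \<in> edges G" for e using that finite_edges CE0 by (intro member_le_sum) auto
  have CVs: "\<bar>g (Vertex v) - f (Vertex v)\<bar> \<le> CV" if "v \<in> verts G" for v unfolding CV_def using that finite_verts by (intro member_le_sum) auto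
  have S0: "0 \<le> (\<Sum>e\<in>edges G. CE e)" using CE0 by (rule sum_nonneg)
  show ?thesis
  proof (rule that[of C])
    show "0 < C" using CV0 S0 by (simp add: C_def)
    fix l m :: real and y assume l: "0 \<le> l" "l \<le> 1" and m: "0 \<le> m" "m \<le> 1" and y: "y \<in> \<Gamma>"
    have vx: "\<bar>((1 - l) * f (Vertex v) + l * g (Vertex v)) - ((1 - m) * f (Vertex v) + m * g (Vertex v))\<bar> \<le> CV * \<bar>l - m\<bar>" if "v \<in> verts G" for v
    proof -
      have "((1 - l) * f (Vertex v) + l * g (Vertex v)) - ((1 - m) * f (Vertex v) + m * g (Vertex v)) = (g (Vertex v) - f (Vertex v)) * (l - m)"
        by (simp add: algebra_simps)
      then show ?thesis using CVs[OF that] by (simp add: abs_mult mult_right_mono)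
    qed
    show "\<bar>move_chips f g l y - move_chips f g m y\<bar> \<le> C * \<bar>l - m\<bar>"
      using y
    proof (cases rule: curve_cases)
      case (1 v)
      have "CV * \<bar>l - m\<bar> \<le> C * \<bar>l - m\<bar>" using S0 by (intro mult_right_mono) (auto simp: C_def)
      then show ?thesis using vx[OF 1(1)] 1 y by (simp add: move_chips_def)
    next
      case (2 e t)
      let ?p = "\<lambda>l i. pos f g l e i"
      have "\<bar>(\<Sum>i<length (chips f e). ?k e i * max 0 (t - ?p l i)) - (\<Sum>i<length (chips f e). ?k e i * max 0 (t - ?p m i))\<bar>
         = \<bar>\<Sum>i<length (chips f e). ?k e i * (max 0 (t - ?p l i) - max 0 (t - ?p m i))\<bar>"
        by (simp add: right_diff_distrib sum_subtractf)
      also have "\<dots> \<le> (\<Sum>i<length (chips f e). \<bar>?k e i * (max 0 (t - ?p l i) - max 0 (t - ?p m i))\<bar>)" by (rule sum_abs)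
      also have "\<dots> \<le> (\<Sum>i<length (chips f e). ?k e i * len G e * \<bar>l - m\<bar>)"
      proof (rule sum_mono)
        fix i assume "i \<in> {..<length (chips f e)}"
        then have i: "i < length (chips f e)" by simp
        have k0: "0 \<le> ?k e i" using mult_pos(2)[OF f i] by simp
        have "\<bar>max 0 (t - ?p l i) - max 0 (t - ?p m i)\<bar> \<le> \<bar>?p l i - ?p m i\<bar>" by (auto simp: max_def)
        also have "?p l i - ?p m i = (chips g e ! i - chips f e ! i) * (l - m)" by (simp add: pos_def algebra_simps)
        also have "\<bar>(chips g e ! i - chips f e ! i) * (l - m)\<bar> \<le> len G e * \<bar>l - m\<bar>"
          unfolding abs_mult using mult_pos(3,4)[OF f i] mult_pos(3,4)[OF g, of i e] i relatedD(3)[OF R 2(1) f g]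
          by (intro mult_right_mono) auto
        finally show "\<bar>?k e i * (max 0 (t - ?p l i) - max 0 (t - ?p m i))\<bar> \<le> ?k e i * len G e * \<bar>l - m\<bar>"
          unfolding abs_mult using k0 by (simp add: mult.assoc mult_left_mono)
      qed
      also have "\<dots> = CE e * \<bar>l - m\<bar>" by (simp add: CE_def sum_distrib_right)
      finally have "\<bar>move_chips f g l y - move_chips f g m y\<bar> \<le> CV * \<bar>l - m\<bar> + CE e * \<bar>l - m\<bar>"
        using vx[OF edgeD(1)[OF 2(1)]] 2(2,3) unfolding 2(5) move_chips_edge[OF R 2(1) f g l less_imp_le[OF 2(2)] less_imp_le[OF 2(3)]] move_chips_edge[OF R 2(1) f g m less_imp_le[OF 2(2)] less_imp_le[OF 2(3)]]
        by linarith
      also have "\<dots> \<le> C * \<bar>l - m\<bar>" unfolding distrib_right[symmetric] using CEs[OF 2(1)] by (intro mult_right_mono) (auto simp: C_def)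
      finally show ?thesis .
    qed
  qed
qed

section \<open>Cells as classes of related functions\<close>

lemma same_type_sym: "same_type G F F' \<Longrightarrow> same_type G F' F" and same_type_trans: "same_type G F F' \<Longrightarrow> same_type G F' F'' \<Longrightarrow> same_type G F F''"
  by (auto simp: same_type_def)

lemma E_continuous: "continuous_map (uniform_topology \<Gamma> RR) LTop E"
  unfolding linear_system_topology_def by (rule quotient_imp_continuous_map[OF quotient_map_quotient_topology])

lemma related_same_component:
  assumes R: "related f g" and f: "f \<in> RR" and g: "g \<in> RR"
  obtains C where "connectedin LTop C" "E f \<in> C" "E g \<in> C" "C \<subseteq> {F \<in> LS. same_type G (E f) F}"
proof -
  obtain K where K: "0 < K" "\<And>l m y. 0 \<le> l \<Longrightarrow> l \<le> 1 \<Longrightarrow> 0 \<le> m \<Longrightarrow> m \<le> 1 \<Longrightarrow> y \<in> \<Gamma> \<Longrightarrow> \<bar>move_chips f g l y - move_chips f g m y\<bar> \<le> K * \<bar>l - m\<bar>"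
    using mv_Lipschitz[OF R f g] by blast
  have "continuous_map (top_of_set {0..1}) (uniform_topology \<Gamma> RR) (move_chips f g)"
    unfolding continuous_map_def
  proof (intro conjI allI impI)
    show "move_chips f g \<in> topspace (top_of_set {0..1}) \<rightarrow> topspace (uniform_topology \<Gamma> RR)" using move_chips_related(1)[OF R f g] by simp
    fix U assume U: "openin (uniform_topology \<Gamma> RR) U"
    show "openin (top_of_set {0..1}) {x \<in> topspace (top_of_set {0..1}). move_chips f g x \<in> U}"
      unfolding openin_contains_ball
    proof (intro conjI ballI)
      fix l assume "l \<in> {x \<in> topspace (top_of_set {0..1}). move_chips f g x \<in> U}"
      then have l: "0 \<le> l" "l \<le> 1" "move_chips f g l \<in> U" by auto
      obtain \<epsilon> where \<epsilon>: "\<epsilon> > 0" "\<And>h. h \<in> RR \<Longrightarrow> (\<forall>x\<in>\<Gamma>. \<bar>h x - move_chips f g l x\<bar> < \<epsilon>) \<Longrightarrow> h \<in> U"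
        using U l(3) unfolding openin_uniform_topology by blast
      have "move_chips f g m \<in> U" if m: "0 \<le> m" "m \<le> 1" "\<bar>l - m\<bar> < \<epsilon> / K" for m
      proof (rule \<epsilon>(2)[OF move_chips_related(1)[OF R f g m(1,2)]], rule ballI)
        fix x assume "x \<in> \<Gamma>"
        then have "\<bar>move_chips f g m x - move_chips f g l x\<bar> \<le> K * \<bar>l - m\<bar>" using K(2)[OF m(1,2) l(1,2)] by (simp add: abs_minus_commute)
        also have "\<dots> < \<epsilon>" using m(3) K(1) by (simp add: field_simps)
        finally show "\<bar>move_chips f g m x - move_chips f g l x\<bar> < \<epsilon>" .
      qed
      then show "\<exists>e>0. ball l e \<inter> {0..1} \<subseteq> {x \<in> topspace (top_of_set {0..1}). move_chips f g x \<in> U}"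
        using \<epsilon>(1) K(1) by (intro exI[of _ "\<epsilon> / K"]) (auto simp: dist_real_def)
    qed auto
  qed
  from continuous_map_compose[OF this E_continuous]
  have "connectedin LTop ((E \<circ> move_chips f g) ` {0..1})"
    by (rule connectedin_continuous_map_image) (simp add: connectedin_subtopology)
  moreover have "E f \<in> (E \<circ> move_chips f g) ` {0..1}" using move_chips_ends(1)[OF R f g] by (intro image_eqI[of _ _ 0]) auto
  moreover have "E g \<in> (E \<circ> move_chips f g) ` {0..1}" using move_chips_ends(2)[OF R f g] by (intro image_eqI[of _ _ 1]) auto
  moreover have "(E \<circ> move_chips f g) ` {0..1} \<subseteq> {F \<in> LS. same_type G (E f) F}"
    using move_chips_related[OF R f g] linear_system_eq by (auto simp: related_def)
  ultimately show ?thesis by (rule that)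
qed

text \<open>Interpolation joins the two divisors within one type, and the component of a vertex in
  its type is a single point.\<close>

lemma cell_vertex_related_eq:
  assumes V: "E f \<in> cell_vertices G D" and f: "f \<in> RR" and g: "g \<in> RR" and R: "related f g"
  shows "E g = E f"
proof -
  obtain F0 where F0: "F0 \<in> LS" "{E f} \<in> connected_components_of (subtopology LTop {F \<in> LS. same_type G F0 F})"
    using V by (auto simp: cell_vertices_def open_cells_def)
  have "E f \<in> topspace (subtopology LTop {F \<in> LS. same_type G F0 F})" using connected_components_of_subset[OF F0(2)] by blast
  then have st: "same_type G F0 (E f)" by simp
  obtain C where C: "connectedin LTop C" "E f \<in> C" "E g \<in> C" "C \<subseteq> {F \<in> LS. same_type G (E f) F}"
    using related_same_component[OF R f g] by blast
  have "C \<subseteq> {F \<in> LS. same_type G F0 F}" using C(4) same_type_trans[OF st] by blast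
  then have "connectedin (subtopology LTop {F \<in> LS. same_type G F0 F}) C" using C(1) by (simp add: connectedin_subtopology)
  from connected_components_of_maximal[OF F0(2) this] have "C \<subseteq> {E f}" using C(2) by (simp add: disjnt_def)
  then show ?thesis using C(3) by blast
qed

text \<open>Next to a vertex \<open>E f\<close> vanishes, so the difference \<open>u = g - f\<close>
  is convex along each arm; being uniformly small, it has slope less than \<open>1\<close>, hence at
  most \<open>0\<close>. The divisors agree at the vertex, so these slopes add up to zero and all
  vanish.\<close>

lemma near_same_type_slopes:
  assumes f: "f \<in> RR"
  obtains \<epsilon> where "\<epsilon> > 0" "\<And>g. g \<in> RR \<Longrightarrow> (\<forall>x\<in>\<Gamma>. \<bar>g x - f x\<bar> < \<epsilon>) \<Longrightarrow> same_type G (E f) (E g) \<Longrightarrow> related f g"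
proof -
  define TT where "TT = (\<Union>v\<in>verts G. tangents G (Vertex v))"
  have finT: "finite TT" unfolding TT_def using finite_verts finite_tangents by blast
  have finE: "finite {x. E f x \<noteq> 0}" using add_div_divisors[OF RR_pl[OF f]] by (simp add: divisors_def)
  have "\<forall>\<tau>\<in>TT. \<exists>r. r > 0 \<and> (\<forall>h. 0 < h \<and> h < r \<longrightarrow> E f (ray G \<tau> h) = 0 \<and> (case \<tau> of (e, t, s) \<Rightarrow> 0 < t + s * h \<and> t + s * h < len G e))"
  proof
    fix \<tau> assume "\<tau> \<in> TT"
    then obtain v where \<tau>0: "\<tau> \<in> tangents G (Vertex v)" by (auto simp: TT_def)
    obtain e t s where \<tau>: "\<tau> = (e, t, s)" by (cases \<tau>)
    obtain R where R: "R > 0" "\<And>h. 0 < h \<Longrightarrow> h < R \<Longrightarrow> 0 < t + s * h \<and> t + s * h < len G e"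
      using tangent_arm[OF \<tau>0[unfolded \<tau>]] by metis
    obtain q where q: "q > 0" "\<And>h. 0 < h \<Longrightarrow> h < q \<Longrightarrow> ray G \<tau> h \<notin> {x. E f x \<noteq> 0}"
      using near_notin_finite[OF \<tau>0 finE] unfolding near_iff by blast
    show "\<exists>r. r > 0 \<and> (\<forall>h. 0 < h \<and> h < r \<longrightarrow> E f (ray G \<tau> h) = 0 \<and> (case \<tau> of (e, t, s) \<Rightarrow> 0 < t + s * h \<and> t + s * h < len G e))"
      using R q by (intro exI[of _ "min R q"]) (auto simp: \<tau>)
  qed
  from bchoice[OF this] obtain r where r0: "\<forall>\<tau>\<in>TT. r \<tau> > 0 \<and> (\<forall>h. 0 < h \<and> h < r \<tau> \<longrightarrow> E f (ray G \<tau> h) = 0 \<and> (case \<tau> of (e, t, s) \<Rightarrow> 0 < t + s * h \<and> t + s * h < len G e))" ..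
  \<comment> \<open>The quarter makes the oscillation of \<open>u\<close>, which is below
    \<open>2 * \<epsilon>\<close>, at most half an arm length, so over that half a slope of
    \<open>1\<close> is impossible. The entry \<open>1\<close> covers a curve without edges.\<close>
  define \<epsilon> where "\<epsilon> = Min (insert 1 (r ` TT)) / 4"
  have \<epsilon>: "\<epsilon> > 0" unfolding \<epsilon>_def using finT r0 by (simp add: Min_gr_iff)
  have \<epsilon>r: "4 * \<epsilon> \<le> r \<tau>" if "\<tau> \<in> TT" for \<tau> unfolding \<epsilon>_def using finT that by simp
  show ?thesis
  proof (rule that[OF \<epsilon>])
    fix g assume g: "g \<in> RR" and near: "\<forall>x\<in>\<Gamma>. \<bar>g x - f x\<bar> < \<epsilon>" and st: "same_type G (E f) (E g)"
    define u where "u y = g y - f y" for y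
    have plu: "pl G u" unfolding u_def by (rule pl_diff[OF RR_pl[OF g] RR_pl[OF f]])
    have ou: "ord_at G u x = E g x - E f x" for x unfolding u_def ord_at_diff[OF RR_pl[OF g] RR_pl[OF f]] add_div_def by simp
    have sl0: "slope G u \<tau> = 0" if v: "v \<in> verts G" and \<tau>0: "\<tau> \<in> tangents G (Vertex v)" for v \<tau>
    proof -
      have le: "slope G u \<sigma> \<le> 0" if \<sigma>0: "\<sigma> \<in> tangents G (Vertex v)" for \<sigma>
      proof -
        obtain e t s where \<sigma>: "\<sigma> = (e, t, s)" by (cases \<sigma>)
        have TT: "\<sigma> \<in> TT" using v \<sigma>0 by (auto simp: TT_def)
        have r: "r \<sigma> > 0" "\<And>h. 0 < h \<Longrightarrow> h < r \<sigma> \<Longrightarrow> E f (ray G \<sigma> h) = 0" "\<And>h. 0 < h \<Longrightarrow> h < r \<sigma> \<Longrightarrow> 0 < t + s * h \<and> t + s * h < len G e"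
          using bspec[OF r0 TT] unfolding \<sigma> by auto
        have "u (ray G \<sigma> (r \<sigma> / 2)) \<ge> u (ray G \<sigma> 0) + of_int (slope G u (e, t + s * 0, s)) * (r \<sigma> / 2 - 0)"
          unfolding \<sigma>
        proof (rule arm_convex[OF plu \<sigma>0[unfolded \<sigma>], of "r (e,t,s)"])
          fix h assume "0 < h" "h < r (e, t, s)"
          then show "0 < t + s * h \<and> t + s * h < len G e" "0 \<le> ord_at G u (ray G (e, t, s) h)"
            using r(2,3)[unfolded \<sigma>] E_nonneg[OF g] by (simp_all add: ou)
        qed (use r(1)[unfolded \<sigma>] in auto)
        moreover have "\<bar>u (ray G \<sigma> (r \<sigma> / 2))\<bar> < \<epsilon>" "\<bar>u (ray G \<sigma> 0)\<bar> < \<epsilon>" using near ray_in[OF \<sigma>0] by (auto simp: u_def)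
        ultimately have "of_int (slope G u \<sigma>) * (r \<sigma> / 2) < 2 * \<epsilon>" unfolding \<sigma> by simp
        also have "\<dots> \<le> r \<sigma> / 2" using \<epsilon>r[OF TT] by simp
        finally have "of_int (slope G u \<sigma>) * (r \<sigma> / 2) < 1 * (r \<sigma> / 2)" by simp
        then have "real_of_int (slope G u \<sigma>) < 1" using r(1) by (simp only: mult_less_cancel_right)
        then show ?thesis by linarith
      qed
      have "E g (Vertex v) = E f (Vertex v)" using st v by (simp add: same_type_def)
      then have "(\<Sum>\<sigma>\<in>tangents G (Vertex v). - slope G u \<sigma>) = 0" using ou[of "Vertex v"] by (simp add: ord_at_slope sum_negf)
      then have "- slope G u \<tau> = 0" using sum_nonneg_0[OF finite_tangents _ _ \<tau>0, of "\<lambda>\<sigma>. - slope G u \<sigma>"] le by simp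
      then show ?thesis by simp
    qed
    have "slope G f (e, 0, 1) = slope G g (e, 0, 1)" if e: "e \<in> edges G" for e
    proof -
      have \<tau>: "(e, 0, 1) \<in> tangents G (Vertex (fst e))" using e by (auto simp: tangents_Vertex)
      show ?thesis using sl0[OF edgeD(1)[OF e] \<tau>] slope_diff[OF RR_pl[OF g] RR_pl[OF f] \<tau>] unfolding u_def by simp
    qed
    then show "related f g" unfolding related_def using st by blast
  qed
qed

lemma related_sym: "related f g \<Longrightarrow> related g f" and related_trans: "related f g \<Longrightarrow> related g h \<Longrightarrow> related f h"
  unfolding related_def using same_type_sym same_type_trans by (metis, metis)

text \<open>Around each member of the class a uniform ball contains, within the type, only related
  functions. The union \<open>W\<close> of these balls is open, and so is its image by
  \<open>E_open\<close>.\<close>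

lemma openin_related_class:
  assumes f: "f \<in> RR"
  shows "openin (subtopology LTop {F \<in> LS. same_type G (E f) F}) {E g | g. g \<in> RR \<and> related f g}"
proof -
  \<comment> \<open>Distance at most some \<open>\<eta> < \<epsilon>\<close> is used because a
    strict bound at each point alone leaves no uniform margin.\<close>
  define W where "W = {g \<in> RR. \<exists>w\<in>RR. related f w \<and> (\<exists>\<epsilon>>0. (\<forall>h\<in>RR. (\<forall>x\<in>\<Gamma>. \<bar>h x - w x\<bar> < \<epsilon>) \<longrightarrow> same_type G (E w) (E h) \<longrightarrow> related w h) \<and> (\<exists>\<eta><\<epsilon>. \<forall>x\<in>\<Gamma>. \<bar>g x - w x\<bar> \<le> \<eta>))}"
  have "openin (uniform_topology \<Gamma> RR) W" unfolding openin_uniform_topology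
  proof (intro conjI ballI)
    show "W \<subseteq> RR" by (auto simp: W_def)
    fix g assume "g \<in> W"
    then obtain w \<epsilon> \<eta> where w: "w \<in> RR" "related f w" "\<epsilon> > 0" "\<forall>h\<in>RR. (\<forall>x\<in>\<Gamma>. \<bar>h x - w x\<bar> < \<epsilon>) \<longrightarrow> same_type G (E w) (E h) \<longrightarrow> related w h" "\<eta> < \<epsilon>" "\<forall>x\<in>\<Gamma>. \<bar>g x - w x\<bar> \<le> \<eta>" "g \<in> RR"
      unfolding W_def by blast
    have "g' \<in> W" if g': "g' \<in> RR" "\<forall>x\<in>\<Gamma>. \<bar>g' x - g x\<bar> < (\<epsilon> - \<eta>) / 2" for g'
    proof -
      have "\<forall>x\<in>\<Gamma>. \<bar>g' x - w x\<bar> \<le> (\<epsilon> + \<eta>) / 2"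
      proof
        fix x assume x: "x \<in> \<Gamma>"
        have "\<bar>g' x - w x\<bar> \<le> \<bar>g' x - g x\<bar> + \<bar>g x - w x\<bar>" by linarith
        also have "\<dots> \<le> (\<epsilon> - \<eta>) / 2 + \<eta>" using g'(2) w(6) x by (intro add_mono) (auto intro: less_imp_le)
        finally show "\<bar>g' x - w x\<bar> \<le> (\<epsilon> + \<eta>) / 2" by (simp add: field_simps)
      qed
      moreover have "(\<epsilon> + \<eta>) / 2 < \<epsilon>" using w(5) by simp
      ultimately show ?thesis unfolding W_def using g'(1) w(1-4) by blast
    qed
    then show "\<exists>\<epsilon>>0. \<forall>g'\<in>RR. (\<forall>x\<in>\<Gamma>. \<bar>g' x - g x\<bar> < \<epsilon>) \<longrightarrow> g' \<in> W" using w(5) by (intro exI[of _ "(\<epsilon> - \<eta>) / 2"]) simp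
  qed
  then have "openin LTop (E ` W)" by (rule E_open)
  moreover have "{E g | g. g \<in> RR \<and> related f g} = E ` W \<inter> {F \<in> LS. same_type G (E f) F}"
  proof (rule set_eqI, rule iffI)
    fix F assume "F \<in> {E g | g. g \<in> RR \<and> related f g}"
    then obtain g where g: "F = E g" "g \<in> RR" "related f g" by blast
    obtain \<epsilon> where \<epsilon>: "\<epsilon> > 0" "\<And>h. h \<in> RR \<Longrightarrow> (\<forall>x\<in>\<Gamma>. \<bar>h x - g x\<bar> < \<epsilon>) \<Longrightarrow> same_type G (E g) (E h) \<Longrightarrow> related g h"
      using near_same_type_slopes[OF g(2)] by blast
    have "g \<in> W" unfolding W_def using g(2,3) \<epsilon> by (intro CollectI conjI bexI[of _ g] exI[of _ \<epsilon>] ballI impI exI[of _ "0::real"]) auto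
    moreover have "F \<in> {F \<in> LS. same_type G (E f) F}" using g linear_system_eq by (auto simp: related_def)
    ultimately show "F \<in> E ` W \<inter> {F \<in> LS. same_type G (E f) F}" using g(1) by blast
  next
    fix F assume "F \<in> E ` W \<inter> {F \<in> LS. same_type G (E f) F}"
    then obtain g where g: "g \<in> W" "F = E g" "same_type G (E f) (E g)" by blast
    then obtain w \<epsilon> \<eta> where w: "w \<in> RR" "related f w" "\<forall>h\<in>RR. (\<forall>x\<in>\<Gamma>. \<bar>h x - w x\<bar> < \<epsilon>) \<longrightarrow> same_type G (E w) (E h) \<longrightarrow> related w h" "\<eta> < \<epsilon>" "\<forall>x\<in>\<Gamma>. \<bar>g x - w x\<bar> \<le> \<eta>" "g \<in> RR"
      unfolding W_def by blast
    have "same_type G (E w) (E g)" using w(2) g(3) same_type_sym same_type_trans unfolding related_def by blast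
    moreover have "\<forall>x\<in>\<Gamma>. \<bar>g x - w x\<bar> < \<epsilon>" using w(4,5) by force
    ultimately have "related w g" using w(3,6) by blast
    then have "related f g" using related_trans w(2) by blast
    then show "F \<in> {E g | g. g \<in> RR \<and> related f g}" using g(2) w(6) by blast
  qed
  ultimately show ?thesis unfolding openin_subtopology by blast
qed

text \<open>If the class of \<open>f\<close> contained only one divisor, this divisor would be open
  in its type; the rest of the type is a union of classes and open too. The point would be a
  component, hence a vertex.\<close>

lemma not_cell_vertex_related:
  assumes f: "f \<in> RR" and n: "E f \<notin> cell_vertices G D"
  obtains g where "g \<in> RR" "related f g" "E g \<noteq> E f"
proof (rule ccontr)
  assume nt: "\<not> thesis"
  let ?T = "{F \<in> LS. same_type G (E f) F}"
  let ?X = "subtopology LTop ?T"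
  have single: "{E g | g. g \<in> RR \<and> related f g} = {E f}"
  proof -
    have "related f f" by (simp add: related_def same_type_def)
    then show ?thesis using nt that f by blast
  qed
  have o1: "openin ?X {E f}" using openin_related_class[OF f] unfolding single .
  have EfX: "E f \<in> topspace ?X" using f linear_system_eq by (auto simp: same_type_def)
  have "openin ?X (topspace ?X - {E f})"
  proof (subst openin_subopen, rule ballI)
    fix F assume F: "F \<in> topspace ?X - {E f}"
    then obtain g where g: "g \<in> RR" "F = E g" "same_type G (E f) (E g)" using linear_system_eq by auto
    have "{F \<in> LS. same_type G (E g) F} = ?T" using g(3) same_type_sym same_type_trans by blast
    then have "openin ?X {E h | h. h \<in> RR \<and> related g h}" using openin_related_class[OF g(1)] by simp
    moreover have "F \<in> {E h | h. h \<in> RR \<and> related g h}" using g(1,2) by (auto simp: related_def same_type_def)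
    moreover have "{E h | h. h \<in> RR \<and> related g h} \<subseteq> topspace ?X - {E f}"
    proof
      fix H assume "H \<in> {E h | h. h \<in> RR \<and> related g h}"
      then obtain h where h: "H = E h" "h \<in> RR" "related g h" by blast
      have "same_type G (E f) (E h)" using g(3) h(3) same_type_trans unfolding related_def by blast
      then have "H \<in> topspace ?X" using h linear_system_eq by auto
      \<comment> \<open>Equal divisors mean equal functions up to a constant, which does not affect
        slopes; so \<open>h\<close> would be related to \<open>f\<close>, and \<open>g\<close> with
        it.\<close>
      moreover have "H \<noteq> E f"
      proof
        assume "H = E f"
        then have "E h = E f" using h(1) by simp
        then obtain c where c: "h = (\<lambda>x\<in>\<Gamma>. c + f x)" using add_div_eq_iff[OF h(2) f] by blast
        have "slope G h \<tau> = slope G f \<tau>" if "\<tau> \<in> tangents G x" for \<tau> x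
        proof -
          have "slope G h \<tau> = slope G (\<lambda>y. c + f y) \<tau>" using that unfolding c by (intro slope_cong) auto
          then show ?thesis using slope_add[OF pl_const RR_pl[OF f] that] slope_const[OF that] by simp
        qed
        moreover have "(e, 0, 1) \<in> tangents G (Vertex (fst e))" if "e \<in> edges G" for e using that by (auto simp: tangents_Vertex)
        ultimately have "related h f" using h \<open>H = E f\<close> unfolding related_def same_type_def by metis
        then have "related f g" using h(3) related_sym related_trans by blast
        then have "E g \<in> {E g | g. g \<in> RR \<and> related f g}" using g(1) by blast
        then show False using single F g(2) by blast
      qed
      ultimately show "H \<in> topspace ?X - {E f}" by blast
    qed
    ultimately show "\<exists>T. openin ?X T \<and> F \<in> T \<and> T \<subseteq> topspace ?X - {E f}" by blast
  qed
  then have c1: "closedin ?X {E f}" using EfX by (simp add: closedin_def)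
  have "connected_component_of_set ?X (E f) \<subseteq> {E f}"
    using connectedin_clopen_cases[OF connectedin_connected_component_of c1 o1, of "E f"] EfX connected_component_of_refl[of ?X "E f"]
    by (auto simp: disjnt_def)
  then have "connected_component_of_set ?X (E f) = {E f}" using EfX connected_component_of_refl[of ?X "E f"] by blast
  then have "{E f} \<in> connected_components_of ?X" using EfX connected_component_in_connected_components_of[of ?X "E f"] by simp
  moreover have "E f \<in> LS" using f linear_system_eq by blast
  ultimately have "E f \<in> cell_vertices G D" unfolding cell_vertices_def open_cells_def by blast
  with n show False by blast
qed

end

section \<open>Vertices beyond a point\<close>

context div_class
begin

definition chip_set :: "('a point \<Rightarrow> int) \<Rightarrow> 'a point set" where
  "chip_set F = {Inner e t | e t. e \<in> edges G \<and> 0 < t \<and> t < len G e \<and> F (Inner e t) \<noteq> 0}"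

text \<open>The difference of two related functions, freed of the contribution of the moving chips, is a
  function \<open>b\<close> that can only jump at chips; it is constant only if no chip moves. Its level sets
  cut the curve.\<close>

lemma related_locally_constant:
  assumes R: "related f g" and f: "f \<in> RR" and g: "g \<in> RR" and ne: "E g \<noteq> E f"
  obtains b :: "'a point \<Rightarrow> real" and y0 y1 where "\<And>y \<tau>. y \<in> \<Gamma> \<Longrightarrow> \<tau> \<in> tangents G y \<Longrightarrow> \<exists>c. near G \<tau> (\<lambda>z. b z = c)"
    "\<And>y \<tau>. y \<in> \<Gamma> - chip_set (E f) \<Longrightarrow> \<tau> \<in> tangents G y \<Longrightarrow> near G \<tau> (\<lambda>z. b z = b y)"
    "y0 \<in> \<Gamma> - chip_set (E f)" "y1 \<in> \<Gamma> - chip_set (E f)" "b y1 \<noteq> b y0"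
proof -
  let ?n = "\<lambda>e. length (chips f e)"
  let ?k = "\<lambda>e i. real_of_int (mult_seq G (E f) e ! i)"
  \<comment> \<open>Shifting a chip of multiplicity \<open>k\<close> from \<open>x\<close> to
    \<open>x'\<close> changes the function beyond both positions by \<open>k * (x - x')\<close>.
    \<open>\<beta>\<close> accumulates these changes, placing each jump at the position of the chip
    for \<open>f\<close>.\<close>
  define d where "d e i = ?k e i * (chips f e ! i - chips g e ! i)" for e i
  define hV where "hV v = g (Vertex v) - f (Vertex v)" for v
  define \<beta> where "\<beta> e t = hV (fst e) + (\<Sum>i<?n e. if chips f e ! i < t then d e i else 0)" for e t
  define b where "b y = (case y of Vertex v \<Rightarrow> hV v | Inner e t \<Rightarrow> \<beta> e t)" for y
  have xs: "0 < chips f e ! i" "chips f e ! i < len G e" if "i < ?n e" for e i using mult_pos(3,4)[OF f that] .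
  have b_edge: "b (edge_point G e t) = \<beta> e t" if e: "e \<in> edges G" and t: "0 \<le> t" "t \<le> len G e" for e t
  proof -
    note ln = relatedD(3)[OF R e f g]
    consider "t = 0" | "t = len G e" | "0 < t" "t < len G e" using t by linarith
    then show ?thesis
    proof cases
      case 1
      have "(\<Sum>i<?n e. if chips f e ! i < 0 then d e i else 0) = 0" using xs[of _ e] by (intro sum.neutral) (auto dest: less_asym)
      then show ?thesis using 1 e by (simp add: b_def \<beta>_def)
    next
      case 2
      have L: "0 \<le> len G e" using edgeD(4)[OF e] by simp
      have hinge: "(\<Sum>i<?n e. ?k e i * max 0 (len G e - q i)) = (\<Sum>i<?n e. ?k e i * (len G e - q i))"
        if "\<And>i. i < ?n e \<Longrightarrow> q i < len G e" for q
      proof (rule sum.cong[OF refl])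
        fix i assume "i \<in> {..<?n e}"
        then show "?k e i * max 0 (len G e - q i) = ?k e i * (len G e - q i)" using that[of i] by simp
      qed
      have F: "f (Vertex (snd e)) = f (Vertex (fst e)) + of_int (slope G f (e, 0, 1)) * len G e + (\<Sum>i<?n e. ?k e i * (len G e - chips f e ! i)) - D_part e (len G e)"
        using chip_formula[OF f e L order_refl] hinge[of "\<lambda>i. chips f e ! i"] mult_pos(4)[OF f] e by simp
      have Gg: "g (Vertex (snd e)) = g (Vertex (fst e)) + of_int (slope G f (e, 0, 1)) * len G e + (\<Sum>i<?n e. ?k e i * (len G e - chips g e ! i)) - D_part e (len G e)"
        using chip_formula[OF g e L order_refl] hinge[of "\<lambda>i. chips g e ! i"] mult_pos(4)[OF g] relatedD[OF R e f g] e by simp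
      have "hV (snd e) = hV (fst e) + ((\<Sum>i<?n e. ?k e i * (len G e - chips g e ! i)) - (\<Sum>i<?n e. ?k e i * (len G e - chips f e ! i)))"
        unfolding hV_def F Gg by simp
      also have "(\<Sum>i<?n e. ?k e i * (len G e - chips g e ! i)) - (\<Sum>i<?n e. ?k e i * (len G e - chips f e ! i)) = (\<Sum>i<?n e. d e i)"
        unfolding sum_subtractf[symmetric] by (intro sum.cong refl) (simp add: d_def algebra_simps)
      also have "(\<Sum>i<?n e. d e i) = (\<Sum>i<?n e. if chips f e ! i < len G e then d e i else 0)"
        using xs(2)[of _ e] by (intro sum.cong) auto
      finally show ?thesis using 2 e by (simp add: b_def \<beta>_def)
    next
      case 3 then show ?thesis using e by (simp add: b_def)
    qed
  qed
  have \<beta>r: "\<forall>\<^sub>F h in at_right 0. \<beta> e (t + h) = hV (fst e) + (\<Sum>i<?n e. if chips f e ! i \<le> t then d e i else 0)" for e t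
  proof -
    have "\<forall>\<^sub>F h in at_right 0. chips f e ! i < t + h \<longleftrightarrow> chips f e ! i \<le> t" for i
      unfolding eventually_at_right_0 by (intro exI[of _ "if chips f e ! i \<le> t then 1 else chips f e ! i - t"]) auto
    then have "\<forall>\<^sub>F h in at_right 0. \<forall>i\<in>{..<?n e}. chips f e ! i < t + h \<longleftrightarrow> chips f e ! i \<le> t"
      by (intro eventually_ball_finite) auto
    then show ?thesis
    proof (rule eventually_mono)
      fix h :: real assume "\<forall>i\<in>{..<?n e}. chips f e ! i < t + h \<longleftrightarrow> chips f e ! i \<le> t"
      then have "(\<Sum>i<?n e. if chips f e ! i < t + h then d e i else 0) = (\<Sum>i<?n e. if chips f e ! i \<le> t then d e i else 0)"
        by (intro sum.cong) auto
      then show "\<beta> e (t + h) = hV (fst e) + (\<Sum>i<?n e. if chips f e ! i \<le> t then d e i else 0)" by (simp add: \<beta>_def)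
    qed
  qed
  have \<beta>l: "\<forall>\<^sub>F h in at_right 0. \<beta> e (t - h) = \<beta> e t" for e t
  proof -
    have "\<forall>\<^sub>F h in at_right 0. chips f e ! i < t - h \<longleftrightarrow> chips f e ! i < t" for i
      unfolding eventually_at_right_0 by (intro exI[of _ "if chips f e ! i < t then t - chips f e ! i else 1"]) auto
    then have "\<forall>\<^sub>F h in at_right 0. \<forall>i\<in>{..<?n e}. chips f e ! i < t - h \<longleftrightarrow> chips f e ! i < t"
      by (intro eventually_ball_finite) auto
    then show ?thesis
    proof (rule eventually_mono)
      fix h :: real assume "\<forall>i\<in>{..<?n e}. chips f e ! i < t - h \<longleftrightarrow> chips f e ! i < t"
      then have "(\<Sum>i<?n e. if chips f e ! i < t - h then d e i else 0) = (\<Sum>i<?n e. if chips f e ! i < t then d e i else 0)"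
        by (intro sum.cong) auto
      then show "\<beta> e (t - h) = \<beta> e t" by (simp add: \<beta>_def)
    qed
  qed
  have nb: "near G (e, t, s) (\<lambda>z. b z = (if s = 1 then hV (fst e) + (\<Sum>i<?n e. if chips f e ! i \<le> t then d e i else 0) else \<beta> e t))"
    if \<tau>: "(e, t, s) \<in> tangents G y" for e t s y
  proof -
    note TD = tangentD[OF \<tau>]
    obtain R where R: "R > 0" "\<And>h. 0 < h \<Longrightarrow> h < R \<Longrightarrow> 0 < t + s * h \<and> t + s * h < len G e"
      using tangent_arm[OF \<tau>] by metis
    have "\<forall>\<^sub>F h in at_right 0. 0 < h \<and> h < R" using R(1) unfolding eventually_at_right_0 by (intro exI[of _ R]) auto
    then have "\<forall>\<^sub>F h in at_right 0. b (ray G (e, t, s) h) = \<beta> e (t + s * h)"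
      by (rule eventually_mono) (use b_edge[OF TD(1)] R(2) in \<open>simp add: ray_def less_imp_le\<close>)
    moreover have "\<forall>\<^sub>F h in at_right 0. \<beta> e (t + s * h) = (if s = 1 then hV (fst e) + (\<Sum>i<?n e. if chips f e ! i \<le> t then d e i else 0) else \<beta> e t)"
      using TD(5) \<beta>r[of e t] \<beta>l[of e t] by (cases "s = 1") auto
    ultimately show ?thesis unfolding near_def by eventually_elim simp
  qed
  have B1: "\<exists>c. near G \<tau> (\<lambda>z. b z = c)" if "\<tau> \<in> tangents G y" for y \<tau>
  proof -
    obtain e t s where \<tau>: "\<tau> = (e, t, s)" by (cases \<tau>)
    show ?thesis using nb[OF that[unfolded \<tau>]] unfolding \<tau> by (rule exI)
  qed
  have B2: "near G \<tau> (\<lambda>z. b z = b y)" if y: "y \<in> \<Gamma> - chip_set (E f)" and \<tau>0: "\<tau> \<in> tangents G y" for y \<tau>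
  proof -
    obtain e t s where \<tau>: "\<tau> = (e, t, s)" by (cases \<tau>)
    note TD = tangentD[OF \<tau>0[unfolded \<tau>]]
    have "chips f e ! i \<noteq> t" if i: "i < ?n e" for i
    proof
      assume eq: "chips f e ! i = t"
      then have "0 < t" "t < len G e" using xs[OF i] by auto
      moreover have "E f (Inner e t) \<noteq> 0" using mult_pos(1,2)[OF f i] eq by simp
      ultimately have "Inner e t \<in> chip_set (E f)" unfolding chip_set_def using TD(1) by blast
      then show False using y TD(1,4) \<open>0 < t\<close> \<open>t < len G e\<close> by simp
    qed
    then have "(\<Sum>i<?n e. if chips f e ! i \<le> t then d e i else 0) = (\<Sum>i<?n e. if chips f e ! i < t then d e i else 0)"
      by (intro sum.cong) (auto simp: less_le)
    then have "(if s = 1 then hV (fst e) + (\<Sum>i<?n e. if chips f e ! i \<le> t then d e i else 0) else \<beta> e t) = \<beta> e t" by (simp add: \<beta>_def)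
    moreover have "b y = \<beta> e t" using b_edge[OF TD(1-3)] TD(4) by simp
    ultimately show ?thesis using nb[OF \<tau>0[unfolded \<tau>]] unfolding \<tau> by simp
  qed
  have "\<exists>y0 y1. y0 \<in> \<Gamma> - chip_set (E f) \<and> y1 \<in> \<Gamma> - chip_set (E f) \<and> b y1 \<noteq> b y0"
  proof (rule ccontr)
    assume "\<not> ?thesis"
    then have const: "\<And>y0 y1. y0 \<in> \<Gamma> - chip_set (E f) \<Longrightarrow> y1 \<in> \<Gamma> - chip_set (E f) \<Longrightarrow> b y1 = b y0" by blast
    have finI: "finite (chip_set (E f))"
    proof (rule finite_subset)
      show "chip_set (E f) \<subseteq> {x. E f x \<noteq> 0}" by (auto simp: chip_set_def)
      show "finite {x. E f x \<noteq> 0}" using add_div_divisors[OF RR_pl[OF f]] by (simp add: divisors_def)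
    qed
    have eqx: "chips f e ! i = chips g e ! i" if e: "e \<in> edges G" and i: "i < ?n e" for e i
    proof -
      define t where "t = chips f e ! i"
      have t: "0 < t" "t < len G e" using xs[OF i] by (auto simp: t_def)
      have T1: "(e, t, 1) \<in> tangents G (Inner e t)" "(e, t, -1) \<in> tangents G (Inner e t)" using tangents_Inner[OF e t] by auto
      \<comment> \<open>Points off the chips that realise the values of \<open>b\<close> just before
        and just after a chip; their difference is the jump at that chip.\<close>
      have pick: "\<exists>y \<in> \<Gamma> - chip_set (E f). b y = (if s = 1 then hV (fst e) + (\<Sum>i<?n e. if chips f e ! i \<le> t then d e i else 0) else \<beta> e t)" if \<tau>: "(e, t, s) \<in> tangents G (Inner e t)" for s
      proof -
        have "near G (e, t, s) (\<lambda>z. z \<in> \<Gamma>)" using ray_in[OF \<tau>] by (simp add: near_def)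
        from near_ex[OF near_conj[OF this near_conj[OF near_notin_finite[OF \<tau> finI] nb[OF \<tau>]]]] show ?thesis by blast
      qed
      obtain ya where ya: "ya \<in> \<Gamma> - chip_set (E f)" "b ya = hV (fst e) + (\<Sum>i<?n e. if chips f e ! i \<le> t then d e i else 0)" using pick[OF T1(1)] by auto
      obtain yb where yb: "yb \<in> \<Gamma> - chip_set (E f)" "b yb = \<beta> e t" using pick[OF T1(2)] by auto
      have "(\<Sum>j<?n e. if chips f e ! j \<le> t then d e j else 0) - (\<Sum>j<?n e. if chips f e ! j < t then d e j else 0) = 0"
        using const[OF ya(1) yb(1)] ya(2) yb(2) by (simp add: \<beta>_def)
      moreover have "(\<Sum>j<?n e. if chips f e ! j \<le> t then d e j else 0) - (\<Sum>j<?n e. if chips f e ! j < t then d e j else 0) = (\<Sum>j<?n e. if j = i then d e j else 0)"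
        unfolding sum_subtractf[symmetric]
      proof (rule sum.cong[OF refl])
        fix j assume "j \<in> {..<?n e}"
        then have "chips f e ! j = t \<longleftrightarrow> j = i" unfolding t_def using i chips(3)[OF f, of e] by (simp add: nth_eq_iff_index_eq)
        then show "(if chips f e ! j \<le> t then d e j else 0) - (if chips f e ! j < t then d e j else 0) = (if j = i then d e j else 0)" by auto
      qed
      ultimately have "d e i = 0" using i by simp
      then show ?thesis using mult_pos(2)[OF f i] by (simp add: d_def)
    qed
    have "E g x = E f x" for x
    proof (cases "x \<in> \<Gamma>")
      case True
      then show ?thesis
      proof (cases rule: curve_cases)
        case (1 v) then show ?thesis using R by (simp add: related_def same_type_def)
      next
        case (2 e t)
        have ch: "chips g e = chips f e" using eqx[OF 2(1)] relatedD(3)[OF R 2(1) f g] by (intro nth_equalityI) auto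
        show ?thesis
        proof (cases "t \<in> set (chips f e)")
          case True
          then obtain i where i: "i < ?n e" "chips f e ! i = t" by (auto simp: in_set_conv_nth)
          then show ?thesis using mult_pos(1)[OF f i(1)] mult_pos(1)[OF g, of i e] ch relatedD(2)[OF R 2(1) f g] 2(4) by simp
        next
          case False
          then have "t \<notin> set (chips g e)" using ch by simp
          with False show ?thesis unfolding chips(1)[OF f] chips(1)[OF g] using 2 by simp
        qed
      qed
    qed (simp add: add_div_def D_off ord_at_off)
    then show False using ne by blast
  qed
  then obtain y0 y1 where y: "y0 \<in> \<Gamma> - chip_set (E f)" "y1 \<in> \<Gamma> - chip_set (E f)" "b y1 \<noteq> b y0" by blast
  show ?thesis by (rule that[OF B1 B2 y])
qed

section \<open>Cuts of the curve at chips\<close>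

lemma finite_IS: "f \<in> RR \<Longrightarrow> finite (chip_set (E f))"
proof (rule finite_subset)
  show "chip_set (E f) \<subseteq> {x. E f x \<noteq> 0}" by (auto simp: chip_set_def)
  show "finite {x. E f x \<noteq> 0}" if "f \<in> RR" using add_div_divisors[OF RR_pl[OF that]] by (simp add: divisors_def)
qed

text \<open>A separation of the curve with the chips inside edges removed. The last clause covers
  directions that start at such chips: each of them leads into one of the two parts.\<close>

definition split :: "('a point \<Rightarrow> int) \<Rightarrow> 'a point set \<Rightarrow> 'a point set \<Rightarrow> bool" where
  "split F A A' \<longleftrightarrow> A \<union> A' = \<Gamma> - chip_set F \<and> A \<inter> A' = {} \<and> A \<noteq> {} \<and> A' \<noteq> {} \<and>
     (\<forall>y\<in>A. \<forall>\<tau>\<in>tangents G y. near G \<tau> (\<lambda>z. z \<in> A)) \<and>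
     (\<forall>y\<in>A'. \<forall>\<tau>\<in>tangents G y. near G \<tau> (\<lambda>z. z \<in> A')) \<and>
     (\<forall>y\<in>\<Gamma>. \<forall>\<tau>\<in>tangents G y. near G \<tau> (\<lambda>z. z \<in> A) \<or> near G \<tau> (\<lambda>z. z \<in> A'))"

lemma split_sym: "split F A A' \<Longrightarrow> split F A' A"
  unfolding split_def by (auto simp: Un_commute Int_commute)

text \<open>The parts are a level set of the jump function \<open>b\<close> and its complement, both
  outside the chips.\<close>

lemma not_cell_vertex_split:
  assumes f: "f \<in> RR" and n: "E f \<notin> cell_vertices G D"
  obtains A A' where "split (E f) A A'"
proof -
  obtain g where g: "g \<in> RR" "related f g" "E g \<noteq> E f" using not_cell_vertex_related[OF f n] by blast
  show ?thesis
  proof (rule related_locally_constant[OF g(2) f g(1,3)])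
    fix b :: "'a point \<Rightarrow> real" and y0 y1
    assume B1: "\<And>y \<tau>. y \<in> \<Gamma> \<Longrightarrow> \<tau> \<in> tangents G y \<Longrightarrow> \<exists>c. near G \<tau> (\<lambda>z. b z = c)"
      and B2: "\<And>y \<tau>. y \<in> \<Gamma> - chip_set (E f) \<Longrightarrow> \<tau> \<in> tangents G y \<Longrightarrow> near G \<tau> (\<lambda>z. b z = b y)"
      and y: "y0 \<in> \<Gamma> - chip_set (E f)" "y1 \<in> \<Gamma> - chip_set (E f)" "b y1 \<noteq> b y0"
    define A where "A = {y \<in> \<Gamma> - chip_set (E f). b y = b y0}"
    define A' where "A' = {y \<in> \<Gamma> - chip_set (E f). b y \<noteq> b y0}"
    have off: "near G \<tau> (\<lambda>z. z \<in> \<Gamma> - chip_set (E f))" if "\<tau> \<in> tangents G y" for \<tau> y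
    proof -
      have "near G \<tau> (\<lambda>z. z \<in> \<Gamma>)" using ray_in[OF that] by (simp add: near_def)
      from near_conj[OF this near_notin_finite[OF that finite_IS[OF f]]] show ?thesis by (rule near_mono) blast
    qed
    have nr: "near G \<tau> (\<lambda>z. z \<in> A) \<or> near G \<tau> (\<lambda>z. z \<in> A')" if y: "y \<in> \<Gamma>" "\<tau> \<in> tangents G y" for y \<tau>
    proof -
      obtain c where c: "near G \<tau> (\<lambda>z. b z = c)" using B1[OF y] by blast
      have "near G \<tau> (\<lambda>z. b z = c \<and> z \<in> \<Gamma> - chip_set (E f))" by (rule near_conj[OF c off[OF y(2)]])
      then show ?thesis
      proof (cases "c = b y0")
        case True
        have "near G \<tau> (\<lambda>z. z \<in> A)" by (rule near_mono[OF near_conj[OF c off[OF y(2)]]]) (simp add: A_def True)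
        then show ?thesis ..
      next
        case False
        have "near G \<tau> (\<lambda>z. z \<in> A')" by (rule near_mono[OF near_conj[OF c off[OF y(2)]]]) (simp add: A'_def False)
        then show ?thesis ..
      qed
    qed
    have "split (E f) A A'" unfolding split_def
    proof (intro conjI ballI)
      show "A \<union> A' = \<Gamma> - chip_set (E f)" "A \<inter> A' = {}" by (auto simp: A_def A'_def)
      show "A \<noteq> {}" "A' \<noteq> {}" using y by (auto simp: A_def A'_def)
    next
      fix y \<tau> assume "y \<in> A" "\<tau> \<in> tangents G y"
      then have "near G \<tau> (\<lambda>z. b z = b y0 \<and> z \<in> \<Gamma> - chip_set (E f))" using near_conj[OF B2 off, of y \<tau> y] by (simp add: A_def)
      then show "near G \<tau> (\<lambda>z. z \<in> A)" by (rule near_mono) (simp add: A_def)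
    next
      fix y \<tau> assume y: "y \<in> A'" "\<tau> \<in> tangents G y"
      then have "near G \<tau> (\<lambda>z. b z = b y \<and> z \<in> \<Gamma> - chip_set (E f))" using near_conj[OF B2 off, of y \<tau> y] by (simp add: A'_def)
      then show "near G \<tau> (\<lambda>z. z \<in> A')" by (rule near_mono) (use y(1) in \<open>simp add: A'_def\<close>)
    next
      fix y \<tau> assume "y \<in> \<Gamma>" "\<tau> \<in> tangents G y"
      then show "near G \<tau> (\<lambda>z. z \<in> A) \<or> near G \<tau> (\<lambda>z. z \<in> A')" by (rule nr)
    qed
    then show ?thesis by (rule that)
  qed
qed

text \<open>The part together with the chips bordering on it. A chip between the two parts belongs
  to both sides.\<close>

definition side :: "('a point \<Rightarrow> int) \<Rightarrow> 'a point set \<Rightarrow> 'a point set" where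
  "side F A = A \<union> {y \<in> chip_set F. \<exists>\<tau>\<in>tangents G y. near G \<tau> (\<lambda>z. z \<in> A)}"

lemma chip_set_curve: "chip_set F \<subseteq> \<Gamma>"
  by (auto simp: chip_set_def curve_def)

lemma near_disjoint: "near G \<tau> (\<lambda>z. z \<in> A) \<Longrightarrow> near G \<tau> (\<lambda>z. z \<in> B) \<Longrightarrow> A \<inter> B \<noteq> {}"
  using near_ex[OF near_conj] by blast

text \<open>A bordering chip lies inside an edge and has two directions, one of which leads into
  \<open>A\<close>; so at most one leaves the side. At all other points of the side no direction
  leaves.\<close>

lemma side_near:
  assumes sp: "split F A A'"
  shows "y \<in> \<Gamma> - side F A \<Longrightarrow> \<tau> \<in> tangents G y \<Longrightarrow> near G \<tau> (\<lambda>z. z \<notin> side F A)"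
    and "y \<in> side F A \<Longrightarrow> \<tau> \<in> tangents G y \<Longrightarrow> near G \<tau> (\<lambda>z. z \<in> side F A) \<or> near G \<tau> (\<lambda>z. z \<notin> side F A)"
    and "\<tau> \<in> tangents G y \<Longrightarrow> near G \<tau> (\<lambda>z. z \<notin> side F A) \<longleftrightarrow> near G \<tau> (\<lambda>z. z \<in> A')"
    and "y \<in> side F A \<Longrightarrow> card {\<tau>\<in>tangents G y. near G \<tau> (\<lambda>z. z \<notin> side F A)} \<le> (if y \<in> chip_set F then 1 else 0)"
proof -
  have AA: "A \<inter> A' = {}" "A \<union> A' = \<Gamma> - chip_set F" using sp by (auto simp: split_def)
  have A'n: "z \<notin> side F A" if "z \<in> A'" for z using that AA unfolding side_def by blast
  have n1: "near G \<tau> (\<lambda>z. z \<notin> side F A)" if "near G \<tau> (\<lambda>z. z \<in> A')" for \<tau> by (rule near_mono[OF that A'n])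
  have n2: "near G \<tau> (\<lambda>z. z \<in> side F A)" if "near G \<tau> (\<lambda>z. z \<in> A)" for \<tau> by (rule near_mono[OF that]) (simp add: side_def)
  have di: "near G \<tau> (\<lambda>z. z \<in> A) \<or> near G \<tau> (\<lambda>z. z \<in> A')" if "\<tau> \<in> tangents G y" for \<tau> y
    using sp tangents_off that unfolding split_def by blast
  show eq: "near G \<tau> (\<lambda>z. z \<notin> side F A) \<longleftrightarrow> near G \<tau> (\<lambda>z. z \<in> A')" if "\<tau> \<in> tangents G y" for \<tau> y
  proof
    assume a: "near G \<tau> (\<lambda>z. z \<notin> side F A)"
    have "\<not> near G \<tau> (\<lambda>z. z \<in> A)"
    proof
      assume "near G \<tau> (\<lambda>z. z \<in> A)"
      from near_ex[OF near_conj[OF n2[OF this] a]] show False by blast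
    qed
    then show "near G \<tau> (\<lambda>z. z \<in> A')" using di[OF that] by blast
  qed (rule n1)
  show "near G \<tau> (\<lambda>z. z \<notin> side F A)" if y: "y \<in> \<Gamma> - side F A" "\<tau> \<in> tangents G y"
  proof (cases "y \<in> chip_set F")
    case True
    then have "\<not> near G \<tau> (\<lambda>z. z \<in> A)" using y unfolding side_def by blast
    then show ?thesis using di[OF y(2)] n1 by blast
  next
    case False
    then have "y \<in> A'" using y(1) AA unfolding side_def by blast
    then have "near G \<tau> (\<lambda>z. z \<in> A')" using sp y(2) unfolding split_def by blast
    then show ?thesis by (rule n1)
  qed
  show "near G \<tau> (\<lambda>z. z \<in> side F A) \<or> near G \<tau> (\<lambda>z. z \<notin> side F A)" if "y \<in> side F A" "\<tau> \<in> tangents G y"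
    using di[OF that(2)] n1 n2 by blast
  show "card {\<tau>\<in>tangents G y. near G \<tau> (\<lambda>z. z \<notin> side F A)} \<le> (if y \<in> chip_set F then 1 else 0)" if y: "y \<in> side F A"
  proof (cases "y \<in> chip_set F")
    case True
    then obtain e t where e: "y = Inner e t" "e \<in> edges G" "0 < t" "t < len G e" by (auto simp: chip_set_def)
    have "y \<notin> A" using True AA(2) by blast
    then obtain \<sigma> where \<sigma>: "\<sigma> \<in> tangents G y" "near G \<sigma> (\<lambda>z. z \<in> A)" using y unfolding side_def by blast
    have "\<not> near G \<sigma> (\<lambda>z. z \<notin> side F A)" using eq[OF \<sigma>(1)] near_disjoint[OF \<sigma>(2)] AA(1) by blast
    then have "{\<tau>\<in>tangents G y. near G \<tau> (\<lambda>z. z \<notin> side F A)} \<subseteq> tangents G y - {\<sigma>}" by blast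
    then have "card {\<tau>\<in>tangents G y. near G \<tau> (\<lambda>z. z \<notin> side F A)} \<le> card (tangents G y - {\<sigma>})"
      using finite_tangents by (intro card_mono) auto
    also have "\<dots> = card (tangents G y) - 1" using \<sigma>(1) finite_tangents by simp
    also have "card (tangents G y) = 2" using tangents_Inner[OF e(2-4)] e(1) by simp
    finally show ?thesis using True by simp
  next
    case False
    then have "y \<in> A" using y unfolding side_def by blast
    have z: "{\<tau>\<in>tangents G y. near G \<tau> (\<lambda>z. z \<notin> side F A)} = {}"
    proof (rule equals0I)
      fix \<tau> assume \<tau>: "\<tau> \<in> {\<tau>\<in>tangents G y. near G \<tau> (\<lambda>z. z \<notin> side F A)}"
      then have "near G \<tau> (\<lambda>z. z \<in> A)" using sp \<open>y \<in> A\<close> unfolding split_def by blast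
      moreover have "near G \<tau> (\<lambda>z. z \<in> A')" using \<tau> eq by blast
      ultimately show False using near_disjoint AA(1) by blast
    qed
    show ?thesis using False unfolding z by simp
  qed
qed

text \<open>At each chip at most one direction leaves the side, so any number of chips up to the
  full multiplicity can be sent along it without the divisor becoming negative.\<close>

lemma side_fire:
  fixes w :: "('a \<times> 'a) \<times> real \<times> real \<Rightarrow> int"
  assumes f: "f \<in> RR" and sp: "split (E f) A A'" and w: "\<And>\<tau>. 1 \<le> w \<tau>"
    and wE: "\<And>y \<tau>. y \<in> chip_set (E f) \<Longrightarrow> \<tau> \<in> tangents G y \<Longrightarrow> w \<tau> \<le> E f y"
  obtains u \<delta> where "pl G u" "\<delta> > 0" "\<And>y. y \<in> side (E f) A \<Longrightarrow> u y = 0" "\<And>y. y \<in> \<Gamma> - side (E f) A \<Longrightarrow> u y < 0"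
    "\<And>y \<tau> h. y \<in> side (E f) A \<Longrightarrow> \<tau> \<in> tangents G y \<Longrightarrow> near G \<tau> (\<lambda>z. z \<in> A') \<Longrightarrow> 0 < h \<Longrightarrow> h < \<delta> \<Longrightarrow> u (ray G \<tau> h) = - of_int (w \<tau>) * h"
    "\<And>x. 0 \<le> E f x + ord_at G u x"
proof -
  let ?X = "side (E f) A"
  note S = side_near[OF sp]
  have X\<Gamma>: "?X \<subseteq> \<Gamma>" using sp chip_set_curve unfolding side_def split_def by blast
  have "{\<tau>. \<exists>y\<in>?X. \<tau> \<in> tangents G y \<and> near G \<tau> (\<lambda>z. z \<notin> ?X)} \<subseteq> (\<Union>y\<in>chip_set (E f). tangents G y)"
  proof
    fix \<tau> assume "\<tau> \<in> {\<tau>. \<exists>y\<in>?X. \<tau> \<in> tangents G y \<and> near G \<tau> (\<lambda>z. z \<notin> ?X)}"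
    then obtain y where y: "y \<in> ?X" "\<tau> \<in> tangents G y" "near G \<tau> (\<lambda>z. z \<notin> ?X)" by blast
    have "y \<in> chip_set (E f)"
    proof (rule ccontr)
      assume "y \<notin> chip_set (E f)"
      then have "card {\<tau>\<in>tangents G y. near G \<tau> (\<lambda>z. z \<notin> ?X)} = 0" using S(4)[OF y(1)] by simp
      then have "{\<tau>\<in>tangents G y. near G \<tau> (\<lambda>z. z \<notin> ?X)} = {}" using finite_tangents by (subst (asm) card_0_eq) auto
      then show False using y(2,3) by blast
    qed
    then show "\<tau> \<in> (\<Union>y\<in>chip_set (E f). tangents G y)" using y(2) by blast
  qed
  moreover have "finite (\<Union>y\<in>chip_set (E f). tangents G y)" using finite_IS[OF f] finite_tangents by (rule finite_UN_I)
  ultimately have fin: "finite {\<tau>. \<exists>y\<in>?X. \<tau> \<in> tangents G y \<and> near G \<tau> (\<lambda>z. z \<notin> ?X)}" by (rule finite_subset)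
  show ?thesis
  proof (rule fire[where w = w, OF X\<Gamma> S(1) S(2) fin w])
    fix u and \<delta> :: real
    assume u: "pl G u" "\<delta> > 0" "\<And>y. y \<in> ?X \<Longrightarrow> u y = 0" "\<And>y. y \<in> \<Gamma> - ?X \<Longrightarrow> u y < 0"
      and ur: "\<And>y \<tau> h. y \<in> ?X \<Longrightarrow> \<tau> \<in> tangents G y \<Longrightarrow> near G \<tau> (\<lambda>z. z \<notin> ?X) \<Longrightarrow> 0 < h \<Longrightarrow> h < \<delta> \<Longrightarrow> u (ray G \<tau> h) = - of_int (w \<tau>) * h"
      and uo: "\<And>y. y \<in> \<Gamma> - ?X \<Longrightarrow> 0 \<le> ord_at G u y"
        "\<And>y. y \<in> ?X \<Longrightarrow> ord_at G u y = - (\<Sum>\<tau>\<in>{\<tau>\<in>tangents G y. near G \<tau> (\<lambda>z. z \<notin> ?X)}. w \<tau>)"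
    show ?thesis
    proof (rule that[OF u])
      show "u (ray G \<tau> h) = - of_int (w \<tau>) * h" if "y \<in> ?X" "\<tau> \<in> tangents G y" "near G \<tau> (\<lambda>z. z \<in> A')" "0 < h" "h < \<delta>" for y \<tau> h
        using ur[OF that(1,2)] S(3)[OF that(2)] that by blast
      fix x show "0 \<le> E f x + ord_at G u x"
      proof (cases "x \<in> ?X")
        case x: True
        let ?L = "{\<tau>\<in>tangents G x. near G \<tau> (\<lambda>z. z \<notin> ?X)}"
        have "(\<Sum>\<tau>\<in>?L. w \<tau>) \<le> E f x"
        proof (cases "x \<in> chip_set (E f)")
          case True
          have "(\<Sum>\<tau>\<in>?L. w \<tau>) \<le> (\<Sum>\<tau>\<in>?L. E f x)" using wE[OF True] by (intro sum_mono) blast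
          also have "\<dots> = int (card ?L) * E f x" by simp
          also have "\<dots> \<le> 1 * E f x" using S(4)[OF x] True E_nonneg[OF f, of x] by (intro mult_right_mono) auto
          finally show ?thesis by simp
        next
          case False
          then have "card ?L = 0" using S(4)[OF x] by simp
          then have "?L = {}" using finite_tangents by (subst (asm) card_0_eq) auto
          then show ?thesis unfolding \<open>?L = {}\<close> using E_nonneg[OF f, of x] by simp
        qed
        then show ?thesis using uo(2)[OF x] by simp
      next
        case False
        then show ?thesis using uo(1)[of x] E_nonneg[OF f, of x] ord_at_off[of x u] by (cases "x \<in> \<Gamma>") auto
      qed
    qed
  qed
qed

text \<open>A side that misses \<open>Q\<close> could be fired with weight \<open>1\<close>,
  lowering the function at \<open>Q\<close> against the maximality of \<open>rd Q\<close>. By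
  symmetry \<open>Q\<close> belongs to both sides, that is, to the cut.\<close>

lemma split_contains:
  assumes Q: "Q \<in> \<Gamma>" and sp: "split (E (rd Q)) A A'"
  shows "Q \<in> side (E (rd Q)) A"
proof (rule ccontr)
  assume nQ: "Q \<notin> side (E (rd Q)) A"
  note R = rd_RR[OF Q]
  have p: "1 \<le> E (rd Q) y" if "y \<in> chip_set (E (rd Q))" for y using that E_nonneg[OF R, of y] by (auto simp: chip_set_def)
  show False
  proof (rule side_fire[where w = "\<lambda>_. 1", OF R sp])
    fix u and \<delta> :: real
    assume u: "pl G u" "\<And>y. y \<in> side (E (rd Q)) A \<Longrightarrow> u y = 0" "\<And>y. y \<in> \<Gamma> - side (E (rd Q)) A \<Longrightarrow> u y < 0" "\<And>x. 0 \<le> E (rd Q) x + ord_at G u x"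
    obtain a where a: "a \<in> A" using sp unfolding split_def by blast
    then have "a \<in> side (E (rd Q)) A" "a \<in> \<Gamma>" using sp unfolding split_def side_def by blast+
    then show False using fire_contradiction[OF Q u(1,4), of a] u(2)[of a] u(3)[of Q] nQ Q by simp
  qed (simp_all add: p)
qed

lemma rd_triangle: "x \<in> \<Gamma> \<Longrightarrow> P \<in> \<Gamma> \<Longrightarrow> Q \<in> \<Gamma> \<Longrightarrow> rd P x \<le> rd Q x + rd P Q"
  using rd_ge[OF _ _ rd_RR, of x Q P] by simp

text \<open>\<open>Q\<close> is a chip on the cut. It is moved a short distance \<open>h\<close>
  into the other part while side \<open>A\<close> is fired. Testing \<open>rd Q'\<close> on the
  fired function bounds it from below on the side of \<open>x\<close>; the order of
  \<open>rd Q' - rd Q\<close> at \<open>Q\<close> bounds \<open>rd Q' Q\<close> from above by the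
  same amount, and the triangle inequality does the rest.\<close>

lemma cut_step_side:
  assumes Q: "Q \<in> \<Gamma>" and sp: "split (E (rd Q)) A A'" and x: "x \<in> side (E (rd Q)) A"
  obtains Q' e t where "Q' \<in> \<Gamma>" "e \<in> edges G" "t \<in> {0..len G e}" "Q' = edge_point G e t" "rd Q' x = rd Q x + rd Q' Q" "0 < rd Q' Q + rd Q Q'"
proof -
  let ?F = "E (rd Q)"
  note R = rd_RR[OF Q]
  have QA: "Q \<in> side ?F A" and QA': "Q \<in> side ?F A'" using split_contains[OF Q] sp split_sym by blast+
  have AA: "A \<inter> A' = {}" "A \<union> A' = \<Gamma> - chip_set ?F" using sp by (auto simp: split_def)
  have QI: "Q \<in> chip_set ?F" "Q \<notin> A'" using QA QA' AA unfolding side_def by blast+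
  obtain \<tau> where \<tau>0: "\<tau> \<in> tangents G Q" "near G \<tau> (\<lambda>z. z \<in> A')" using QA' QI unfolding side_def by blast
  \<comment> \<open>All chips at \<open>Q\<close> travel together and one chip from each other place
    on the cut. The full weight at \<open>Q\<close> is what makes the lower bound meet the upper
    one.\<close>
  define w where "w \<sigma> = (if \<sigma> \<in> tangents G Q then ?F Q else 1)" for \<sigma>
  have pos: "1 \<le> ?F y" if "y \<in> chip_set ?F" for y using that E_nonneg[OF R, of y] by (auto simp: chip_set_def)
  have w1: "1 \<le> w \<sigma>" for \<sigma> using pos[OF QI(1)] by (simp add: w_def)
  have wE: "w \<sigma> \<le> ?F y" if y: "y \<in> chip_set ?F" "\<sigma> \<in> tangents G y" for y \<sigma>
  proof (cases "\<sigma> \<in> tangents G Q")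
    case True
    obtain e t s where \<sigma>: "\<sigma> = (e, t, s)" by (cases \<sigma>)
    have "y = Q" using tangentD(4)[OF y(2)[unfolded \<sigma>]] tangentD(4)[OF True[unfolded \<sigma>]] by simp
    then show ?thesis using True by (simp add: w_def)
  qed (use pos[OF y(1)] in \<open>simp add: w_def\<close>)
  obtain e t s where \<tau>: "\<tau> = (e, t, s)" by (cases \<tau>)
  note \<tau>1 = \<tau>0(1)[unfolded \<tau>]
  note TD = tangentD[OF \<tau>1]
  obtain r where r: "r > 0" "\<And>h. 0 < h \<Longrightarrow> h < r \<Longrightarrow> 0 < t + s * h \<and> t + s * h < len G e"
    using tangent_arm[OF \<tau>1] by metis
  have finF: "finite {x. ?F x \<noteq> 0}" using add_div_divisors[OF RR_pl[OF R]] by (simp add: divisors_def)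
  obtain q where q: "q > 0" "\<And>h. 0 < h \<Longrightarrow> h < q \<Longrightarrow> ray G \<tau> h \<notin> {x. ?F x \<noteq> 0}"
    using near_notin_finite[OF \<tau>0(1) finF] unfolding near_iff by blast
  show ?thesis
  proof (rule side_fire[OF R sp w1 wE])
    fix u and \<delta> :: real
    assume u: "pl G u" "\<delta> > 0" "\<And>y. y \<in> side ?F A \<Longrightarrow> u y = 0"
      and ur: "\<And>y \<tau> h. y \<in> side ?F A \<Longrightarrow> \<tau> \<in> tangents G y \<Longrightarrow> near G \<tau> (\<lambda>z. z \<in> A') \<Longrightarrow> 0 < h \<Longrightarrow> h < \<delta> \<Longrightarrow> u (ray G \<tau> h) = - of_int (w \<tau>) * h"
      and uo: "\<And>x. 0 \<le> ?F x + ord_at G u x"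
    define h where "h = min \<delta> (min r q) / 2"
    have h: "0 < h" "h < \<delta>" "h < min r q" using u(2) r(1) q(1) by (auto simp: h_def)
    define Q' where "Q' = ray G \<tau> h"
    have Q': "Q' \<in> \<Gamma>" "Q' = edge_point G e (t + s * h)" "t + s * h \<in> {0..len G e}"
      using ray_in[OF \<tau>0(1)] r(2)[of h] h by (auto simp: Q'_def \<tau> ray_def)
    have uQ': "u Q' = - of_int (?F Q) * h" using ur[OF QA \<tau>0 h(1,2)] \<tau>0(1) by (simp add: Q'_def w_def)
    have x\<Gamma>: "x \<in> \<Gamma>" using x AA chip_set_curve unfolding side_def by blast
    let ?g = "\<lambda>y\<in>\<Gamma>. rd Q y + u y"
    have g: "?g \<in> RR" unfolding RR_iff using uo by (simp add: pl_add[OF RR_pl[OF R] u(1)] ord_at_add[OF RR_pl[OF R] u(1)] add_div_def add.assoc)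
    \<comment> \<open>The fired function is \<open>rd Q\<close> on the side and is lowered by
      \<open>?F Q * h\<close> at \<open>Q'\<close>; normalising it at \<open>Q'\<close> raises the
      side by that amount.\<close>
    have lower: "rd Q y - rd Q Q' + of_int (?F Q) * h \<le> rd Q' y" if "y \<in> side ?F A" "y \<in> \<Gamma>" for y
      using rd_ge[OF that(2) Q'(1) g] u(3)[OF that(1)] uQ' that(2) Q'(1) by simp
    define v where "v y = rd Q' y - rd Q y" for y
    have plv: "pl G v" unfolding v_def by (rule pl_diff[OF RR_pl[OF rd_RR[OF Q'(1)]] RR_pl[OF R]])
    have ov: "ord_at G v y = E (rd Q') y - ?F y" for y unfolding v_def ord_at_diff[OF RR_pl[OF rd_RR[OF Q'(1)]] RR_pl[OF R]] add_div_def by simp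
    have vmax: "v y \<le> v Q" if "y \<in> \<Gamma>" for y
      using fire_contradiction[OF Q plv _ that] E_nonneg[OF rd_RR[OF Q'(1)]] by (simp add: ov)
    \<comment> \<open>\<open>v\<close> is largest at \<open>Q\<close>, so all its slopes there are
      nonpositive. Their sum is at least \<open>- ?F Q\<close>, because \<open>E (rd Q')\<close> is
      nonnegative at \<open>Q\<close>; hence no single slope is below \<open>- ?F Q\<close>.\<close>
    have le0: "slope G v \<sigma> \<le> 0" if "\<sigma> \<in> tangents G Q" for \<sigma> by (rule slope_le_max[OF plv Q vmax that])
    have "(\<Sum>\<sigma>\<in>tangents G Q - {\<tau>}. slope G v \<sigma>) \<le> 0" using le0 by (intro sum_nonpos) blast
    moreover have "ord_at G v Q = slope G v \<tau> + (\<Sum>\<sigma>\<in>tangents G Q - {\<tau>}. slope G v \<sigma>)"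
      unfolding ord_at_slope by (rule sum.remove[OF finite_tangents \<tau>0(1)])
    ultimately have sl: "- ?F Q \<le> slope G v \<tau>" using ov[of Q] E_nonneg[OF rd_RR[OF Q'(1)], of Q] by linarith
    have "v (ray G (e, t, s) 0) + of_int (slope G v (e, t + s * 0, s)) * (h - 0) \<le> v (ray G (e, t, s) h)"
    proof (rule arm_convex[OF plv \<tau>1, of "min r q"])
      fix k assume k: "0 < k" "k < min r q"
      then show "0 < t + s * k \<and> t + s * k < len G e" using r(2) by simp
      show "0 \<le> ord_at G v (ray G (e, t, s) k)" using q(2)[of k] k E_nonneg[OF rd_RR[OF Q'(1)]] by (simp add: ov \<tau>)
    qed (use h r q in auto)
    then have "v Q + of_int (slope G v \<tau>) * h \<le> v Q'" using ray_0[OF \<tau>0(1)] by (simp add: Q'_def \<tau>)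
    moreover have "of_int (- ?F Q) * h \<le> of_int (slope G v \<tau>) * h" using sl h(1) by (intro mult_right_mono) (simp_all only: of_int_le_iff less_imp_le)
    ultimately have upper: "rd Q' Q \<le> of_int (?F Q) * h - rd Q Q'"
      using rd_self[OF Q] rd_self[OF Q'(1)] by (simp add: v_def)
    have "rd Q' x = rd Q x + rd Q' Q"
      using lower[OF x x\<Gamma>] upper rd_triangle[OF x\<Gamma> Q'(1) Q] by linarith
    moreover have "0 < of_int (?F Q) * h" using pos[OF QI(1)] h(1) by simp
    then have "0 < rd Q' Q + rd Q Q'" using lower[OF QA Q] rd_self[OF Q] by linarith
    ultimately show ?thesis using that[OF Q'(1) TD(1) Q'(3,2)] by blast
  qed
qed

text \<open>\<open>x\<close> lies on at least one of the two sides, and the roles of the sides can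
  be exchanged.\<close>

lemma cut_step:
  assumes Q: "Q \<in> \<Gamma>" and n: "E (rd Q) \<notin> cell_vertices G D" and x: "x \<in> \<Gamma>"
  obtains Q' e t where "Q' \<in> \<Gamma>" "e \<in> edges G" "t \<in> {0..len G e}" "Q' = edge_point G e t" "rd Q' x = rd Q x + rd Q' Q" "0 < rd Q' Q + rd Q Q'"
proof -
  obtain A A' where sp: "split (E (rd Q)) A A'" using not_cell_vertex_split[OF rd_RR[OF Q] n] by blast
  have "x \<in> side (E (rd Q)) A \<or> x \<in> side (E (rd Q)) A'"
  proof (cases "x \<in> chip_set (E (rd Q))")
    case True
    then obtain e t where "x = Inner e t" "e \<in> edges G" "0 < t" "t < len G e" by (auto simp: chip_set_def)
    then obtain \<tau> where \<tau>: "\<tau> \<in> tangents G x" using tangents_Inner by blast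
    then have "near G \<tau> (\<lambda>z. z \<in> A) \<or> near G \<tau> (\<lambda>z. z \<in> A')" using sp x unfolding split_def by blast
    then show ?thesis using True \<tau> unfolding side_def by blast
  next
    case False
    then show ?thesis using x sp unfolding side_def split_def by blast
  qed
  then show ?thesis
    using cut_step_side[OF Q sp, of x] cut_step_side[OF Q split_sym[OF sp], of x] that by blast
qed

text \<open>Regularity in the base point follows from regularity in the argument: by the triangle
  inequality a change of base from \<open>P\<close> to \<open>Q\<close> costs at most the larger of
  \<open>rd P Q\<close> and \<open>rd Q P\<close>.\<close>

lemma rd_Lipschitz:
  obtains B :: real where "B \<ge> 0" "\<And>y e s t. y \<in> \<Gamma> \<Longrightarrow> e \<in> edges G \<Longrightarrow> s \<in> {0..len G e} \<Longrightarrow> t \<in> {0..len G e} \<Longrightarrow>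
     \<bar>rd (edge_point G e s) y - rd (edge_point G e t) y\<bar> \<le> B * \<bar>s - t\<bar>"
proof -
  obtain B :: int where B: "B \<ge> 0" "\<And>f e s t. f \<in> RR \<Longrightarrow> e \<in> edges G \<Longrightarrow> s \<in> {0..len G e} \<Longrightarrow> t \<in> {0..len G e} \<Longrightarrow>
       \<bar>f (edge_point G e s) - f (edge_point G e t)\<bar> \<le> of_int B * \<bar>s - t\<bar>"
    using RR_slope_bound by metis
  show ?thesis
  proof (rule that[of "of_int B"])
    fix y e s t assume y: "y \<in> \<Gamma>" and e: "e \<in> edges G" and s: "s \<in> {0..len G e}" "t \<in> {0..len G e}"
    let ?P = "edge_point G e s" and ?Q = "edge_point G e t"
    note in\<Gamma> = edge_point_in[OF e]
    have "rd ?P y \<le> rd ?Q y + rd ?P ?Q" "rd ?Q y \<le> rd ?P y + rd ?Q ?P" using rd_triangle[OF y] in\<Gamma> by auto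
    moreover have "\<bar>rd ?P ?P - rd ?P ?Q\<bar> \<le> of_int B * \<bar>s - t\<bar>" "\<bar>rd ?Q ?P - rd ?Q ?Q\<bar> \<le> of_int B * \<bar>s - t\<bar>"
      using B(2)[OF rd_RR[OF in\<Gamma>] e s] by auto
    ultimately show "\<bar>rd ?P y - rd ?Q y\<bar> \<le> of_int B * \<bar>s - t\<bar>" using rd_self[OF in\<Gamma>] by auto
  qed (use B(1) in simp)
qed

lemma continuous_on_Lipschitz_real:
  fixes f :: "real \<Rightarrow> real"
  assumes "\<And>s t. s \<in> A \<Longrightarrow> t \<in> A \<Longrightarrow> \<bar>f s - f t\<bar> \<le> B * \<bar>s - t\<bar>" "B \<ge> 0"
  shows "continuous_on A f"
  by (rule lipschitz_on_continuous_on[of B]) (use assms in \<open>auto intro!: lipschitz_onI simp: dist_real_def\<close>)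

text \<open>Moving \<open>Q\<close> away from \<open>x\<close> as long as possible leads to a vertex of the linear system.\<close>

lemma ex_vertex_beyond:
  assumes x: "x \<in> \<Gamma>" and P: "P \<in> \<Gamma>"
  shows "\<exists>Q\<in>\<Gamma>. E (rd Q) \<in> cell_vertices G D \<and> rd Q x = rd P x + rd Q P"
proof -
  obtain B :: real where B: "B \<ge> 0" "\<And>y e s t. y \<in> \<Gamma> \<Longrightarrow> e \<in> edges G \<Longrightarrow> s \<in> {0..len G e} \<Longrightarrow> t \<in> {0..len G e} \<Longrightarrow>
     \<bar>rd (edge_point G e s) y - rd (edge_point G e t) y\<bar> \<le> B * \<bar>s - t\<bar>"
    using rd_Lipschitz by blast
  have cont: "continuous_map T euclideanreal (\<lambda>Q. rd Q y)" if y: "y \<in> \<Gamma>" for y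
    unfolding continuous_map_T_edges
  proof
    fix e assume e: "e \<in> edges G"
    show "continuous_on {0..len G e} (\<lambda>t. rd (edge_point G e t) y)" by (rule continuous_on_Lipschitz_real[OF B(2)[OF y e] B(1)])
  qed
  define S where "S = {Q \<in> \<Gamma>. rd Q x - rd Q P = rd P x}"
  have "closedin T {Q \<in> topspace T. rd Q x - rd Q P \<in> {rd P x}}"
    by (rule closedin_continuous_map_preimage[OF continuous_map_diff[OF cont[OF x] cont[OF P]]]) simp
  then have "closedin T S" by (simp add: S_def)
  then have cS: "compactin T S" using closed_compactin[OF compact_T] by (auto simp: S_def)
  have "P \<in> S" using P rd_self[OF P] by (simp add: S_def)
  have cy: "continuous_on {0..len G e} (\<lambda>t. rd Q (edge_point G e t))" if "e \<in> edges G" "Q \<in> \<Gamma>" for e Q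
    using pl_continuous[OF RR_pl[OF rd_RR[OF that(2)]]] that(1) unfolding continuous_map_T_edges by blast
  \<comment> \<open>The sum of these integrals is a potential that decreases strictly when \<open>Q\<close> crosses a cut.\<close>
  define J where "J Q e = integral {0..len G e} (\<lambda>t. rd Q (edge_point G e t) - rd Q x)" for Q e
  have cyx: "continuous_on {0..len G e} (\<lambda>t. rd Q (edge_point G e t) - rd Q x)" if "e \<in> edges G" "Q \<in> \<Gamma>" for e Q
    using cy[OF that] by (intro continuous_intros)
  have intg: "(\<lambda>t. rd Q (edge_point G e t) - rd Q x) integrable_on {0..len G e}" if "e \<in> edges G" "Q \<in> \<Gamma>" for e Q
    by (rule integrable_continuous_real[OF cyx[OF that]])
  define \<Psi> where "\<Psi> Q = (\<Sum>e\<in>edges G. J Q e)" for Q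
  have "continuous_map T euclideanreal \<Psi>" unfolding \<Psi>_def
  proof (rule continuous_map_sum[OF finite_edges])
    fix e assume e: "e \<in> edges G"
    show "continuous_map T euclideanreal (\<lambda>Q. J Q e)" unfolding continuous_map_T_edges
    proof
      fix e' assume e': "e' \<in> edges G"
      note ep = edge_point_in[OF e']
      show "continuous_on {0..len G e'} (\<lambda>t. J (edge_point G e' t) e)"
      proof (rule continuous_on_Lipschitz_real[of _ _ "2 * B * len G e"])
        fix s t assume st: "s \<in> {0..len G e'}" "t \<in> {0..len G e'}"
        let ?P = "edge_point G e' s" and ?Q = "edge_point G e' t"
        have "J ?P e - J ?Q e = integral {0..len G e} (\<lambda>u. (rd ?P (edge_point G e u) - rd ?P x) - (rd ?Q (edge_point G e u) - rd ?Q x))"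
          unfolding J_def by (rule integral_diff[OF intg[OF e ep] intg[OF e ep], symmetric])
        also have "norm \<dots> \<le> (2 * B * \<bar>s - t\<bar>) * (len G e - 0)"
        proof (rule integral_bound)
          show "0 \<le> len G e" using edgeD(4)[OF e] by simp
          show "continuous_on {0..len G e} (\<lambda>u. (rd ?P (edge_point G e u) - rd ?P x) - (rd ?Q (edge_point G e u) - rd ?Q x))"
            by (rule continuous_on_diff[OF cyx[OF e ep] cyx[OF e ep]])
          fix u assume "u \<in> {0..len G e}"
          have "\<bar>rd ?P (edge_point G e u) - rd ?Q (edge_point G e u)\<bar> \<le> B * \<bar>s - t\<bar>" by (rule B(2)[OF edge_point_in[OF e] e' st])
          moreover have "\<bar>rd ?P x - rd ?Q x\<bar> \<le> B * \<bar>s - t\<bar>" by (rule B(2)[OF x e' st])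
          ultimately show "norm ((rd ?P (edge_point G e u) - rd ?P x) - (rd ?Q (edge_point G e u) - rd ?Q x)) \<le> 2 * B * \<bar>s - t\<bar>"
            unfolding real_norm_def by linarith
        qed
        finally show "\<bar>J ?P e - J ?Q e\<bar> \<le> 2 * B * len G e * \<bar>s - t\<bar>" by (simp add: mult_ac)
      qed (use B(1) edgeD(4)[OF e] in simp)
    qed
  qed
  from image_compactin[OF cS this] have "compact (\<Psi> ` S)" by simp
  then obtain Q where Q: "Q \<in> S" "\<And>Q'. Q' \<in> S \<Longrightarrow> \<Psi> Q \<le> \<Psi> Q'"
    using compact_attains_inf[of "\<Psi> ` S"] \<open>P \<in> S\<close> by auto
  have Q\<Gamma>: "Q \<in> \<Gamma>" and Qx: "rd Q x = rd P x + rd Q P" using Q(1) by (auto simp: S_def)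
  have "E (rd Q) \<in> cell_vertices G D"
  proof (rule ccontr)
    assume n: "E (rd Q) \<notin> cell_vertices G D"
    show False
    proof (rule cut_step[OF Q\<Gamma> n x])
      fix Q' e t assume Q': "Q' \<in> \<Gamma>" and e: "e \<in> edges G" and t: "t \<in> {0..len G e}" "Q' = edge_point G e t" and st: "rd Q' x = rd Q x + rd Q' Q" "0 < rd Q' Q + rd Q Q'"
      \<comment> \<open>Equality along the way from \<open>Q'\<close> over \<open>Q\<close> and
        \<open>P\<close> to \<open>x\<close> forces the equation for \<open>Q'\<close> and
        \<open>P\<close>, so the search stays inside \<open>S\<close>.\<close>
      have "rd Q' P \<le> rd Q P + rd Q' Q" "rd Q' x \<le> rd P x + rd Q' P" using rd_triangle[OF P Q' Q\<Gamma>] rd_triangle[OF x Q' P] by auto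
      then have "Q' \<in> S" using Q' st(1) Qx by (simp add: S_def)
      have le: "rd Q' y - rd Q' x \<le> rd Q y - rd Q x" if "y \<in> \<Gamma>" for y using rd_triangle[OF that Q' Q\<Gamma>] st(1) by simp
      have Jle: "J Q' e' \<le> J Q e'" if "e' \<in> edges G" for e'
        unfolding J_def using le[OF edge_point_in[OF that]] by (intro integral_le intg[OF that] Q' Q\<Gamma>)
      \<comment> \<open>The integrands are ordered by \<open>le\<close> and differ at
        \<open>Q'\<close> itself, by \<open>rd Q' Q + rd Q Q'\<close>. By continuity the integral
        over the edge containing \<open>Q'\<close> drops strictly.\<close>
      have "J Q' e \<noteq> J Q e"
      proof
        assume "J Q' e = J Q e"
        then have "integral {0..len G e} (\<lambda>u. (rd Q (edge_point G e u) - rd Q x) - (rd Q' (edge_point G e u) - rd Q' x)) = 0"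
          unfolding J_def integral_diff[OF intg[OF e Q\<Gamma>] intg[OF e Q']] by simp
        moreover have "0 \<le> (rd Q (edge_point G e u) - rd Q x) - (rd Q' (edge_point G e u) - rd Q' x)" for u
          using le[OF edge_point_in[OF e], of u] by linarith
        note integral_eq_0_iff[OF continuous_on_diff[OF cyx[OF e Q\<Gamma>] cyx[OF e Q']] edgeD(4)[OF e] this]
        ultimately have "(rd Q (edge_point G e t) - rd Q x) - (rd Q' (edge_point G e t) - rd Q' x) = 0"
          using t(1) by blast
        then show False using st rd_self[OF Q'] unfolding t(2) by simp
      qed
      then have "J Q' e < J Q e" using Jle[OF e] by simp
      then have "\<Psi> Q' < \<Psi> Q" unfolding \<Psi>_def using finite_edges e Jle by (intro sum_strict_mono_ex1) auto
      then show False using Q(2)[OF \<open>Q' \<in> S\<close>] by simp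
    qed
  qed
  then show ?thesis using Q\<Gamma> Qx by blast
qed

end

section \<open>Tropical coordinates\<close>

text \<open>Both compositions with the projections are constant on fibres and descend by the
  universal property of the quotients; the descended maps are inverse to each other because
  \<open>\<phi>\<close> and \<open>\<psi>\<close> are inverse up to fibres.\<close>

lemma homeomorphic_map_of_quotient_maps:
  assumes q: "quotient_map X Y q" and p: "quotient_map X' Y' p"
    and \<phi>: "continuous_map X X' \<phi>" and \<psi>: "continuous_map X' X \<psi>"
    and qp: "\<And>x y. x \<in> topspace X \<Longrightarrow> y \<in> topspace X \<Longrightarrow> q x = q y \<Longrightarrow> p (\<phi> x) = p (\<phi> y)"
    and pq: "\<And>x y. x \<in> topspace X' \<Longrightarrow> y \<in> topspace X' \<Longrightarrow> p x = p y \<Longrightarrow> q (\<psi> x) = q (\<psi> y)"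
    and \<psi>\<phi>: "\<And>x. x \<in> topspace X \<Longrightarrow> q (\<psi> (\<phi> x)) = q x"
    and \<phi>\<psi>: "\<And>x. x \<in> topspace X' \<Longrightarrow> p (\<phi> (\<psi> x)) = p x"
  obtains \<theta> where "homeomorphic_map Y Y' \<theta>" "\<And>x. x \<in> topspace X \<Longrightarrow> \<theta> (q x) = p (\<phi> x)"
proof -
  have 1: "continuous_map X Y' (\<lambda>x. p (\<phi> x))"
    using continuous_map_compose[OF \<phi> quotient_imp_continuous_map[OF p]] by (simp add: o_def)
  have 2: "continuous_map X' Y (\<lambda>x. q (\<psi> x))"
    using continuous_map_compose[OF \<psi> quotient_imp_continuous_map[OF q]] by (simp add: o_def)
  have "\<exists>\<theta>. continuous_map Y Y' \<theta> \<and> (\<forall>x\<in>topspace X. \<theta> (q x) = p (\<phi> x))"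
    by (rule quotient_map_lift_exists[OF q 1]) ((rule qp; assumption), blast)
  then obtain \<theta> where \<theta>: "continuous_map Y Y' \<theta>" "\<And>x. x \<in> topspace X \<Longrightarrow> \<theta> (q x) = p (\<phi> x)" by auto
  have "\<exists>\<omega>. continuous_map Y' Y \<omega> \<and> (\<forall>x\<in>topspace X'. \<omega> (p x) = q (\<psi> x))"
    by (rule quotient_map_lift_exists[OF p 2]) ((rule pq; assumption), blast)
  then obtain \<omega> where \<omega>: "continuous_map Y' Y \<omega>" "\<And>x. x \<in> topspace X' \<Longrightarrow> \<omega> (p x) = q (\<psi> x)" by auto
  have in1: "\<phi> x \<in> topspace X'" if "x \<in> topspace X" for x using continuous_map_image_subset_topspace[OF \<phi>] that by blast
  have in2: "\<psi> x \<in> topspace X" if "x \<in> topspace X'" for x using continuous_map_image_subset_topspace[OF \<psi>] that by blast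
  have "\<omega> (\<theta> y) = y" if "y \<in> topspace Y" for y
  proof -
    obtain x where x: "x \<in> topspace X" "y = q x" using quotient_imp_surjective_map[OF q] \<open>y \<in> topspace Y\<close> by blast
    then show ?thesis using \<theta>(2)[OF x(1)] \<omega>(2)[OF in1[OF x(1)]] \<psi>\<phi>[OF x(1)] by simp
  qed
  moreover have "\<theta> (\<omega> y) = y" if "y \<in> topspace Y'" for y
  proof -
    obtain x where x: "x \<in> topspace X'" "y = p x" using quotient_imp_surjective_map[OF p] \<open>y \<in> topspace Y'\<close> by blast
    then show ?thesis using \<omega>(2)[OF x(1)] \<theta>(2)[OF in2[OF x(1)]] \<phi>\<psi>[OF x(1)] by simp
  qed
  ultimately have "homeomorphic_maps Y Y' \<theta> \<omega>" unfolding homeomorphic_maps_def using \<theta>(1) \<omega>(1) by simp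
  then show ?thesis using that \<theta>(2) homeomorphic_maps_map by blast
qed

text \<open>In general a quotient map need not restrict to a quotient map on a saturated subset; an
  open one restricts to an open one.\<close>

lemma quotient_map_saturated:
  assumes "continuous_map X Y q" "open_map X Y q" "q ` topspace X = topspace Y" "C \<subseteq> topspace Y"
  shows "quotient_map (subtopology X {x \<in> topspace X. q x \<in> C}) (subtopology Y C) q"
proof (rule continuous_open_imp_quotient_map)
  show "continuous_map (subtopology X {x \<in> topspace X. q x \<in> C}) (subtopology Y C) q"
    using assms(1) by (auto simp: continuous_map_in_subtopology intro: continuous_map_from_subtopology)
  show "open_map (subtopology X {x \<in> topspace X. q x \<in> C}) (subtopology Y C) q"
    by (rule open_map_restriction[OF assms(2) refl])
  show "q ` topspace (subtopology X {x \<in> topspace X. q x \<in> C}) = topspace (subtopology Y C)"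
    using assms(3,4) by (auto simp: topspace_subtopology)
qed

lemma trop_class_self: "z \<in> extensional F \<Longrightarrow> z \<in> trop_class F z"
  unfolding trop_class_def by (auto intro!: exI[of _ 0] simp: extensional_def zero_ereal_def[symmetric] fun_eq_iff)

lemma trop_class_translate: "trop_class F (\<lambda>i\<in>F. ereal c + z i) = trop_class F z"
proof -
  have eq: "(\<lambda>i\<in>F. ereal d + (\<lambda>i\<in>F. ereal c + z i) i) = (\<lambda>i\<in>F. ereal (d + c) + z i)" for d
    by (rule restrict_ext) (simp add: add.assoc[symmetric])
  have "(\<lambda>i\<in>F. ereal d + z i) \<in> trop_class F (\<lambda>i\<in>F. ereal c + z i)" for d
    unfolding trop_class_def eq by (auto intro!: exI[of _ "d - c"])
  then show ?thesis unfolding trop_class_def eq by blast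
qed

lemma trop_class_eqD:
  assumes "trop_class F y = trop_class F z" "y \<in> extensional F"
  obtains c where "y = (\<lambda>i\<in>F. ereal c + z i)"
  using trop_class_self[OF assms(2)] unfolding assms(1) by (auto simp: trop_class_def)

lemma trop_convE:
  assumes "C \<in> trop_conv F S"
  obtains A where "finite A" "A \<noteq> {}" "A \<subseteq> UNIV \<times> \<Union>S" "C = trop_class F (\<lambda>i\<in>F. Max ((\<lambda>(c, s). ereal c + s i) ` A))"
  using assms unfolding trop_conv_def by blast

abbreviation trop_topology :: "'i set \<Rightarrow> ('i \<Rightarrow> ereal) topology" where
  "trop_topology F \<equiv> subtopology (product_topology (\<lambda>_. top_of_set {..<\<infinity>}) F) (trop_vectors F)"

lemma topspace_trop_topology: "topspace (trop_topology F) = trop_vectors F"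
  by (auto simp: topspace_subtopology trop_vectors_def topspace_product_topology)

lemma trop_translate: "z \<in> trop_vectors F \<Longrightarrow> (\<lambda>i\<in>F. ereal c + z i) \<in> trop_vectors F"
  unfolding trop_vectors_def by (auto simp: PiE_def Pi_def)

lemma continuous_trop_translate: "continuous_map (trop_topology F) (trop_topology F) (\<lambda>z. \<lambda>i\<in>F. ereal c + z i)"
  unfolding continuous_map_in_subtopology[of _ _ "trop_vectors F"] continuous_map_componentwise
proof (intro conjI ballI)
  show "(\<lambda>z. \<lambda>i\<in>F. ereal c + z i) ` topspace (trop_topology F) \<subseteq> extensional F" by auto
  show "(\<lambda>z. \<lambda>i\<in>F. ereal c + z i) \<in> topspace (trop_topology F) \<rightarrow> trop_vectors F"
    unfolding topspace_trop_topology using trop_translate by blast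
  fix k assume k: "k \<in> F"
  have 1: "continuous_map (trop_topology F) (top_of_set {..<\<infinity>}) (\<lambda>z. z k)"
    by (rule continuous_map_from_subtopology[OF continuous_map_product_projection[OF k]])
  have "continuous_on {..<\<infinity>} (\<lambda>y. ereal c + y)"
    unfolding continuous_on_def by (auto intro!: tendsto_cadd_ereal tendsto_intros)
  then have 2: "continuous_map (top_of_set {..<\<infinity>}) (top_of_set {..<\<infinity>}) (\<lambda>y. ereal c + y)"
    by (auto simp: continuous_map_in_subtopology)
  show "continuous_map (trop_topology F) (top_of_set {..<\<infinity>}) (\<lambda>z. (\<lambda>i\<in>F. ereal c + z i) k)"
    using continuous_map_compose[OF 1 2] k by (simp add: o_def)
qed

text \<open>The saturation of an open set is the union of its preimages under the continuous
  translations by constants.\<close>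

lemma open_map_trop_class: "open_map (trop_topology F) (TP_topology F) (trop_class F)"
  unfolding open_map_def
proof (intro allI impI)
  fix U assume U: "openin (trop_topology F) U"
  have sub: "U \<subseteq> trop_vectors F" using openin_subset[OF U] by (simp add: topspace_trop_topology)
  have "{x \<in> topspace (trop_topology F). trop_class F x \<in> trop_class F ` U} =
      (\<Union>c. {x \<in> topspace (trop_topology F). (\<lambda>i\<in>F. ereal c + x i) \<in> U})" (is "?l = ?r")
  proof
    show "?l \<subseteq> ?r"
    proof
      fix x assume "x \<in> ?l"
      then obtain u where x: "x \<in> topspace (trop_topology F)" and u: "u \<in> U" "trop_class F u = trop_class F x" by auto
      have "u \<in> extensional F" using u(1) sub by (auto simp: trop_vectors_def PiE_def)
      from trop_class_eqD[OF u(2) this] obtain c where "u = (\<lambda>i\<in>F. ereal c + x i)" .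
      then show "x \<in> ?r" using x u(1) by auto
    qed
    show "?r \<subseteq> ?l"
    proof
      fix x assume "x \<in> ?r"
      then obtain c where x: "x \<in> topspace (trop_topology F)" "(\<lambda>i\<in>F. ereal c + x i) \<in> U" by auto
      then have "trop_class F x \<in> trop_class F ` U" using trop_class_translate[of F c x] imageI[OF x(2), of "trop_class F"] by simp
      then show "x \<in> ?l" using x(1) by blast
    qed
  qed
  moreover have "openin (trop_topology F) ?r"
  proof (rule openin_Union)
    fix S assume "S \<in> range (\<lambda>c. {x \<in> topspace (trop_topology F). (\<lambda>i\<in>F. ereal c + x i) \<in> U})"
    then obtain c where "S = {x \<in> topspace (trop_topology F). (\<lambda>i\<in>F. ereal c + x i) \<in> U}" by blast
    then show "openin (trop_topology F) S" using openin_continuous_map_preimage[OF continuous_trop_translate[of F c] U] by simp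
  qed
  moreover have "trop_class F ` U \<subseteq> trop_class F ` topspace (trop_topology F)"
    unfolding topspace_trop_topology using sub by (rule image_mono)
  ultimately show "openin (TP_topology F) (trop_class F ` U)"
    unfolding TP_topology_def openin_quotient_topology by (simp only: simp_thms)
qed

lemma Max_max:
  fixes u v :: "'i \<Rightarrow> 'b::linorder"
  assumes "finite I" "I \<noteq> {}"
  shows "Max ((\<lambda>i. max (u i) (v i)) ` I) = max (Max (u ` I)) (Max (v ` I))"
  using assms by (induction rule: finite_ne_induct) (simp_all add: ac_simps)

lemma Max_add_left:
  fixes u :: "'i \<Rightarrow> real" assumes "finite I" "I \<noteq> {}"
  shows "Max ((\<lambda>i. c + u i) ` I) = c + Max (u ` I)"
  using Max_add_commute[OF assms, of u c] by (simp add: add.commute)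

lemma Max_less_add:
  fixes u v :: "'i \<Rightarrow> real" assumes I: "finite I" "I \<noteq> {}" and "\<And>i. i \<in> I \<Longrightarrow> u i < v i + e"
  shows "Max (u ` I) < Max (v ` I) + e"
proof -
  have "u i < Max (v ` I) + e" if i: "i \<in> I" for i
    using assms(3)[OF i] Max_ge[OF finite_imageI[OF I(1)] imageI[OF i], of v] by linarith
  then show ?thesis using I by simp
qed

section \<open>Finiteness and generation by vertex functions\<close>

context div_class
begin

abbreviation "VF \<equiv> vertex_funs G D"
abbreviation "M \<equiv> red_module G D"

lemma VF_iff: "f \<in> VF \<longleftrightarrow> (\<exists>P\<in>\<Gamma>. f = rd P \<and> E (rd P) \<in> cell_vertices G D)"
proof -
  have "f \<in> VF \<longleftrightarrow> (\<exists>P\<in>\<Gamma>. f = red_fun G D P \<and> Red G D P \<in> cell_vertices G D)" unfolding vertex_funs_def by blast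
  also have "\<dots> \<longleftrightarrow> (\<exists>P\<in>\<Gamma>. f = rd P \<and> E (rd P) \<in> cell_vertices G D)" by (rule bex_cong[OF refl]) (simp add: red_fun_eq Red_eq)
  finally show ?thesis .
qed

lemma VF_RR: "f \<in> VF \<Longrightarrow> f \<in> RR"
  using VF_iff rd_RR by auto

lemma RR_eq_restrict: "f \<in> RR \<Longrightarrow> (\<lambda>x\<in>\<Gamma>. f x) = f"
  using RR_iff[of f] by (auto intro: extensional_restrict)

text \<open>The slope bounds limit the multiplicities and also the number of chips on an edge: a
  chip is a point of \<open>D\<close> or a breakpoint, and each breakpoint adds at least
  \<open>1\<close> to the bounded sum of absolute orders.\<close>

lemma finite_type_data:
  "finite ((\<lambda>f. (\<lambda>v\<in>verts G. E f (Vertex v), \<lambda>e\<in>edges G. mult_seq G (E f) e, \<lambda>e\<in>edges G. slope G f (e, 0, 1))) ` RR)"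
proof -
  obtain B :: int where B: "B \<ge> 0"
    "\<And>f v \<tau>. f \<in> RR \<Longrightarrow> v \<in> verts G \<Longrightarrow> \<tau> \<in> tangents G (Vertex v) \<Longrightarrow> \<bar>slope G f \<tau>\<bar> \<le> B"
    "\<And>f e. f \<in> RR \<Longrightarrow> e \<in> edges G \<Longrightarrow> (\<Sum>x\<in>ord_breaks f e. \<bar>ord_at G f (Inner e x)\<bar>) \<le> B"
    using RR_bound by metis
  let ?N = "\<lambda>v. D_norm + int (card (tangents G (Vertex v))) * B"
  let ?L = "\<lambda>e. {xs. set xs \<subseteq> {0..D_norm + B} \<and> length xs \<le> card (D_breaks e) + nat B}"
  have V: "E f (Vertex v) \<in> {0..?N v}" if f: "f \<in> RR" and v: "v \<in> verts G" for f v
  proof -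
    have "ord_at G f (Vertex v) \<le> (\<Sum>\<tau>\<in>tangents G (Vertex v). B)"
      unfolding ord_at_slope using B(2)[OF f v] by (intro sum_mono) (simp add: abs_le_iff)
    then show ?thesis using E_nonneg[OF f, of "Vertex v"] D_norm_ge[of "Vertex v"] by (simp add: add_div_def)
  qed
  have S: "slope G f (e, 0, 1) \<in> {-B..B}" if f: "f \<in> RR" and e: "e \<in> edges G" for f e
  proof -
    have "(e, 0, 1) \<in> tangents G (Vertex (fst e))" using e by (simp add: tangents_Vertex)
    moreover have "fst e \<in> verts G" using e tropical by (auto simp: tropical_curve_def)
    ultimately show ?thesis using B(2)[OF f, of "fst e" "(e, 0, 1)"] by (simp add: abs_le_iff)
  qed
  have L: "mult_seq G (E f) e \<in> ?L e" if f: "f \<in> RR" and e: "e \<in> edges G" for f e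
  proof -
    note So = ord_breaks[OF RR_pl[OF f] e]
    have le: "E f (Inner e t) \<le> D_norm + B" if t: "t \<in> {0<..<len G e}" for t
    proof (cases "t \<in> ord_breaks f e")
      case True
      have "\<bar>ord_at G f (Inner e t)\<bar> \<le> (\<Sum>x\<in>ord_breaks f e. \<bar>ord_at G f (Inner e x)\<bar>)"
        by (rule member_le_sum[OF True _ So(1)]) simp
      then show ?thesis using B(3)[OF f e] D_norm_ge[of "Inner e t"] by (simp add: add_div_def)
    next
      case False
      then show ?thesis using So(3)[OF t False] D_norm_ge[of "Inner e t"] B(1) by (simp add: add_div_def)
    qed
    let ?S = "{t \<in> {0<..<len G e}. E f (Inner e t) \<noteq> 0}"
    have sub: "?S \<subseteq> D_breaks e \<union> ord_breaks f e" using So(3) by (auto simp: D_breaks_def add_div_def)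
    have finS: "finite ?S" by (rule finite_subset[OF sub]) (use finite_SD So(1) in simp)
    have "int (card (ord_breaks f e)) = (\<Sum>x\<in>ord_breaks f e. 1)" by simp
    also have "\<dots> \<le> (\<Sum>x\<in>ord_breaks f e. \<bar>ord_at G f (Inner e x)\<bar>)" by (rule sum_mono) (auto simp: ord_breaks_def)
    finally have "card (ord_breaks f e) \<le> nat B" using B(3)[OF f e] by linarith
    moreover have "card ?S \<le> card (D_breaks e) + card (ord_breaks f e)"
      using card_mono[OF _ sub] finite_SD So(1) card_Un_le[of "D_breaks e" "ord_breaks f e"] by fastforce
    ultimately have "length (mult_seq G (E f) e) \<le> card (D_breaks e) + nat B" by (simp add: mult_seq_def)
    moreover have "set (mult_seq G (E f) e) \<subseteq> {0..D_norm + B}"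
      unfolding mult_seq_def using finS le E_nonneg[OF f] by auto
    ultimately show ?thesis by simp
  qed
  have "finite (PiE (verts G) (\<lambda>v. {0..?N v}) \<times> PiE (edges G) ?L \<times> PiE (edges G) (\<lambda>_. {-B..B}))"
    using finite_verts finite_edges by (intro finite_cartesian_product finite_PiE) (auto intro: finite_lists_length_le)
  moreover have "(\<lambda>f. (\<lambda>v\<in>verts G. E f (Vertex v), \<lambda>e\<in>edges G. mult_seq G (E f) e, \<lambda>e\<in>edges G. slope G f (e, 0, 1))) ` RR
      \<subseteq> PiE (verts G) (\<lambda>v. {0..?N v}) \<times> PiE (edges G) ?L \<times> PiE (edges G) (\<lambda>_. {-B..B})"
  proof (rule image_subsetI, intro SigmaI restrict_PiE_iff[THEN iffD2] ballI)
    fix f v assume "f \<in> RR" "v \<in> verts G" then show "E f (Vertex v) \<in> {0..?N v}" by (rule V)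
  next
    fix f e assume "f \<in> RR" "e \<in> edges G" then show "mult_seq G (E f) e \<in> ?L e" by (rule L)
  next
    fix f e assume "f \<in> RR" "e \<in> edges G" then show "slope G f (e, 0, 1) \<in> {-B..B}" by (rule S)
  qed
  ultimately show ?thesis by (rule finite_subset[rotated])
qed

text \<open>Functions with equal type data are related, and related vertices coincide; so the
  finitely many type data determine the divisor of a vertex function.\<close>

lemma finite_vertex_divisors: "finite (E ` VF)"
proof -
  define k where "k f = (\<lambda>v\<in>verts G. E f (Vertex v), \<lambda>e\<in>edges G. mult_seq G (E f) e, \<lambda>e\<in>edges G. slope G f (e, 0, 1))" for f
  have fin: "finite (k ` VF)"
    by (rule finite_subset[OF _ finite_type_data]) (use VF_RR in \<open>auto simp: k_def\<close>)
  have eq: "E g = E f" if f: "f \<in> VF" and g: "g \<in> VF" and k: "k f = k g" for f g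
  proof -
    have k': "(\<lambda>v\<in>verts G. E f (Vertex v)) = (\<lambda>v\<in>verts G. E g (Vertex v))"
      "(\<lambda>e\<in>edges G. mult_seq G (E f) e) = (\<lambda>e\<in>edges G. mult_seq G (E g) e)"
      "(\<lambda>e\<in>edges G. slope G f (e, 0, 1)) = (\<lambda>e\<in>edges G. slope G g (e, 0, 1))"
      using k by (simp_all add: k_def)
    have "related f g" unfolding related_def same_type_def
    proof (intro conjI ballI)
      show "E f (Vertex v) = E g (Vertex v)" if "v \<in> verts G" for v using fun_cong[OF k'(1), of v] that by simp
      show "mult_seq G (E f) e = mult_seq G (E g) e" if "e \<in> edges G" for e using fun_cong[OF k'(2), of e] that by simp
      show "slope G f (e, 0, 1) = slope G g (e, 0, 1)" if "e \<in> edges G" for e using fun_cong[OF k'(3), of e] that by simp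
    qed
    moreover have "E f \<in> cell_vertices G D" using f VF_iff by auto
    ultimately show ?thesis using cell_vertex_related_eq VF_RR f g by blast
  qed
  have "E ` VF \<subseteq> (\<lambda>d. E (inv_into VF k d)) ` k ` VF"
  proof
    fix F assume "F \<in> E ` VF"
    then obtain f where f: "f \<in> VF" "F = E f" by blast
    have "k f \<in> k ` VF" using f(1) by (rule imageI)
    from f_inv_into_f[OF this] inv_into_into[OF this]
    have "k (inv_into VF k (k f)) = k f" "inv_into VF k (k f) \<in> VF" .
    then have "F = E (inv_into VF k (k f))" using eq[of "inv_into VF k (k f)" f] f by simp
    then show "F \<in> (\<lambda>d. E (inv_into VF k d)) ` k ` VF" using f(1) by blast
  qed
  then show ?thesis using fin finite_surj by blast
qed

text \<open>The vertex functions may be infinite in number, so maxima over them are taken over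
  representatives modulo constants.\<close>

definition reps :: "('a point \<Rightarrow> real) set" where
  "reps = (SOME R. finite R \<and> R \<noteq> {} \<and> R \<subseteq> VF \<and> (\<forall>f\<in>VF. \<exists>r\<in>R. \<exists>c. \<forall>x\<in>\<Gamma>. f x = c + r x))"

lemma reps: "finite reps" "reps \<noteq> {}" "reps \<subseteq> VF" "\<And>f. f \<in> VF \<Longrightarrow> \<exists>r\<in>reps. \<exists>c. \<forall>x\<in>\<Gamma>. f x = c + r x"
proof -
  obtain R where R: "R \<subseteq> VF" "finite R" "E ` VF = E ` R"
    using finite_subset_image[OF finite_vertex_divisors, of E VF] by auto
  obtain v where "v \<in> verts G" using verts_ne by blast
  then have "Vertex v \<in> \<Gamma>" by (simp add: curve_def)
  \<comment> \<open>Taking \<open>x = P\<close> provides at least one vertex function, so that the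
    maxima over representatives make sense.\<close>
  from ex_vertex_beyond[OF this this] have "VF \<noteq> {}" using VF_iff by blast
  then have "R \<noteq> {}" using R(3) by blast
  moreover have "\<exists>r\<in>R. \<exists>c. \<forall>x\<in>\<Gamma>. f x = c + r x" if f: "f \<in> VF" for f
  proof -
    have "E f \<in> E ` R" using f R(3) by blast
    then obtain r where r: "r \<in> R" "E f = E r" by blast
    have "r \<in> VF" using r(1) R(1) by blast
    from r(2) add_div_eq_iff[OF VF_RR[OF f] VF_RR[OF this]] obtain c where "f = (\<lambda>x\<in>\<Gamma>. c + r x)" by auto
    then have "\<forall>x\<in>\<Gamma>. f x = c + r x" by simp
    then show ?thesis using r(1) by blast
  qed
  ultimately have "\<exists>R. finite R \<and> R \<noteq> {} \<and> R \<subseteq> VF \<and> (\<forall>f\<in>VF. \<exists>r\<in>R. \<exists>c. \<forall>x\<in>\<Gamma>. f x = c + r x)" using R by blast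
  from someI_ex[OF this] show "finite reps" "reps \<noteq> {}" "reps \<subseteq> VF" "\<And>f. f \<in> VF \<Longrightarrow> \<exists>r\<in>reps. \<exists>c. \<forall>x\<in>\<Gamma>. f x = c + r x"
    unfolding reps_def by blast+
qed

text \<open>No representative exceeds \<open>rd P\<close>, by maximality; the vertex beyond
  \<open>P\<close> as seen from \<open>x\<close> attains the value, and its normalisation at
  \<open>P\<close> cancels the constant that separates it from its representative.\<close>

lemma rd_eq_Max:
  assumes P: "P \<in> \<Gamma>" and x: "x \<in> \<Gamma>" shows "rd P x = Max ((\<lambda>f. - f P + f x) ` reps)"
proof (rule Max_eqI[symmetric])
  show "finite ((\<lambda>f. - f P + f x) ` reps)" using reps(1) by simp
  show "y \<le> rd P x" if y: "y \<in> (\<lambda>f. - f P + f x) ` reps" for y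
    using y rd_ge[OF x P] VF_RR reps(3) by force
  obtain Q where Q: "Q \<in> \<Gamma>" "E (rd Q) \<in> cell_vertices G D" "rd Q x = rd P x + rd Q P" using ex_vertex_beyond[OF x P] by blast
  then have "rd Q \<in> VF" using VF_iff by blast
  from reps(4)[OF this] obtain r c where r: "r \<in> reps" "\<forall>x\<in>\<Gamma>. rd Q x = c + r x" by blast
  then have "rd P x = - r P + r x" using Q(3) P x by simp
  then show "rd P x \<in> (\<lambda>f. - f P + f x) ` reps" using r(1) by blast
qed

text \<open>At each point the maximum agrees with one of the functions and has at least its slopes,
  hence at least its order.\<close>

lemma RR_max:
  assumes f: "f \<in> RR" and g: "g \<in> RR" shows "(\<lambda>x\<in>\<Gamma>. max (f x) (g x)) \<in> RR"
  unfolding RR_iff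
proof (intro conjI allI)
  let ?h = "\<lambda>x. max (f x) (g x)"
  note pf = RR_pl[OF f] and pg = RR_pl[OF g]
  show "(\<lambda>x\<in>\<Gamma>. ?h x) \<in> extensional \<Gamma>" by simp
  show "pl G (\<lambda>x\<in>\<Gamma>. ?h x)" using pl_max[OF pf pg] by simp
  fix x
  have "- D x \<le> ord_at G ?h x"
  proof (cases "x \<in> \<Gamma>")
    case x: True
    have sl: "slope G ?h \<tau> = (if f x > g x then slope G f \<tau> else if g x > f x then slope G g \<tau> else max (slope G f \<tau>) (slope G g \<tau>))"
      if "\<tau> \<in> tangents G x" for \<tau>
      by (rule slope_eq[OF that has_slope_max[OF pl_slope[OF pf x that] pl_slope[OF pg x that]]])
    show ?thesis
    proof (cases "g x > f x")
      case True
      have "ord_at G g x \<le> ord_at G ?h x" unfolding ord_at_slope by (rule sum_mono) (use True sl in auto)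
      then show ?thesis using RR_ord[OF g, of x] by linarith
    next
      case False
      have "ord_at G f x \<le> ord_at G ?h x" unfolding ord_at_slope by (rule sum_mono) (use False sl in auto)
      then show ?thesis using RR_ord[OF f, of x] by linarith
    qed
  qed (simp add: ord_at_off D_off)
  then show "0 \<le> D x + ord_at G (\<lambda>x\<in>\<Gamma>. ?h x) x" by simp
qed

lemma M_RR: "g \<in> M \<Longrightarrow> g \<in> RR"
proof (induction rule: red_module.induct)
  case (gen P) then show ?case by (simp only: red_fun_eq rd_RR)
qed (rule RR_max RR_shift; assumption)+

lemma VF_M: "f \<in> VF \<Longrightarrow> f \<in> M"
  unfolding vertex_funs_def by (auto intro: red_module.gen)

lemma M_Max:
  assumes "finite I" "I \<noteq> {}" "\<And>i. i \<in> I \<Longrightarrow> h i \<in> M" shows "(\<lambda>x\<in>\<Gamma>. Max ((\<lambda>i. h i x) ` I)) \<in> M"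
  using assms
proof (induction rule: finite_ne_induct)
  case (singleton i)
  then show ?case using RR_eq_restrict[OF M_RR, of "h i"] by simp
next
  case (insert i I)
  have "(\<lambda>x\<in>\<Gamma>. max (h i x) ((\<lambda>x\<in>\<Gamma>. Max ((\<lambda>i. h i x) ` I)) x)) \<in> M"
    by (rule red_module.tmax) (use insert in auto)
  moreover have "(\<lambda>x\<in>\<Gamma>. max (h i x) ((\<lambda>x\<in>\<Gamma>. Max ((\<lambda>i. h i x) ` I)) x)) = (\<lambda>x\<in>\<Gamma>. Max ((\<lambda>i. h i x) ` insert i I))"
    using insert.hyps by (intro restrict_ext) simp
  ultimately show ?case by (simp only:)
qed

lemma M_eq_Max:
  "g \<in> M \<Longrightarrow> \<exists>b. \<forall>x\<in>\<Gamma>. g x = Max ((\<lambda>f. b f + f x) ` reps)"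
proof (induction rule: red_module.induct)
  case (gen P)
  then show ?case using rd_eq_Max[OF gen] by (intro exI[of _ "\<lambda>f. - f P"]) (simp add: red_fun_eq)
next
  case (tmax f g)
  then obtain b b' where b: "\<forall>x\<in>\<Gamma>. f x = Max ((\<lambda>f. b f + f x) ` reps)" "\<forall>x\<in>\<Gamma>. g x = Max ((\<lambda>f. b' f + f x) ` reps)" by auto
  have "Max ((\<lambda>f. max (b f) (b' f) + f x) ` reps) = max (f x) (g x)" if "x \<in> \<Gamma>" for x
    using b that Max_max[OF reps(1,2), of "\<lambda>f. b f + f x" "\<lambda>f. b' f + f x"] by (simp add: max_add_distrib_left)
  then show ?case by (intro exI[of _ "\<lambda>f. max (b f) (b' f)"]) simp
next
  case (shift f c)
  then obtain b where b: "\<forall>x\<in>\<Gamma>. f x = Max ((\<lambda>f. b f + f x) ` reps)" by auto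
  have "Max ((\<lambda>f. c + b f + f x) ` reps) = c + f x" if "x \<in> \<Gamma>" for x
    using b that Max_add_left[OF reps(1,2), of c "\<lambda>f. b f + f x"] by (simp add: add.assoc)
  then show ?case by (intro exI[of _ "\<lambda>f. c + b f"]) simp
qed

section \<open>Residuated coordinates\<close>

definition gap :: "('a point \<Rightarrow> real) \<Rightarrow> ('a point \<Rightarrow> real) \<Rightarrow> real" where
  "gap g f = (SUP P\<in>\<Gamma>. f P - g P)"

lemma gap_attained:
  assumes "f \<in> RR" "g \<in> RR"
  shows "\<exists>a\<in>\<Gamma>. gap g f = f a - g a" "\<And>P. P \<in> \<Gamma> \<Longrightarrow> f P - g P \<le> gap g f"
proof -
  obtain a where a: "a \<in> \<Gamma>" "\<And>P. P \<in> \<Gamma> \<Longrightarrow> f P - g P \<le> f a - g a"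
    using attains_max[OF pl_continuous[OF pl_diff[OF RR_pl[OF assms(1)] RR_pl[OF assms(2)]]]] by blast
  have eq: "gap g f = f a - g a" unfolding gap_def by (rule cSup_eq_maximum) (use a in auto)
  show "\<exists>a\<in>\<Gamma>. gap g f = f a - g a" using a(1) eq by blast
  show "\<And>P. P \<in> \<Gamma> \<Longrightarrow> f P - g P \<le> gap g f" using a(2) eq by simp
qed

text \<open>Maximality of \<open>rd P\<close> says that \<open>f - rd P\<close> is largest at
  \<open>P\<close>. This is why the coordinates of a reduced divisor are evaluations at its base
  point.\<close>

lemma gap_rd: "f \<in> RR \<Longrightarrow> P \<in> \<Gamma> \<Longrightarrow> gap (rd P) f = f P"
  unfolding gap_def using rd_ge[of _ P f] rd_self[of P] by (intro cSup_eq_maximum) (force simp: algebra_simps)+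

lemma gap_shift:
  assumes f: "f \<in> RR" and g: "g \<in> RR" shows "gap (\<lambda>x\<in>\<Gamma>. c + g x) f = - c + gap g f"
proof -
  obtain a where a: "a \<in> \<Gamma>" "gap g f = f a - g a" using gap_attained(1)[OF f g] by blast
  show ?thesis unfolding gap_def[of "\<lambda>x\<in>\<Gamma>. c + g x"]
    by (rule cSup_eq_maximum) (use a gap_attained(2)[OF f g] in \<open>force simp: algebra_simps\<close>)+
qed

lemma continuous_gap:
  assumes f: "f \<in> RR" shows "continuous_map (uniform_topology \<Gamma> RR) euclideanreal (\<lambda>g. gap g f)"
  unfolding continuous_map_def
proof (intro conjI allI impI)
  fix U assume "openin euclideanreal U"
  then have U: "open U" by simp
  show "openin (uniform_topology \<Gamma> RR) {g \<in> topspace (uniform_topology \<Gamma> RR). gap g f \<in> U}"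
    unfolding openin_uniform_topology topspace_uniform_topology
  proof (intro conjI ballI)
    fix g assume "g \<in> {g \<in> RR. gap g f \<in> U}"
    then have g: "g \<in> RR" "gap g f \<in> U" by auto
    obtain e where e: "e > 0" "\<And>y. dist y (gap g f) < e \<Longrightarrow> y \<in> U" using U g(2) unfolding open_dist by blast
    have lt: "gap h f < gap k f + e" if h: "h \<in> RR" and k: "k \<in> RR" and hk: "\<forall>x\<in>\<Gamma>. \<bar>h x - k x\<bar> < e" for h k
    proof -
      obtain a where a: "a \<in> \<Gamma>" "gap h f = f a - h a" using gap_attained(1)[OF f h] by blast
      have "\<bar>h a - k a\<bar> < e" using hk a(1) by blast
      then show ?thesis using gap_attained(2)[OF f k a(1)] a(2) by linarith
    qed
    have "h \<in> {g \<in> RR. gap g f \<in> U}" if h: "h \<in> RR" "\<forall>x\<in>\<Gamma>. \<bar>h x - g x\<bar> < e" for h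
    proof -
      have "\<forall>x\<in>\<Gamma>. \<bar>g x - h x\<bar> < e" using h(2) by (simp add: abs_minus_commute)
      from lt[OF h(1) g(1) h(2)] lt[OF g(1) h(1) this] have "dist (gap h f) (gap g f) < e" by (simp add: dist_real_def abs_if)
      then show ?thesis using e(2) h(1) by simp
    qed
    then show "\<exists>\<epsilon>>0. \<forall>h\<in>RR. (\<forall>x\<in>\<Gamma>. \<bar>h x - g x\<bar> < \<epsilon>) \<longrightarrow> h \<in> {g \<in> RR. gap g f \<in> U}" using e(1) by blast
  qed auto
qed simp

text \<open>\<open>B\<close> lists coefficients and points; the vector is the tropical combination
  of the evaluations at these points. Vectors of this form make up \<open>tcone\<close>.\<close>

definition trop_comb :: "(real \<times> 'a point) set \<Rightarrow> ('a point \<Rightarrow> real) \<Rightarrow> ereal" where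
  "trop_comb B = (\<lambda>f\<in>VF. ereal (Max ((\<lambda>b. fst b + f (snd b)) ` B)))"

abbreviation "thull \<equiv> trop_conv VF (eval_class VF ` \<Gamma>)"

text \<open>The cone over the hull, before constants are divided out. \<open>coords\<close> and
  \<open>fun_of\<close> will be inverse to each other between \<open>M\<close> and this
  cone.\<close>

definition tcone :: "(('a point \<Rightarrow> real) \<Rightarrow> ereal) set" where
  "tcone = {z \<in> trop_vectors VF. trop_class VF z \<in> thull}"

lemma mono_ereal: "mono ereal"
  by (simp add: mono_def)

lemma trop_comb_cone:
  assumes B: "finite B" "B \<noteq> {}" "snd ` B \<subseteq> \<Gamma>" shows "trop_comb B \<in> tcone"
proof -
  obtain r where r: "r \<in> VF" using reps(2,3) by blast
  have "trop_comb B \<in> trop_vectors VF" unfolding trop_vectors_def trop_comb_def using r by (auto intro!: bexI[of _ r])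
  moreover have "trop_class VF (trop_comb B) \<in> thull"
    unfolding trop_conv_def
  proof (rule CollectI, intro exI conjI)
    let ?A = "(\<lambda>b. (fst b, \<lambda>f\<in>VF. ereal (f (snd b)))) ` B"
    show "finite ?A" "?A \<noteq> {}" using B by auto
    show "?A \<subseteq> UNIV \<times> \<Union> (eval_class VF ` \<Gamma>)"
    proof (rule image_subsetI)
      fix b assume b: "b \<in> B"
      have "(\<lambda>f\<in>VF. ereal (f (snd b))) \<in> eval_class VF (snd b)" unfolding eval_class_def by (rule trop_class_self) simp
      moreover have "snd b \<in> \<Gamma>" using b B(3) by blast
      ultimately show "(fst b, \<lambda>f\<in>VF. ereal (f (snd b))) \<in> UNIV \<times> \<Union> (eval_class VF ` \<Gamma>)" by blast
    qed
    have "trop_comb B = (\<lambda>i\<in>VF. Max ((\<lambda>(c, s). ereal c + s i) ` ?A))"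
      unfolding trop_comb_def
    proof (rule restrict_ext)
      fix f assume f: "f \<in> VF"
      have "(\<lambda>(c, s). ereal c + s f) ` ?A = ereal ` (\<lambda>b. fst b + f (snd b)) ` B"
        unfolding image_image by (rule image_cong) (use f in simp_all)
      then show "ereal (Max ((\<lambda>b. fst b + f (snd b)) ` B)) = Max ((\<lambda>(c, s). ereal c + s f) ` ?A)"
        using mono_Max_commute[OF mono_ereal, of "(\<lambda>b. fst b + f (snd b)) ` B"] B by simp
    qed
    then show "trop_class VF (trop_comb B) = trop_class VF (\<lambda>i\<in>VF. Max ((\<lambda>(c, s). ereal c + s i) ` ?A))" by simp
  qed
  ultimately show ?thesis unfolding tcone_def by blast
qed

lemma cone_trop_comb:
  \<comment> \<open>The hull is formed from arbitrary representatives of the classes; their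
    constants are absorbed into the coefficients, so every coordinate is a real number.\<close>
  assumes z: "z \<in> tcone"
  obtains B where "finite B" "B \<noteq> {}" "snd ` B \<subseteq> \<Gamma>" "z = trop_comb B"
proof -
  have zv: "z \<in> extensional VF" using z by (auto simp: tcone_def trop_vectors_def PiE_def)
  have "trop_class VF z \<in> thull" using z by (simp add: tcone_def)
  from trop_convE[OF this] obtain A where
    A: "finite A" "A \<noteq> {}" "A \<subseteq> UNIV \<times> \<Union> (eval_class VF ` \<Gamma>)" and
    zA: "trop_class VF z = trop_class VF (\<lambda>i\<in>VF. Max ((\<lambda>(c, s). ereal c + s i) ` A))" .
  let ?w = "\<lambda>i. Max ((\<lambda>(c, s). ereal c + s i) ` A)"
  obtain c where c: "z = (\<lambda>i\<in>VF. ereal c + (\<lambda>i\<in>VF. ?w i) i)" using trop_class_eqD[OF zA zv] .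
  have "\<forall>a\<in>A. \<exists>b. snd b \<in> \<Gamma> \<and> (\<forall>i\<in>VF. ereal (fst a) + snd a i = ereal (fst b + i (snd b)))"
  proof
    fix a assume "a \<in> A"
    then obtain P where P: "P \<in> \<Gamma>" "snd a \<in> eval_class VF P" using A(3) by fastforce
    then obtain d where "snd a = (\<lambda>i\<in>VF. ereal d + (\<lambda>f\<in>VF. ereal (f P)) i)"
      unfolding eval_class_def trop_class_def by blast
    then show "\<exists>b. snd b \<in> \<Gamma> \<and> (\<forall>i\<in>VF. ereal (fst a) + snd a i = ereal (fst b + i (snd b)))"
      using P(1) by (intro exI[of _ "(fst a + d, P)"]) (simp add: add.assoc)
  qed
  from bchoice[OF this] obtain \<beta> where \<beta>: "\<And>a. a \<in> A \<Longrightarrow> snd (\<beta> a) \<in> \<Gamma>"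
    "\<And>a i. a \<in> A \<Longrightarrow> i \<in> VF \<Longrightarrow> ereal (fst a) + snd a i = ereal (fst (\<beta> a) + i (snd (\<beta> a)))" by blast
  let ?B = "(\<lambda>a. (c + fst (\<beta> a), snd (\<beta> a))) ` A"
  have "z = trop_comb ?B"
    unfolding c trop_comb_def
  proof (rule restrict_ext)
    fix f assume f: "f \<in> VF"
    have "(\<lambda>(c, s). ereal c + s f) ` A = ereal ` (\<lambda>a. fst (\<beta> a) + f (snd (\<beta> a))) ` A"
      unfolding image_image by (rule image_cong[OF refl]) (use \<beta>(2)[OF _ f] in \<open>simp add: case_prod_beta\<close>)
    then have "?w f = ereal (Max ((\<lambda>a. fst (\<beta> a) + f (snd (\<beta> a))) ` A))"
      using mono_Max_commute[OF mono_ereal, of "(\<lambda>a. fst (\<beta> a) + f (snd (\<beta> a))) ` A"] A by simp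
    moreover have "c + Max ((\<lambda>a. fst (\<beta> a) + f (snd (\<beta> a))) ` A) = Max ((\<lambda>b. fst b + f (snd b)) ` ?B)"
      using Max_add_left[OF A(1,2), of c "\<lambda>a. fst (\<beta> a) + f (snd (\<beta> a))"] by (simp add: image_image add.assoc)
    ultimately show "ereal c + (\<lambda>i\<in>VF. ?w i) f = ereal (Max ((\<lambda>b. fst b + f (snd b)) ` ?B))" using f by simp
  qed
  moreover have "snd ` ?B \<subseteq> \<Gamma>" unfolding image_image by (rule image_subsetI) (use \<beta>(1) in simp)
  ultimately show ?thesis using that[of ?B] A(1,2) by blast
qed

definition coords :: "('a point \<Rightarrow> real) \<Rightarrow> ('a point \<Rightarrow> real) \<Rightarrow> ereal" where
  "coords g = (\<lambda>f\<in>VF. ereal (gap g f))"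

text \<open>\<open>coords\<close> and \<open>fun_of\<close> are residuated to each other: \<open>coords g\<close> is the least \<open>z\<close> with
  \<open>f - z f \<le> g\<close> for all vertex functions \<open>f\<close>.\<close>

definition fun_of :: "(('a point \<Rightarrow> real) \<Rightarrow> ereal) \<Rightarrow> 'a point \<Rightarrow> real" where
  "fun_of z = (\<lambda>P\<in>\<Gamma>. Max ((\<lambda>f. - real_of_ereal (z f) + f P) ` reps))"

lemma coords_shift: "g \<in> RR \<Longrightarrow> coords (\<lambda>x\<in>\<Gamma>. c + g x) = (\<lambda>f\<in>VF. ereal (- c) + coords g f)"
  unfolding coords_def by (rule restrict_ext) (simp add: gap_shift VF_RR)

lemma coords_rd: "P \<in> \<Gamma> \<Longrightarrow> coords (rd P) = (\<lambda>f\<in>VF. ereal (f P))"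
  unfolding coords_def by (rule restrict_ext) (simp add: gap_rd VF_RR)

text \<open>For each representative \<open>f\<close> choose a point \<open>a f\<close> where
  \<open>f - g\<close> is largest. The combination with coefficients \<open>- g (a f)\<close>
  reproduces all coordinates: for any vertex function the point of its own representative is
  optimal, the other points give at most the gap.\<close>

lemma coords_cone:
  assumes g: "g \<in> RR" shows "coords g \<in> tcone"
proof -
  have "\<forall>f\<in>reps. \<exists>a. a \<in> \<Gamma> \<and> gap g f = f a - g a" using gap_attained(1)[OF _ g] VF_RR reps(3) by blast
  from bchoice[OF this] obtain a where a: "\<And>f. f \<in> reps \<Longrightarrow> a f \<in> \<Gamma>" "\<And>f. f \<in> reps \<Longrightarrow> gap g f = f (a f) - g (a f)" by blast
  let ?B = "(\<lambda>f. (- g (a f), a f)) ` reps"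
  have "coords g = trop_comb ?B"
    unfolding coords_def trop_comb_def
  proof (rule restrict_ext)
    fix f assume f: "f \<in> VF"
    have "Max ((\<lambda>b. fst b + f (snd b)) ` ?B) = gap g f"
    proof (rule Max_eqI)
      show "finite ((\<lambda>b. fst b + f (snd b)) ` ?B)" using reps(1) by simp
      show "y \<le> gap g f" if y: "y \<in> (\<lambda>b. fst b + f (snd b)) ` ?B" for y
      proof -
        obtain r where "r \<in> reps" "y = f (a r) - g (a r)" using y by auto
        then show ?thesis using gap_attained(2)[OF VF_RR[OF f] g a(1)] by simp
      qed
      obtain r c where r: "r \<in> reps" "\<forall>x\<in>\<Gamma>. f x = c + r x" using reps(4)[OF f] by blast
      obtain x where x: "x \<in> \<Gamma>" "gap g f = f x - g x" using gap_attained(1)[OF VF_RR[OF f] g] by blast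
      have "r x - g x \<le> gap g r" using gap_attained(2)[OF VF_RR g x(1)] r(1) reps(3) by blast
      then have "gap g f \<le> f (a r) - g (a r)" using a(2)[OF r(1)] x r(2) a(1)[OF r(1)] by simp
      moreover have "f (a r) - g (a r) \<le> gap g f" using gap_attained(2)[OF VF_RR[OF f] g a(1)[OF r(1)]] .
      ultimately have "gap g f = f (a r) - g (a r)" by simp
      then show "gap g f \<in> (\<lambda>b. fst b + f (snd b)) ` ?B" using r(1) by (auto simp: image_image)
    qed
    then show "ereal (gap g f) = ereal (Max ((\<lambda>b. fst b + f (snd b)) ` ?B))" by simp
  qed
  moreover have "trop_comb ?B \<in> tcone" by (rule trop_comb_cone) (use reps(1,2) a(1) in auto)
  ultimately show ?thesis by simp
qed

lemma fun_of_M: "fun_of z \<in> M"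
proof -
  have "(\<lambda>x\<in>\<Gamma>. Max ((\<lambda>f. (\<lambda>x\<in>\<Gamma>. - real_of_ereal (z f) + f x) x) ` reps)) \<in> M"
    by (rule M_Max[OF reps(1,2)]) (rule red_module.shift[OF VF_M], use reps(3) in blast)
  moreover have "(\<lambda>x\<in>\<Gamma>. Max ((\<lambda>f. (\<lambda>x\<in>\<Gamma>. - real_of_ereal (z f) + f x) x) ` reps)) = fun_of z"
    unfolding fun_of_def by (rule restrict_ext) simp
  ultimately show ?thesis by (simp only:)
qed

text \<open>\<open>g\<close> is some maximum of shifted representatives. Replacing each shift by the
  largest one that keeps the term below \<open>g\<close>, namely \<open>- gap g f\<close>, can only
  enlarge the terms and never exceeds \<open>g\<close>.\<close>

lemma fun_of_coords:
  assumes g: "g \<in> M" shows "fun_of (coords g) = g"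
proof -
  obtain b where b: "\<And>x. x \<in> \<Gamma> \<Longrightarrow> g x = Max ((\<lambda>f. b f + f x) ` reps)" using M_eq_Max[OF g] by blast
  have "Max ((\<lambda>f. - gap g f + f x) ` reps) = g x" if x: "x \<in> \<Gamma>" for x
  proof (rule antisym)
    have "- gap g f + f x \<le> g x" if f: "f \<in> reps" for f
      using gap_attained(2)[OF VF_RR M_RR[OF g] x, of f] f reps(3) by auto
    then show "Max ((\<lambda>f. - gap g f + f x) ` reps) \<le> g x" using reps(1,2) by simp
    have "b f + f x \<le> Max ((\<lambda>f. - gap g f + f x) ` reps)" if f: "f \<in> reps" for f
    proof -
      have "f \<in> RR" using f reps(3) VF_RR by blast
      then obtain a where a: "a \<in> \<Gamma>" "gap g f = f a - g a" using gap_attained(1)[OF _ M_RR[OF g]] by blast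
      have "b f + f a \<le> g a" unfolding b[OF a(1)] by (rule Max_ge) (use reps(1) f in auto)
      moreover have "- gap g f + f x \<le> Max ((\<lambda>f. - gap g f + f x) ` reps)" by (rule Max_ge) (use reps(1) f in auto)
      ultimately show ?thesis using a(2) by simp
    qed
    then show "g x \<le> Max ((\<lambda>f. - gap g f + f x) ` reps)" unfolding b[OF x] using reps(1,2) by simp
  qed
  moreover have "coords g f = ereal (gap g f)" if "f \<in> reps" for f using that reps(3) by (auto simp: coords_def)
  ultimately have "fun_of (coords g) = (\<lambda>x\<in>\<Gamma>. g x)"
    unfolding fun_of_def by (intro restrict_ext) (simp cong: image_cong_simp)
  then show ?thesis using RR_eq_restrict[OF M_RR[OF g]] by simp
qed

text \<open>One inequality compares \<open>f\<close> with its own term in the maximum. For the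
  other, \<open>fun_of z\<close> is at most \<open>- fst b\<close> at each point
  \<open>snd b\<close> of the combination, and evaluating the gap at these points recovers every
  term of \<open>z f\<close>.\<close>

lemma coords_fun_of:
  assumes z: "z \<in> tcone" shows "coords (fun_of z) = z"
proof -
  obtain B where B: "finite B" "B \<noteq> {}" "snd ` B \<subseteq> \<Gamma>" "z = trop_comb B" using cone_trop_comb[OF z] .
  let ?m = "\<lambda>f. Max ((\<lambda>b. fst b + f (snd b)) ` B)"
  have zf: "z f = ereal (?m f)" if "f \<in> VF" for f using that by (simp add: B(4) trop_comb_def)
  have le: "fst b + f (snd b) \<le> ?m f" if "b \<in> B" for b f by (rule Max_ge) (use B(1) that in auto)
  have fo: "fun_of z x = Max ((\<lambda>f. - ?m f + f x) ` reps)" if x: "x \<in> \<Gamma>" for x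
  proof -
    have "(\<lambda>f. - real_of_ereal (z f) + f x) ` reps = (\<lambda>f. - ?m f + f x) ` reps"
      by (rule image_cong[OF refl]) (use zf reps(3) in auto)
    then show ?thesis using x by (simp add: fun_of_def)
  qed
  have "gap (fun_of z) f = ?m f" if f: "f \<in> VF" for f
  proof (rule antisym)
    note fR = VF_RR[OF f] and MR = M_RR[OF fun_of_M, of z]
    \<comment> \<open>\<open>fun_of\<close> uses representatives only; passing from \<open>f\<close>
      to \<open>r\<close> changes the coordinate and the function by the same constant.\<close>
    obtain r c where r: "r \<in> reps" "\<forall>x\<in>\<Gamma>. f x = c + r x" using reps(4)[OF f] by blast
    have "(\<lambda>b. fst b + f (snd b)) ` B = (\<lambda>b. c + (fst b + r (snd b))) ` B"
      by (rule image_cong[OF refl]) (use r(2) B(3) in auto)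
    then have mf: "?m f = c + ?m r" using Max_add_left[OF B(1,2), of c "\<lambda>b. fst b + r (snd b)"] by simp
    obtain x where x: "x \<in> \<Gamma>" "gap (fun_of z) f = f x - fun_of z x" using gap_attained(1)[OF fR MR] by blast
    have "- ?m r + r x \<le> fun_of z x" unfolding fo[OF x(1)] by (rule Max_ge) (use r(1) reps(1) in auto)
    then show "gap (fun_of z) f \<le> ?m f" using x r(2) mf by simp
    have "fst b + f (snd b) \<le> gap (fun_of z) f" if b: "b \<in> B" for b
    proof -
      have P: "snd b \<in> \<Gamma>" using b B(3) by blast
      have "- ?m r + r (snd b) \<le> - fst b" for r using le[OF b, of r] by simp
      then have "fun_of z (snd b) \<le> - fst b" unfolding fo[OF P] using reps(1,2) by simp
      then show ?thesis using gap_attained(2)[OF fR MR P] by simp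
    qed
    then show "?m f \<le> gap (fun_of z) f" using B(1,2) by simp
  qed
  then have "coords (fun_of z) = (\<lambda>f\<in>VF. z f)" unfolding coords_def by (intro restrict_ext) (simp add: zf)
  moreover have "(\<lambda>f\<in>VF. z f) = z" using z by (intro extensional_restrict) (auto simp: tcone_def trop_vectors_def PiE_def)
  ultimately show ?thesis by simp
qed

lemma fun_of_translate:
  assumes z: "z \<in> tcone" shows "fun_of (\<lambda>f\<in>VF. ereal c + z f) = (\<lambda>x\<in>\<Gamma>. - c + fun_of z x)"
proof -
  obtain B where B: "z = trop_comb B" using cone_trop_comb[OF z] .
  have "(\<lambda>f. - real_of_ereal ((\<lambda>f\<in>VF. ereal c + z f) f) + f x) ` reps = (\<lambda>f. - c + (- real_of_ereal (z f) + f x)) ` reps" for x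
    by (rule image_cong[OF refl]) (use reps(3) in \<open>auto simp: B trop_comb_def\<close>)
  note img = this
  show ?thesis unfolding fun_of_def
  proof (rule restrict_ext)
    fix x assume x: "x \<in> \<Gamma>"
    show "Max ((\<lambda>f. - real_of_ereal ((\<lambda>f\<in>VF. ereal c + z f) f) + f x) ` reps) = - c + (\<lambda>P\<in>\<Gamma>. Max ((\<lambda>f. - real_of_ereal (z f) + f P) ` reps)) x"
      unfolding img Max_add_left[OF reps(1,2)] using x by simp
  qed
qed

section \<open>Topology of the coordinates\<close>

lemma continuous_coords:
  "continuous_map (subtopology (uniform_topology \<Gamma> RR) M) (subtopology (trop_topology VF) tcone) coords"
  unfolding continuous_map_in_subtopology continuous_map_componentwise
proof (intro conjI ballI)
  let ?X = "subtopology (uniform_topology \<Gamma> RR) M"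
  have M: "coords g \<in> tcone" if "g \<in> topspace ?X" for g using that M_RR coords_cone by (simp add: topspace_subtopology)
  show "coords \<in> topspace ?X \<rightarrow> trop_vectors VF" using M by (auto simp: tcone_def)
  show "coords \<in> topspace ?X \<rightarrow> tcone" using M by auto
  show "coords ` topspace ?X \<subseteq> extensional VF" by (auto simp: coords_def)
  fix f assume f: "f \<in> VF"
  have 1: "continuous_map ?X euclideanreal (\<lambda>g. gap g f)"
    by (rule continuous_map_from_subtopology[OF continuous_gap[OF VF_RR[OF f]]])
  have "continuous_on UNIV ereal" by (intro continuous_on_ereal continuous_on_id)
  then have 2: "continuous_map euclideanreal euclidean ereal" by simp
  have "continuous_map ?X euclidean (\<lambda>g. ereal (gap g f))" using continuous_map_compose[OF 1 2] by (simp add: o_def)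
  then show "continuous_map ?X euclidean (\<lambda>g. coords g f)" using f by (simp add: coords_def)
  show "(\<lambda>g. coords g f) \<in> topspace ?X \<rightarrow> {..<\<infinity>}" using f by (simp add: coords_def)
qed

text \<open>Only the finitely many coordinates in \<open>reps\<close> enter, and on the cone they
  are real. Controlling them by \<open>e\<close> controls the function uniformly, so a basic open
  set of the product topology suffices even when there are infinitely many coordinates.\<close>

lemma continuous_fun_of:
  "continuous_map (subtopology (trop_topology VF) tcone) (subtopology (uniform_topology \<Gamma> RR) M) fun_of"
  unfolding continuous_map_in_subtopology[of _ "uniform_topology \<Gamma> RR"]
proof
  let ?X = "subtopology (trop_topology VF) tcone"
  have tX: "topspace ?X = tcone" unfolding topspace_subtopology[of _ tcone] topspace_trop_topology by (auto simp: tcone_def)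
  have real: "continuous_map ?X euclideanreal (\<lambda>z. real_of_ereal (z f))" if f: "f \<in> VF" for f
  proof -
    have "continuous_map (product_topology (\<lambda>_. top_of_set {..<\<infinity>::ereal}) VF) euclidean (\<lambda>z. z f)"
      using continuous_map_product_projection[OF f, of "\<lambda>_. top_of_set {..<\<infinity>::ereal}"] by (rule continuous_map_into_fulltopology)
    then have "continuous_map ?X euclidean (\<lambda>z. z f)" by (intro continuous_map_from_subtopology)
    moreover have "z f \<in> UNIV - {\<infinity>, -\<infinity>}" if z: "z \<in> tcone" for z
    proof -
      obtain B where "z = trop_comb B" using cone_trop_comb[OF z] .
      then show ?thesis using f by (simp add: trop_comb_def)
    qed
    ultimately have 1: "continuous_map ?X (top_of_set (UNIV - {\<infinity>, -\<infinity>})) (\<lambda>z. z f)"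
      unfolding continuous_map_in_subtopology[of _ euclidean] tX by blast
    have 2: "continuous_map (top_of_set (UNIV - {\<infinity>, -\<infinity>::ereal})) euclideanreal real_of_ereal"
      using continuous_on_real by simp
    show ?thesis using continuous_map_compose[OF 1 2] by (simp add: o_def)
  qed
  show "fun_of \<in> topspace ?X \<rightarrow> M" using fun_of_M by blast
  show "continuous_map ?X (uniform_topology \<Gamma> RR) fun_of"
    unfolding continuous_map_def topspace_uniform_topology
  proof (intro conjI allI impI)
    show "fun_of \<in> topspace ?X \<rightarrow> RR" using fun_of_M M_RR by blast
    fix U assume U: "openin (uniform_topology \<Gamma> RR) U"
    show "openin ?X {z \<in> topspace ?X. fun_of z \<in> U}"
    proof (subst openin_subopen, intro ballI)
      fix z assume "z \<in> {z \<in> topspace ?X. fun_of z \<in> U}"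
      then have z: "z \<in> topspace ?X" "fun_of z \<in> U" by auto
      obtain e where e: "e > 0" "\<And>g. g \<in> RR \<Longrightarrow> (\<forall>x\<in>\<Gamma>. \<bar>g x - fun_of z x\<bar> < e) \<Longrightarrow> g \<in> U"
        using U z(2) unfolding openin_uniform_topology by blast
      let ?N = "\<lambda>f. {w \<in> topspace ?X. real_of_ereal (w f) \<in> ball (real_of_ereal (z f)) e}"
      let ?W = "(\<Inter>f\<in>reps. ?N f) \<inter> topspace ?X"
      have "openin ?X (?N f)" if "f \<in> reps" for f
        by (rule openin_continuous_map_preimage[OF real]) (use that reps(3) in auto)
      then have "openin ?X ?W" by (rule openin_INT[OF reps(1)])
      moreover have "z \<in> ?W" using z(1) e(1) by simp
      moreover have "?W \<subseteq> {z \<in> topspace ?X. fun_of z \<in> U}"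
      proof
        fix w assume w: "w \<in> ?W"
        have d: "\<bar>real_of_ereal (z f) - real_of_ereal (w f)\<bar> < e" if "f \<in> reps" for f
          using w that by (auto simp: dist_real_def)
        have "\<bar>fun_of w x - fun_of z x\<bar> < e" if x: "x \<in> \<Gamma>" for x
        proof -
          let ?m = "\<lambda>z f. - real_of_ereal (z f) + f x"
          have m: "fun_of z x = Max (?m z ` reps)" for z using x by (simp add: fun_of_def)
          have "?m w f < ?m z f + e" "?m z f < ?m w f + e" if "f \<in> reps" for f using d[OF that] by linarith+
          then have "Max (?m w ` reps) < Max (?m z ` reps) + e" "Max (?m z ` reps) < Max (?m w ` reps) + e"
            by (simp_all only: Max_less_add[OF reps(1,2)])
          then show ?thesis unfolding m by linarith
        qed
        then have "fun_of w \<in> U" using e(2) M_RR[OF fun_of_M] by blast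
        then show "w \<in> {z \<in> topspace ?X. fun_of z \<in> U}" using w by blast
      qed
      ultimately show "\<exists>T. openin ?X T \<and> z \<in> T \<and> T \<subseteq> {z \<in> topspace ?X. fun_of z \<in> U}" by blast
    qed
  qed
qed

text \<open>The module is closed under adding constants, hence saturated, and \<open>E_open\<close>
  allows restricting to it.\<close>

lemma quotient_map_E:
  "quotient_map (subtopology (uniform_topology \<Gamma> RR) M) (subtopology LTop (E ` M)) E"
proof -
  have "{f \<in> topspace (uniform_topology \<Gamma> RR). E f \<in> E ` M} = M"
  proof
    show "M \<subseteq> {f \<in> topspace (uniform_topology \<Gamma> RR). E f \<in> E ` M}" using M_RR by auto
    show "{f \<in> topspace (uniform_topology \<Gamma> RR). E f \<in> E ` M} \<subseteq> M"
    proof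
      fix f assume "f \<in> {f \<in> topspace (uniform_topology \<Gamma> RR). E f \<in> E ` M}"
      then obtain g where f: "f \<in> RR" and g: "g \<in> M" "E f = E g" by auto
      from g(2) add_div_eq_iff[OF f M_RR[OF g(1)]] obtain c where "f = (\<lambda>x\<in>\<Gamma>. c + g x)" by auto
      then show "f \<in> M" using red_module.shift[OF g(1), of c] by simp
    qed
  qed
  moreover have "open_map (uniform_topology \<Gamma> RR) LTop E" using E_open by (simp add: open_map_def)
  moreover have "E ` topspace (uniform_topology \<Gamma> RR) = topspace LTop" by (simp add: linear_system_eq)
  moreover have "E ` M \<subseteq> topspace LTop" using M_RR by (auto simp: linear_system_eq)
  ultimately show ?thesis using quotient_map_saturated[OF E_continuous, of "E ` M"] by simp
qed

text \<open>A finite maximum of shifted evaluations has only finite coordinates, so every class in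
  the hull comes from an admissible vector.\<close>

lemma hull_eq: "thull = trop_class VF ` tcone"
proof
  show "trop_class VF ` tcone \<subseteq> thull" by (auto simp: tcone_def)
  show "thull \<subseteq> trop_class VF ` tcone"
  proof
    fix C assume C: "C \<in> thull"
    obtain A where
      A: "finite A" "A \<noteq> {}" "A \<subseteq> UNIV \<times> \<Union> (eval_class VF ` \<Gamma>)" and
      CA: "C = trop_class VF (\<lambda>i\<in>VF. Max ((\<lambda>(c, s). ereal c + s i) ` A))"
      using trop_convE[OF C] .
    let ?z = "\<lambda>i\<in>VF. Max ((\<lambda>(c, s). ereal c + s i) ` A)"
    have fin: "ereal (fst a) + snd a i \<noteq> \<infinity>" "ereal (fst a) + snd a i \<noteq> -\<infinity>" if a: "a \<in> A" and i: "i \<in> VF" for a i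
    proof -
      obtain P where P: "P \<in> \<Gamma>" "snd a \<in> eval_class VF P" using A(3) a by fastforce
      then obtain d where "snd a = (\<lambda>i\<in>VF. ereal d + (\<lambda>f\<in>VF. ereal (f P)) i)"
        unfolding eval_class_def trop_class_def by blast
      then show "ereal (fst a) + snd a i \<noteq> \<infinity>" "ereal (fst a) + snd a i \<noteq> -\<infinity>" using i by simp_all
    qed
    have zi: "?z i \<noteq> \<infinity>" "?z i \<noteq> -\<infinity>" if i: "i \<in> VF" for i
    proof -
      have "Max ((\<lambda>(c, s). ereal c + s i) ` A) \<in> (\<lambda>(c, s). ereal c + s i) ` A" by (rule Max_in) (use A(1,2) in auto)
      then obtain a where "a \<in> A" "?z i = ereal (fst a) + snd a i" using i by (auto simp: case_prod_beta)
      then show "?z i \<noteq> \<infinity>" "?z i \<noteq> -\<infinity>" using fin[OF _ i] by simp_all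
    qed
    obtain r where r: "r \<in> VF" using reps(2,3) by blast
    have "?z \<in> PiE VF (\<lambda>_. {..<\<infinity>})" by (rule PiE_I) (use zi(1) in \<open>auto simp del: restrict_apply' simp: less_top[symmetric] top_ereal_def\<close>)
    then have "?z \<in> trop_vectors VF" unfolding trop_vectors_def using zi(2)[OF r] r by blast
    then show "C \<in> trop_class VF ` tcone" unfolding tcone_def using C CA by blast
  qed
qed

lemma quotient_map_trop_class:
  "quotient_map (subtopology (trop_topology VF) tcone) (subtopology (TP_topology VF) thull) (trop_class VF)"
proof -
  have "quotient_map (trop_topology VF) (TP_topology VF) (trop_class VF)"
    unfolding TP_topology_def by (rule quotient_map_quotient_topology)
  then have c: "continuous_map (trop_topology VF) (TP_topology VF) (trop_class VF)"
    and s: "trop_class VF ` topspace (trop_topology VF) = topspace (TP_topology VF)"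
    by (rule quotient_imp_continuous_map, rule quotient_imp_surjective_map)
  have "tcone \<subseteq> trop_vectors VF" unfolding tcone_def by blast
  then have "trop_class VF ` tcone \<subseteq> topspace (TP_topology VF)"
    unfolding s[symmetric] topspace_trop_topology by (rule image_mono)
  then have "thull \<subseteq> topspace (TP_topology VF)" unfolding hull_eq .
  moreover have "{x \<in> topspace (trop_topology VF). trop_class VF x \<in> thull} = tcone"
    unfolding topspace_trop_topology tcone_def ..
  ultimately show ?thesis using quotient_map_saturated[OF c open_map_trop_class s, of thull] by simp
qed

lemma embedding_theorem:
  obtains \<Theta> where "homeomorphic_map (subtopology LTop (reduced_linear_system G D)) (subtopology (TP_topology VF) thull) \<Theta>"
    "\<And>P. P \<in> \<Gamma> \<Longrightarrow> \<Theta> (Red G D P) = eval_class VF P"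
proof -
  let ?X = "subtopology (uniform_topology \<Gamma> RR) M" and ?X' = "subtopology (trop_topology VF) tcone"
  have tX: "topspace ?X = M" using M_RR by (auto simp: topspace_subtopology)
  have tX': "topspace ?X' = tcone" unfolding topspace_subtopology[of _ tcone] topspace_trop_topology by (auto simp: tcone_def)
  obtain \<Theta> where \<Theta>: "homeomorphic_map (subtopology LTop (E ` M)) (subtopology (TP_topology VF) thull) \<Theta>"
    "\<And>g. g \<in> topspace ?X \<Longrightarrow> \<Theta> (E g) = trop_class VF (coords g)"
  proof (rule homeomorphic_map_of_quotient_maps[OF quotient_map_E quotient_map_trop_class continuous_coords continuous_fun_of])
    fix f g assume f: "f \<in> topspace ?X" and g: "g \<in> topspace ?X" and eq: "E f = E g"
    have R: "f \<in> RR" "g \<in> RR" using f g unfolding tX by (simp_all only: M_RR)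
    from eq add_div_eq_iff[OF R] obtain c where "f = (\<lambda>x\<in>\<Gamma>. c + g x)" by auto
    then show "trop_class VF (coords f) = trop_class VF (coords g)" using coords_shift[OF R(2)] trop_class_translate by simp
  next
    fix y z assume y: "y \<in> topspace ?X'" and z: "z \<in> topspace ?X'" and eq: "trop_class VF y = trop_class VF z"
    have "y \<in> extensional VF" using y unfolding tX' by (auto simp: tcone_def trop_vectors_def PiE_def)
    from trop_class_eqD[OF eq this] obtain c where "y = (\<lambda>i\<in>VF. ereal c + z i)" .
    then have "fun_of y = (\<lambda>x\<in>\<Gamma>. - c + fun_of z x)" using fun_of_translate z unfolding tX' by simp
    then show "E (fun_of y) = E (fun_of z)" by (simp only: E_shift[OF M_RR[OF fun_of_M]])
  next
    fix g assume "g \<in> topspace ?X" then show "E (fun_of (coords g)) = E g" unfolding tX by (simp only: fun_of_coords)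
  next
    fix z assume "z \<in> topspace ?X'" then show "trop_class VF (coords (fun_of z)) = trop_class VF z" unfolding tX' by (simp only: coords_fun_of)
  next
    fix \<theta> assume "homeomorphic_map (subtopology LTop (E ` M)) (subtopology (TP_topology VF) thull) \<theta>"
      "\<And>x. x \<in> topspace ?X \<Longrightarrow> \<theta> (E x) = trop_class VF (coords x)"
    then show thesis by (rule that)
  qed
  show thesis
  proof (rule that)
    show "homeomorphic_map (subtopology LTop (reduced_linear_system G D)) (subtopology (TP_topology VF) thull) \<Theta>"
      unfolding reduced_linear_system_def by (rule \<Theta>(1))
    fix P assume P: "P \<in> \<Gamma>"
    have "rd P \<in> M" using red_module.gen[OF P, of D] red_fun_eq[OF P] by simp
    then have "\<Theta> (E (rd P)) = trop_class VF (coords (rd P))" using \<Theta>(2) unfolding tX by simp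
    then show "\<Theta> (Red G D P) = eval_class VF P" unfolding Red_eq[OF P] eval_class_def coords_rd[OF P] .
  qed
qed

text \<open>The homeomorphism between the images of the curve is the restriction of the one between
  the reduced linear system and the hull, because \<open>\<Theta>\<close> carries
  \<open>Red G D P\<close> to the evaluation at \<open>P\<close>.\<close>

lemma vertex_coordinates:
  "finite (E ` VF) \<and>
    subtopology (TP_topology VF) (eval_class VF ` \<Gamma>) homeomorphic_space subtopology LTop (Red G D ` \<Gamma>) \<and>
    (\<exists>\<Theta>. inj_on \<Theta> (reduced_linear_system G D) \<and> \<Theta> ` reduced_linear_system G D = thull \<and>
       (\<forall>P \<in> \<Gamma>. \<Theta> (Red G D P) = eval_class VF P) \<and>
       homeomorphic_map (subtopology LTop (reduced_linear_system G D)) (subtopology (TP_topology VF) thull) \<Theta>)"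
proof -
  let ?L = "reduced_linear_system G D"
  obtain \<Theta> where \<Theta>: "homeomorphic_map (subtopology LTop ?L) (subtopology (TP_topology VF) thull) \<Theta>"
    "\<And>P. P \<in> \<Gamma> \<Longrightarrow> \<Theta> (Red G D P) = eval_class VF P" using embedding_theorem by blast
  have tL: "topspace (subtopology LTop ?L) = ?L" using M_RR by (auto simp: reduced_linear_system_def linear_system_eq topspace_subtopology)
  have tH: "topspace (subtopology (TP_topology VF) thull) = thull"
  proof -
    have "topspace (subtopology (trop_topology VF) tcone) = tcone"
      unfolding topspace_subtopology[of _ tcone] topspace_trop_topology by (auto simp: tcone_def)
    then have "topspace (subtopology (TP_topology VF) thull) = trop_class VF ` tcone"
      unfolding quotient_imp_surjective_map[OF quotient_map_trop_class, symmetric] by (rule arg_cong)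
    then show ?thesis unfolding hull_eq .
  qed
  have RedL: "Red G D P \<in> ?L" if P: "P \<in> \<Gamma>" for P
    unfolding reduced_linear_system_def Red_eq[OF P] using red_module.gen[OF P, of D] red_fun_eq[OF P] by auto
  have inj: "inj_on \<Theta> ?L" and im: "\<Theta> ` ?L = thull"
    using homeomorphic_imp_injective_map[OF \<Theta>(1)] homeomorphic_imp_surjective_map[OF \<Theta>(1)] unfolding tL tH by simp_all
  have ev: "eval_class VF ` \<Gamma> \<subseteq> thull"
  proof (rule image_subsetI)
    fix P assume P: "P \<in> \<Gamma>"
    show "eval_class VF P \<in> thull" unfolding \<Theta>(2)[OF P, symmetric] im[symmetric] by (rule imageI[OF RedL[OF P]])
  qed
  have hm: "homeomorphic_map (subtopology (subtopology LTop ?L) (Red G D ` \<Gamma>))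
      (subtopology (subtopology (TP_topology VF) thull) (eval_class VF ` \<Gamma>)) \<Theta>"
  proof (rule homeomorphic_map_subtopologies_alt[OF \<Theta>(1)])
    fix H assume H: "H \<in> topspace (subtopology LTop ?L)"
    show "\<Theta> H \<in> eval_class VF ` \<Gamma> \<longleftrightarrow> H \<in> Red G D ` \<Gamma>"
    proof
      assume "\<Theta> H \<in> eval_class VF ` \<Gamma>"
      then obtain P where P: "P \<in> \<Gamma>" "\<Theta> H = eval_class VF P" by blast
      have eq: "\<Theta> H = \<Theta> (Red G D P)" unfolding \<Theta>(2)[OF P(1)] by (rule P(2))
      have "H \<in> ?L" using H unfolding tL .
      from inj_onD[OF inj eq this RedL[OF P(1)]] have "H = Red G D P" .
      then show "H \<in> Red G D ` \<Gamma>" using P(1) by (rule image_eqI)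
    next
      assume "H \<in> Red G D ` \<Gamma>"
      then obtain P where P: "P \<in> \<Gamma>" "H = Red G D P" by blast
      show "\<Theta> H \<in> eval_class VF ` \<Gamma>" unfolding P(2) \<Theta>(2)[OF P(1)] using P(1) by (rule imageI)
    qed
  qed
  have "?L \<inter> Red G D ` \<Gamma> = Red G D ` \<Gamma>" "thull \<inter> eval_class VF ` \<Gamma> = eval_class VF ` \<Gamma>" using RedL ev by blast+
  with hm have "homeomorphic_map (subtopology LTop (Red G D ` \<Gamma>)) (subtopology (TP_topology VF) (eval_class VF ` \<Gamma>)) \<Theta>"
    by (simp only: subtopology_subtopology)
  then have "subtopology (TP_topology VF) (eval_class VF ` \<Gamma>) homeomorphic_space subtopology LTop (Red G D ` \<Gamma>)"
    unfolding homeomorphic_space_sym[of "subtopology (TP_topology VF) (eval_class VF ` \<Gamma>)"] by (rule homeomorphic_map_imp_homeomorphic_space)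
  moreover have "\<exists>\<Theta>. inj_on \<Theta> ?L \<and> \<Theta> ` ?L = thull \<and> (\<forall>P \<in> \<Gamma>. \<Theta> (Red G D P) = eval_class VF P) \<and>
       homeomorphic_map (subtopology LTop ?L) (subtopology (TP_topology VF) thull) \<Theta>"
    by (rule exI[of _ \<Theta>]) (intro conjI ballI inj im \<Theta>)
  ultimately show ?thesis using finite_vertex_divisors by (intro conjI)
qed

end

text \<open>With an empty linear system the zero divisor, of degree \<open>0\<close>, realises the
  minimum in the definition of the rank, which would then be \<open>-1\<close>.\<close>

lemma RR_space_ne:
  assumes "D \<in> divisors G" "0 \<le> div_rank G D" shows "RR_space G D \<noteq> {}"
proof
  assume R: "RR_space G D = {}"
  have "linear_system G D = {}"
  proof (rule equals0I)
    fix F assume "F \<in> linear_system G D"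
    then obtain f where f: "effective F" "f \<in> rational_functions G" "\<And>x. F x - D x = ord_at G f x"
      unfolding linear_system_def lin_equiv_def by blast
    have "add_div G D f = F" unfolding add_div_def f(3)[symmetric] by simp
    then have "f \<in> RR_space G D" using f(1,2) by (simp add: RR_space_def)
    then show False using R by blast
  qed
  then have "\<exists>F\<in>divisors G. effective F \<and> div_degree F = int 0 \<and> linear_system G (\<lambda>x. D x - F x) = {}"
    by (intro bexI[of _ "\<lambda>_. 0"]) (auto simp: divisors_def effective_def div_degree_def)
  from Least_le[of "\<lambda>n. \<exists>F\<in>divisors G. effective F \<and> div_degree F = int n \<and> linear_system G (\<lambda>x. D x - F x) = {}", OF this]
  show False using assms(2) unfolding div_rank_def by simp
qed

theorem theorem26:
  fixes G :: "'v metric_graph" and D :: "'v point \<Rightarrow> int"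
  assumes "tropical_curve G"
    and "D \<in> divisors G"
    and "div_rank G D \<ge> 0"
    and F_def: "F = vertex_funs G D"
  shows "finite (add_div G D ` F) \<and>
    subtopology (TP_topology F) (eval_class F ` curve G) homeomorphic_space
      subtopology (linear_system_topology G D) (Red G D ` curve G) \<and>
    (\<exists>\<Theta>. inj_on \<Theta> (reduced_linear_system G D) \<and>
       \<Theta> ` reduced_linear_system G D = trop_conv F (eval_class F ` curve G) \<and>
       (\<forall>P \<in> curve G. \<Theta> (Red G D P) = eval_class F P) \<and>
       homeomorphic_map
         (subtopology (linear_system_topology G D) (reduced_linear_system G D))
         (subtopology (TP_topology F) (trop_conv F (eval_class F ` curve G))) \<Theta>)"
proof -
  interpret div_class G D
    using assms(1,2) RR_space_ne[OF assms(2,3)] by unfold_locales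
  show ?thesis unfolding F_def by (rule vertex_coordinates)
qed

end
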